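(* Let $\Lambda\subset\mathbb{C}$ be a lattice of rank $2$, let $U$ be a continuous $\Lambda$-periodic function on $\mathbb{C}$, and let $$\mathcal{D}=\begin{pmatrix}0&\partial\\-\bar\partial&0\end{pmatrix}+\begin{pmatrix}U&0\\0&U\end{pmatrix}.$$ There is an analytic set $Q(\mathcal{D})\subset\mathbb{C}^3$ of positive codimension such that there exists a Floquet function of $\mathcal{D}$ with the quasimomenta $k=(k_1,k_2)$ and the eigenvalue $E$ if and only if $(k_1,k_2,E)\in Q(\mathcal{D})$. Its intersection $Q_0(\mathcal{D})$ with the plane $E=0$ is an analytic set of complex dimension one.
   Context: $z=x^1+ix^2$, $\partial=\frac12(\partial_{x^1}-i\partial_{x^2})$, $\bar\partial=\frac12(\partial_{x^1}+i\partial_{x^2})$. For $k=(k_1,k_2)\in\mathbb{C}^2$ and $\gamma\in\mathbb{C}$ put $\langle k,\gamma\rangle=k_1\mathrm{Re}\,\gamma+k_2\mathrm{Im}\,\gamma$. A Floquet function of $\mathcal{D}$ with quasimomenta $k\in\mathbb{C}^2$ and eigenvalue $E\in\mathbb{C}$ is a nonzero function $f:\mathbb{C}\to\mathbb{C}^2$ (locally square integrable) with $\mathcal{D}f=Ef$ and $f(z+\gamma)=e^{2\pi i\langle k,\gamma\rangle}f(z)$ for all $\gamma\in\Lambda$. *)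

theory Defs
  imports "HOL-Analysis.Analysis"
begin

definition holomorphic_mv_on :: "(complex ^ 'n \<Rightarrow> complex) \<Rightarrow> (complex ^ 'n) set \<Rightarrow> bool" where
  "holomorphic_mv_on F S \<longleftrightarrow>
     (\<forall>x\<in>S. \<exists>F'. (F has_derivative F') (at x) \<and> (\<forall>c v. F' (c *s v) = c * F' v))"

text \<open>The point \<open>p\<close> ranges over the whole space, so analytic sets are closed.\<close>

definition analytic_set :: "(complex ^ 'n) set \<Rightarrow> bool" where
  "analytic_set A \<longleftrightarrow>
     (\<forall>p. \<exists>V \<F>. open V \<and> p \<in> V \<and> finite \<F> \<and> (\<forall>F\<in>\<F>. holomorphic_mv_on F V) \<and>
        A \<inter> V = {w \<in> V. \<forall>F\<in>\<F>. F w = 0})"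

text \<open>Near a regular point of dimension \<open>d\<close> a biholomorphic chart straightens the set to the
  coordinate subspace spanned by \<open>d\<close> of the coordinates (those with index in \<open>J\<close>).\<close>

definition regular_point :: "(complex ^ 'n) set \<Rightarrow> nat \<Rightarrow> complex ^ 'n \<Rightarrow> bool" where
  "regular_point A d p \<longleftrightarrow> p \<in> A \<and>
     (\<exists>V W \<phi> \<psi> J. open V \<and> p \<in> V \<and> open W \<and>
        homeomorphism V W \<phi> \<psi> \<and>
        (\<forall>j. holomorphic_mv_on (\<lambda>z. \<phi> z $ j) V) \<and>
        (\<forall>j. holomorphic_mv_on (\<lambda>w. \<psi> w $ j) W) \<and>
        card (J :: 'n set) = d \<and>
        \<phi> ` (A \<inter> V) = {w \<in> W. \<forall>j. j \<notin> J \<longrightarrow> w $ j = 0})"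

text \<open>The supremum in the extended reals gives the empty set dimension \<open>-\<infinity>\<close>, hence codimension \<open>\<infinity>\<close>.\<close>

definition analytic_dim :: "(complex ^ 'n) set \<Rightarrow> ereal" where
  "analytic_dim A = (SUP d \<in> {d. \<exists>p. regular_point A d p}. ereal (real d))"

definition analytic_codim :: "(complex ^ 'n) set \<Rightarrow> ereal" where
  "analytic_codim A = ereal (real CARD('n)) - analytic_dim A"

definition partial1 :: "(complex \<Rightarrow> complex) \<Rightarrow> complex \<Rightarrow> complex" where
  "partial1 \<phi> z = vector_derivative (\<lambda>t. \<phi> (z + of_real t)) (at 0)"

definition partial2 :: "(complex \<Rightarrow> complex) \<Rightarrow> complex \<Rightarrow> complex" where
  "partial2 \<phi> z = vector_derivative (\<lambda>t. \<phi> (z + \<i> * of_real t)) (at 0)"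

definition del :: "(complex \<Rightarrow> complex) \<Rightarrow> complex \<Rightarrow> complex" where
  "del \<phi> z = (partial1 \<phi> z - \<i> * partial2 \<phi> z) / 2"

definition delbar :: "(complex \<Rightarrow> complex) \<Rightarrow> complex \<Rightarrow> complex" where
  "delbar \<phi> z = (partial1 \<phi> z + \<i> * partial2 \<phi> z) / 2"

text \<open>Differentiability is over the reals here: \<open>differentiable\<close> refers to the Frechet
  derivative of a map between real vector spaces.\<close>

primrec Ck :: "nat \<Rightarrow> (complex \<Rightarrow> complex) \<Rightarrow> bool" where
  "Ck 0 \<phi> \<longleftrightarrow> continuous_on UNIV \<phi>"
| "Ck (Suc k) \<phi> \<longleftrightarrow> (\<forall>z. \<phi> differentiable (at z)) \<and> Ck k (partial1 \<phi>) \<and> Ck k (partial2 \<phi>)"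

definition test_function :: "(complex \<Rightarrow> complex) \<Rightarrow> bool" where
  "test_function \<phi> \<longleftrightarrow> (\<forall>k. Ck k \<phi>) \<and> compact (closure {z. \<phi> z \<noteq> 0})"

definition plane_lattice :: "complex set \<Rightarrow> bool" where
  "plane_lattice \<Lambda> \<longleftrightarrow>
     (\<exists>\<omega>1 \<omega>2. \<omega>1 \<noteq> \<omega>2 \<and> independent {\<omega>1, \<omega>2} \<and>
        \<Lambda> = {of_int m * \<omega>1 + of_int n * \<omega>2 |m n. True})"

definition loc_square_integrable :: "(complex \<Rightarrow> complex ^ 2) \<Rightarrow> bool" where
  "loc_square_integrable f \<longleftrightarrow> f \<in> borel_measurable lebesgue \<and>
     (\<forall>K. compact K \<longrightarrow> set_integrable lebesgue K (\<lambda>z. (norm (f z))\<^sup>2))"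

text \<open>The equation \<open>\<D> f = g\<close> in the sense of distributions, where
  \<open>\<D> f = (\<partial> f\<^sub>2 + U f\<^sub>1, - \<partial>bar f\<^sub>1 + U f\<^sub>2)\<close>; the derivatives are moved to the test function.
  For \<open>U\<close> merely continuous, solutions need not be classically differentiable.\<close>

definition dirac_eq :: "(complex \<Rightarrow> complex) \<Rightarrow> (complex \<Rightarrow> complex ^ 2) \<Rightarrow>
    (complex \<Rightarrow> complex ^ 2) \<Rightarrow> bool" where
  "dirac_eq U f g \<longleftrightarrow>
     (\<forall>\<phi>. test_function \<phi> \<longrightarrow>
        (LINT z|lebesgue. - (f z $ 2) * del \<phi> z + U z * f z $ 1 * \<phi> z)
          = (LINT z|lebesgue. g z $ 1 * \<phi> z) \<and>
        (LINT z|lebesgue. f z $ 1 * delbar \<phi> z + U z * f z $ 2 * \<phi> z)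
          = (LINT z|lebesgue. g z $ 2 * \<phi> z))"

definition quasi_pairing :: "complex ^ 2 \<Rightarrow> complex \<Rightarrow> complex" where
  "quasi_pairing k \<gamma> = k $ 1 * of_real (Re \<gamma>) + k $ 2 * of_real (Im \<gamma>)"

text \<open>Locally square integrable functions are understood up to null sets: both the nonvanishing
  of \<open>f\<close> and its quasi-periodicity are stated almost everywhere. Read pointwise, a function
  supported on one coset of \<open>\<Lambda>\<close> would be a Floquet function for every \<open>k\<close> and \<open>E\<close>.\<close>

definition floquet_function :: "complex set \<Rightarrow> (complex \<Rightarrow> complex) \<Rightarrow> complex ^ 2 \<Rightarrow> complex \<Rightarrow>
    (complex \<Rightarrow> complex ^ 2) \<Rightarrow> bool" where
  "floquet_function \<Lambda> U k E f \<longleftrightarrow>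
     loc_square_integrable f \<and>
     \<not> (AE z in lebesgue. f z = 0) \<and>
     dirac_eq U f (\<lambda>z. E *s f z) \<and>
     (\<forall>\<gamma>\<in>\<Lambda>. AE z in lebesgue.
        f (z + \<gamma>) = exp (2 * of_real pi * \<i> * quasi_pairing k \<gamma>) *s f z)"

end

theory Submission
  imports Defs "HOL-Complex_Analysis.Complex_Analysis" "Jordan_Normal_Form.Determinant"
begin

text \<open>
Write \<open>f z = exp (2 \<pi> \<i> \<langle>k, z\<rangle>) * g z\<close>. The quasi-periodicity of \<open>f\<close> says that \<open>g\<close> is periodic, so \<open>f\<close>
  is determined by the Fourier coefficients \<open>x\<close>, \<open>y\<close> of the two components of \<open>g\<close>. Let \<open>\<kappa>\<close> run through
  the dual lattice, written as complex numbers, and let \<open>N\<close> be the operator on square-summable families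
  that multiplication by \<open>U\<close> induces on Fourier coefficients. Then \<open>\<D> f = E f\<close> becomes the system of
  mode equations

    \<open>\<pi> \<i> (k\<^sub>1 + \<i> k\<^sub>2 + \<kappa>) x\<^sub>\<kappa> = (N y)\<^sub>\<kappa> - E y\<^sub>\<kappa>\<close>,   \<open>\<pi> \<i> (k\<^sub>1 - \<i> k\<^sub>2 + cnj \<kappa>) y\<^sub>\<kappa> = E x\<^sub>\<kappa> - (N x)\<^sub>\<kappa>\<close>,

  and \<open>Q\<close> is the set \<open>dirac_spectrum\<close> of the \<open>(k\<^sub>1, k\<^sub>2, E)\<close> for which it has a nonzero solution
  (\<open>mode_equations_if_floquet\<close>, \<open>floquet_if_mode_equations\<close>). The translation needs that the Fourier
  modes are complete in the square-integrable functions on a cell (\<open>fourier_complete\<close>), and a smooth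
  cutoff function whose lattice translates add up to 1. The cutoff turns integrals over a cell into
  integrals over the plane, so that the equation, which is tested against functions of compact
  support, can be tested against Fourier modes.

  Analyticity. The system reads \<open>l\<^sub>i z\<^sub>i = (K w z)\<^sub>i\<close>, where \<open>l\<^sub>i\<close> tends to infinity and the bounded operator
  \<open>K w\<close> depends polynomially on \<open>w = (k\<^sub>1, k\<^sub>2, E)\<close>. Near a given point all but finitely many coordinates
  can be eliminated by a contraction that depends holomorphically on \<open>w\<close>; the remaining finite linear
  system is singular exactly where its determinant vanishes (\<open>hypersurface_singular_pencil\<close>). So \<open>Q\<close> is
  locally the zero set of one holomorphic function. By the identity theorem such a set has empty
  interior unless it is the whole space (\<open>hypersurface_eq_UNIV_if_interior\<close>), and a set with empty
  interior has no regular point of full dimension. And \<open>Q\<close> is not the whole space: for \<open>k = 0\<close> the free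
  part of the operator is symmetric, so there is no imaginary eigenvalue of modulus larger than the
  norm of \<open>N\<close> (\<open>dirac_spectrum_excludes_imaginary_energy\<close>). This gives positive codimension.

  Dimension at zero energy. Use \<open>a = k\<^sub>1 - \<i> k\<^sub>2\<close> and \<open>b = k\<^sub>1 + \<i> k\<^sub>2\<close> as coordinates of the plane \<open>E = 0\<close>. If \<open>a\<close>
  is large and keeps a distance from all \<open>- cnj \<kappa>\<close>, the second equation determines \<open>y\<close>, and what is left
  for \<open>x\<close> is the equation for vanishing \<open>U\<close> with a perturbation that becomes small after composition
  with the compact inverse of \<open>x\<^sub>\<kappa> \<mapsto> \<pi> \<i> \<kappa> x\<^sub>\<kappa>\<close> on the modes \<open>\<kappa> \<noteq> 0\<close>. Hence near \<open>b = 0\<close>, where for vanishing \<open>U\<close>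
  the mode \<open>\<kappa> = 0\<close> is a solution, the slice is the graph \<open>b = \<beta> a\<close> of a holomorphic function
  (\<open>zero_energy_graph\<close>). A graph provides a regular point of dimension 1 (\<open>regular_point_graph\<close>), and it
  shows that the slice is not the whole plane. As the slice is a hypersurface of the plane too, it has
  empty interior there, and by invariance of domain it has no regular point of dimension 2 or more
  (\<open>slice_interior_if_regular_dim_2\<close>).
\<close>

(* Entries of matrices and coefficients of power series are written with the same infix symbol as
  components of vectors; only the last reading is meant here. *)
no_notation Matrix.vec_index (infixl "$" 100)
no_notation fps_nth (infixl "$" 75)

section \<open>Square-summable families\<close>

text \<open>A type of its own for the Hilbert space of square-summable families makes it an instance of the class
  \<open>banach\<close>, so that bounded linear maps and their operator norm are available. The class provides real
  scalars only; multiplication by complex scalars is added below as \<open>cscale\<close>.\<close>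

typedef 'i ell2 = "{x :: 'i \<Rightarrow> complex. (\<lambda>i. (cmod (x i))\<^sup>2) summable_on UNIV}"
  morphisms coord Abs_ell2
  by (rule exI[of _ "\<lambda>_. 0"]) simp

setup_lifting type_definition_ell2

lemma coord_ext: "(\<And>i. coord x i = coord y i) \<Longrightarrow> x = y"
  by (metis coord_inject ext)

text \<open>Bounds for finite sums decide about membership and norm. The square roots of these sums are the
  seminorms \<open>L2_set\<close>, for which the triangle and Cauchy-Schwarz inequalities are known.\<close>

lemma square_summable_iff_bdd:
  fixes x :: "'i \<Rightarrow> complex"
  shows "(\<lambda>i. (cmod (x i))\<^sup>2) summable_on UNIV \<longleftrightarrow>
         (\<exists>B. \<forall>F. finite F \<longrightarrow> (\<Sum>i\<in>F. (cmod (x i))\<^sup>2) \<le> B)"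
proof
  assume s: "(\<lambda>i. (cmod (x i))\<^sup>2) summable_on UNIV"
  show "\<exists>B. \<forall>F. finite F \<longrightarrow> (\<Sum>i\<in>F. (cmod (x i))\<^sup>2) \<le> B"
    by (intro exI[of _ "\<Sum>\<^sub>\<infinity>i. (cmod (x i))\<^sup>2"] allI impI finite_sum_le_infsum s) auto
next
  assume "\<exists>B. \<forall>F. finite F \<longrightarrow> (\<Sum>i\<in>F. (cmod (x i))\<^sup>2) \<le> B"
  then obtain B where "\<And>F. finite F \<Longrightarrow> (\<Sum>i\<in>F. (cmod (x i))\<^sup>2) \<le> B" by blast
  then show "(\<lambda>i. (cmod (x i))\<^sup>2) summable_on UNIV"
    by (intro nonneg_bdd_above_summable_on) (auto intro!: bdd_aboveI[of _ B])
qed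

lemma L2_set_le_imp_ell2:
  fixes x :: "'i \<Rightarrow> complex"
  assumes "\<And>F. finite F \<Longrightarrow> L2_set (\<lambda>i. cmod (x i)) F \<le> B"
  shows "(\<lambda>i. (cmod (x i))\<^sup>2) summable_on UNIV"
  unfolding square_summable_iff_bdd
proof (intro exI allI impI)
  fix F :: "'i set" assume "finite F"
  then have "sqrt (\<Sum>i\<in>F. (cmod (x i))\<^sup>2) \<le> B" using assms[of F] by (simp add: L2_set_def)
  then show "(\<Sum>i\<in>F. (cmod (x i))\<^sup>2) \<le> B\<^sup>2"
    by (rule sqrt_le_D)
qed

lemma square_summable_add:
  fixes x y :: "'i \<Rightarrow> complex"
  assumes "(\<lambda>i. (cmod (x i))\<^sup>2) summable_on UNIV" "(\<lambda>i. (cmod (y i))\<^sup>2) summable_on UNIV"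
  shows "(\<lambda>i. (cmod (x i + y i))\<^sup>2) summable_on UNIV"
proof (rule summable_on_comparison_test)
  show "(\<lambda>i. 2 * (cmod (x i))\<^sup>2 + 2 * (cmod (y i))\<^sup>2) summable_on UNIV"
    by (intro summable_on_add summable_on_cmult_right assms)
  fix i
  have "(cmod (x i + y i))\<^sup>2 \<le> (cmod (x i) + cmod (y i))\<^sup>2"
    by (intro power_mono norm_triangle_ineq) auto
  also have "\<dots> \<le> 2 * (cmod (x i))\<^sup>2 + 2 * (cmod (y i))\<^sup>2"
    using zero_le_power2[of "cmod (x i) - cmod (y i)"] by (simp add: power2_eq_square algebra_simps)
  finally show "(cmod (x i + y i))\<^sup>2 \<le> 2 * (cmod (x i))\<^sup>2 + 2 * (cmod (y i))\<^sup>2" .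
qed auto

instantiation ell2 :: (type) real_vector
begin

lift_definition zero_ell2 :: "'a ell2" is "\<lambda>_. 0" by simp
lift_definition plus_ell2 :: "'a ell2 \<Rightarrow> 'a ell2 \<Rightarrow> 'a ell2" is "\<lambda>x y i. x i + y i"
  by (rule square_summable_add)
lift_definition uminus_ell2 :: "'a ell2 \<Rightarrow> 'a ell2" is "\<lambda>x i. - x i" by simp
lift_definition minus_ell2 :: "'a ell2 \<Rightarrow> 'a ell2 \<Rightarrow> 'a ell2" is "\<lambda>x y i. x i - y i"
  subgoal for x y using square_summable_add[of x "\<lambda>i. - y i"] by simp
  done
lift_definition scaleR_ell2 :: "real \<Rightarrow> 'a ell2 \<Rightarrow> 'a ell2" is "\<lambda>r x i. r *\<^sub>R x i"
  by (auto simp: power_mult_distrib intro: summable_on_cmult_right)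

instance
proof
  fix x y z :: "'a ell2" and a b :: real
  show "x + y + z = x + (y + z)" by transfer (simp add: algebra_simps)
  show "x + y = y + x" by transfer (simp add: algebra_simps)
  show "0 + x = x" by transfer simp
  show "- x + x = 0" by transfer simp
  show "x - y = x + - y" by transfer simp
  show "a *\<^sub>R (x + y) = a *\<^sub>R x + a *\<^sub>R y" by transfer (simp add: algebra_simps)
  show "(a + b) *\<^sub>R x = a *\<^sub>R x + b *\<^sub>R x" by transfer (simp add: algebra_simps)
  show "a *\<^sub>R b *\<^sub>R x = (a * b) *\<^sub>R x" by transfer simp
  show "1 *\<^sub>R x = x" by transfer simp
qed

end

instantiation ell2 :: (type) real_normed_vector
begin

definition "norm_ell2 (x :: 'a ell2) = sqrt (\<Sum>\<^sub>\<infinity>i. (cmod (coord x i))\<^sup>2)"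

lemma L2_set_le_norm_ell2: "finite F \<Longrightarrow> L2_set (\<lambda>i. cmod (coord x i)) F \<le> norm (x :: 'a ell2)"
  using coord[of x] unfolding L2_set_def norm_ell2_def
  by (intro real_sqrt_le_mono finite_sum_le_infsum) auto

lemma norm_ell2_leI:
  fixes x :: "'a ell2"
  assumes "\<And>F. finite F \<Longrightarrow> L2_set (\<lambda>i. cmod (coord x i)) F \<le> B"
  shows "norm x \<le> B"
proof -
  have B: "B \<ge> 0" using assms[of "{}"] by simp
  have "(\<Sum>\<^sub>\<infinity>i. (cmod (coord x i))\<^sup>2) \<le> B\<^sup>2"
  proof (rule infsum_le_finite_sums)
    show "(\<lambda>i. (cmod (coord x i))\<^sup>2) summable_on UNIV" using coord[of x] by simp
    fix F :: "'a set" assume "finite F"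
    then have "sqrt (\<Sum>i\<in>F. (cmod (coord x i))\<^sup>2) \<le> B" using assms[of F] by (simp add: L2_set_def)
    then show "(\<Sum>i\<in>F. (cmod (coord x i))\<^sup>2) \<le> B\<^sup>2" by (rule sqrt_le_D)
  qed
  then show ?thesis unfolding norm_ell2_def using B by (simp add: real_le_lsqrt infsum_nonneg)
qed

lemma L2_set_add_le:
  fixes x y :: "'a \<Rightarrow> complex"
  shows "L2_set (\<lambda>i. cmod (x i + y i)) F \<le> L2_set (\<lambda>i. cmod (x i)) F + L2_set (\<lambda>i. cmod (y i)) F"
  by (rule order_trans[OF L2_set_mono L2_set_triangle_ineq]) (auto intro: norm_triangle_ineq)

definition "dist_ell2 (x :: 'a ell2) y = norm (x - y)"
definition "sgn_ell2 (x :: 'a ell2) = x /\<^sub>R norm x"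
definition [code del]: "uniformity_ell2 = (INF e\<in>{0<..}. principal {(x :: 'a ell2, y). dist x y < e})"
definition [code del]: "open_ell2 (U :: 'a ell2 set) \<longleftrightarrow> (\<forall>x\<in>U. \<forall>\<^sub>F (x', y) in uniformity. x' = x \<longrightarrow> y \<in> U)"

lemma cmod_coord_le_norm: "cmod (coord x i) \<le> norm (x :: 'a ell2)"
  using L2_set_le_norm_ell2[of "{i}" x] by (simp add: L2_set_def)

instance
proof
  fix x y :: "'a ell2" and a :: real
  show "dist x y = norm (x - y)" by (rule dist_ell2_def)
  show "sgn x = x /\<^sub>R norm x" by (rule sgn_ell2_def)
  show "uniformity = (INF e\<in>{0<..}. principal {(x :: 'a ell2, y). dist x y < e})" by (rule uniformity_ell2_def)
  show "open U \<longleftrightarrow> (\<forall>x\<in>U. \<forall>\<^sub>F (x', y) in uniformity. x' = x \<longrightarrow> y \<in> U)" for U :: "'a ell2 set"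
    by (rule open_ell2_def)
  show "norm x = 0 \<longleftrightarrow> x = 0"
  proof
    assume "norm x = 0"
    then have "coord x i = 0" for i using cmod_coord_le_norm[of x i] by simp
    then show "x = 0" by (intro coord_ext) (simp add: zero_ell2.rep_eq)
  qed (simp add: norm_ell2_def zero_ell2.rep_eq)
  show "norm (x + y) \<le> norm x + norm y"
  proof (rule norm_ell2_leI)
    fix F :: "'a set" assume F: "finite F"
    show "L2_set (\<lambda>i. cmod (coord (x + y) i)) F \<le> norm x + norm y"
      using L2_set_add_le[of "coord x" "coord y" F] L2_set_le_norm_ell2[OF F, of x] L2_set_le_norm_ell2[OF F, of y]
      by (simp add: plus_ell2.rep_eq)
  qed
  show "norm (a *\<^sub>R x) = \<bar>a\<bar> * norm x"
    unfolding norm_ell2_def scaleR_ell2.rep_eq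
    by (simp add: power_mult_distrib infsum_cmult_right' real_sqrt_mult)
qed
end

lemma coord_add [simp]: "coord (x + y) i = coord x i + coord y i" by transfer simp
lemma coord_diff [simp]: "coord (x - y) i = coord x i - coord y i" by transfer simp
lemma coord_minus [simp]: "coord (- x) i = - coord x i" by transfer simp
lemma coord_zero [simp]: "coord 0 i = 0" by transfer simp
lemma coord_scaleR [simp]: "coord (r *\<^sub>R x) i = r *\<^sub>R coord x i" by transfer simp

lemma coord_sum: "coord (\<Sum>j\<in>F. f j) i = (\<Sum>j\<in>F. coord (f j) i)"
  by (induction F rule: infinite_finite_induct) auto

lemma bounded_linear_coord: "bounded_linear (\<lambda>x. coord x i)"
  by (rule bounded_linear_intro[where K=1]) (auto simp: cmod_coord_le_norm)

text \<open>Completeness is proved with this: the coordinatewise limit of a Cauchy sequence satisfies the bounds on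
  finite sets, hence is a member of the space with the same bound for its norm.\<close>

lemma ell2_of_bounded:
  fixes f :: "'i \<Rightarrow> complex"
  assumes "\<And>F. finite F \<Longrightarrow> L2_set (\<lambda>i. cmod (f i)) F \<le> B"
  shows "\<exists>x. coord x = f \<and> norm x \<le> B"
proof -
  have *: "coord (Abs_ell2 f) = f" using L2_set_le_imp_ell2[OF assms] by (simp add: Abs_ell2_inverse)
  then show ?thesis using assms by (intro exI[of _ "Abs_ell2 f"]) (auto intro!: norm_ell2_leI)
qed

instance ell2 :: (type) banach
proof
  fix X :: "nat \<Rightarrow> 'a ell2" assume X: "Cauchy X"
  have "Cauchy (\<lambda>n. coord (X n) i)" for i
    by (rule bounded_linear.Cauchy[OF bounded_linear_coord X])
  then have "\<exists>l. (\<lambda>n. coord (X n) i) \<longlonglongrightarrow> l" for i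
    by (simp add: Cauchy_convergent convergentD)
  then obtain l where l: "\<And>i. (\<lambda>n. coord (X n) i) \<longlonglongrightarrow> l i" by metis
  have tail: "L2_set (\<lambda>i. cmod (l i - coord (X n) i)) F \<le> e"
    if F: "finite F" and N: "\<forall>m\<ge>N. \<forall>n\<ge>N. norm (X m - X n) < e" and n: "n \<ge> N" for F N n e
  proof (rule LIMSEQ_le_const2)
    show "(\<lambda>m. L2_set (\<lambda>i. cmod (coord (X m) i - coord (X n) i)) F) \<longlonglongrightarrow> L2_set (\<lambda>i. cmod (l i - coord (X n) i)) F"
      unfolding L2_set_def by (intro tendsto_intros l)
    show "\<exists>N. \<forall>m\<ge>N. L2_set (\<lambda>i. cmod (coord (X m) i - coord (X n) i)) F \<le> e"
    proof (intro exI[of _ N] allI impI)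
      fix m assume "m \<ge> N"
      then have "norm (X m - X n) < e" using N n by blast
      then show "L2_set (\<lambda>i. cmod (coord (X m) i - coord (X n) i)) F \<le> e"
        using L2_set_le_norm_ell2[OF F, of "X m - X n"] by simp
    qed
  qed
  have C: "\<exists>N. \<forall>m\<ge>N. \<forall>n\<ge>N. norm (X m - X n) < e" if "e > 0" for e
    using X that unfolding Cauchy_iff by blast
  obtain N1 where N1: "\<forall>m\<ge>N1. \<forall>n\<ge>N1. norm (X m - X n) < 1" using C[of 1] by auto
  obtain d where d: "coord d = (\<lambda>i. l i - coord (X N1) i)"
    using ell2_of_bounded[of "\<lambda>i. l i - coord (X N1) i" 1] tail[OF _ N1] by blast
  define L where "L = d + X N1"
  have L: "coord L i = l i" for i by (simp add: L_def d)
  have "X \<longlonglongrightarrow> L"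
  proof (rule LIMSEQ_I)
    fix r :: real assume r: "r > 0"
    obtain N where N: "\<forall>m\<ge>N. \<forall>n\<ge>N. norm (X m - X n) < r/2" using C[of "r/2"] r by auto
    have "norm (X n - L) < r" if "n \<ge> N" for n
    proof -
      have "norm (L - X n) \<le> r/2"
        by (rule norm_ell2_leI) (use tail[OF _ N that] L in simp)
      then show ?thesis using r by (simp add: norm_minus_commute)
    qed
    then show "\<exists>no. \<forall>n\<ge>no. norm (X n - L) < r" by blast
  qed
  then show "convergent X" by (rule convergentI)
qed

lemma coord_mem [simp]: "(\<lambda>i. (cmod (coord x i))\<^sup>2) summable_on UNIV"
  using coord[of x] by simp

lift_definition cscale :: "complex \<Rightarrow> 'i ell2 \<Rightarrow> 'i ell2" is "\<lambda>c x i. c * x i"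
  by (auto simp: norm_mult power_mult_distrib intro: summable_on_cmult_right)

lemma coord_cscale [simp]: "coord (cscale c x) i = c * coord x i" by transfer simp

lemma norm_cscale [simp]: "norm (cscale c x) = cmod c * norm x"
  unfolding norm_ell2_def by (simp add: norm_mult power_mult_distrib infsum_cmult_right' real_sqrt_mult)

lemma cscale_add: "cscale c (x + y) = cscale c x + cscale c y"
  by (rule coord_ext) (simp add: algebra_simps)

lemma cscale_diff: "cscale c (x - y) = cscale c x - cscale c y"
  by (rule coord_ext) (simp add: algebra_simps)

lemma L2_set_mult_le_norm:
  assumes "\<And>i. cmod (d i) \<le> K" "finite F"
  shows "L2_set (\<lambda>i. cmod (d i * coord x i)) F \<le> K * norm x"
proof -
  have K: "K \<ge> 0" using assms(1) norm_ge_zero order_trans by blast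
  have "L2_set (\<lambda>i. cmod (d i * coord x i)) F \<le> L2_set (\<lambda>i. K * cmod (coord x i)) F"
    by (rule L2_set_mono) (auto simp: norm_mult intro: mult_right_mono assms)
  also have "\<dots> = K * L2_set (\<lambda>i. cmod (coord x i)) F" using K by (simp add: L2_set_right_distrib)
  also have "\<dots> \<le> K * norm x" using K L2_set_le_norm_ell2[OF assms(2)] by (rule mult_left_mono[rotated])
  finally show ?thesis .
qed

text \<open>Meaningful for bounded \<open>d\<close> only; the bound \<open>K\<close> appears as a hypothesis of the lemmas.\<close>

definition diag_op :: "('i \<Rightarrow> complex) \<Rightarrow> 'i ell2 \<Rightarrow>\<^sub>L 'i ell2" where
  "diag_op d = Blinfun (\<lambda>x. Abs_ell2 (\<lambda>i. d i * coord x i))"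

lemma
  assumes "\<And>i. cmod (d i) \<le> K"
  shows coord_diag_op: "coord (blinfun_apply (diag_op d) x) i = d i * coord x i"
    and norm_diag_op: "norm (diag_op d) \<le> K"
proof -
  have K: "K \<ge> 0" using assms norm_ge_zero order_trans by blast
  have c: "coord (Abs_ell2 (\<lambda>i. d i * coord x i)) = (\<lambda>i. d i * coord x i)" for x
  proof -
    have "(\<lambda>i. (cmod (d i * coord x i))\<^sup>2) summable_on UNIV"
      by (rule L2_set_le_imp_ell2[where B = "K * norm x"], rule L2_set_mult_le_norm, rule assms)
    then show ?thesis by (simp add: Abs_ell2_inverse)
  qed
  have n: "norm (Abs_ell2 (\<lambda>i. d i * coord x i)) \<le> norm x * K" for x
    by (rule norm_ell2_leI, subst c, subst mult.commute[of _ K], rule L2_set_mult_le_norm, rule assms)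
  have "bounded_linear (\<lambda>x. Abs_ell2 (\<lambda>i. d i * coord x i))"
  proof (rule bounded_linear_intro[where K = K])
    show "Abs_ell2 (\<lambda>i. d i * coord (x + y) i) = Abs_ell2 (\<lambda>i. d i * coord x i) + Abs_ell2 (\<lambda>i. d i * coord y i)" for x y
      by (rule coord_ext, subst (1) c, simp only: coord_add c distrib_left)
    show "Abs_ell2 (\<lambda>i. d i * coord (r *\<^sub>R x) i) = r *\<^sub>R Abs_ell2 (\<lambda>i. d i * coord x i)" for r x
      by (rule coord_ext, subst (1) c, simp only: coord_scaleR c mult_scaleR_right)
  qed (rule n)
  then have a: "blinfun_apply (diag_op d) x = Abs_ell2 (\<lambda>i. d i * coord x i)" for x
    unfolding diag_op_def by (simp add: bounded_linear_Blinfun_apply)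
  show "coord (blinfun_apply (diag_op d) x) i = d i * coord x i" by (simp add: a c)
  show "norm (diag_op d) \<le> K"
    by (rule norm_blinfun_bound[OF K]) (use n in \<open>simp add: a mult.commute\<close>)
qed

definition unit_ell2 :: "'i \<Rightarrow> 'i ell2" where
  "unit_ell2 j = Abs_ell2 (\<lambda>i. if i = j then 1 else 0)"

lemma coord_unit_ell2 [simp]: "coord (unit_ell2 j) i = (if i = j then 1 else 0)"
proof -
  have "(\<lambda>i. (cmod (if i = j then 1 else 0))\<^sup>2) summable_on UNIV"
    by (rule summable_on_cong_neutral[THEN iffD1, of _ "{j}"]) auto
  then show ?thesis unfolding unit_ell2_def by (simp add: Abs_ell2_inverse)
qed

lemma nonneg_summable_tail:
  fixes f :: "'i \<Rightarrow> real"
  assumes "f summable_on UNIV" "\<And>i. f i \<ge> 0" "e > 0"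
  obtains G where "finite G" "\<And>F. finite F \<Longrightarrow> F \<inter> G = {} \<Longrightarrow> sum f F \<le> e"
proof -
  have "(sum f \<longlongrightarrow> infsum f UNIV) (finite_subsets_at_top UNIV)"
    using assms(1) by (simp add: summable_iff_has_sum_infsum has_sum_def)
  then have "\<forall>\<^sub>F G in finite_subsets_at_top UNIV. dist (sum f G) (infsum f UNIV) < e"
    using assms(3) tendstoD by blast
  then obtain G where G: "finite G" "dist (sum f G) (infsum f UNIV) < e"
    unfolding eventually_finite_subsets_at_top by auto
  have "sum f F \<le> e" if F: "finite F" "F \<inter> G = {}" for F
  proof -
    have "sum f F + sum f G = sum f (F \<union> G)" using F G(1) by (simp add: sum.union_disjoint)
    also have "\<dots> \<le> infsum f UNIV"
      by (rule finite_sum_le_infsum) (use F G assms in auto)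
    finally show ?thesis using G(2) by (simp add: dist_real_def)
  qed
  then show thesis using that G(1) by blast
qed

definition trunc :: "'i set \<Rightarrow> 'i ell2 \<Rightarrow> 'i ell2" where
  "trunc G x = (\<Sum>i\<in>G. cscale (coord x i) (unit_ell2 i))"

lemma coord_trunc: "finite G \<Longrightarrow> coord (trunc G x) i = (if i \<in> G then coord x i else 0)"
  unfolding trunc_def by (simp add: coord_sum if_distrib cong: if_cong)

lemma trunc_approx:
  fixes x :: "'i ell2"
  assumes "e > 0"
  obtains G where "finite G" "\<And>G'. finite G' \<Longrightarrow> G \<subseteq> G' \<Longrightarrow> norm (x - trunc G' x) \<le> e"
proof -
  obtain G where G: "finite G" "\<And>F. finite F \<Longrightarrow> F \<inter> G = {} \<Longrightarrow> (\<Sum>i\<in>F. (cmod (coord x i))\<^sup>2) \<le> e\<^sup>2"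
    using nonneg_summable_tail[OF coord_mem[of x], of "e\<^sup>2"] assms by auto
  have "norm (x - trunc G' x) \<le> e" if G': "finite G'" "G \<subseteq> G'" for G'
  proof (rule norm_ell2_leI)
    fix F :: "'i set" assume F: "finite F"
    have "(\<Sum>i\<in>F. (cmod (coord (x - trunc G' x) i))\<^sup>2) = (\<Sum>i\<in>F - G'. (cmod (coord x i))\<^sup>2)"
      using F G' by (intro sum.mono_neutral_cong_right) (auto simp: coord_trunc)
    also have "\<dots> \<le> e\<^sup>2" using F G' by (intro G(2)) auto
    finally show "L2_set (\<lambda>i. cmod (coord (x - trunc G' x) i)) F \<le> e"
      unfolding L2_set_def using assms by (simp add: real_le_lsqrt sum_nonneg)
  qed
  then show thesis using that G(1) by blast
qed

text \<open>Bounded linear maps are real linear by their type, so complex linearity is a separate property.\<close>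

definition complex_linear_op :: "('i ell2 \<Rightarrow>\<^sub>L 'j ell2) \<Rightarrow> bool" where
  "complex_linear_op T \<longleftrightarrow> (\<forall>c x. blinfun_apply T (cscale c x) = cscale c (blinfun_apply T x))"

text \<open>By the easy half of the Riesz representation theorem, the values of a bounded complex linear
  functional at the unit vectors form a square-summable family. The functional is therefore small on
  vectors supported where the tail of this family is small.\<close>

lemma functional_tail_small:
  fixes f :: "'i ell2 \<Rightarrow> complex"
  assumes f: "bounded_linear f" and fc: "\<And>c x. f (cscale c x) = c * f x" and e: "e > 0"
  obtains G where "finite G" "\<And>y. (\<And>i. i \<in> G \<Longrightarrow> coord y i = 0) \<Longrightarrow> cmod (f y) \<le> e * norm y"
proof -
  interpret f: bounded_linear f by (rule f)
  obtain C where C: "C \<ge> 0" "\<And>x. norm (f x) \<le> norm x * C" using f.nonneg_bounded by blast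
  define r where "r i = f (unit_ell2 i)" for i
  have f_trunc: "f (trunc F y) = (\<Sum>i\<in>F. coord y i * r i)" for F y
    unfolding trunc_def by (simp add: f.sum fc r_def)
  have "L2_set (\<lambda>i. cmod (r i)) F \<le> C" if F: "finite F" for F
  proof -
    \<comment> \<open>Testing the functional against its own coefficients gives \<open>L\<^sup>2 \<le> C * L\<close>.\<close>
    let ?v = "\<Sum>i\<in>F. cscale (cnj (r i)) (unit_ell2 i)"
    let ?L = "L2_set (\<lambda>i. cmod (r i)) F"
    have cv: "coord ?v i = (if i \<in> F then cnj (r i) else 0)" for i
      using F by (simp add: coord_sum if_distrib cong: if_cong)
    have "norm ?v \<le> ?L"
    proof (rule norm_ell2_leI)
      fix G :: "'i set" assume "finite G"
      then have "(\<Sum>i\<in>G. (cmod (coord ?v i))\<^sup>2) = (\<Sum>i\<in>G \<inter> F. (cmod (r i))\<^sup>2)"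
        by (intro sum.mono_neutral_cong_right) (auto simp: cv)
      also have "\<dots> \<le> (\<Sum>i\<in>F. (cmod (r i))\<^sup>2)" by (rule sum_mono2) (use F in auto)
      finally show "L2_set (\<lambda>i. cmod (coord ?v i)) G \<le> ?L" unfolding L2_set_def by simp
    qed
    have "f ?v = (\<Sum>i\<in>F. cnj (r i) * r i)" by (simp add: f.sum fc r_def)
    also have "\<dots> = of_real (\<Sum>i\<in>F. (cmod (r i))\<^sup>2)"
      by (simp add: complex_norm_square mult.commute del: of_real_power)
    also have "(\<Sum>i\<in>F. (cmod (r i))\<^sup>2) = ?L\<^sup>2" unfolding L2_set_def by (simp add: sum_nonneg)
    finally have "?L\<^sup>2 = norm (f ?v)" by (simp add: norm_power)
    also have "\<dots> \<le> norm ?v * C" by (rule C(2))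
    also have "\<dots> \<le> ?L * C" by (intro mult_right_mono \<open>norm ?v \<le> ?L\<close> C(1))
    finally have *: "?L * ?L \<le> ?L * C" by (simp only: power2_eq_square)
    show ?thesis
    proof (cases "?L = 0")
      case False
      then have "?L > 0" using L2_set_nonneg[of "\<lambda>i. cmod (r i)" F] by linarith
      then show ?thesis using * by (simp only: mult_le_cancel_left_pos)
    qed (simp only: C(1))
  qed
  then have "(\<lambda>i. (cmod (r i))\<^sup>2) summable_on UNIV" by (rule L2_set_le_imp_ell2)
  then obtain G where G: "finite G" "\<And>F. finite F \<Longrightarrow> F \<inter> G = {} \<Longrightarrow> (\<Sum>i\<in>F. (cmod (r i))\<^sup>2) \<le> e\<^sup>2"
    using nonneg_summable_tail[of "\<lambda>i. (cmod (r i))\<^sup>2" "e\<^sup>2"] e by auto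
  have "cmod (f y) \<le> e * norm y" if y: "\<And>i. i \<in> G \<Longrightarrow> coord y i = 0" for y
  proof (rule field_le_epsilon)
    fix t :: real assume t: "t > 0"
    obtain B where B: "B > 0" "\<And>x. norm (f x) \<le> norm x * B" using f.pos_bounded by blast
    obtain F where F: "finite F" "norm (y - trunc F y) \<le> t / B"
      using trunc_approx[of "t / B" y] t B(1) by (metis divide_pos_pos order_refl)
    have "norm (f (y - trunc F y)) \<le> t" using B(2)[of "y - trunc F y"] F(2) B(1)
      by (simp add: pos_le_divide_eq order_trans)
    moreover have "norm (f (trunc F y)) \<le> e * norm y"
    proof -
      have "f (trunc F y) = (\<Sum>i\<in>F - G. coord y i * r i)" unfolding f_trunc
        using F(1) y by (intro sum.mono_neutral_right) auto
      then have "norm (f (trunc F y)) \<le> (\<Sum>i\<in>F - G. cmod (coord y i) * cmod (r i))"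
        using norm_sum[of "\<lambda>i. coord y i * r i" "F - G"] by (simp add: norm_mult)
      also have "\<dots> \<le> L2_set (\<lambda>i. cmod (coord y i)) (F - G) * L2_set (\<lambda>i. cmod (r i)) (F - G)"
        using L2_set_mult_ineq[of "\<lambda>i. cmod (coord y i)" "\<lambda>i. cmod (r i)" "F - G"] by simp
      also have "\<dots> \<le> norm y * e"
      proof (rule mult_mono)
        show "L2_set (\<lambda>i. cmod (r i)) (F - G) \<le> e" unfolding L2_set_def
          by (rule real_le_lsqrt) (use G(2)[of "F - G"] F(1) e in auto)
      qed (use F(1) L2_set_le_norm_ell2[of "F - G" y] in auto)
      finally show ?thesis by (simp add: mult.commute)
    qed
    ultimately show "norm (f y) \<le> e * norm y + t"
      using norm_triangle_ineq[of "f (y - trunc F y)" "f (trunc F y)"] by (simp add: f.diff)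
  qed
  then show thesis using that G(1) by blast
qed

section \<open>Contractions depending on a parameter\<close>

text \<open>For operators of norm at most 1/2 the equation \<open>x = y + T x\<close> is solved by a Neumann series. Only the
  following consequences are used, with \<open>T\<close> depending on a parameter.\<close>

lemma fixed_point_norm_le:
  fixes T :: "'b::real_normed_vector \<Rightarrow>\<^sub>L 'b"
  assumes "norm T \<le> 1/2" "x = y + blinfun_apply T x"
  shows "norm x \<le> 2 * norm y"
proof -
  have "norm x \<le> norm y + norm (blinfun_apply T x)" by (metis assms(2) norm_triangle_ineq)
  also have "norm (blinfun_apply T x) \<le> 1/2 * norm x"
    by (rule order_trans[OF norm_blinfun mult_right_mono[OF assms(1)]]) simp
  finally show ?thesis by simp
qed

lemma fixed_point_unique:
  fixes T :: "'b::real_normed_vector \<Rightarrow>\<^sub>L 'b"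
  assumes "norm T \<le> 1/2" "x = y + blinfun_apply T x" "x' = y + blinfun_apply T x'"
  shows "x = x'"
proof -
  have "x - x' = 0 + blinfun_apply T (x - x')" using assms(2,3) by (metis add_0 add_diff_cancel_left blinfun.diff_right)
  from fixed_point_norm_le[OF assms(1) this] show ?thesis by simp
qed

lemma fixed_point_exists:
  fixes T :: "'b::banach \<Rightarrow>\<^sub>L 'b"
  assumes "norm T \<le> 1/2"
  shows "\<exists>x. x = y + blinfun_apply T x"
proof -
  have "\<exists>!x. y + blinfun_apply T x = x"
  proof (rule banach_fix_type[where c = "1/2"])
    show "\<forall>x z. dist (y + blinfun_apply T x) (y + blinfun_apply T z) \<le> 1/2 * dist x z"
    proof (intro allI)
      fix x z
      have "norm (blinfun_apply T (x - z)) \<le> 1/2 * norm (x - z)"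
        by (rule order_trans[OF norm_blinfun mult_right_mono[OF assms]]) simp
      then show "dist (y + blinfun_apply T x) (y + blinfun_apply T z) \<le> 1/2 * dist x z"
        by (simp add: dist_norm blinfun.diff_right)
    qed
  qed auto
  then show ?thesis by metis
qed

text \<open>Formal differentiation of the equation \<open>x = y + T x\<close> gives a fixed point equation for the derivative,
  which has a solution because \<open>T w\<close> is a contraction. The error of the resulting linear approximation
  satisfies a fixed point equation too, with an inhomogeneous term of second order.\<close>

lemma fixed_point_has_derivative:
  fixes T :: "'a::real_normed_vector \<Rightarrow> 'b::banach \<Rightarrow>\<^sub>L 'b"
  assumes V: "open V" "w \<in> V" and T: "\<And>w. w \<in> V \<Longrightarrow> norm (T w) \<le> 1/2"
    and x: "\<And>w. w \<in> V \<Longrightarrow> x w = y + blinfun_apply (T w) (x w)"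
    and T': "(T has_derivative T') (at w)"
  shows "\<exists>x'. (x has_derivative x') (at w) \<and>
              (\<forall>v. x' v = blinfun_apply (T' v) (x w) + blinfun_apply (T w) (x' v))"
proof -
  interpret T': bounded_linear T' by (rule has_derivative_bounded_linear[OF T'])
  obtain x' where x': "\<And>v. x' v = blinfun_apply (T' v) (x w) + blinfun_apply (T w) (x' v)"
    proof -
    have "\<forall>v. \<exists>u. u = blinfun_apply (T' v) (x w) + blinfun_apply (T w) u"
      by (intro allI fixed_point_exists T V)
    from choice[OF this] show thesis using that by blast
  qed
  note unique = fixed_point_unique[OF T[OF V(2)]]
  obtain C where C: "\<And>v. norm (T' v) \<le> norm v * C" "C \<ge> 0" using T'.nonneg_bounded by blast
  have lin: "bounded_linear x'"
  proof (rule bounded_linear_intro)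
    fix u v
    show "x' (u + v) = x' u + x' v"
      by (rule unique[OF x'], subst x'[of u], subst x'[of v])
         (simp add: T'.add blinfun.add_left blinfun.add_right)
    fix r
    show "x' (r *\<^sub>R v) = r *\<^sub>R x' v"
      by (rule unique[OF x'], subst x'[of v])
         (simp add: T'.scaleR blinfun.scaleR_left blinfun.scaleR_right scaleR_add_right)
    have "norm (x' v) \<le> 2 * norm (blinfun_apply (T' v) (x w))"
      by (rule fixed_point_norm_le[OF T[OF V(2)] x'])
    also have "\<dots> \<le> 2 * ((norm v * C) * norm (x w))"
      by (intro mult_left_mono order_trans[OF norm_blinfun] mult_right_mono C) auto
    finally show "norm (x' v) \<le> norm v * (2 * C * norm (x w))" by (simp add: algebra_simps)
  qed
  have "(x has_derivative x') (at w)"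
    unfolding has_derivative_at_alt
  proof (intro conjI lin allI impI)
    fix e :: real assume e: "e > 0"
    define M where "M = norm y"
    define K where "K = C + 1"
    have "M \<ge> 0" "K > 0" using C(2) by (auto simp: M_def K_def)
    define e1 where "e1 = min 1 (e / (2 * (2 * (2 * M + 1))))"
    have e1: "e1 > 0" "e1 \<le> 1" using e \<open>M \<ge> 0\<close> by (auto simp: e1_def add_nonneg_pos)
    have "e1 * (2 * (2 * M + 1)) \<le> e / (2 * (2 * (2 * M + 1))) * (2 * (2 * M + 1))"
      by (rule mult_right_mono) (use \<open>M \<ge> 0\<close> in \<open>auto simp: e1_def\<close>)
    also have "\<dots> = e / 2" using \<open>M \<ge> 0\<close> by (simp add: field_simps add_nonneg_eq_0_iff)
    finally have e1': "e1 * (2 * (2 * M + 1)) \<le> e / 2" .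
    obtain d1 where d1: "d1 > 0" "\<And>z. norm (z - w) < d1 \<Longrightarrow> norm (T z - T w - T' (z - w)) \<le> e1 * norm (z - w)"
      using T' e1(1) unfolding has_derivative_at_alt by blast
    obtain d2 where d2: "d2 > 0" "ball w d2 \<subseteq> V" using V open_contains_ball by metis
    define d3 where "d3 = e / (2 * (8 * K * K * M + 1))"
    have d3: "d3 > 0" "d3 * (8 * K * K * M) \<le> e / 2" using e \<open>M \<ge> 0\<close> \<open>K > 0\<close>
      by (auto simp: d3_def field_simps add_pos_nonneg)
    have "norm (x z - x w - x' (z - w)) \<le> e * norm (z - w)" if z: "norm (z - w) < min d1 (min d2 d3)" for z
    proof -
      have zV: "z \<in> V" using z d2(2) by (auto simp: subset_iff dist_norm norm_minus_commute)
      let ?n = "norm (z - w)"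
      have R: "norm (T z - T w - T' (z - w)) \<le> e1 * ?n" using d1(2) z by simp
      have D: "norm (T z - T w) \<le> K * ?n"
      proof -
        have "norm (T z - T w) \<le> norm (T z - T w - T' (z - w)) + norm (T' (z - w))"
          by (metis diff_add_cancel norm_triangle_ineq)
        also have "\<dots> \<le> 1 * ?n + C * ?n" 
          by (intro add_mono order_trans[OF R] mult_right_mono e1) (use C(1)[of "z - w"] in \<open>auto simp: mult.commute\<close>)
        finally show ?thesis by (simp add: K_def algebra_simps)
      qed
      have xM: "norm (x u) \<le> 2 * M" if "u \<in> V" for u
        unfolding M_def by (rule fixed_point_norm_le[OF T[OF that] x[OF that]])
      have "x z - x w = blinfun_apply (T z - T w) (x z) + blinfun_apply (T w) (x z - x w)"
      proof -
        have "x z - x w = (y + blinfun_apply (T z) (x z)) - (y + blinfun_apply (T w) (x w))"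
          by (rule arg_cong2[where f = "(-)", OF x[OF zV] x[OF V(2)]])
        then show ?thesis by (rule trans) (simp add: blinfun.diff_left blinfun.diff_right)
      qed
      note xzw = this
      from fixed_point_norm_le[OF T[OF V(2)] this]
      have "norm (x z - x w) \<le> 2 * norm (blinfun_apply (T z - T w) (x z))" .
      also have "\<dots> \<le> 2 * ((K * ?n) * (2 * M))"
        by (intro mult_left_mono order_trans[OF norm_blinfun] mult_mono D xM zV) (use \<open>K > 0\<close> in auto)
      finally have xd: "norm (x z - x w) \<le> 4 * K * M * ?n" by (simp add: algebra_simps)
      let ?E = "x z - x w - x' (z - w)"
      let ?r = "blinfun_apply (T z - T w - T' (z - w)) (x w) + blinfun_apply (T z - T w) (x z - x w)"
      have "?E = ?r + blinfun_apply (T w) ?E"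
      proof -
        have "?E = (blinfun_apply (T z - T w) (x z) + blinfun_apply (T w) (x z - x w))
            - (blinfun_apply (T' (z - w)) (x w) + blinfun_apply (T w) (x' (z - w)))"
          by (rule arg_cong2[where f = "(-)", OF xzw x'])
        then show ?thesis by (rule trans) (simp add: blinfun.diff_left blinfun.diff_right)
      qed
      from fixed_point_norm_le[OF T[OF V(2)] this]
      have "norm ?E \<le> 2 * norm ?r" .
      also have "\<dots> \<le> 2 * ((e1 * ?n) * (2 * M) + (K * ?n) * (4 * K * M * ?n))"
        by (intro mult_left_mono norm_triangle_le add_mono order_trans[OF norm_blinfun] mult_mono R D xM V xd)
           (use \<open>K > 0\<close> e1 in auto)
      also have "\<dots> = (e1 * (2 * (2 * M)) + ?n * (8 * K * K * M)) * ?n" by (simp add: algebra_simps)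
      also have "\<dots> \<le> e * ?n"
      proof (rule mult_right_mono)
        have "?n * (8 * K * K * M) \<le> d3 * (8 * K * K * M)" 
          by (rule mult_right_mono) (use z \<open>K > 0\<close> \<open>M \<ge> 0\<close> in auto)
        moreover have "e1 * (2 * (2 * M)) \<le> e1 * (2 * (2 * M + 1))" using e1(1) by simp
        ultimately show "e1 * (2 * (2 * M)) + ?n * (8 * K * K * M) \<le> e" using e1' d3(2) by linarith
      qed simp
      finally show ?thesis .
    qed
    then show "\<exists>d>0. \<forall>z. norm (z - w) < d \<longrightarrow> norm (x z - x w - x' (z - w)) \<le> e * norm (z - w)"
      using d1(1) d2(1) d3(1) by (intro exI[of _ "min d1 (min d2 d3)"]) auto
  qed
  then show ?thesis using x' by blast
qed

section \<open>Zero sets of holomorphic functions and singular operator pencils\<close>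

text \<open>The determinant of a system indexed by an arbitrary finite set, written out by the Leibniz formula.
  In this form it is visibly a polynomial in the entries, and the enumeration \<open>h\<close> of the index set does
  not depend on the matrix, which is a matrix of functions in the application.\<close>

lemma singular_system_iff_leibniz_sum:
  fixes S :: "'i set"
  assumes S: "finite S"
  obtains h where
    "\<And>A :: 'i \<Rightarrow> 'i \<Rightarrow> complex. (\<exists>c. (\<exists>j\<in>S. c j \<noteq> 0) \<and> (\<forall>i\<in>S. (\<Sum>j\<in>S. A i j * c j) = 0)) \<longleftrightarrow>
       (\<Sum>p\<in>{p. p permutes {0..<card S}}. of_int (sign p) * (\<Prod>i=0..<card S. A (h i) (h (p i)))) = 0"
proof -
  let ?n = "card S"
  obtain h where h: "bij_betw h {0..<?n} S" using ex_bij_betw_nat_finite[OF S] by blast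
  have hS: "h ` {0..<?n} = S" and hinj: "inj_on h {0..<?n}" using h by (auto simp: bij_betw_def)
  have "(\<exists>c. (\<exists>j\<in>S. c j \<noteq> 0) \<and> (\<forall>i\<in>S. (\<Sum>j\<in>S. A i j * c j) = 0)) \<longleftrightarrow>
       (\<Sum>p\<in>{p. p permutes {0..<?n}}. of_int (sign p) * (\<Prod>i=0..<?n. A (h i) (h (p i)))) = 0"
    for A :: "'i \<Rightarrow> 'i \<Rightarrow> complex"
  proof -
    let ?M = "Matrix.mat ?n ?n (\<lambda>(i, j). A (h i) (h j))"
    have M: "?M \<in> carrier_mat ?n ?n" by simp
    have perm: "p i < ?n" if "p permutes {0..<?n}" "i < ?n" for p i
      using permutes_in_image[OF that(1), of i] that(2) by simp
    have det: "Determinant.det ?M = (\<Sum>p\<in>{p. p permutes {0..<?n}}. of_int (sign p) * (\<Prod>i=0..<?n. A (h i) (h (p i))))"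
      unfolding Determinant.det_def by (auto intro!: sum.cong prod.cong simp: perm)
    have row: "Matrix.vec_index (?M *\<^sub>v v) i = (\<Sum>j=0..<?n. A (h i) (h j) * Matrix.vec_index v j)"
      if "v \<in> carrier_vec ?n" "i < ?n" for v i
      using that by (auto simp: scalar_prod_def intro!: sum.cong)
    have re: "(\<Sum>j\<in>S. g j) = (\<Sum>j=0..<?n. g (h j))" for g :: "'i \<Rightarrow> complex"
      using sum.reindex_bij_betw[OF h, of g] by simp
    have "(\<exists>c. (\<exists>j\<in>S. c j \<noteq> 0) \<and> (\<forall>i\<in>S. (\<Sum>j\<in>S. A i j * c j) = 0)) \<longleftrightarrow>
          (\<exists>v. v \<in> carrier_vec ?n \<and> v \<noteq> 0\<^sub>v ?n \<and> ?M *\<^sub>v v = 0\<^sub>v ?n)"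
    proof
      assume "\<exists>c. (\<exists>j\<in>S. c j \<noteq> 0) \<and> (\<forall>i\<in>S. (\<Sum>j\<in>S. A i j * c j) = 0)"
      then obtain c j where c: "j \<in> S" "c j \<noteq> 0" "\<And>i. i \<in> S \<Longrightarrow> (\<Sum>j\<in>S. A i j * c j) = 0" by blast
      let ?v = "Matrix.vec ?n (\<lambda>j. c (h j))"
      obtain m where m: "m < ?n" "h m = j" using c(1) hS by force
      have v: "?v \<in> carrier_vec ?n" by simp
      have "?v \<noteq> 0\<^sub>v ?n"
      proof
        assume "?v = 0\<^sub>v ?n"
        then have "Matrix.vec_index ?v m = Matrix.vec_index (0\<^sub>v ?n) m" by simp
        then show False using m c(2) by simp
      qed
      moreover have "?M *\<^sub>v ?v = 0\<^sub>v ?n"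
      proof (rule eq_vecI)
        fix i assume "i < dim_vec (0\<^sub>v ?n :: complex Matrix.vec)"
        then have i: "i < ?n" by simp
        have "(\<Sum>j\<in>S. A (h i) j * c j) = 0" using i hS by (intro c(3)) auto
        then show "Matrix.vec_index (?M *\<^sub>v ?v) i = Matrix.vec_index (0\<^sub>v ?n) i"
          unfolding row[OF v i] re using i by simp
      qed simp
      ultimately show "\<exists>v. v \<in> carrier_vec ?n \<and> v \<noteq> 0\<^sub>v ?n \<and> ?M *\<^sub>v v = 0\<^sub>v ?n" using v by blast
    next
      assume "\<exists>v. v \<in> carrier_vec ?n \<and> v \<noteq> 0\<^sub>v ?n \<and> ?M *\<^sub>v v = 0\<^sub>v ?n"
      then obtain v where v: "v \<in> carrier_vec ?n" "v \<noteq> 0\<^sub>v ?n" "?M *\<^sub>v v = 0\<^sub>v ?n" by blast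
      define c where "c j = Matrix.vec_index v (the_inv_into {0..<?n} h j)" for j
      have ch: "c (h m) = Matrix.vec_index v m" if "m < ?n" for m
        unfolding c_def using the_inv_into_f_f[OF hinj, of m] that by simp
      obtain m where m: "m < ?n" "Matrix.vec_index v m \<noteq> 0"
        using v(1,2) by (metis carrier_vecD eq_vecI index_zero_vec(1) index_zero_vec(2))
      have "(\<Sum>j\<in>S. A i j * c j) = 0" if i: "i \<in> S" for i
      proof -
        obtain l where l: "l < ?n" "h l = i" using i hS by force
        have "(\<Sum>j\<in>S. A i j * c j) = (\<Sum>j=0..<?n. A (h l) (h j) * Matrix.vec_index v j)"
          unfolding re l(2) by (auto intro!: sum.cong simp: ch)
        also have "\<dots> = 0" using row[OF v(1) l(1)] v(3) l(1) by simp
        finally show ?thesis .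
      qed
      moreover have "h m \<in> S" "c (h m) \<noteq> 0" using m hS ch by auto
      ultimately show "\<exists>c. (\<exists>j\<in>S. c j \<noteq> 0) \<and> (\<forall>i\<in>S. (\<Sum>j\<in>S. A i j * c j) = 0)" by blast
    qed
    then show ?thesis using det_0_iff_vec_prod_zero_field[OF M] det by simp
  qed
  then show thesis by (rule that)
qed

lemma holomorphic_mv_on_const: "holomorphic_mv_on (\<lambda>w. c) S"
  unfolding holomorphic_mv_on_def by (auto intro!: exI[of _ "\<lambda>_. 0"] derivative_eq_intros)

lemma holomorphic_mv_on_add:
  assumes "holomorphic_mv_on F S" "holomorphic_mv_on G S"
  shows "holomorphic_mv_on (\<lambda>w. F w + G w) S"
  unfolding holomorphic_mv_on_def
proof
  fix x assume "x \<in> S"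
  then obtain F' G' where "(F has_derivative F') (at x)" "\<forall>c v. F' (c *s v) = c * F' v"
    "(G has_derivative G') (at x)" "\<forall>c v. G' (c *s v) = c * G' v"
    using assms unfolding holomorphic_mv_on_def by meson
  then show "\<exists>F'. ((\<lambda>w. F w + G w) has_derivative F') (at x) \<and> (\<forall>c v. F' (c *s v) = c * F' v)"
    by (intro exI[of _ "\<lambda>v. F' v + G' v"]) (auto intro!: derivative_eq_intros simp: algebra_simps)
qed

lemma holomorphic_mv_on_mult:
  assumes "holomorphic_mv_on F S" "holomorphic_mv_on G S"
  shows "holomorphic_mv_on (\<lambda>w. F w * G w) S"
  unfolding holomorphic_mv_on_def
proof
  fix x assume "x \<in> S"
  then obtain F' G' where "(F has_derivative F') (at x)" "\<forall>c v. F' (c *s v) = c * F' v"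
    "(G has_derivative G') (at x)" "\<forall>c v. G' (c *s v) = c * G' v"
    using assms unfolding holomorphic_mv_on_def by meson
  then show "\<exists>F'. ((\<lambda>w. F w * G w) has_derivative F') (at x) \<and> (\<forall>c v. F' (c *s v) = c * F' v)"
    by (intro exI[of _ "\<lambda>v. F x * G' v + F' v * G x"]) (auto intro!: has_derivative_mult simp: algebra_simps)
qed

lemma holomorphic_mv_on_diff:
  assumes "holomorphic_mv_on F S" "holomorphic_mv_on G S"
  shows "holomorphic_mv_on (\<lambda>w. F w - G w) S"
  using holomorphic_mv_on_add[OF assms(1) holomorphic_mv_on_mult[OF holomorphic_mv_on_const[of "-1"] assms(2)]]
  by simp

lemma holomorphic_mv_on_sum:
  "(\<And>i. i \<in> I \<Longrightarrow> holomorphic_mv_on (F i) S) \<Longrightarrow> holomorphic_mv_on (\<lambda>w. \<Sum>i\<in>I. F i w) S"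
  by (induction I rule: infinite_finite_induct) (auto intro: holomorphic_mv_on_add holomorphic_mv_on_const)

lemma holomorphic_mv_on_prod:
  "(\<And>i. i \<in> I \<Longrightarrow> holomorphic_mv_on (F i) S) \<Longrightarrow> holomorphic_mv_on (\<lambda>w. \<Prod>i\<in>I. F i w) S"
  by (induction I rule: infinite_finite_induct) (auto intro: holomorphic_mv_on_mult holomorphic_mv_on_const)

text \<open>Locally the zero set of a single holomorphic function, the constant 0 being admitted: the empty set and
  the whole space are hypersurfaces in this sense.\<close>

definition hypersurface :: "(complex ^ 'n) set \<Rightarrow> bool" where
  "hypersurface A \<longleftrightarrow>
     (\<forall>p. \<exists>V F. open V \<and> p \<in> V \<and> holomorphic_mv_on F V \<and> A \<inter> V = {w \<in> V. F w = 0})"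

text \<open>Lyapunov-Schmidt reduction. Near \<open>p\<close> the norm of \<open>K w\<close> is bounded by some \<open>C\<close>. Dividing the equations
  with \<open>cmod (l i) > 2 * C\<close> by \<open>l i\<close> makes their right-hand side a contraction, so the coordinates in the
  finite set \<open>S\<close> of the other indices determine a solution of these equations. It is a linear combination
  of the solutions \<open>X w j\<close> that belong to the unit vectors, \<open>j \<in> S\<close>, which are holomorphic in \<open>w\<close>. Inserting
  it in the equations with index in \<open>S\<close> gives a finite system with matrix \<open>A w\<close>.\<close>

lemma hypersurface_singular_pencil:
  fixes K :: "complex ^ 'n \<Rightarrow> 'i ell2 \<Rightarrow>\<^sub>L 'i ell2" and l :: "'i \<Rightarrow> complex"
  assumes K: "\<And>w. \<exists>K'. (K has_derivative K') (at w) \<and>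
                  (\<forall>c v x. blinfun_apply (K' (c *s v)) x = cscale c (blinfun_apply (K' v) x))"
    and Klin: "\<And>w. complex_linear_op (K w)"
    and l: "\<And>R. finite {i. cmod (l i) \<le> R}"
  shows "hypersurface {w. \<exists>x. x \<noteq> 0 \<and> (\<forall>i. l i * coord x i = coord (blinfun_apply (K w) x) i)}"
  unfolding hypersurface_def
proof
  fix p :: "complex ^ 'n"
  define C where "C = norm (K p) + 1"
  have C: "C > 0" unfolding C_def by (simp add: add_nonneg_pos)
  have "\<forall>e>0. \<exists>d>0. \<forall>w. dist w p < d \<longrightarrow> dist (K w) (K p) < e"
    using K[of p] has_derivative_continuous continuous_at_eps_delta by metis
  from this[rule_format, of 1] obtain r where r: "r > 0" "\<And>w. dist w p < r \<Longrightarrow> dist (K w) (K p) < 1"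
    by auto
  define V where "V = ball p r"
  have V: "open V" "p \<in> V" using r(1) by (auto simp: V_def)
  have KC: "norm (K w) \<le> C" if "w \<in> V" for w
  proof -
    have "norm (K w - K p) \<le> 1" using r(2)[of w] that by (auto simp: V_def dist_norm norm_minus_commute)
    then show ?thesis using norm_triangle_ineq[of "K w - K p" "K p"] by (simp add: C_def)
  qed
  define S where "S = {i. cmod (l i) \<le> 2 * C}"
  have S: "finite S" unfolding S_def by (rule l)
  have lnz: "l i \<noteq> 0" if "i \<notin> S" for i using that C by (auto simp: S_def)
  define d where "d i = (if i \<in> S then 0 else 1 / l i)" for i
  have d: "cmod (d i) \<le> 1 / (2 * C)" for i
  proof (cases "i \<in> S")
    case False
    then have "2 * C \<le> cmod (l i)" by (simp add: S_def)
    then have "1 / cmod (l i) \<le> 1 / (2 * C)" using C by (simp add: frac_le)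
    then show ?thesis using False by (simp add: d_def norm_divide)
  qed (use C in \<open>simp add: d_def\<close>)
  note cd = coord_diag_op[of d, OF d]
  define T where "T w = diag_op d o\<^sub>L K w" for w
  have T: "norm (T w) \<le> 1/2" if "w \<in> V" for w
  proof -
    have "norm (T w) \<le> norm (diag_op d) * norm (K w)" unfolding T_def by (rule norm_blinfun_compose)
    also have "\<dots> \<le> 1 / (2 * C) * C" using norm_diag_op[of d, OF d] KC[OF that] C
      by (intro mult_mono) auto
    finally show ?thesis using C by simp
  qed
  have Tlin: "blinfun_apply (T w) (cscale c x) = cscale c (blinfun_apply (T w) x)" for w c x
    using Klin[of w] by (intro coord_ext) (simp add: T_def complex_linear_op_def cd)
  define X where "X w j = (SOME x. x = unit_ell2 j + blinfun_apply (T w) x)" for w j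
  have X: "X w j = unit_ell2 j + blinfun_apply (T w) (X w j)" if "w \<in> V" for w j
    unfolding X_def by (rule someI_ex[OF fixed_point_exists[OF T[OF that]]])
  define A where "A w i j = (if i = j then l i else 0) - coord (blinfun_apply (K w) (X w j)) i" for w i j
  have hol: "holomorphic_mv_on (\<lambda>w. A w i j) V" for i j
    unfolding A_def
  proof (intro holomorphic_mv_on_diff holomorphic_mv_on_const)
    show "holomorphic_mv_on (\<lambda>w. coord (blinfun_apply (K w) (X w j)) i) V"
      unfolding holomorphic_mv_on_def
    proof
      fix w assume w: "w \<in> V"
      obtain K' where K': "(K has_derivative K') (at w)"
        "\<And>c v x. blinfun_apply (K' (c *s v)) x = cscale c (blinfun_apply (K' v) x)" using K[of w] by auto
      have T': "(T has_derivative (\<lambda>v. diag_op d o\<^sub>L K' v)) (at w)"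
        unfolding T_def
        by (rule bounded_linear.has_derivative[OF bounded_bilinear.bounded_linear_right[OF bounded_bilinear_blinfun_compose] K'(1)])
      obtain X' where X': "((\<lambda>w. X w j) has_derivative X') (at w)"
        "\<And>v. X' v = blinfun_apply (diag_op d o\<^sub>L K' v) (X w j) + blinfun_apply (T w) (X' v)"
        using fixed_point_has_derivative[OF V(1) w T X T'] by blast
      have X'c: "X' (c *s v) = cscale c (X' v)" for c v
      proof (rule fixed_point_unique[OF T[OF w] X'(2)])
        show "cscale c (X' v) = blinfun_apply (diag_op d o\<^sub>L K' (c *s v)) (X w j) + blinfun_apply (T w) (cscale c (X' v))"
          by (subst X'(2)[of v]) (rule coord_ext, simp add: Tlin cscale_add K'(2) cd algebra_simps)
      qed
      have "((\<lambda>w. coord (blinfun_apply (K w) (X w j)) i) has_derivative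
              (\<lambda>v. coord (blinfun_apply (K w) (X' v) + blinfun_apply (K' v) (X w j)) i)) (at w)"
        by (intro bounded_linear.has_derivative[OF bounded_linear_coord]
              bounded_bilinear.FDERIV[OF bounded_bilinear_blinfun_apply] K'(1) X'(1))
      moreover have "coord (blinfun_apply (K w) (X' (c *s v)) + blinfun_apply (K' (c *s v)) (X w j)) i
          = c * coord (blinfun_apply (K w) (X' v) + blinfun_apply (K' v) (X w j)) i" for c v
        using Klin[of w] by (simp add: X'c K'(2) complex_linear_op_def algebra_simps)
      ultimately show "\<exists>F'. ((\<lambda>w. coord (blinfun_apply (K w) (X w j)) i) has_derivative F') (at w) \<and>
           (\<forall>c v. F' (c *s v) = c * F' v)" by blast
    qed
  qed
  obtain h where h:
    "\<And>A :: 'i \<Rightarrow> 'i \<Rightarrow> complex. (\<exists>c. (\<exists>j\<in>S. c j \<noteq> 0) \<and> (\<forall>i\<in>S. (\<Sum>j\<in>S. A i j * c j) = 0)) \<longleftrightarrow>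
       (\<Sum>p\<in>{p. p permutes {0..<card S}}. of_int (sign p) * (\<Prod>i=0..<card S. A (h i) (h (p i)))) = 0"
    by (rule singular_system_iff_leibniz_sum[OF S], rule that, assumption)
  define F where "F w = (\<Sum>p\<in>{p. p permutes {0..<card S}}. of_int (sign p) * (\<Prod>i=0..<card S. A w (h i) (h (p i))))" for w
  have "holomorphic_mv_on F V"
    unfolding F_def by (intro holomorphic_mv_on_sum holomorphic_mv_on_mult holomorphic_mv_on_prod holomorphic_mv_on_const hol)
  moreover have "(\<exists>x. x \<noteq> 0 \<and> (\<forall>i. l i * coord x i = coord (blinfun_apply (K w) x) i)) \<longleftrightarrow> F w = 0" if w: "w \<in> V" for w
  proof -
    have Tc: "coord (blinfun_apply (T w) x) i = (if i \<in> S then 0 else coord (blinfun_apply (K w) x) i / l i)" for x i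
      by (simp add: T_def cd d_def)
    have lincomb: "x = (\<Sum>j\<in>S. cscale (c j) (X w j)) \<Longrightarrow> x = (\<Sum>j\<in>S. cscale (c j) (unit_ell2 j)) + blinfun_apply (T w) x" for x c
    proof -
      assume x: "x = (\<Sum>j\<in>S. cscale (c j) (X w j))"
      have "x = (\<Sum>j\<in>S. cscale (c j) (unit_ell2 j + blinfun_apply (T w) (X w j)))"
        unfolding x by (rule sum.cong[OF refl], subst X[OF w], rule refl)
      also have "\<dots> = (\<Sum>j\<in>S. cscale (c j) (unit_ell2 j)) + blinfun_apply (T w) x"
        unfolding x by (simp add: cscale_add sum.distrib blinfun.sum_right Tlin)
      finally show ?thesis .
    qed
    have cS: "coord (\<Sum>j\<in>S. cscale (c j) (unit_ell2 j)) i = (if i \<in> S then c i else 0)" for c i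
      using S by (simp add: coord_sum if_distrib cong: if_cong)
    have Kx: "coord (blinfun_apply (K w) x) i = (\<Sum>j\<in>S. c j * coord (blinfun_apply (K w) (X w j)) i)"
      if "x = (\<Sum>j\<in>S. cscale (c j) (X w j))" for x c i
      using Klin[of w] by (simp add: that blinfun.sum_right coord_sum complex_linear_op_def)
    have Ax: "(\<Sum>j\<in>S. A w i j * c j) = l i * c i - coord (blinfun_apply (K w) x) i"
      if "x = (\<Sum>j\<in>S. cscale (c j) (X w j))" "i \<in> S" for x c i
    proof -
      have "(\<Sum>j\<in>S. A w i j * c j) = (\<Sum>j\<in>S. (if i = j then l i * c j else 0)) - (\<Sum>j\<in>S. c j * coord (blinfun_apply (K w) (X w j)) i)"
        unfolding A_def sum_subtractf[symmetric] by (rule sum.cong) (auto simp: algebra_simps)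
      then show ?thesis using S that(2) Kx[OF that(1)] by simp
    qed
    have "(\<exists>x. x \<noteq> 0 \<and> (\<forall>i. l i * coord x i = coord (blinfun_apply (K w) x) i)) \<longleftrightarrow>
          (\<exists>c. (\<exists>j\<in>S. c j \<noteq> 0) \<and> (\<forall>i\<in>S. (\<Sum>j\<in>S. A w i j * c j) = 0))"
    proof
      assume "\<exists>x. x \<noteq> 0 \<and> (\<forall>i. l i * coord x i = coord (blinfun_apply (K w) x) i)"
      then obtain x where x: "x \<noteq> 0" "\<And>i. l i * coord x i = coord (blinfun_apply (K w) x) i" by blast
      let ?c = "coord x"
      have 1: "x = (\<Sum>j\<in>S. cscale (?c j) (unit_ell2 j)) + blinfun_apply (T w) x"
        by (rule coord_ext) (simp add: cS Tc x(2)[symmetric] lnz)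
      have eq: "x = (\<Sum>j\<in>S. cscale (?c j) (X w j))"
        by (rule fixed_point_unique[OF T[OF w] 1 lincomb[OF refl]])
      have "\<exists>j\<in>S. ?c j \<noteq> 0"
      proof (rule ccontr)
        assume "\<not> (\<exists>j\<in>S. ?c j \<noteq> 0)"
        then have "(\<Sum>j\<in>S. cscale (?c j) (X w j)) = 0" by (intro sum.neutral) (auto intro: coord_ext)
        then show False using eq x(1) by simp
      qed
      moreover have "(\<Sum>j\<in>S. A w i j * ?c j) = 0" if "i \<in> S" for i
        using Ax[OF eq that] x(2)[of i] by simp
      ultimately show "\<exists>c. (\<exists>j\<in>S. c j \<noteq> 0) \<and> (\<forall>i\<in>S. (\<Sum>j\<in>S. A w i j * c j) = 0)" by blast
    next
      assume "\<exists>c. (\<exists>j\<in>S. c j \<noteq> 0) \<and> (\<forall>i\<in>S. (\<Sum>j\<in>S. A w i j * c j) = 0)"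
      then obtain c j where c: "j \<in> S" "c j \<noteq> 0" "\<And>i. i \<in> S \<Longrightarrow> (\<Sum>j\<in>S. A w i j * c j) = 0" by blast
      define x where "x = (\<Sum>j\<in>S. cscale (c j) (X w j))"
      have cx: "coord x i = (if i \<in> S then c i else coord (blinfun_apply (K w) x) i / l i)" for i
        by (subst lincomb[OF x_def]) (simp add: cS Tc)
      have "l i * coord x i = coord (blinfun_apply (K w) x) i" for i
        using cx[of i] lnz[of i] c(3)[of i] Ax[OF x_def, of i] by (cases "i \<in> S") auto
      moreover have "x \<noteq> 0" using cx[of j] c by auto
      ultimately show "\<exists>x. x \<noteq> 0 \<and> (\<forall>i. l i * coord x i = coord (blinfun_apply (K w) x) i)" by blast
    qed
    then show ?thesis unfolding F_def h[of "A w"] .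
  qed
  ultimately show "\<exists>V F. open V \<and> p \<in> V \<and> holomorphic_mv_on F V \<and>
      {w. \<exists>x. x \<noteq> 0 \<and> (\<forall>i. l i * coord x i = coord (blinfun_apply (K w) x) i)} \<inter> V = {w \<in> V. F w = 0}"
    using V by (intro exI[of _ V] exI[of _ F]) auto
qed

section \<open>The identity theorem and the Dirac mode equations\<close>

lemma bounded_linear_vector_scalar_mult_left: "bounded_linear (\<lambda>t. t *s (v :: complex ^ 'n))"
proof -
  have "linear (\<lambda>t. t *s v)"
    by (rule linearI) (simp_all add: Finite_Cartesian_Product.vec_eq_iff distrib_right)
  then show ?thesis by (rule linear_conv_bounded_linear[THEN iffD1])
qed

lemma holomorphic_mv_on_line:
  assumes F: "holomorphic_mv_on F V" and D: "\<And>t. t \<in> D \<Longrightarrow> p + t *s v \<in> V"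
  shows "(\<lambda>t. F (p + t *s v)) holomorphic_on D"
  unfolding holomorphic_on_def
proof
  fix t assume "t \<in> D"
  then obtain F' where F': "(F has_derivative F') (at (p + t *s v))" "\<And>c v. F' (c *s v) = c * F' v"
    using F D unfolding holomorphic_mv_on_def by meson
  have "((\<lambda>t. p + t *s v) has_derivative (\<lambda>s. s *s v)) (at t)"
    using has_derivative_add[OF has_derivative_const bounded_linear_imp_has_derivative[OF bounded_linear_vector_scalar_mult_left]]
    by simp
  from has_derivative_compose[OF this F'(1)]
  have "((\<lambda>t. F (p + t *s v)) has_derivative (\<lambda>s. s * F' v)) (at t)" by (simp add: F'(2))
  then have "((\<lambda>t. F (p + t *s v)) has_field_derivative F' v) (at t)"
    by (simp add: has_field_derivative_def mult.commute[of _ "F' v"])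
  then show "(\<lambda>t. F (p + t *s v)) field_differentiable at t within D"
    using field_differentiable_at_within field_differentiable_def by blast
qed

text \<open>The interior is also closed. For this the identity theorem for functions of one variable is applied
  along the complex line through an interior point \<open>p\<close> and an arbitrary point \<open>q\<close> of a ball on which the
  set is given by a holomorphic function.\<close>

lemma hypersurface_eq_UNIV_if_interior:
  fixes A :: "(complex ^ 'n) set"
  assumes A: "hypersurface A" and int: "interior A \<noteq> {}"
  shows "A = UNIV"
proof -
  have "closure (interior A) \<subseteq> interior A"
  proof
    fix w assume w: "w \<in> closure (interior A)"
    obtain V F where VF: "open V" "w \<in> V" "holomorphic_mv_on F V" "A \<inter> V = {z \<in> V. F z = 0}"
      using A unfolding hypersurface_def by meson
    obtain r where r: "r > 0" "ball w r \<subseteq> V" using VF(1,2) open_contains_ball by metis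
    obtain p where p: "p \<in> interior A" "p \<in> ball w r"
      using w r(1) unfolding closure_approachable by (metis dist_commute mem_ball)
    have "q \<in> A" if q: "q \<in> ball w r" for q
    proof -
      define D where "D = {t. p + t *s (q - p) \<in> ball w r}"
      have D': "D = (\<lambda>t. t *s (q - p)) -` ball (w - p) r"
        by (auto simp: D_def dist_norm algebra_simps)
      have cont: "continuous_on UNIV (\<lambda>t. t *s (q - p))"
        by (rule linear_continuous_on[OF bounded_linear_vector_scalar_mult_left])
      have "open D" unfolding D' by (rule open_vimage[OF open_ball cont])
      have "convex D" unfolding D'
        by (rule convex_linear_vimage[OF bounded_linear.linear[OF bounded_linear_vector_scalar_mult_left] convex_ball])
      define U where "U = D \<inter> (\<lambda>t. p + t *s (q - p)) -` interior A"
      have "open U" unfolding U_def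
        by (intro open_Int \<open>open D\<close> open_vimage continuous_intros cont) auto
      have U: "0 \<in> U" using p by (auto simp: U_def D_def)
      have "F (p + 1 *s (q - p)) = 0"
      proof (rule analytic_continuation_open[where f = "\<lambda>t. F (p + t *s (q - p))" and g = "\<lambda>_. 0" and s = U and s' = D])
        show "(\<lambda>t. F (p + t *s (q - p))) holomorphic_on D"
          by (rule holomorphic_mv_on_line[OF VF(3)]) (use r(2) in \<open>auto simp: D_def\<close>)
        show "connected D" using \<open>convex D\<close> by (rule convex_connected)
        show "F (p + t *s (q - p)) = 0" if "t \<in> U" for t
        proof -
          have "p + t *s (q - p) \<in> A \<inter> V" using that interior_subset r(2) by (auto simp: U_def D_def)
          then show ?thesis using VF(4) by auto
        qed
        show "1 \<in> D" using q by (simp add: D_def)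
      qed (use \<open>open U\<close> \<open>open D\<close> U in \<open>auto simp: U_def\<close>)
      then have "F q = 0" by simp
      then show ?thesis using VF(4) q r(2) by auto
    qed
    then show "w \<in> interior A" using r(1) by (meson centre_in_ball interiorI open_ball subsetI)
  qed
  then have "closed (interior A)" by (metis closure_subset closure_closed closed_closure subset_antisym)
  then have "interior A = UNIV" using int clopen by blast
  then show ?thesis using interior_subset by blast
qed

lemma complex_linear_op_compose:
  "complex_linear_op S \<Longrightarrow> complex_linear_op T \<Longrightarrow> complex_linear_op (S o\<^sub>L T)"
  by (simp add: complex_linear_op_def)

lemma complex_linear_op_add: "complex_linear_op S \<Longrightarrow> complex_linear_op T \<Longrightarrow> complex_linear_op (S + T)"
  by (simp add: complex_linear_op_def blinfun.add_left cscale_add)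

lemma complex_linear_op_diff: "complex_linear_op S \<Longrightarrow> complex_linear_op T \<Longrightarrow> complex_linear_op (S - T)"
  by (simp add: complex_linear_op_def blinfun.diff_left cscale_diff)

lemma complex_linear_op_diag:
  assumes "\<And>i. cmod (d i) \<le> K"
  shows "complex_linear_op (diag_op d)"
  unfolding complex_linear_op_def by (auto intro!: coord_ext simp: coord_diag_op[OF assms])

definition scalar_op :: "complex \<Rightarrow> 'i ell2 \<Rightarrow>\<^sub>L 'i ell2" where
  "scalar_op c = diag_op (\<lambda>_. c)"

lemma scalar_op_apply [simp]: "blinfun_apply (scalar_op c) x = cscale c x"
  unfolding scalar_op_def by (rule coord_ext) (simp add: coord_diag_op[of _ "cmod c"])

lemma norm_scalar_op: "norm (scalar_op c) \<le> cmod c"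
  unfolding scalar_op_def by (rule norm_diag_op) simp

lemma bounded_linear_scalar_op: "bounded_linear scalar_op"
proof (rule bounded_linear_intro[where K = 1])
  show "scalar_op (c + d) = scalar_op c + scalar_op d" for c d
    by (rule blinfun_eqI, rule coord_ext) (simp add: blinfun.add_left algebra_simps)
  show "scalar_op (r *\<^sub>R c) = r *\<^sub>R scalar_op c" for r c
    by (rule blinfun_eqI, rule coord_ext) (simp add: blinfun.scaleR_left)
qed (simp add: norm_scalar_op)

lemma complex_linear_op_scalar: "complex_linear_op (scalar_op c)"
  unfolding complex_linear_op_def by (auto intro!: coord_ext)

text \<open>The pair \<open>(x, y)\<close> of unknowns is treated as one family indexed by pairs, the first component of the
  index choosing between \<open>x\<close> and \<open>y\<close>. \<open>part\<close> and \<open>embed\<close> are the projections and injections of this direct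
  sum.\<close>

lift_definition part_raw :: "'s \<Rightarrow> ('s \<times> 'i) ell2 \<Rightarrow> 'i ell2" is "\<lambda>s x i. x (s, i)"
proof -
  fix s and x :: "'s \<times> 'i \<Rightarrow> complex"
  assume "(\<lambda>i. (cmod (x i))\<^sup>2) summable_on UNIV"
  then have "(\<lambda>i. (cmod (x i))\<^sup>2) summable_on range (Pair s)"
    using summable_on_subset_banach subset_UNIV by metis
  then show "(\<lambda>i. (cmod (x (s, i)))\<^sup>2) summable_on UNIV"
    by (subst (asm) summable_on_reindex) (auto simp: inj_on_def o_def)
qed

lemma norm_part_raw:
  fixes s :: 's and x :: "('s \<times> 'i) ell2"
  shows "norm (part_raw s x) \<le> norm x"
proof (rule norm_ell2_leI)
  fix F :: "'i set" assume F: "finite F"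
  have "L2_set (\<lambda>i. cmod (coord (part_raw s x) i)) F = L2_set (\<lambda>i. cmod (coord x i)) (Pair s ` F)"
    unfolding L2_set_def by (subst sum.reindex) (auto simp: inj_on_def part_raw.rep_eq)
  also have "\<dots> \<le> norm x" by (rule L2_set_le_norm_ell2) (use F in simp)
  finally show "L2_set (\<lambda>i. cmod (coord (part_raw s x) i)) F \<le> norm x" .
qed

definition part :: "'s \<Rightarrow> ('s \<times> 'i) ell2 \<Rightarrow>\<^sub>L 'i ell2" where
  "part s = Blinfun (part_raw s)"

lemma coord_part [simp]:
  fixes s :: 's and x :: "('s \<times> 'i) ell2"
  shows "coord (blinfun_apply (part s) x) i = coord x (s, i)"
proof -
  have "bounded_linear (part_raw s :: ('s \<times> 'i) ell2 \<Rightarrow> 'i ell2)"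
    by (rule bounded_linear_intro[where K = 1]) (auto intro!: coord_ext simp: part_raw.rep_eq norm_part_raw)
  then show ?thesis by (simp add: part_def bounded_linear_Blinfun_apply part_raw.rep_eq)
qed

lemma L2_set_embed_le:
  fixes y :: "'i ell2"
  assumes F: "finite F"
  shows "L2_set (\<lambda>p. cmod (if fst p = s then coord y (snd p) else 0)) F \<le> norm y"
proof -
  have "(\<Sum>p\<in>F. (cmod (if fst p = s then coord y (snd p) else 0))\<^sup>2) = (\<Sum>p\<in>{p\<in>F. fst p = s}. (cmod (coord y (snd p)))\<^sup>2)"
    using F by (intro sum.mono_neutral_cong_right) auto
  also have "\<dots> = (\<Sum>i\<in>snd ` {p\<in>F. fst p = s}. (cmod (coord y i))\<^sup>2)"
    by (subst sum.reindex) (auto simp: inj_on_def)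
  finally have "L2_set (\<lambda>p. cmod (if fst p = s then coord y (snd p) else 0)) F
      = L2_set (\<lambda>i. cmod (coord y i)) (snd ` {p\<in>F. fst p = s})" by (simp only: L2_set_def)
  also have "\<dots> \<le> norm y" by (rule L2_set_le_norm_ell2) (use F in simp)
  finally show ?thesis .
qed

lift_definition embed_raw :: "'s \<Rightarrow> 'i ell2 \<Rightarrow> ('s \<times> 'i) ell2" is "\<lambda>s y p. if fst p = s then y (snd p) else 0"
proof -
  fix s :: 's and y :: "'i \<Rightarrow> complex"
  assume "(\<lambda>i. (cmod (y i))\<^sup>2) summable_on UNIV"
  then have "coord (Abs_ell2 y) = y" by (simp add: Abs_ell2_inverse)
  then show "(\<lambda>p. (cmod (if fst p = s then y (snd p) else 0))\<^sup>2) summable_on UNIV"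
    using L2_set_le_imp_ell2[OF L2_set_embed_le[of _ s "Abs_ell2 y"]] by (simp only:)
qed

definition embed :: "'s \<Rightarrow> 'i ell2 \<Rightarrow>\<^sub>L ('s \<times> 'i) ell2" where
  "embed s = Blinfun (embed_raw s)"

lemma coord_embed [simp]:
  fixes s :: 's and y :: "'i ell2"
  shows "coord (blinfun_apply (embed s) y) p = (if fst p = s then coord y (snd p) else 0)"
proof -
  have "norm (embed_raw s y) \<le> norm y" for y :: "'i ell2"
    by (rule norm_ell2_leI) (simp only: embed_raw.rep_eq L2_set_embed_le)
  then have "bounded_linear (embed_raw s :: 'i ell2 \<Rightarrow> ('s \<times> 'i) ell2)"
    by (intro bounded_linear_intro[where K = 1]) (auto intro!: coord_ext simp: embed_raw.rep_eq)
  then show ?thesis by (simp add: embed_def bounded_linear_Blinfun_apply embed_raw.rep_eq)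
qed

lemma complex_linear_op_part: "complex_linear_op (part s)"
  and complex_linear_op_embed: "complex_linear_op (embed s)"
  by (auto simp: complex_linear_op_def intro!: coord_ext)

text \<open>The mode equations: \<open>\<kappa>\<close> lists the dual lattice, \<open>N\<close> is multiplication by the potential, and the
  components of \<open>w\<close> are the two quasimomenta and the eigenvalue.\<close>

definition dirac_spectrum :: "('i ell2 \<Rightarrow>\<^sub>L 'i ell2) \<Rightarrow> ('i \<Rightarrow> complex) \<Rightarrow> (complex ^ 3) set" where
  "dirac_spectrum N \<kappa> = {w. \<exists>x y. (x \<noteq> 0 \<or> y \<noteq> 0) \<and>
     (\<forall>i. pi * \<i> * (w $ 1 + \<i> * w $ 2 + \<kappa> i) * coord x i = coord (blinfun_apply N y) i - w $ 3 * coord y i) \<and>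
     (\<forall>i. pi * \<i> * (w $ 1 - \<i> * w $ 2 + cnj (\<kappa> i)) * coord y i = w $ 3 * coord x i - coord (blinfun_apply N x) i)}"

text \<open>The index \<open>True\<close> marks \<open>x\<close> and \<open>False\<close> marks \<open>y\<close>. The diagonal \<open>l\<close> collects the terms of the mode equations
  with \<open>\<kappa>\<close>, and all others go into \<open>K w\<close>, a polynomial of degree one in \<open>w\<close>.\<close>

lemma hypersurface_dirac_spectrum:
  fixes N :: "'i ell2 \<Rightarrow>\<^sub>L 'i ell2" and \<kappa> :: "'i \<Rightarrow> complex"
  assumes N: "complex_linear_op N" and fin: "\<And>R. finite {i. cmod (\<kappa> i) \<le> R}"
  shows "hypersurface (dirac_spectrum N \<kappa>)"
proof -
  define l where "l p = (if fst p then pi * \<i> * \<kappa> (snd p) else pi * \<i> * cnj (\<kappa> (snd p)))" for p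
  define C0 where "C0 = (embed True o\<^sub>L (N o\<^sub>L part False)) - (embed False o\<^sub>L (N o\<^sub>L part True))"
  define C1 :: "(bool \<times> 'i) ell2 \<Rightarrow>\<^sub>L (bool \<times> 'i) ell2" where "C1 = scalar_op (- (pi * \<i>))"
  define C2 :: "(bool \<times> 'i) ell2 \<Rightarrow>\<^sub>L (bool \<times> 'i) ell2" where "C2 = diag_op (\<lambda>p. if fst p then pi else - pi)"
  define C3 :: "(bool \<times> 'i) ell2 \<Rightarrow>\<^sub>L (bool \<times> 'i) ell2" where "C3 = (embed False o\<^sub>L part True) - (embed True o\<^sub>L part False)"
  define K where "K w = C0 + (scalar_op (w $ 1) o\<^sub>L C1) + (scalar_op (w $ 2) o\<^sub>L C2) + (scalar_op (w $ 3) o\<^sub>L C3)"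
    for w :: "complex ^ 3"
  have d: "cmod (if fst p then pi else - pi) \<le> pi" for p :: "bool \<times> 'i" by simp
  have Clin: "complex_linear_op C0" "complex_linear_op C1" "complex_linear_op C2" "complex_linear_op C3"
    unfolding C0_def C1_def C2_def C3_def
    by (intro complex_linear_op_compose complex_linear_op_diff complex_linear_op_scalar N
          complex_linear_op_part complex_linear_op_embed complex_linear_op_diag[where K = pi] d)+
  have Klin: "complex_linear_op (K w)" for w
    unfolding K_def by (intro complex_linear_op_compose complex_linear_op_add complex_linear_op_scalar Clin)
  have bl: "bounded_linear (\<lambda>v :: complex ^ 3. scalar_op (v $ j) o\<^sub>L C)" for j and C :: "(bool \<times> 'i) ell2 \<Rightarrow>\<^sub>L (bool \<times> 'i) ell2"
    by (rule bounded_linear_compose[OF bounded_bilinear.bounded_linear_left[OF bounded_bilinear_blinfun_compose]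
          bounded_linear_compose[OF bounded_linear_scalar_op bounded_linear_vec_nth]])
  have der: "\<exists>K'. (K has_derivative K') (at w) \<and>
        (\<forall>c v x. blinfun_apply (K' (c *s v)) x = cscale c (blinfun_apply (K' v) x))" for w
  proof (intro exI conjI allI)
    show "(K has_derivative (\<lambda>v. 0 + (scalar_op (v $ 1) o\<^sub>L C1) + (scalar_op (v $ 2) o\<^sub>L C2) + (scalar_op (v $ 3) o\<^sub>L C3))) (at w)"
      unfolding K_def by (intro has_derivative_add has_derivative_const bounded_linear_imp_has_derivative bl)
    show "blinfun_apply (0 + (scalar_op ((c *s v) $ 1) o\<^sub>L C1) + (scalar_op ((c *s v) $ 2) o\<^sub>L C2) + (scalar_op ((c *s v) $ 3) o\<^sub>L C3)) x
        = cscale c (blinfun_apply (0 + (scalar_op (v $ 1) o\<^sub>L C1) + (scalar_op (v $ 2) o\<^sub>L C2) + (scalar_op (v $ 3) o\<^sub>L C3)) x)"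
      for c and v :: "complex ^ 3" and x
      by (rule coord_ext) (simp add: blinfun.add_left algebra_simps)
  qed
  have lfin: "finite {p. cmod (l p) \<le> R}" for R
  proof (rule finite_subset)
    show "{p. cmod (l p) \<le> R} \<subseteq> (UNIV :: bool set) \<times> {i. cmod (\<kappa> i) \<le> R / pi}"
      by (auto simp: l_def norm_mult field_simps split: if_splits)
  qed (use fin in auto)
  have "dirac_spectrum N \<kappa> = {w. \<exists>z. z \<noteq> 0 \<and> (\<forall>p. l p * coord z p = coord (blinfun_apply (K w) z) p)}"
  proof (rule Set.set_eqI)
    fix w :: "complex ^ 3"
    have cK: "coord (blinfun_apply (K w) z) (True, i) = coord (blinfun_apply N (blinfun_apply (part False) z)) i
         - pi * \<i> * (w $ 1 + \<i> * w $ 2) * coord z (True, i) - w $ 3 * coord z (False, i)"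
      "coord (blinfun_apply (K w) z) (False, i) = - coord (blinfun_apply N (blinfun_apply (part True) z)) i
         - pi * \<i> * (w $ 1 - \<i> * w $ 2) * coord z (False, i) + w $ 3 * coord z (True, i)" for z i
      by (simp_all add: K_def C0_def C1_def C2_def C3_def blinfun.add_left blinfun.diff_left coord_diag_op[OF d] algebra_simps)
    have eqs: "(\<forall>p. l p * coord z p = coord (blinfun_apply (K w) z) p) \<longleftrightarrow>
     (\<forall>i. pi * \<i> * (w $ 1 + \<i> * w $ 2 + \<kappa> i) * coord (blinfun_apply (part True) z) i
          = coord (blinfun_apply N (blinfun_apply (part False) z)) i - w $ 3 * coord (blinfun_apply (part False) z) i) \<and>
     (\<forall>i. pi * \<i> * (w $ 1 - \<i> * w $ 2 + cnj (\<kappa> i)) * coord (blinfun_apply (part False) z) i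
          = w $ 3 * coord (blinfun_apply (part True) z) i - coord (blinfun_apply N (blinfun_apply (part True) z)) i)" for z
      unfolding split_paired_All
      by (simp add: all_bool_eq cK l_def) (auto simp: algebra_simps)
    show "w \<in> dirac_spectrum N \<kappa> \<longleftrightarrow> w \<in> {w. \<exists>z. z \<noteq> 0 \<and> (\<forall>p. l p * coord z p = coord (blinfun_apply (K w) z) p)}"
    proof
      assume "w \<in> dirac_spectrum N \<kappa>"
      then obtain x y where xy: "x \<noteq> 0 \<or> y \<noteq> 0"
        "\<forall>i. pi * \<i> * (w $ 1 + \<i> * w $ 2 + \<kappa> i) * coord x i = coord (blinfun_apply N y) i - w $ 3 * coord y i"
        "\<forall>i. pi * \<i> * (w $ 1 - \<i> * w $ 2 + cnj (\<kappa> i)) * coord y i = w $ 3 * coord x i - coord (blinfun_apply N x) i"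
        unfolding dirac_spectrum_def by blast
      let ?z = "blinfun_apply (embed True) x + blinfun_apply (embed False) y"
      have p: "blinfun_apply (part True) ?z = x" "blinfun_apply (part False) ?z = y"
        by (auto intro!: coord_ext)
      then have "?z \<noteq> 0" using xy(1) by (metis blinfun.zero_right)
      then show "w \<in> {w. \<exists>z. z \<noteq> 0 \<and> (\<forall>p. l p * coord z p = coord (blinfun_apply (K w) z) p)}"
        using xy(2,3) eqs[of ?z] unfolding p by blast
    next
      assume "w \<in> {w. \<exists>z. z \<noteq> 0 \<and> (\<forall>p. l p * coord z p = coord (blinfun_apply (K w) z) p)}"
      then obtain z where z: "z \<noteq> 0" "\<forall>p. l p * coord z p = coord (blinfun_apply (K w) z) p" by blast
      have "blinfun_apply (part True) z \<noteq> 0 \<or> blinfun_apply (part False) z \<noteq> 0"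
      proof (rule ccontr)
        assume "\<not> ?thesis"
        then have "coord z (s, i) = 0" for s i using coord_part[of s z i] by (cases s) auto
        then have "z = 0" by (intro coord_ext) auto
        then show False using z(1) by blast
      qed
      then show "w \<in> dirac_spectrum N \<kappa>" using z(2) eqs[of z] unfolding dirac_spectrum_def by blast
    qed
  qed
  then show ?thesis using hypersurface_singular_pencil[of K l, OF der Klin lfin] by simp
qed

lemma norm_ell2_square: "(norm x)\<^sup>2 = (\<Sum>\<^sub>\<infinity>i. (cmod (coord x i))\<^sup>2)"
  unfolding norm_ell2_def by (simp add: infsum_nonneg)

text \<open>For \<open>k = 0\<close> the terms with \<open>\<kappa>\<close> define a symmetric operator. In the imaginary part of the inner product
  of \<open>(x, y)\<close> with the equation they cancel, mode by mode, and \<open>t * ((norm x)\<^sup>2 + (norm y)\<^sup>2)\<close> remains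
  on one side against terms with \<open>N\<close> on the other.\<close>

lemma dirac_spectrum_excludes_imaginary_energy:
  fixes N :: "'i ell2 \<Rightarrow>\<^sub>L 'i ell2"
  assumes w: "w $ 1 = 0" "w $ 2 = 0" "w $ 3 = \<i> * complex_of_real t" and t: "t > norm N"
  shows "w \<notin> dirac_spectrum N \<kappa>"
proof
  assume "w \<in> dirac_spectrum N \<kappa>"
  then obtain x y where ne: "x \<noteq> 0 \<or> y \<noteq> 0"
    and x: "\<And>i. pi * \<i> * \<kappa> i * coord x i = coord (blinfun_apply N y) i - \<i> * t * coord y i"
    and y: "\<And>i. pi * \<i> * cnj (\<kappa> i) * coord y i = \<i> * t * coord x i - coord (blinfun_apply N x) i"
    unfolding dirac_spectrum_def using w by auto
  have pt: "t * ((cmod (coord x i))\<^sup>2 + (cmod (coord y i))\<^sup>2)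
     \<le> cmod (coord (blinfun_apply N x) i) * cmod (coord x i) + cmod (coord (blinfun_apply N y) i) * cmod (coord y i)" for i
  proof -
    let ?x = "coord x i" and ?y = "coord y i" and ?Nx = "coord (blinfun_apply N x) i" and ?Ny = "coord (blinfun_apply N y) i"
    have 1: "\<i> * t * ?x * cnj ?x = ?Nx * cnj ?x + pi * \<i> * (cnj (\<kappa> i) * ?y * cnj ?x)"
      using arg_cong[OF y[of i], of "\<lambda>z. z * cnj ?x"] by (simp add: algebra_simps)
    have 2: "\<i> * t * ?y * cnj ?y = ?Ny * cnj ?y - pi * \<i> * cnj (cnj (\<kappa> i) * ?y * cnj ?x)"
      using arg_cong[OF x[of i], of "\<lambda>z. z * cnj ?y"] by (simp add: algebra_simps)
    have n: "z * cnj z = (cmod z)\<^sup>2" for z by (simp add: complex_norm_square del: of_real_power)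
    have "Im (\<i> * t * ?x * cnj ?x + \<i> * t * ?y * cnj ?y) = t * ((cmod ?x)\<^sup>2 + (cmod ?y)\<^sup>2)"
      by (simp add: mult.assoc n algebra_simps del: of_real_power complex_mult_cnj)
    moreover have "Im (\<i> * t * ?x * cnj ?x + \<i> * t * ?y * cnj ?y) = Im (?Nx * cnj ?x + ?Ny * cnj ?y)"
      unfolding 1 2 by (simp add: algebra_simps)
    moreover have "Im (?Nx * cnj ?x + ?Ny * cnj ?y) \<le> cmod (?Nx * cnj ?x + ?Ny * cnj ?y)"
      using abs_Im_le_cmod abs_le_D1 by blast
    moreover have "\<dots> \<le> cmod ?Nx * cmod ?x + cmod ?Ny * cmod ?y"
      by (rule order_trans[OF norm_triangle_ineq]) (simp add: norm_mult)
    ultimately show ?thesis by linarith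
  qed
  have CS: "(\<Sum>i\<in>F. cmod (coord (blinfun_apply N u) i) * cmod (coord u i)) \<le> norm N * (norm u)\<^sup>2"
    if F: "finite F" for F u
  proof -
    have "(\<Sum>i\<in>F. cmod (coord (blinfun_apply N u) i) * cmod (coord u i))
       \<le> L2_set (\<lambda>i. cmod (coord (blinfun_apply N u) i)) F * L2_set (\<lambda>i. cmod (coord u i)) F"
      using L2_set_mult_ineq[of "\<lambda>i. cmod (coord (blinfun_apply N u) i)" "\<lambda>i. cmod (coord u i)" F] by simp
    also have "\<dots> \<le> norm (blinfun_apply N u) * norm u"
      by (intro mult_mono L2_set_le_norm_ell2 F) auto
    also have "\<dots> \<le> (norm N * norm u) * norm u" by (intro mult_right_mono norm_blinfun) auto
    finally show ?thesis by (simp add: power2_eq_square mult.assoc)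
  qed
  let ?B = "norm N * ((norm x)\<^sup>2 + (norm y)\<^sup>2)"
  have s: "(\<lambda>i. (cmod (coord x i))\<^sup>2 + (cmod (coord y i))\<^sup>2) summable_on UNIV" by (intro summable_on_add coord_mem)
  have "t * ((norm x)\<^sup>2 + (norm y)\<^sup>2) = (\<Sum>\<^sub>\<infinity>i. t * ((cmod (coord x i))\<^sup>2 + (cmod (coord y i))\<^sup>2))"
    unfolding norm_ell2_square by (simp add: infsum_cmult_right' infsum_add[OF coord_mem coord_mem])
  also have "\<dots> \<le> ?B"
  proof (rule infsum_le_finite_sums)
    show "(\<lambda>i. t * ((cmod (coord x i))\<^sup>2 + (cmod (coord y i))\<^sup>2)) summable_on UNIV"
      by (intro summable_on_cmult_right s)
    fix F :: "'i set" assume F: "finite F"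
    have "(\<Sum>i\<in>F. t * ((cmod (coord x i))\<^sup>2 + (cmod (coord y i))\<^sup>2))
       \<le> (\<Sum>i\<in>F. cmod (coord (blinfun_apply N x) i) * cmod (coord x i) + cmod (coord (blinfun_apply N y) i) * cmod (coord y i))"
      by (rule sum_mono) (rule pt)
    also have "\<dots> \<le> ?B" using CS[OF F, of x] CS[OF F, of y] by (simp add: sum.distrib distrib_left)
    finally show "(\<Sum>i\<in>F. t * ((cmod (coord x i))\<^sup>2 + (cmod (coord y i))\<^sup>2)) \<le> ?B" .
  qed
  finally have "(t - norm N) * ((norm x)\<^sup>2 + (norm y)\<^sup>2) \<le> 0" by (simp add: left_diff_distrib)
  moreover have "(norm x)\<^sup>2 + (norm y)\<^sup>2 > 0" using ne by (auto intro: add_pos_nonneg add_nonneg_pos)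
  ultimately show False using t by (simp add: mult_le_0_iff)
qed

section \<open>Inverse symbols at large quasimomenta\<close>

text \<open>The inverse of \<open>y\<^sub>i \<mapsto> \<pi> \<i> (a + cnj (\<kappa> i)) y\<^sub>i\<close>, the left-hand side of the second mode equation with
  \<open>a = k\<^sub>1 - \<i> k\<^sub>2\<close>; in the position variable the operator is \<open>\<partial>\<close> acting on quasi-periodic functions.\<close>

definition antiholo_inverse :: "('i \<Rightarrow> complex) \<Rightarrow> complex \<Rightarrow> 'i ell2 \<Rightarrow>\<^sub>L 'i ell2" where
  "antiholo_inverse \<kappa> a = diag_op (\<lambda>i. 1 / (pi * \<i> * (a + cnj (\<kappa> i))))"

lemma cmod_inverse_symbol_le:
  assumes "\<rho> > 0" "cmod c \<ge> \<rho>"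
  shows "cmod (1 / (pi * \<i> * c)) \<le> 1 / (pi * \<rho>)"
proof -
  have "1 / (pi * cmod c) \<le> 1 / (pi * \<rho>)"
    by (rule frac_le) (use assms in auto)
  then show ?thesis by (simp add: norm_mult norm_divide)
qed

text \<open>As \<open>a\<close> tends to infinity the entries of the inverse stay bounded by the distance condition, and any
  finite number of them tends to 0. A row of \<open>N\<close> is a square-summable family, so that its entries outside
  of a finite set contribute little. The threshold for \<open>a\<close> depends on \<open>i\<close>: the product of \<open>N\<close> and the
  inverse need not be small in norm, because the modes with \<open>cnj (\<kappa> j)\<close> close to \<open>- a\<close> move with \<open>a\<close>.\<close>

lemma antiholo_inverse_row_small:
  fixes N :: "'i ell2 \<Rightarrow>\<^sub>L 'j ell2" and \<kappa> :: "'i \<Rightarrow> complex"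
  assumes N: "complex_linear_op N" and \<rho>: "\<rho> > 0" and e: "e > 0"
  shows "\<forall>\<^sub>F a in at_infinity. (\<forall>j. cmod (a + cnj (\<kappa> j)) \<ge> \<rho>) \<longrightarrow>
    (\<forall>y. cmod (coord (blinfun_apply N (blinfun_apply (antiholo_inverse \<kappa> a) y)) i) \<le> e * norm y)"
proof -
  define f where "f y = coord (blinfun_apply N y) i" for y
  have fb: "bounded_linear f" unfolding f_def
    by (rule bounded_linear_compose[OF bounded_linear_coord blinfun.bounded_linear_right])
  have fc: "f (cscale c x) = c * f x" for c x using N by (simp add: f_def complex_linear_op_def)
  have "e * pi * \<rho> / 2 > 0" using e \<rho> by simp
  from functional_tail_small[OF fb fc this]
  obtain G where G: "finite G" "\<And>y. (\<And>i. i \<in> G \<Longrightarrow> coord y i = 0) \<Longrightarrow> cmod (f y) \<le> e * pi * \<rho> / 2 * norm y"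
    by blast
  define \<eta> where "\<eta> = e / (2 * (norm N + 1))"
  have np: "norm N + 1 > 0" by (simp add: add_nonneg_pos)
  have \<eta>: "\<eta> > 0" using e np by (simp add: \<eta>_def)
  have "cmod (f (blinfun_apply (antiholo_inverse \<kappa> a) y)) \<le> e * norm y"
    if a: "cmod a \<ge> (\<Sum>j\<in>G. cmod (\<kappa> j)) + 1 / (pi * \<eta>)" and far: "\<And>j. cmod (a + cnj (\<kappa> j)) \<ge> \<rho>" for a y
  proof -
    let ?A = "\<lambda>j. 1 / (pi * \<i> * (a + cnj (\<kappa> j)))"
    define d1 where "d1 j = (if j \<in> G then ?A j else 0)" for j
    define d2 where "d2 j = (if j \<in> G then 0 else ?A j)" for j
    have Ab: "cmod (?A j) \<le> 1 / (pi * \<rho>)" for j by (rule cmod_inverse_symbol_le[OF \<rho> far])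
    have d1: "cmod (d1 j) \<le> \<eta>" for j
    proof (cases "j \<in> G")
      case True
      have "cmod (\<kappa> j) \<le> (\<Sum>j\<in>G. cmod (\<kappa> j))" by (rule member_le_sum) (use True G in auto)
      then have "cmod (a + cnj (\<kappa> j)) \<ge> 1 / (pi * \<eta>)"
        using a norm_diff_ineq[of a "cnj (\<kappa> j)"] by simp
      from cmod_inverse_symbol_le[OF _ this] \<eta> have "cmod (?A j) \<le> 1 / (pi * (1 / (pi * \<eta>)))" by simp
      then show ?thesis using True \<eta> by (simp add: d1_def)
    qed (use \<eta> in \<open>simp add: d1_def\<close>)
    have d2: "cmod (d2 j) \<le> 1 / (pi * \<rho>)" for j using Ab[of j] \<rho> by (simp add: d2_def)
    have split: "blinfun_apply (antiholo_inverse \<kappa> a) y = blinfun_apply (diag_op d1) y + blinfun_apply (diag_op d2) y"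
      unfolding antiholo_inverse_def
      by (rule coord_ext) (simp add: coord_diag_op[of _ _, OF Ab] coord_diag_op[OF d1] coord_diag_op[OF d2], simp add: d1_def d2_def)
    have 1: "cmod (f (blinfun_apply (diag_op d1) y)) \<le> e / 2 * norm y"
    proof -
      have "cmod (f (blinfun_apply (diag_op d1) y)) \<le> norm N * (norm (diag_op d1) * norm y)"
        unfolding f_def by (intro order_trans[OF cmod_coord_le_norm] order_trans[OF norm_blinfun] mult_left_mono norm_blinfun) auto
      also have "\<dots> \<le> (norm N + 1) * (\<eta> * norm y)"
        by (intro mult_mono norm_diag_op d1) (use \<eta> in auto)
      also have "\<dots> = (\<eta> * (norm N + 1)) * norm y" by (simp add: mult_ac)
      also have "\<eta> * (norm N + 1) = e / 2" unfolding \<eta>_def using np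
        by (subst times_divide_eq_left, subst mult.commute[of 2], subst divide_divide_eq_left[symmetric]) simp
      finally show ?thesis .
    qed
    have 2: "cmod (f (blinfun_apply (diag_op d2) y)) \<le> e / 2 * norm y"
    proof -
      have "cmod (f (blinfun_apply (diag_op d2) y)) \<le> e * pi * \<rho> / 2 * norm (blinfun_apply (diag_op d2) y)"
        by (rule G(2)) (simp add: coord_diag_op[OF d2] d2_def)
      also have "\<dots> \<le> e * pi * \<rho> / 2 * (1 / (pi * \<rho>) * norm y)"
        by (intro mult_left_mono order_trans[OF norm_blinfun] mult_right_mono norm_diag_op d2) (use e \<rho> in auto)
      also have "\<dots> = e / 2 * norm y" using \<rho> by simp
      finally show ?thesis .
    qed
    show ?thesis unfolding split linear_add[OF bounded_linear.linear[OF fb]]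
      using norm_triangle_ineq[of "f (blinfun_apply (diag_op d1) y)" "f (blinfun_apply (diag_op d2) y)"] 1 2
      by (simp add: field_simps)
  qed
  then show ?thesis unfolding eventually_at_infinity f_def by blast
qed

text \<open>The inverse of the left-hand side of the first mode equation for \<open>b = k\<^sub>1 + \<i> k\<^sub>2 = 0\<close>, on the complement
  of the mode \<open>z\<close> with \<open>\<kappa> z = 0\<close>, which spans the kernel.\<close>

definition holo_inverse :: "'i \<Rightarrow> ('i \<Rightarrow> complex) \<Rightarrow> 'i ell2 \<Rightarrow>\<^sub>L 'i ell2" where
  "holo_inverse z \<kappa> = diag_op (\<lambda>i. if i = z then 0 else 1 / (pi * \<i> * \<kappa> i))"

lemma holo_inverse_bound:
  assumes "\<delta> > 0" "\<And>i. i \<noteq> z \<Longrightarrow> cmod (\<kappa> i) \<ge> \<delta>"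
  shows "cmod (if i = z then 0 else 1 / (pi * \<i> * \<kappa> i)) \<le> 1 / (pi * \<delta>)"
  using cmod_inverse_symbol_le[OF assms(1) assms(2)[of i]] assms(1) by auto

text \<open>The rows of \<open>N\<close> become small one at a time, and a compact operator to the left makes the convergence
  uniform: its entries outside a finite set \<open>S\<close> are small, and the rows in \<open>S\<close> are finite in number.\<close>

lemma compact_sandwich_small:
  fixes N :: "'i ell2 \<Rightarrow>\<^sub>L 'i ell2" and \<kappa> :: "'i \<Rightarrow> complex"
  assumes N: "complex_linear_op N" and fin: "\<And>R. finite {i. cmod (\<kappa> i) \<le> R}"
    and \<delta>: "\<delta> > 0" "\<And>i. i \<noteq> z \<Longrightarrow> cmod (\<kappa> i) \<ge> \<delta>" and \<rho>: "\<rho> > 0" and e: "e > 0"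
  shows "\<forall>\<^sub>F a in at_infinity. (\<forall>j. cmod (a + cnj (\<kappa> j)) \<ge> \<rho>) \<longrightarrow>
    (\<forall>y. norm (blinfun_apply (holo_inverse z \<kappa>) (blinfun_apply N (blinfun_apply (antiholo_inverse \<kappa> a) y))) \<le> e * norm y)"
proof -
  have np: "norm N + 1 > 0" by (simp add: add_nonneg_pos)
  define e1 where "e1 = e * (pi * \<rho>) / (2 * (norm N + 1))"
  have e1: "e1 > 0" using e \<rho> np by (simp add: e1_def)
  define S where "S = {i. cmod (\<kappa> i) \<le> 1 / (pi * e1)}"
  have S: "finite S" unfolding S_def by (rule fin)
  define e2 where "e2 = e * (pi * \<delta>) / (2 * (card S + 1))"
  have e2: "e2 > 0" using e \<delta> by (simp add: e2_def)
  have "\<forall>\<^sub>F a in at_infinity. \<forall>i\<in>S. (\<forall>j. cmod (a + cnj (\<kappa> j)) \<ge> \<rho>) \<longrightarrow>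
    (\<forall>y. cmod (coord (blinfun_apply N (blinfun_apply (antiholo_inverse \<kappa> a) y)) i) \<le> e2 * norm y)"
    by (rule eventually_ball_finite[OF S]) (use antiholo_inverse_row_small[OF N \<rho> e2] in blast)
  then show ?thesis
  proof (rule eventually_mono, intro impI allI)
    fix a y
    assume a: "\<forall>i\<in>S. (\<forall>j. cmod (a + cnj (\<kappa> j)) \<ge> \<rho>) \<longrightarrow>
      (\<forall>y. cmod (coord (blinfun_apply N (blinfun_apply (antiholo_inverse \<kappa> a) y)) i) \<le> e2 * norm y)"
      and far: "\<forall>j. cmod (a + cnj (\<kappa> j)) \<ge> \<rho>"
    define u where "u = blinfun_apply N (blinfun_apply (antiholo_inverse \<kappa> a) y)"
    have uS: "cmod (coord u i) \<le> e2 * norm y" if "i \<in> S" for i using a far that by (simp add: u_def)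
    have un: "norm u \<le> (norm N + 1) * (1 / (pi * \<rho>) * norm y)"
      unfolding u_def antiholo_inverse_def
      by (intro order_trans[OF norm_blinfun] mult_mono norm_diag_op mult_right_mono cmod_inverse_symbol_le \<rho>) (use far \<rho> in auto)
    define b where "b i = (if i = z then 0 else 1 / (pi * \<i> * \<kappa> i))" for i
    have b: "cmod (b i) \<le> 1 / (pi * \<delta>)" for i unfolding b_def by (rule holo_inverse_bound[OF \<delta>])
    define d1 where "d1 i = (if i \<in> S then b i else 0)" for i
    define d2 where "d2 i = (if i \<in> S then 0 else b i)" for i
    have d1: "cmod (d1 i) \<le> 1 / (pi * \<delta>)" for i using b[of i] \<delta>(1) by (simp add: d1_def)
    have d2: "cmod (d2 i) \<le> e1" for i
    proof (cases "i \<in> S \<or> i = z")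
      case False
      then have "cmod (\<kappa> i) \<ge> 1 / (pi * e1)" by (simp add: S_def)
      from cmod_inverse_symbol_le[OF _ this] e1 False show ?thesis by (simp add: d2_def b_def)
    qed (use e1 in \<open>auto simp: d2_def b_def\<close>)
    have split: "blinfun_apply (holo_inverse z \<kappa>) u = blinfun_apply (diag_op d1) u + blinfun_apply (diag_op d2) u"
      unfolding holo_inverse_def b_def[symmetric]
      by (rule coord_ext) (simp add: coord_diag_op[OF b] coord_diag_op[OF d1] coord_diag_op[OF d2], simp add: d1_def d2_def)
    have 1: "norm (blinfun_apply (diag_op d1) u) \<le> e / 2 * norm y"
    proof (rule norm_ell2_leI)
      fix F :: "'i set" assume F: "finite F"
      have "L2_set (\<lambda>i. cmod (coord (blinfun_apply (diag_op d1) u) i)) F \<le> (\<Sum>i\<in>F. cmod (coord (blinfun_apply (diag_op d1) u) i))"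
        by (rule L2_set_le_sum) simp
      also have "\<dots> = (\<Sum>i\<in>F \<inter> S. cmod (coord (blinfun_apply (diag_op d1) u) i))"
        by (rule sum.mono_neutral_right) (use F in \<open>auto simp: coord_diag_op[OF d1] d1_def\<close>)
      also have "\<dots> \<le> (\<Sum>i\<in>F \<inter> S. 1 / (pi * \<delta>) * (e2 * norm y))"
        by (rule sum_mono, subst coord_diag_op[OF d1], subst norm_mult, intro mult_mono d1 uS) (use \<delta> in auto)
      also have "\<dots> = card (F \<inter> S) * (1 / (pi * \<delta>) * (e2 * norm y))" by simp
      also have "\<dots> \<le> (card S + 1) * (1 / (pi * \<delta>) * (e2 * norm y))"
        by (rule mult_right_mono) (use e2 \<delta> card_mono[OF S, of "F \<inter> S"] in auto)
      also have "\<dots> = (e2 * (card S + 1) / (pi * \<delta>)) * norm y" by (simp add: mult_ac)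
      also have "e2 * (card S + 1) = e * (pi * \<delta>) / 2"
      proof -
        have "c / (2 * m) * m = c / 2" if "m > 0" for c m :: real using that by simp
        from this[of "real (card S + 1)" "e * (pi * \<delta>)"] show ?thesis unfolding e2_def by simp
      qed
      also have "e * (pi * \<delta>) / 2 / (pi * \<delta>) * norm y = e / 2 * norm y" using \<delta>(1) by simp
      finally show "L2_set (\<lambda>i. cmod (coord (blinfun_apply (diag_op d1) u) i)) F \<le> e / 2 * norm y" .
    qed
    have "norm (blinfun_apply (diag_op d2) u) \<le> e1 * ((norm N + 1) * (1 / (pi * \<rho>) * norm y))"
      by (intro order_trans[OF norm_blinfun] mult_mono norm_diag_op d2 un) (use e1 in auto)
    also have "\<dots> = (e1 * (norm N + 1) / (pi * \<rho>)) * norm y" by (simp add: mult_ac)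
    also have "e1 * (norm N + 1) = e * (pi * \<rho>) / 2"
    proof -
      have "c / (2 * m) * m = c / 2" if "m > 0" for c m :: real using that by simp
      from this[OF np] show ?thesis unfolding e1_def .
    qed
    also have "e * (pi * \<rho>) / 2 / (pi * \<rho>) * norm y = e / 2 * norm y" using \<rho> by simp
    finally have 2: "norm (blinfun_apply (diag_op d2) u) \<le> e / 2 * norm y" .
    show "norm (blinfun_apply (holo_inverse z \<kappa>) (blinfun_apply N (blinfun_apply (antiholo_inverse \<kappa> a) y))) \<le> e * norm y"
      unfolding u_def[symmetric] split
      using norm_triangle_ineq[of "blinfun_apply (diag_op d1) u" "blinfun_apply (diag_op d2) u"] 1 2
      by (simp add: field_simps)
  qed
qed

lemma antiholo_inverse_has_derivative:
  fixes \<kappa> :: "'i \<Rightarrow> complex"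
  assumes \<rho>: "\<rho> > 0" and D: "open D" "a \<in> D" and far: "\<And>a j. a \<in> D \<Longrightarrow> cmod (a + cnj (\<kappa> j)) \<ge> \<rho>"
  shows "(antiholo_inverse \<kappa> has_derivative
     (\<lambda>v. scalar_op v o\<^sub>L diag_op (\<lambda>i. - 1 / (pi * \<i> * (a + cnj (\<kappa> i))\<^sup>2)))) (at a)"
  unfolding has_derivative_at_alt
proof (intro conjI allI impI)
  show "bounded_linear (\<lambda>v. scalar_op v o\<^sub>L diag_op (\<lambda>i. - 1 / (pi * \<i> * (a + cnj (\<kappa> i))\<^sup>2)))"
    by (rule bounded_linear_compose[OF bounded_bilinear.bounded_linear_left[OF bounded_bilinear_blinfun_compose] bounded_linear_scalar_op])
  fix e :: real assume e: "e > 0"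
  obtain d where d: "d > 0" "ball a d \<subseteq> D" using D open_contains_ball by metis
  have b2: "cmod (- 1 / (pi * \<i> * (a + cnj (\<kappa> i))\<^sup>2)) \<le> 1 / (pi * \<rho>\<^sup>2)" for i
  proof -
    have "1 / (pi * (cmod (a + cnj (\<kappa> i)))\<^sup>2) \<le> 1 / (pi * \<rho>\<^sup>2)"
      by (rule frac_le) (use far[OF D(2), of i] \<rho> in \<open>auto intro: power_mono\<close>)
    then show ?thesis by (simp add: norm_mult norm_divide norm_power)
  qed
  have "norm (antiholo_inverse \<kappa> y - antiholo_inverse \<kappa> a - (scalar_op (y - a) o\<^sub>L diag_op (\<lambda>i. - 1 / (pi * \<i> * (a + cnj (\<kappa> i))\<^sup>2))))
      \<le> e * norm (y - a)" if y: "norm (y - a) < min d (e * (pi * \<rho>^3))" for y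
  proof -
    have yD: "y \<in> D" using d(2) y by (auto simp: subset_iff dist_norm norm_minus_commute)
    define q where "q i = (y - a)\<^sup>2 / (pi * \<i> * (y + cnj (\<kappa> i)) * (a + cnj (\<kappa> i))\<^sup>2)" for i
    have q: "cmod (q i) \<le> (cmod (y - a))\<^sup>2 / (pi * \<rho>^3)" for i
    proof -
      have "\<rho> * \<rho>\<^sup>2 \<le> cmod (y + cnj (\<kappa> i)) * (cmod (a + cnj (\<kappa> i)))\<^sup>2"
        using far[OF D(2), of i] far[OF yD, of i] \<rho> by (intro mult_mono power_mono) auto
      then have "(cmod (y - a))\<^sup>2 / (pi * (cmod (y + cnj (\<kappa> i)) * (cmod (a + cnj (\<kappa> i)))\<^sup>2)) \<le> (cmod (y - a))\<^sup>2 / (pi * (\<rho> * \<rho>\<^sup>2))"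
        by (intro frac_le mult_left_mono) (use \<rho> in auto)
      then show ?thesis
        by (simp add: q_def norm_mult norm_divide norm_power power3_eq_cube power2_eq_square mult.assoc)
    qed
    have alg: "1 / (c * u) - 1 / (c * v) - (u - v) * (- 1 / (c * v\<^sup>2)) = (u - v)\<^sup>2 / (c * u * v\<^sup>2)"
      if "c \<noteq> 0" "u \<noteq> 0" "v \<noteq> 0" for c u v :: complex
      using that by (simp add: divide_simps) (simp add: algebra_simps power2_eq_square)
    have "antiholo_inverse \<kappa> y - antiholo_inverse \<kappa> a - (scalar_op (y - a) o\<^sub>L diag_op (\<lambda>i. - 1 / (pi * \<i> * (a + cnj (\<kappa> i))\<^sup>2))) = diag_op q"
    proof (rule blinfun_eqI, rule coord_ext)
      fix x i
      have nz: "y + cnj (\<kappa> i) \<noteq> 0" "a + cnj (\<kappa> i) \<noteq> 0" using far[OF D(2), of i] far[OF yD, of i] \<rho> by auto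
      have qi: "1 / (pi * \<i> * (y + cnj (\<kappa> i))) - 1 / (pi * \<i> * (a + cnj (\<kappa> i))) - (y - a) * (- 1 / (pi * \<i> * (a + cnj (\<kappa> i))\<^sup>2)) = q i"
        using alg[of "pi * \<i>", OF _ nz] by (simp add: q_def)
      have "coord (blinfun_apply (antiholo_inverse \<kappa> y - antiholo_inverse \<kappa> a - (scalar_op (y - a) o\<^sub>L diag_op (\<lambda>i. - 1 / (pi * \<i> * (a + cnj (\<kappa> i))\<^sup>2)))) x) i
         = (1 / (pi * \<i> * (y + cnj (\<kappa> i))) - 1 / (pi * \<i> * (a + cnj (\<kappa> i))) - (y - a) * (- 1 / (pi * \<i> * (a + cnj (\<kappa> i))\<^sup>2))) * coord x i"
        unfolding blinfun.diff_left coord_diff antiholo_inverse_def blinfun_apply_blinfun_compose scalar_op_apply coord_cscale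
          coord_diag_op[of "\<lambda>i. 1 / (pi * \<i> * (a + cnj (\<kappa> i)))", OF cmod_inverse_symbol_le[OF \<rho> far[OF D(2)]]]
          coord_diag_op[of "\<lambda>i. 1 / (pi * \<i> * (y + cnj (\<kappa> i)))", OF cmod_inverse_symbol_le[OF \<rho> far[OF yD]]]
          coord_diag_op[of "\<lambda>i. - 1 / (pi * \<i> * (a + cnj (\<kappa> i))\<^sup>2)", OF b2]
        by (simp only: left_diff_distrib mult.assoc)
      also have "\<dots> = coord (blinfun_apply (diag_op q) x) i" unfolding qi coord_diag_op[OF q] ..
      finally show "coord (blinfun_apply (antiholo_inverse \<kappa> y - antiholo_inverse \<kappa> a - (scalar_op (y - a) o\<^sub>L diag_op (\<lambda>i. - 1 / (pi * \<i> * (a + cnj (\<kappa> i))\<^sup>2)))) x) i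
         = coord (blinfun_apply (diag_op q) x) i" .
    qed
    also have "norm (diag_op q) \<le> (cmod (y - a))\<^sup>2 / (pi * \<rho>^3)" by (rule norm_diag_op[OF q])
    also have "\<dots> = (cmod (y - a) / (pi * \<rho>^3)) * cmod (y - a)" by (simp add: power2_eq_square)
    also have "\<dots> \<le> e * cmod (y - a)"
      by (rule mult_right_mono) (use y \<rho> in \<open>auto simp: pos_divide_le_eq\<close>)
    finally show ?thesis .
  qed
  then show "\<exists>d>0. \<forall>y. norm (y - a) < d \<longrightarrow>
      norm (antiholo_inverse \<kappa> y - antiholo_inverse \<kappa> a - (scalar_op (y - a) o\<^sub>L diag_op (\<lambda>i. - 1 / (pi * \<i> * (a + cnj (\<kappa> i))\<^sup>2))))
      \<le> e * norm (y - a)"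
    using d(1) e \<rho> by (intro exI[of _ "min d (e * (pi * \<rho>^3))"]) auto
qed

section \<open>The zero energy curve\<close>

text \<open>The mode equations for \<open>E = 0\<close> in the coordinates \<open>a = k\<^sub>1 - \<i> k\<^sub>2\<close>, \<open>b = k\<^sub>1 + \<i> k\<^sub>2\<close>.\<close>

definition zero_mode_pair :: "('i ell2 \<Rightarrow>\<^sub>L 'i ell2) \<Rightarrow> ('i \<Rightarrow> complex) \<Rightarrow> complex \<Rightarrow> complex \<Rightarrow> bool" where
  "zero_mode_pair N \<kappa> a b \<longleftrightarrow> (\<exists>x y. (x \<noteq> 0 \<or> y \<noteq> 0) \<and>
     (\<forall>i. pi * \<i> * (b + \<kappa> i) * coord x i = coord (blinfun_apply N y) i) \<and>
     (\<forall>i. pi * \<i> * (a + cnj (\<kappa> i)) * coord y i = - coord (blinfun_apply N x) i))"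

lemma coord_antiholo_inverse:
  assumes "\<rho> > 0" "\<And>j. cmod (a + cnj (\<kappa> j)) \<ge> \<rho>"
  shows "coord (blinfun_apply (antiholo_inverse \<kappa> a) x) i = coord x i / (pi * \<i> * (a + cnj (\<kappa> i)))"
    and "norm (antiholo_inverse \<kappa> a) \<le> 1 / (pi * \<rho>)"
    and "complex_linear_op (antiholo_inverse \<kappa> a)"
proof -
  note b = cmod_inverse_symbol_le[OF assms(1) assms(2)]
  show "coord (blinfun_apply (antiholo_inverse \<kappa> a) x) i = coord x i / (pi * \<i> * (a + cnj (\<kappa> i)))"
    unfolding antiholo_inverse_def by (subst coord_diag_op[of "\<lambda>i. 1 / (pi * \<i> * (a + cnj (\<kappa> i)))", OF b]) simp
  show "norm (antiholo_inverse \<kappa> a) \<le> 1 / (pi * \<rho>)" unfolding antiholo_inverse_def by (rule norm_diag_op[OF b])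
  show "complex_linear_op (antiholo_inverse \<kappa> a)" unfolding antiholo_inverse_def by (rule complex_linear_op_diag[OF b])
qed

lemma coord_holo_inverse:
  assumes "\<delta> > 0" "\<And>i. i \<noteq> z \<Longrightarrow> cmod (\<kappa> i) \<ge> \<delta>"
  shows "coord (blinfun_apply (holo_inverse z \<kappa>) x) i = (if i = z then 0 else coord x i / (pi * \<i> * \<kappa> i))"
    and "norm (holo_inverse z \<kappa>) \<le> 1 / (pi * \<delta>)"
    and "complex_linear_op (holo_inverse z \<kappa>)"
proof -
  have b: "cmod (if i = z then 0 else 1 / (pi * \<i> * \<kappa> i)) \<le> 1 / (pi * \<delta>)" for i
    by (rule holo_inverse_bound) (use assms in auto)
  show "coord (blinfun_apply (holo_inverse z \<kappa>) x) i = (if i = z then 0 else coord x i / (pi * \<i> * \<kappa> i))"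
    unfolding holo_inverse_def by (subst coord_diag_op[of "\<lambda>i. if i = z then 0 else 1 / (pi * \<i> * \<kappa> i)", OF b]) simp
  show "norm (holo_inverse z \<kappa>) \<le> 1 / (pi * \<delta>)" unfolding holo_inverse_def by (rule norm_diag_op[OF b])
  show "complex_linear_op (holo_inverse z \<kappa>)" unfolding holo_inverse_def by (rule complex_linear_op_diag[OF b])
qed

lemma field_differentiable_if_complex_linear:
  assumes "(f has_derivative F) (at a)" "\<And>c v :: complex. F (c * v) = c * F v"
  shows "f field_differentiable (at a)"
proof -
  have "F = (*) (F 1)"
  proof
    fix v show "F v = F 1 * v" using assms(2)[of v 1] by (simp add: mult.commute)
  qed
  then have "(f has_field_derivative F 1) (at a)"
    unfolding has_field_derivative_def by (rule has_derivative_eq_rhs[OF assms(1)])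
  then show ?thesis unfolding field_differentiable_def by blast
qed

text \<open>Elimination of \<open>y\<close>, which the second equation determines.\<close>

lemma zero_mode_pair_iff_scalar:
  fixes N :: "'i ell2 \<Rightarrow>\<^sub>L 'i ell2"
  assumes \<rho>: "\<rho> > 0" and far: "\<And>j. cmod (a + cnj (\<kappa> j)) \<ge> \<rho>"
  shows "zero_mode_pair N \<kappa> a b \<longleftrightarrow>
    (\<exists>x. x \<noteq> 0 \<and> (\<forall>i. pi * \<i> * (b + \<kappa> i) * coord x i =
        - coord (blinfun_apply N (blinfun_apply (antiholo_inverse \<kappa> a) (blinfun_apply N x))) i))"
proof
  note A = coord_antiholo_inverse(1)[of \<rho> a \<kappa>, OF \<rho> far]
  have nz: "a + cnj (\<kappa> i) \<noteq> 0" for i using far[of i] \<rho> by auto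
  assume "zero_mode_pair N \<kappa> a b"
  then obtain x y where xy: "x \<noteq> 0 \<or> y \<noteq> 0"
     "\<And>i. pi * \<i> * (b + \<kappa> i) * coord x i = coord (blinfun_apply N y) i"
     "\<And>i. pi * \<i> * (a + cnj (\<kappa> i)) * coord y i = - coord (blinfun_apply N x) i"
    unfolding zero_mode_pair_def by blast
  have y: "y = - blinfun_apply (antiholo_inverse \<kappa> a) (blinfun_apply N x)"
  proof (rule coord_ext)
    fix i
    have c: "pi * \<i> * (a + cnj (\<kappa> i)) \<noteq> 0" using nz[of i] by simp
    have "coord y i = (pi * \<i> * (a + cnj (\<kappa> i))) * coord y i / (pi * \<i> * (a + cnj (\<kappa> i)))"
      using c by (simp only: nonzero_mult_div_cancel_left not_False_eq_True)
    also have "\<dots> = - coord (blinfun_apply N x) i / (pi * \<i> * (a + cnj (\<kappa> i)))" by (simp only: xy(3))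
    finally show "coord y i = coord (- blinfun_apply (antiholo_inverse \<kappa> a) (blinfun_apply N x)) i" by (simp add: A)
  qed
  have "x \<noteq> 0" using xy(1) unfolding y by (auto simp: blinfun.zero_right)
  moreover have "pi * \<i> * (b + \<kappa> i) * coord x i =
        - coord (blinfun_apply N (blinfun_apply (antiholo_inverse \<kappa> a) (blinfun_apply N x))) i" for i
    using xy(2)[of i] unfolding y by (simp add: blinfun.minus_right)
  ultimately show "\<exists>x. x \<noteq> 0 \<and> (\<forall>i. pi * \<i> * (b + \<kappa> i) * coord x i =
        - coord (blinfun_apply N (blinfun_apply (antiholo_inverse \<kappa> a) (blinfun_apply N x))) i)" by blast
next
  note A = coord_antiholo_inverse(1)[of \<rho> a \<kappa>, OF \<rho> far]
  have nz: "a + cnj (\<kappa> i) \<noteq> 0" for i using far[of i] \<rho> by auto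
  assume "\<exists>x. x \<noteq> 0 \<and> (\<forall>i. pi * \<i> * (b + \<kappa> i) * coord x i =
        - coord (blinfun_apply N (blinfun_apply (antiholo_inverse \<kappa> a) (blinfun_apply N x))) i)"
  then obtain x where x: "x \<noteq> 0" "\<And>i. pi * \<i> * (b + \<kappa> i) * coord x i =
        - coord (blinfun_apply N (blinfun_apply (antiholo_inverse \<kappa> a) (blinfun_apply N x))) i" by blast
  show "zero_mode_pair N \<kappa> a b"
    unfolding zero_mode_pair_def
  proof (intro exI conjI allI)
    show "x \<noteq> 0 \<or> - blinfun_apply (antiholo_inverse \<kappa> a) (blinfun_apply N x) \<noteq> 0" using x(1) by blast
    show "pi * \<i> * (b + \<kappa> i) * coord x i = coord (blinfun_apply N (- blinfun_apply (antiholo_inverse \<kappa> a) (blinfun_apply N x))) i" for i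
      using x(2)[of i] by (simp add: blinfun.minus_right)
    show "pi * \<i> * (a + cnj (\<kappa> i)) * coord (- blinfun_apply (antiholo_inverse \<kappa> a) (blinfun_apply N x)) i
       = - coord (blinfun_apply N x) i" for i
      using nz[of i] by (simp add: A)
  qed
qed

text \<open>After elimination of \<open>y\<close>, the equations for \<open>x\<close> with index other than \<open>z\<close> are a fixed point problem for
  the operator \<open>T a b\<close>. For large \<open>a\<close> it is a contraction: its first term is small by
  \<open>compact_sandwich_small\<close>, its second term because \<open>b\<close> is small. So \<open>x\<close> is a multiple of the solution
  \<open>X a b\<close> with inhomogeneous term the unit vector at \<open>z\<close>. What remains is the equation with index \<open>z\<close>,
  and it reads \<open>b = \<psi> a b\<close>, where \<open>\<psi> a\<close> is a contraction of the disc of radius \<open>r\<close>. Its fixed point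
  \<open>\<beta> a\<close> is a uniform limit of iterates, which are holomorphic in \<open>a\<close>.\<close>

lemma zero_energy_graph:
  fixes N :: "'i ell2 \<Rightarrow>\<^sub>L 'i ell2" and \<kappa> :: "'i \<Rightarrow> complex"
  assumes N: "complex_linear_op N" and fin: "\<And>R. finite {i. cmod (\<kappa> i) \<le> R}"
    and z: "\<kappa> z = 0" and \<delta>: "\<delta> > 0" "\<And>i. i \<noteq> z \<Longrightarrow> cmod (\<kappa> i) \<ge> \<delta>"
    and \<rho>: "\<rho> > 0" and gap: "\<And>R. \<exists>a. cmod a \<ge> R \<and> (\<forall>i. cmod (a + cnj (\<kappa> i)) \<ge> 2 * \<rho>)"
  obtains a0 r \<beta> where "r > 0" "\<beta> holomorphic_on ball a0 \<rho>" "\<And>a. a \<in> ball a0 \<rho> \<Longrightarrow> cmod (\<beta> a) < r"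
    "\<And>a b. a \<in> ball a0 \<rho> \<Longrightarrow> cmod b < r \<Longrightarrow> zero_mode_pair N \<kappa> a b \<longleftrightarrow> b = \<beta> a"
proof -
  \<comment> \<open>With \<open>r\<close>, \<open>e\<close> and \<open>e'\<close> chosen like this, both terms of \<open>T a b\<close> have norm at most 1/4, and \<open>\<psi> a\<close> maps
    the disc of radius \<open>r\<close> to itself with a Lipschitz constant of at most 1/2.\<close>
  define r where "r = \<delta> / 4"
  have r: "r > 0" using \<delta> by (simp add: r_def)
  define e where "e = \<delta> / (16 * (norm N + 1))"
  define e' where "e' = 1 / (4 * (norm N + 1))"
  have np: "norm N + 1 > 0" by (simp add: add_nonneg_pos)
  have e: "e > 0" "e' > 0" using np \<delta> by (auto simp: e_def e'_def)
  have eN: "e * norm N \<le> \<delta> / 16" "e' * norm N \<le> 1 / 4"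
    using np \<delta> by (auto simp: e_def e'_def field_simps)
  have "\<forall>\<^sub>F a in at_infinity.
     ((\<forall>j. cmod (a + cnj (\<kappa> j)) \<ge> \<rho>) \<longrightarrow>
      (\<forall>y. cmod (coord (blinfun_apply N (blinfun_apply (antiholo_inverse \<kappa> a) y)) z) \<le> e * norm y)) \<and>
     ((\<forall>j. cmod (a + cnj (\<kappa> j)) \<ge> \<rho>) \<longrightarrow>
      (\<forall>y. norm (blinfun_apply (holo_inverse z \<kappa>) (blinfun_apply N (blinfun_apply (antiholo_inverse \<kappa> a) y))) \<le> e' * norm y))"
    by (rule eventually_conj[OF antiholo_inverse_row_small[OF N \<rho> e(1)] compact_sandwich_small[OF N fin \<delta> \<rho> e(2)]])
  then obtain R where R: "\<And>a. cmod a \<ge> R \<Longrightarrow> (\<And>j. cmod (a + cnj (\<kappa> j)) \<ge> \<rho>) \<Longrightarrow>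
      (\<forall>y. cmod (coord (blinfun_apply N (blinfun_apply (antiholo_inverse \<kappa> a) y)) z) \<le> e * norm y) \<and>
      (\<forall>y. norm (blinfun_apply (holo_inverse z \<kappa>) (blinfun_apply N (blinfun_apply (antiholo_inverse \<kappa> a) y))) \<le> e' * norm y)"
    unfolding eventually_at_infinity by blast
  obtain a0 where a0: "cmod a0 \<ge> R + \<rho>" "\<And>i. cmod (a0 + cnj (\<kappa> i)) \<ge> 2 * \<rho>" using gap by blast
  define D where "D = ball a0 \<rho>"
  have D: "open D" by (simp add: D_def)
  have far: "cmod (a + cnj (\<kappa> j)) \<ge> \<rho>" if "a \<in> D" for a j
  proof -
    have "cmod (a0 - a) \<le> \<rho>" using that by (simp add: D_def dist_norm)
    then show ?thesis using a0(2)[of j] norm_triangle_ineq[of "a0 - a" "a + cnj (\<kappa> j)"] by simp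
  qed
  have big: "cmod a \<ge> R" if "a \<in> D" for a
    using that a0(1) norm_triangle_ineq[of a "a0 - a"] by (simp add: D_def dist_norm)
  define A where "A a = antiholo_inverse \<kappa> a" for a
  define B where "B = holo_inverse z \<kappa>"
  have row: "cmod (coord (blinfun_apply N (blinfun_apply (A a) y)) z) \<le> e * norm y"
    and sand: "norm (blinfun_apply B (blinfun_apply N (blinfun_apply (A a) y))) \<le> e' * norm y" if "a \<in> D" for a y
    using R[OF big[OF that] far[OF that]] unfolding A_def B_def by auto
  have Bc: "coord (blinfun_apply B x) i = (if i = z then 0 else coord x i / (pi * \<i> * \<kappa> i))" for x i
    unfolding B_def by (rule coord_holo_inverse(1)[OF \<delta>])
  have Bn: "norm B \<le> 1 / (pi * \<delta>)" unfolding B_def by (rule coord_holo_inverse(2)[OF \<delta>])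
  have Blin: "complex_linear_op B" unfolding B_def by (rule coord_holo_inverse(3)[OF \<delta>])
  have Alin: "complex_linear_op (A a)" if "a \<in> D" for a unfolding A_def by (rule coord_antiholo_inverse(3)[OF \<rho> far[OF that]])
  define T where "T a b = - (B o\<^sub>L ((N o\<^sub>L (A a o\<^sub>L N)) + scalar_op (pi * \<i> * b)))" for a b
  have Tc: "blinfun_apply (T a b) x = - blinfun_apply B (blinfun_apply N (blinfun_apply (A a) (blinfun_apply N x)))
       - blinfun_apply B (cscale (pi * \<i> * b) x)" for a b x
    by (simp add: T_def blinfun.minus_left blinfun.add_left blinfun.add_right)
  have Tlin: "complex_linear_op (T a b)" if "a \<in> D" for a b
    unfolding complex_linear_op_def Tc
    using N Blin Alin[OF that] by (auto intro!: coord_ext simp: complex_linear_op_def algebra_simps Bc)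
  have Tn: "norm (T a b) \<le> 1/2" if a: "a \<in> D" and b: "cmod b \<le> r" for a b
  proof (rule norm_blinfun_bound)
    fix x
    have "norm (blinfun_apply B (blinfun_apply N (blinfun_apply (A a) (blinfun_apply N x)))) \<le> e' * (norm N * norm x)"
      by (rule order_trans[OF sand[OF a] mult_left_mono[OF norm_blinfun]]) (use e in auto)
    also have "\<dots> = (e' * norm N) * norm x" by simp
    also have "\<dots> \<le> 1/4 * norm x" by (intro mult_right_mono eN) auto
    finally have 1: "norm (blinfun_apply B (blinfun_apply N (blinfun_apply (A a) (blinfun_apply N x)))) \<le> 1/4 * norm x" .
    have "norm (blinfun_apply B (cscale (pi * \<i> * b) x)) \<le> 1 / (pi * \<delta>) * (pi * r * norm x)"
      by (intro order_trans[OF norm_blinfun] mult_mono Bn) (use b \<delta> in \<open>auto simp: norm_mult intro!: mult_right_mono\<close>)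
    also have "\<dots> = 1/4 * norm x" using \<delta> by (simp add: r_def)
    finally have 2: "norm (blinfun_apply B (cscale (pi * \<i> * b) x)) \<le> 1/4 * norm x" .
    show "norm (blinfun_apply (T a b) x) \<le> 1/2 * norm x"
      unfolding Tc using 1 2 norm_triangle_ineq4[of "- blinfun_apply B (blinfun_apply N (blinfun_apply (A a) (blinfun_apply N x)))" "blinfun_apply B (cscale (pi * \<i> * b) x)"]
      by simp
  qed simp
  define X where "X a b = (SOME x. x = unit_ell2 z + blinfun_apply (T a b) x)" for a b
  have X: "X a b = unit_ell2 z + blinfun_apply (T a b) (X a b)" if "a \<in> D" "cmod b \<le> r" for a b
    unfolding X_def by (rule someI_ex[OF fixed_point_exists[OF Tn[OF that]]])
  have "norm (unit_ell2 z :: 'i ell2) \<le> 1"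
    by (rule norm_ell2_leI) (auto simp: L2_set_def if_distrib[of "\<lambda>x. (cmod x)\<^sup>2"] cong: if_cong)
  then have Xn: "norm (X a b) \<le> 2" if "a \<in> D" "cmod b \<le> r" for a b
    using fixed_point_norm_le[OF Tn[OF that] X[OF that]] by simp
  define \<psi> where "\<psi> a b = - coord (blinfun_apply N (blinfun_apply (A a) (blinfun_apply N (X a b)))) z / (pi * \<i>)" for a b
  have pi1: "1 \<le> pi" using pi_gt3 by simp
  have \<psi>r: "cmod (\<psi> a b) < r" if "a \<in> D" "cmod b \<le> r" for a b
  proof -
    have "cmod (coord (blinfun_apply N (blinfun_apply (A a) (blinfun_apply N (X a b)))) z) \<le> e * (norm N * 2)"
      by (intro order_trans[OF row[OF that(1)]] mult_left_mono order_trans[OF norm_blinfun] Xn that) (use e in auto)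
    also have "\<dots> \<le> \<delta> / 8" using eN(1) by simp
    finally have *: "cmod (coord (blinfun_apply N (blinfun_apply (A a) (blinfun_apply N (X a b)))) z) \<le> \<delta> / 8" .
    have "cmod (\<psi> a b) = cmod (coord (blinfun_apply N (blinfun_apply (A a) (blinfun_apply N (X a b)))) z) / pi"
      by (simp add: \<psi>_def norm_divide norm_mult)
    also have "\<dots> \<le> \<delta> / 8 / 1" by (rule frac_le) (use * pi1 \<delta> in auto)
    also have "\<dots> < r" using \<delta> by (simp add: r_def)
    finally show ?thesis .
  qed
  have \<psi>L: "cmod (\<psi> a b - \<psi> a b') \<le> 1/2 * cmod (b - b')" if a: "a \<in> D" and b: "cmod b \<le> r" "cmod b' \<le> r" for a b b'
  proof -
    have TT: "blinfun_apply (T a b) x - blinfun_apply (T a b') x = - blinfun_apply B (cscale (pi * \<i> * (b - b')) x)" for x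
      unfolding Tc by (rule coord_ext) (simp add: Bc algebra_simps diff_divide_distrib)
    have eq: "X a b - X a b' = - blinfun_apply B (cscale (pi * \<i> * (b - b')) (X a b')) + blinfun_apply (T a b) (X a b - X a b')"
    proof -
      have "X a b - X a b' = (unit_ell2 z + blinfun_apply (T a b) (X a b)) - (unit_ell2 z + blinfun_apply (T a b') (X a b'))"
        by (rule arg_cong2[where f = "(-)", OF X[OF a b(1)] X[OF a b(2)]])
      then show ?thesis by (rule trans) (simp add: TT[symmetric] blinfun.diff_right)
    qed
    from fixed_point_norm_le[OF Tn[OF a b(1)] this]
    have "norm (X a b - X a b') \<le> 2 * norm (blinfun_apply B (cscale (pi * \<i> * (b - b')) (X a b')))" by simp
    also have "\<dots> \<le> 2 * (1 / (pi * \<delta>) * (pi * cmod (b - b') * 2))"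
      by (intro mult_left_mono order_trans[OF norm_blinfun] mult_mono Bn) (use Xn[OF a b(2)] \<delta> in \<open>auto simp: norm_mult intro!: mult_left_mono\<close>)
    also have "\<dots> = 4 / \<delta> * cmod (b - b')" by simp
    finally have XX: "norm (X a b - X a b') \<le> 4 / \<delta> * cmod (b - b')" .
    have "\<psi> a b - \<psi> a b' = - coord (blinfun_apply N (blinfun_apply (A a) (blinfun_apply N (X a b - X a b')))) z / (pi * \<i>)"
      by (simp add: \<psi>_def blinfun.diff_right diff_divide_distrib)
    then have "cmod (\<psi> a b - \<psi> a b') = cmod (coord (blinfun_apply N (blinfun_apply (A a) (blinfun_apply N (X a b - X a b')))) z) / pi"
      by (simp add: norm_divide norm_mult)
    also have "\<dots> \<le> (e * (norm N * (4 / \<delta> * cmod (b - b')))) / 1"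
      by (intro frac_le order_trans[OF row[OF a]] mult_left_mono order_trans[OF norm_blinfun] XX pi1) (use e \<delta> in auto)
    also have "\<dots> = (e * norm N) * (4 / \<delta> * cmod (b - b'))" by simp
    also have "\<dots> \<le> \<delta> / 16 * (4 / \<delta> * cmod (b - b'))" by (intro mult_right_mono eN) (use \<delta> in auto)
    also have "\<dots> \<le> 1/2 * cmod (b - b')" using \<delta> by simp
    finally show ?thesis .
  qed
  have \<psi>hol: "(\<lambda>a. \<psi> a (g a)) holomorphic_on D" if g: "g holomorphic_on D" and gr: "\<And>a. a \<in> D \<Longrightarrow> cmod (g a) \<le> r" for g
    unfolding holomorphic_on_def
  proof
    fix a assume a: "a \<in> D"
    obtain g' where g': "(g has_field_derivative g') (at a)"
      using g a D holomorphic_on_imp_differentiable_at field_differentiable_def by blast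
    define A' where "A' = diag_op (\<lambda>i. - 1 / (pi * \<i> * (a + cnj (\<kappa> i))\<^sup>2))"
    have A': "(A has_derivative (\<lambda>v. scalar_op v o\<^sub>L A')) (at a)"
      unfolding A_def[abs_def] A'_def by (rule antiholo_inverse_has_derivative[OF \<rho> D a far])
    have A'lin: "complex_linear_op A'" unfolding A'_def
    proof (rule complex_linear_op_diag[where K = "1 / (pi * \<rho>\<^sup>2)"])
      fix i
      have "1 / (pi * (cmod (a + cnj (\<kappa> i)))\<^sup>2) \<le> 1 / (pi * \<rho>\<^sup>2)"
        by (rule frac_le) (use far[OF a, of i] \<rho> in \<open>auto intro: power_mono\<close>)
      then show "cmod (- 1 / (pi * \<i> * (a + cnj (\<kappa> i))\<^sup>2)) \<le> 1 / (pi * \<rho>\<^sup>2)" by (simp add: norm_mult norm_divide norm_power)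
    qed
    note comp_left = bounded_bilinear.bounded_linear_left[OF bounded_bilinear_blinfun_compose]
    note comp_right = bounded_bilinear.bounded_linear_right[OF bounded_bilinear_blinfun_compose]
    define T' where "T' v = - (B o\<^sub>L ((N o\<^sub>L ((scalar_op v o\<^sub>L A') o\<^sub>L N)) + scalar_op (pi * \<i> * (g' * v))))" for v
    have g'': "(g has_derivative (\<lambda>v. g' * v)) (at a)" using g' by (simp add: has_field_derivative_def)
    have T': "((\<lambda>a. T a (g a)) has_derivative T') (at a)"
      unfolding T_def T'_def[abs_def]
      by (intro has_derivative_minus bounded_linear.has_derivative[OF comp_right] has_derivative_add
           bounded_linear.has_derivative[OF comp_left] A'
           bounded_linear.has_derivative[OF bounded_linear_scalar_op]
           bounded_linear.has_derivative[OF bounded_linear_mult_right] g'')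
    obtain x' where x': "((\<lambda>a. X a (g a)) has_derivative x') (at a)"
      "\<And>v. x' v = blinfun_apply (T' v) (X a (g a)) + blinfun_apply (T a (g a)) (x' v)"
      using fixed_point_has_derivative[OF D a Tn[OF _ gr] X[OF _ gr] T'] by blast
    have x'c: "x' (c * v) = cscale c (x' v)" for c v
    proof (rule fixed_point_unique[OF Tn[OF a gr[OF a]] x'(2)])
      have T'c: "blinfun_apply (T' (c * v)) x = cscale c (blinfun_apply (T' v) x)" for x
        using N Blin A'lin
        by (intro coord_ext) (simp add: T'_def blinfun.minus_left blinfun.add_left blinfun.add_right complex_linear_op_def Bc algebra_simps)
      show "cscale c (x' v) = blinfun_apply (T' (c * v)) (X a (g a)) + blinfun_apply (T a (g a)) (cscale c (x' v))"
        by (subst x'(2)[of v]) (use Tlin[OF a, of "g a"] in \<open>simp add: T'c cscale_add complex_linear_op_def\<close>)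
    qed
    define P where "P v = blinfun_apply N (blinfun_apply (A a) (blinfun_apply N (x' v)) + blinfun_apply (scalar_op v o\<^sub>L A') (blinfun_apply N (X a (g a))))" for v
    have "((\<lambda>a. blinfun_apply N (blinfun_apply (A a) (blinfun_apply N (X a (g a))))) has_derivative P) (at a)"
      unfolding P_def[abs_def]
      by (intro bounded_linear.has_derivative[OF blinfun.bounded_linear_right]
           bounded_bilinear.FDERIV[OF bounded_bilinear_blinfun_apply] A' x'(1))
    from bounded_linear.has_derivative[OF bounded_linear_coord[of z] this]
    have "((\<lambda>a. - coord (blinfun_apply N (blinfun_apply (A a) (blinfun_apply N (X a (g a))))) z * (1 / (pi * \<i>)))
        has_derivative (\<lambda>v. - coord (P v) z * (1 / (pi * \<i>)))) (at a)"
      by (intro bounded_linear.has_derivative[OF bounded_linear_mult_left] has_derivative_minus)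
    then have der: "((\<lambda>a. \<psi> a (g a)) has_derivative (\<lambda>v. - coord (P v) z / (pi * \<i>))) (at a)"
      unfolding \<psi>_def by (simp add: divide_inverse)
    have "P (c * v) = cscale c (P v)" for c v
      using N Alin[OF a] unfolding P_def x'c complex_linear_op_def
      by (simp add: blinfun.add_right) (rule coord_ext, simp add: algebra_simps)
    then have "(\<lambda>a. \<psi> a (g a)) field_differentiable at a"
      by (intro field_differentiable_if_complex_linear[OF der]) simp
    then show "(\<lambda>a. \<psi> a (g a)) field_differentiable at a within D" by (rule field_differentiable_at_within)
  qed
  \<comment> \<open>Banach's theorem gives the fixed point for each \<open>a\<close> separately; holomorphy comes from the iterates.\<close>
  define \<beta>n where "\<beta>n n a = ((\<psi> a) ^^ n) 0" for n a
  have \<beta>nr: "cmod (\<beta>n n a) \<le> r" if "a \<in> D" for n a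
    by (induction n) (use r \<psi>r[OF that] in \<open>auto simp: \<beta>n_def less_imp_le\<close>)
  have \<beta>nhol: "\<beta>n n holomorphic_on D" for n
  proof (induction n)
    case 0
    then show ?case by (simp add: \<beta>n_def[abs_def])
  next
    case (Suc n)
    have "(\<lambda>a. \<psi> a (\<beta>n n a)) holomorphic_on D" by (rule \<psi>hol[OF Suc \<beta>nr])
    then show ?case by (simp add: \<beta>n_def[abs_def])
  qed
  have "\<exists>b. cmod b \<le> r \<and> \<psi> a b = b" if a: "a \<in> D" for a
  proof -
    have "\<exists>!b. b \<in> cball 0 r \<and> \<psi> a b = b"
      by (rule Banach_fix[where c = "1/2"])
         (use \<psi>L[OF a] \<psi>r[OF a] r in \<open>auto simp: dist_norm less_imp_le intro!: complete_eq_closed[THEN iffD2]\<close>)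
    then show ?thesis by auto
  qed
  then obtain \<beta> where \<beta>: "\<And>a. a \<in> D \<Longrightarrow> cmod (\<beta> a) \<le> r" "\<And>a. a \<in> D \<Longrightarrow> \<psi> a (\<beta> a) = \<beta> a" by metis
  have \<beta>r: "cmod (\<beta> a) < r" if "a \<in> D" for a using \<psi>r[OF that \<beta>(1)[OF that]] \<beta>(2)[OF that] by simp
  have conv: "cmod (\<beta>n n a - \<beta> a) \<le> (1/2) ^ n * r" if a: "a \<in> D" for n a
  proof (induction n)
    case 0
    then show ?case using \<beta>(1)[OF a] by (simp add: \<beta>n_def)
  next
    case (Suc n)
    have "cmod (\<beta>n (Suc n) a - \<beta> a) = cmod (\<psi> a (\<beta>n n a) - \<psi> a (\<beta> a))" using \<beta>(2)[OF a] by (simp add: \<beta>n_def)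
    also have "\<dots> \<le> 1/2 * cmod (\<beta>n n a - \<beta> a)" by (rule \<psi>L[OF a \<beta>nr[OF a] \<beta>(1)[OF a]])
    also have "\<dots> \<le> 1/2 * ((1/2) ^ n * r)" by (rule mult_left_mono[OF Suc]) simp
    finally show ?case by simp
  qed
  have "uniform_limit D \<beta>n \<beta> sequentially"
  proof (rule uniform_limitI)
    fix d :: real assume d: "d > 0"
    have "(\<lambda>n. (1/2) ^ n * r) \<longlonglongrightarrow> 0 * r" by (intro tendsto_mult LIMSEQ_realpow_zero tendsto_const) auto
    then have "\<forall>\<^sub>F n in sequentially. (1/2) ^ n * r < d" using d by (auto dest: order_tendstoD(2))
    then show "\<forall>\<^sub>F n in sequentially. \<forall>a\<in>D. dist (\<beta>n n a) (\<beta> a) < d"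
      by (rule eventually_mono) (use conv in \<open>auto simp: dist_norm intro: le_less_trans\<close>)
  qed
  then have "\<beta> holomorphic_on D"
  proof (intro holomorphic_uniform_sequence[OF D \<beta>nhol])
    fix x assume lim: "uniform_limit D \<beta>n \<beta> sequentially" and "x \<in> D"
    then obtain d where "d > 0" "cball x d \<subseteq> D" using D open_contains_cball by metis
    then show "\<exists>d>0. cball x d \<subseteq> D \<and> uniform_limit (cball x d) \<beta>n \<beta> sequentially"
      using uniform_limit_on_subset[OF lim] by blast
  qed
  moreover have "zero_mode_pair N \<kappa> a b \<longleftrightarrow> b = \<beta> a" if a: "a \<in> D" and b: "cmod b < r" for a b
  proof -
    have b': "cmod b \<le> r" using b by simp
    have \<kappa>nz: "\<kappa> i \<noteq> 0" if "i \<noteq> z" for i using \<delta>(1) \<delta>(2)[OF that] by auto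
    let ?M = "\<lambda>x. blinfun_apply N (blinfun_apply (A a) (blinfun_apply N x))"
    have Mlin: "?M (cscale c x) = cscale c (?M x)" for c x using N Alin[OF a] by (simp add: complex_linear_op_def)
    have coT: "coord (blinfun_apply (T a b) x) i = (if i = z then 0 else - (coord (?M x) i + pi * \<i> * b * coord x i) / (pi * \<i> * \<kappa> i))" for x i
    proof -
      have "- (p / c) - q / c = - (p + q) / c" for p q c :: complex by (simp add: divide_inverse algebra_simps)
      then show ?thesis unfolding Tc coord_diff coord_minus Bc coord_cscale
        by (cases "i = z") (simp_all only: if_True if_False simp_thms, simp)
    qed
    have solves: "(\<forall>i. i \<noteq> z \<longrightarrow> pi * \<i> * (b + \<kappa> i) * coord x i = - coord (?M x) i) \<longleftrightarrow>
        x = cscale (coord x z) (unit_ell2 z) + blinfun_apply (T a b) x" for x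
    proof -
      have "x = cscale (coord x z) (unit_ell2 z) + blinfun_apply (T a b) x \<longleftrightarrow>
         (\<forall>i. coord x i = coord (cscale (coord x z) (unit_ell2 z) + blinfun_apply (T a b) x) i)"
        by (metis coord_ext)
      also have "\<dots> \<longleftrightarrow> (\<forall>i. i \<noteq> z \<longrightarrow> coord x i = - (coord (?M x) i + pi * \<i> * b * coord x i) / (pi * \<i> * \<kappa> i))"
        by (auto simp: coT)
      also have "\<dots> \<longleftrightarrow> (\<forall>i. i \<noteq> z \<longrightarrow> pi * \<i> * (b + \<kappa> i) * coord x i = - coord (?M x) i)"
      proof -
        have "coord x i = - (coord (?M x) i + pi * \<i> * b * coord x i) / (pi * \<i> * \<kappa> i) \<longleftrightarrow>
           pi * \<i> * (b + \<kappa> i) * coord x i = - coord (?M x) i" if "i \<noteq> z" for i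
        proof -
          have "pi * \<i> * \<kappa> i \<noteq> 0" using \<kappa>nz[OF that] by simp
          then have "coord x i = - (coord (?M x) i + pi * \<i> * b * coord x i) / (pi * \<i> * \<kappa> i) \<longleftrightarrow>
             coord x i * (pi * \<i> * \<kappa> i) = - (coord (?M x) i + pi * \<i> * b * coord x i)"
            by (rule nonzero_eq_divide_eq)
          then show ?thesis by (auto simp: algebra_simps eq_neg_iff_add_eq_0)
        qed
        then show ?thesis by auto
      qed
      finally show ?thesis by blast
    qed
    have atz: "pi * \<i> * (b + \<kappa> z) * coord x z = - coord (?M x) z \<longleftrightarrow> b * c = \<psi> a b * c"
      if x: "x = cscale c (X a b)" and c: "coord x z = c" for x c
    proof -
      have "coord (?M x) z = - (pi * \<i>) * (\<psi> a b * c)" unfolding x Mlin by (simp add: \<psi>_def)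
      then have "pi * \<i> * (b + \<kappa> z) * coord x z = - coord (?M x) z \<longleftrightarrow> (pi * \<i>) * (b * c) = (pi * \<i>) * (\<psi> a b * c)"
        by (simp add: z c mult.assoc)
      then show ?thesis by simp
    qed
    have zp: "zero_mode_pair N \<kappa> a b \<longleftrightarrow>
        (\<exists>x. x \<noteq> 0 \<and> (\<forall>i. pi * \<i> * (b + \<kappa> i) * coord x i = - coord (?M x) i))"
      unfolding A_def by (rule zero_mode_pair_iff_scalar[OF \<rho> far[OF a]])
    have "zero_mode_pair N \<kappa> a b \<longleftrightarrow> b = \<psi> a b"
    proof
      assume "zero_mode_pair N \<kappa> a b"
      then obtain x where x: "x \<noteq> 0" "\<And>i. pi * \<i> * (b + \<kappa> i) * coord x i = - coord (?M x) i"
        unfolding zp by (elim exE conjE) (simp only: that)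
      have 1: "x = cscale (coord x z) (unit_ell2 z) + blinfun_apply (T a b) x" using solves[of x] x(2) by blast
      have "cscale (coord x z) (X a b) = cscale (coord x z) (unit_ell2 z + blinfun_apply (T a b) (X a b))"
        using X[OF a b'] by (rule arg_cong)
      also have "\<dots> = cscale (coord x z) (unit_ell2 z) + blinfun_apply (T a b) (cscale (coord x z) (X a b))"
        using Tlin[OF a, of b] by (simp add: complex_linear_op_def cscale_add)
      finally have 2: "x = cscale (coord x z) (X a b)" by (rule fixed_point_unique[OF Tn[OF a b'] 1])
      have "coord x z \<noteq> 0"
      proof
        assume "coord x z = 0"
        then have "x = 0" by (subst 2) (auto intro: coord_ext)
        then show False using x(1) by blast
      qed
      then show "b = \<psi> a b" using atz[OF 2 refl] x(2)[of z] by simp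
    next
      assume b\<psi>: "b = \<psi> a b"
      let ?x = "X a b"
      have xz: "coord ?x z = 1" by (subst X[OF a b']) (simp add: coT)
      have "?x = cscale (coord ?x z) (unit_ell2 z) + blinfun_apply (T a b) ?x"
      proof -
        have "cscale (coord ?x z) (unit_ell2 z) = unit_ell2 z" unfolding xz by (rule coord_ext) simp
        then show ?thesis using X[OF a b'] by (simp only:)
      qed
      then have off: "\<And>i. i \<noteq> z \<Longrightarrow> pi * \<i> * (b + \<kappa> i) * coord ?x i = - coord (?M ?x) i" using solves[of ?x] by blast
      have "?x = cscale 1 ?x" by (rule coord_ext) simp
      then have "pi * \<i> * (b + \<kappa> z) * coord ?x z = - coord (?M ?x) z" using atz[of ?x 1] xz b\<psi> by simp
      then have "pi * \<i> * (b + \<kappa> i) * coord ?x i = - coord (?M ?x) i" for i using off[of i] by (cases "i = z") auto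
      moreover have "?x \<noteq> 0" using xz by auto
      ultimately show "zero_mode_pair N \<kappa> a b" unfolding zp by blast
    qed
    also have "\<dots> \<longleftrightarrow> b = \<beta> a"
    proof
      assume "b = \<psi> a b"
      then have "cmod (b - \<beta> a) \<le> 1/2 * cmod (b - \<beta> a)" using \<psi>L[OF a b' \<beta>(1)[OF a]] \<beta>(2)[OF a] by metis
      then show "b = \<beta> a" by simp
    qed (use \<beta>(2)[OF a] in simp)
    finally show ?thesis .
  qed
  ultimately show thesis using that[OF r] \<beta>r unfolding D_def by blast
qed

section \<open>Regular points and dimension\<close>

lemma holomorphic_mv_on_nth: "holomorphic_mv_on (\<lambda>w. w $ j) S"
  unfolding holomorphic_mv_on_def
  by (auto intro!: exI[of _ "\<lambda>v. v $ j"] bounded_linear_imp_has_derivative bounded_linear_vec_nth)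

lemma holomorphic_mv_on_subset: "holomorphic_mv_on F S \<Longrightarrow> T \<subseteq> S \<Longrightarrow> holomorphic_mv_on F T"
  unfolding holomorphic_mv_on_def by blast

lemma holomorphic_mv_on_compose:
  assumes "holomorphic_mv_on F S" "g holomorphic_on D" "open D" "\<And>w. w \<in> S \<Longrightarrow> F w \<in> D"
  shows "holomorphic_mv_on (\<lambda>w. g (F w)) S"
  unfolding holomorphic_mv_on_def
proof
  fix w assume w: "w \<in> S"
  then obtain F' where F': "(F has_derivative F') (at w)" "\<And>c v. F' (c *s v) = c * F' v"
    using assms(1) unfolding holomorphic_mv_on_def by meson
  obtain g' where g': "(g has_field_derivative g') (at (F w))"
    using holomorphic_on_imp_differentiable_at[OF assms(2,3) assms(4)[OF w]] unfolding field_differentiable_def by blast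
  have "((\<lambda>w. g (F w)) has_derivative (\<lambda>v. g' * F' v)) (at w)"
    using has_derivative_compose[OF F'(1) g'[unfolded has_field_derivative_def]] .
  then show "\<exists>G. ((\<lambda>w. g (F w)) has_derivative G) (at w) \<and> (\<forall>c v. G (c *s v) = c * G v)"
    by (intro exI[of _ "\<lambda>v. g' * F' v"]) (simp add: F'(2))
qed

lemma holomorphic_mv_on_affine_compose:
  fixes L :: "complex ^ 'm \<Rightarrow> complex ^ 'n"
  assumes F: "holomorphic_mv_on F S" and L: "bounded_linear L" "\<And>c v. L (c *s v) = c *s L v"
  shows "holomorphic_mv_on (\<lambda>w. F (L w)) (L -` S)"
  unfolding holomorphic_mv_on_def
proof
  fix w assume "w \<in> L -` S"
  then obtain F' where F': "(F has_derivative F') (at (L w))" "\<And>c v. F' (c *s v) = c * F' v"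
    using F unfolding holomorphic_mv_on_def by (meson vimageE)
  show "\<exists>G. ((\<lambda>w. F (L w)) has_derivative G) (at w) \<and> (\<forall>c v. G (c *s v) = c * G v)"
    using has_derivative_compose[OF bounded_linear_imp_has_derivative[OF L(1)] F'(1)]
    by (intro exI[of _ "\<lambda>v. F' (L v)"]) (simp add: F'(2) L(2))
qed

lemma analytic_set_hypersurface_Int:
  assumes A: "hypersurface A" and \<F>: "finite \<F>" "\<And>F. F \<in> \<F> \<Longrightarrow> holomorphic_mv_on F UNIV"
  shows "analytic_set (A \<inter> {w. \<forall>F\<in>\<F>. F w = 0})"
  unfolding analytic_set_def
proof
  fix p
  obtain V F where VF: "open V" "p \<in> V" "holomorphic_mv_on F V" "A \<inter> V = {w \<in> V. F w = 0}"
    using A unfolding hypersurface_def by meson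
  show "\<exists>V \<F>'. open V \<and> p \<in> V \<and> finite \<F>' \<and> (\<forall>F\<in>\<F>'. holomorphic_mv_on F V) \<and>
      A \<inter> {w. \<forall>F\<in>\<F>. F w = 0} \<inter> V = {w \<in> V. \<forall>F\<in>\<F>'. F w = 0}"
    using VF \<F> holomorphic_mv_on_subset[OF \<F>(2) subset_UNIV]
    by (intro exI[of _ V] exI[of _ "insert F \<F>"]) auto
qed

text \<open>Upper bounds for the dimension come from the topology of charts.\<close>

lemma regular_pointE:
  fixes A :: "(complex ^ 'n) set"
  assumes "regular_point A d p"
  obtains V W :: "(complex ^ 'n) set" and \<phi> \<psi> :: "complex ^ 'n \<Rightarrow> complex ^ 'n" and J :: "'n set" where "p \<in> A" "open V" "p \<in> V" "open W" "homeomorphism V W \<phi> \<psi>" "card J = d"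
    "\<phi> ` (A \<inter> V) = {w \<in> W. \<forall>j. j \<notin> J \<longrightarrow> w $ j = 0}"
proof -
  obtain V W \<phi> \<psi> and J :: "'n set" where *: "open V \<and> p \<in> V \<and> open W \<and> homeomorphism V W \<phi> \<psi> \<and>
        (\<forall>j. holomorphic_mv_on (\<lambda>z. \<phi> z $ j) V) \<and> (\<forall>j. holomorphic_mv_on (\<lambda>w. \<psi> w $ j) W) \<and>
        card J = d \<and> \<phi> ` (A \<inter> V) = {w \<in> W. \<forall>j. j \<notin> J \<longrightarrow> w $ j = 0}"
    using assms[unfolded regular_point_def, THEN conjunct2] by (elim exE)
  show thesis
    by (rule that[of V W \<phi> \<psi> J]) (use * assms[unfolded regular_point_def, THEN conjunct1] in simp_all)
qed

lemma regular_point_full_dim_interior: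
  fixes A :: "(complex ^ 'n) set"
  assumes "regular_point A d p" "d = CARD('n)"
  shows "interior A \<noteq> {}"
proof -
  obtain V W :: "(complex ^ 'n) set" and \<phi> \<psi> :: "complex ^ 'n \<Rightarrow> complex ^ 'n" and J :: "'n set" where *: "p \<in> A" "open V" "p \<in> V" "open W" "homeomorphism V W \<phi> \<psi>" "card J = d"
    "\<phi> ` (A \<inter> V) = {w \<in> W. \<forall>j. j \<notin> J \<longrightarrow> w $ j = 0}"
    by (rule regular_pointE[OF assms(1)])
  have "J = UNIV" using *(6) assms(2) by (simp add: card_eq_UNIV_imp_eq_UNIV)
  then have "\<phi> ` (A \<inter> V) = W" using *(7) by simp
  also have "\<dots> = \<phi> ` V" using *(5) by (simp add: homeomorphism_def)
  finally have "A \<inter> V = V"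
    using inj_on_image_eq_iff[of \<phi> V "A \<inter> V" V] inj_on_inverseI[of V \<psi> \<phi>] homeomorphism_apply1[OF *(5)] by auto
  then show ?thesis using *(2,3) interior_maximal[of V A] by blast
qed

lemma analytic_dim_le:
  assumes "\<And>e p. regular_point A e p \<Longrightarrow> e \<le> d"
  shows "analytic_dim A \<le> ereal (real d)"
  unfolding analytic_dim_def using assms by (auto intro!: SUP_least)

lemma regular_point_le_card:
  fixes A :: "(complex ^ 'n) set"
  assumes "regular_point A d p"
  shows "d \<le> CARD('n)"
proof (rule regular_pointE[OF assms])
  fix J :: "'n set"
  assume "card J = d"
  then show ?thesis using card_mono[OF finite subset_UNIV, of J] by simp
qed

lemma hypersurface_dim_less:
  fixes A :: "(complex ^ 'n) set"
  assumes "hypersurface A" "A \<noteq> UNIV" "regular_point A d p"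
  shows "d < CARD('n)"
proof -
  have "d \<noteq> CARD('n)"
    using regular_point_full_dim_interior[OF assms(3)] hypersurface_eq_UNIV_if_interior[OF assms(1)] assms(2) by blast
  then show ?thesis using regular_point_le_card[OF assms(3)] by linarith
qed

lemma subspace_coordinate_zero: "subspace {w :: complex ^ 'n. \<forall>j. j \<notin> J \<longrightarrow> w $ j = 0}"
  by (auto simp: subspace_def)

lemma bounded_linear_zero_extension:
  "bounded_linear (\<lambda>k :: complex ^ 2. vector [k $ 1, k $ 2, 0] :: complex ^ 3)"
proof -
  have "linear (\<lambda>k :: complex ^ 2. vector [k $ 1, k $ 2, 0] :: complex ^ 3)"
    by (rule linearI) (simp_all add: Finite_Cartesian_Product.vec_eq_iff forall_3)
  then show ?thesis by (rule linear_conv_bounded_linear[THEN iffD1])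
qed

lemma hypersurface_slice:
  fixes A :: "(complex ^ 3) set"
  assumes "hypersurface A"
  shows "hypersurface {k :: complex ^ 2. vector [k $ 1, k $ 2, 0] \<in> A}"
  unfolding hypersurface_def
proof
  fix p :: "complex ^ 2"
  let ?L = "\<lambda>k :: complex ^ 2. vector [k $ 1, k $ 2, 0] :: complex ^ 3"
  have L: "?L (c *s v) = c *s ?L v" for c v by (simp add: Finite_Cartesian_Product.vec_eq_iff forall_3)
  obtain V F where VF: "open V" "?L p \<in> V" "holomorphic_mv_on F V" "A \<inter> V = {w \<in> V. F w = 0}"
    using assms unfolding hypersurface_def by meson
  have "open (?L -` V)" by (rule open_vimage[OF VF(1) linear_continuous_on[OF bounded_linear_zero_extension]])
  moreover have "holomorphic_mv_on (\<lambda>k. F (?L k)) (?L -` V)"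
    by (rule holomorphic_mv_on_affine_compose[OF VF(3) bounded_linear_zero_extension L])
  ultimately show "\<exists>V F. open V \<and> p \<in> V \<and> holomorphic_mv_on F V \<and>
      {k. ?L k \<in> A} \<inter> V = {w \<in> V. F w = 0}"
    using VF(2,4) by (intro exI[of _ "?L -` V"] exI[of _ "\<lambda>k. F (?L k)"]) auto
qed

lemma dim_coordinate_zero_3_2:
  fixes J :: "3 set"
  assumes "card J \<ge> 2"
  shows "dim {w :: complex ^ 3. w $ 3 = 0} \<le> dim {w :: complex ^ 3. \<forall>j. j \<notin> J \<longrightarrow> w $ j = 0}"
proof -
  have "\<exists>i\<in>J. \<exists>j\<in>J. i \<noteq> j"
    using assms card_le_Suc0_iff_eq[OF finite, of J] by auto
  then obtain i j where ij: "i \<noteq> j" "i \<in> J" "j \<in> J" by auto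
  define f :: "complex ^ 3 \<Rightarrow> complex ^ 3" where "f w = (\<chi> l. if l = i then w $ 1 else if l = j then w $ 2 else 0)" for w
  have lin: "linear f" by (rule linearI) (simp_all add: f_def Finite_Cartesian_Product.vec_eq_iff)
  have inj: "inj_on f {w. w $ 3 = 0}"
  proof (rule inj_onI)
    fix u v assume uv: "u \<in> {w. w $ 3 = 0}" "v \<in> {w. w $ 3 = 0}" "f u = f v"
    have "f u $ i = f v $ i" "f u $ j = f v $ j" using uv(3) by simp_all
    then show "u = v" using uv(1,2) ij by (simp add: f_def Finite_Cartesian_Product.vec_eq_iff forall_3)
  qed
  have sub: "subspace {w :: complex ^ 3. w $ 3 = 0}" by (auto simp: subspace_def)
  have "dim {w :: complex ^ 3. w $ 3 = 0} = dim (f ` {w. w $ 3 = 0})"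
    by (rule dim_image_eq[symmetric, OF lin]) (subst real_vector.span_eq_iff[THEN iffD2, OF sub], rule inj)
  also have "\<dots> \<le> dim {w :: complex ^ 3. \<forall>j. j \<notin> J \<longrightarrow> w $ j = 0}"
    by (rule dim_subset) (use ij in \<open>auto simp: f_def\<close>)
  finally show ?thesis .
qed

text \<open>The inverse chart restricted to the coordinate subspace is a continuous injection into the plane \<open>E = 0\<close>
  from a subspace whose dimension is not smaller. By invariance of domain its image, which is the slice
  near \<open>p\<close>, is open in that plane.\<close>

lemma slice_interior_if_regular_dim_2:
  fixes A :: "(complex ^ 3) set"
  assumes reg: "regular_point (A \<inter> {w. w $ 3 = 0}) d p" and d: "d \<ge> 2"
  shows "interior {k :: complex ^ 2. vector [k $ 1, k $ 2, 0] \<in> A} \<noteq> {}"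
proof -
  let ?P = "{w :: complex ^ 3. w $ 3 = 0}"
  obtain V W :: "(complex ^ 3) set" and \<phi> \<psi> :: "complex ^ 3 \<Rightarrow> complex ^ 3" and J :: "3 set" where *: "p \<in> A \<inter> ?P" "open V" "p \<in> V" "open W" "homeomorphism V W \<phi> \<psi>" "card J = d"
    "\<phi> ` (A \<inter> ?P \<inter> V) = {w \<in> W. \<forall>j. j \<notin> J \<longrightarrow> w $ j = 0}"
    by (rule regular_pointE[OF reg])
  let ?U = "{w :: complex ^ 3. \<forall>j. j \<notin> J \<longrightarrow> w $ j = 0}"
  let ?S = "{w \<in> W. \<forall>j. j \<notin> J \<longrightarrow> w $ j = 0}"
  have "\<psi> ` ?S = A \<inter> ?P \<inter> V"
    unfolding *(7)[symmetric] image_image using homeomorphism_apply1[OF *(5)] by force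
  moreover have "openin (top_of_set ?P) (\<psi> ` ?S)"
  proof (rule invariance_of_domain_subspaces[of ?U])
    show "openin (top_of_set ?U) ?S" using *(4) by (auto simp: openin_open)
    show "subspace ?U" by (rule subspace_coordinate_zero)
    show "subspace ?P" by (auto simp: subspace_def)
    show "dim ?P \<le> dim ?U" by (rule dim_coordinate_zero_3_2) (use *(6) d in simp)
    show "continuous_on ?S \<psi>" using homeomorphism_cont2[OF *(5)] by (rule continuous_on_subset) auto
    show "\<psi> \<in> ?S \<rightarrow> ?P" using \<open>\<psi> ` ?S = A \<inter> ?P \<inter> V\<close> by auto
    show "inj_on \<psi> ?S" using homeomorphism_apply2[OF *(5)] by (intro inj_on_inverseI[of _ \<phi>]) auto
  qed
  ultimately have "openin (top_of_set ?P) (A \<inter> ?P \<inter> V)" by simp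
  then obtain O' where O': "open O'" "A \<inter> ?P \<inter> V = ?P \<inter> O'" by (auto simp: openin_open)
  let ?L = "\<lambda>k :: complex ^ 2. vector [k $ 1, k $ 2, 0] :: complex ^ 3"
  have "open (?L -` O')" by (rule open_vimage[OF O'(1) linear_continuous_on[OF bounded_linear_zero_extension]])
  moreover have "?L -` O' \<subseteq> {k. ?L k \<in> A}"
  proof
    fix k assume "k \<in> ?L -` O'"
    then have "?L k \<in> ?P \<inter> O'" by simp
    then show "k \<in> {k. ?L k \<in> A}" using O'(2) by blast
  qed
  moreover have "vector [p $ 1, p $ 2] \<in> ?L -` O'"
  proof -
    have "?L (vector [p $ 1, p $ 2]) = p" using *(1) by (simp add: Finite_Cartesian_Product.vec_eq_iff forall_3)
    moreover have "p \<in> O'" using *(1,3) O'(2) by blast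
    ultimately show ?thesis by simp
  qed
  ultimately show ?thesis using interior_maximal by blast
qed

text \<open>The chart \<open>w \<mapsto> (a, b - \<beta> a, E)\<close>, with \<open>a = w\<^sub>1 - \<i> w\<^sub>2\<close>, \<open>b = w\<^sub>1 + \<i> w\<^sub>2\<close> and \<open>E = w\<^sub>3\<close>, maps the graph in
  the plane \<open>E = 0\<close> to the first coordinate axis.\<close>

lemma regular_point_graph:
  fixes A :: "(complex ^ 3) set"
  assumes \<beta>: "\<beta> holomorphic_on ball a0 \<rho>" "\<And>a. a \<in> ball a0 \<rho> \<Longrightarrow> cmod (\<beta> a) < r" and pos: "\<rho> > 0" "r > 0"
    and A: "\<And>w. w $ 1 - \<i> * w $ 2 \<in> ball a0 \<rho> \<Longrightarrow> cmod (w $ 1 + \<i> * w $ 2) < r \<Longrightarrow> w $ 3 = 0 \<Longrightarrow>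
        w \<in> A \<longleftrightarrow> w $ 1 + \<i> * w $ 2 = \<beta> (w $ 1 - \<i> * w $ 2)"
  shows "\<exists>p. regular_point (A \<inter> {w. w $ 3 = 0}) 1 p"
proof -
  define D where "D = ball a0 \<rho>"
  have D: "open D" "a0 \<in> D" using pos by (auto simp: D_def)
  define av :: "complex ^ 3 \<Rightarrow> complex" where "av w = w $ 1 - \<i> * w $ 2" for w
  define bv :: "complex ^ 3 \<Rightarrow> complex" where "bv w = w $ 1 + \<i> * w $ 2" for w
  have hol_ab: "holomorphic_mv_on av S" "holomorphic_mv_on bv S" for S
    unfolding av_def bv_def
    by (intro holomorphic_mv_on_diff holomorphic_mv_on_add holomorphic_mv_on_mult holomorphic_mv_on_const holomorphic_mv_on_nth)+
  have cont: "continuous_on S av" "continuous_on S bv" "continuous_on S (\<lambda>w :: complex ^ 3. w $ j)" for S j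
    unfolding av_def bv_def by (intro continuous_intros)+
  have \<beta>c: "continuous_on D \<beta>" using \<beta>(1) by (simp add: D_def holomorphic_on_imp_continuous_on)
  define V where "V = {w. av w \<in> D \<and> cmod (bv w) < r}"
  define W where "W = {u :: complex ^ 3. u $ 1 \<in> D \<and> cmod (u $ 2 + \<beta> (u $ 1)) < r}"
  have "open V"
  proof -
    have "V = av -` D \<inter> bv -` ball 0 r" by (auto simp: V_def)
    then show ?thesis using open_vimage[OF D(1) cont(1)] open_vimage[OF open_ball cont(2)] by auto
  qed
  have "open W"
  proof -
    have o: "open ((\<lambda>u :: complex ^ 3. u $ 1) -` D)" by (rule open_vimage[OF D(1) cont(3)])
    have c: "continuous_on ((\<lambda>u :: complex ^ 3. u $ 1) -` D) (\<lambda>u. u $ 2 + \<beta> (u $ 1))"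
      by (intro continuous_on_add cont continuous_on_compose2[OF \<beta>c]) auto
    have "W = ((\<lambda>u. u $ 2 + \<beta> (u $ 1)) -` ball 0 r) \<inter> ((\<lambda>u. u $ 1) -` D)" by (auto simp: W_def)
    then show ?thesis using continuous_open_preimage[OF c o open_ball] by (simp add: Int_commute)
  qed
  define \<phi> :: "complex ^ 3 \<Rightarrow> complex ^ 3" where "\<phi> w = vector [av w, bv w - \<beta> (av w), w $ 3]" for w
  define \<psi> :: "complex ^ 3 \<Rightarrow> complex ^ 3" where
    "\<psi> u = vector [(u $ 1 + (u $ 2 + \<beta> (u $ 1))) / 2, \<i> * (u $ 1 - (u $ 2 + \<beta> (u $ 1))) / 2, u $ 3]" for u
  have ab\<psi>: "av (\<psi> u) = u $ 1" "bv (\<psi> u) = u $ 2 + \<beta> (u $ 1)" "\<psi> u $ 3 = u $ 3" for u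
    by (simp_all add: av_def bv_def \<psi>_def field_simps)
  have \<phi>\<psi>: "\<phi> (\<psi> u) = u" for u
    by (simp add: \<phi>_def ab\<psi> Finite_Cartesian_Product.vec_eq_iff forall_3)
  have \<psi>\<phi>: "\<psi> (\<phi> w) = w" for w
    by (simp add: \<phi>_def \<psi>_def Finite_Cartesian_Product.vec_eq_iff forall_3) (simp add: av_def bv_def field_simps)
  have \<phi>V: "\<phi> w \<in> W \<longleftrightarrow> w \<in> V" for w by (simp add: \<phi>_def W_def V_def)
  have \<psi>W: "\<psi> u \<in> V \<longleftrightarrow> u \<in> W" for u using \<phi>V[of "\<psi> u"] by (simp add: \<phi>\<psi>)
  have vec3: "(vector [x, y, t] :: complex ^ 3) $ j = (if j = 1 then x else if j = 2 then y else t)" for x y t j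
    using exhaust_3[of j] by auto
  have hol\<phi>: "holomorphic_mv_on (\<lambda>w. \<phi> w $ j) V" for j
  proof -
    have "holomorphic_mv_on (\<lambda>w. \<beta> (av w)) V"
      by (rule holomorphic_mv_on_compose[OF hol_ab(1) \<beta>(1)]) (auto simp: V_def D_def)
    then show ?thesis unfolding \<phi>_def vec3
      by (cases "j = 1"; cases "j = 2") (auto intro: hol_ab holomorphic_mv_on_diff holomorphic_mv_on_nth)
  qed
  have hol\<psi>: "holomorphic_mv_on (\<lambda>u. \<psi> u $ j) W" for j
  proof -
    have "holomorphic_mv_on (\<lambda>u. \<beta> (u $ 1)) W"
      by (rule holomorphic_mv_on_compose[OF holomorphic_mv_on_nth \<beta>(1)]) (auto simp: W_def D_def)
    note hb = this
    have "holomorphic_mv_on (\<lambda>u. (u $ 1 + (u $ 2 + \<beta> (u $ 1))) * (1 / 2)) W"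
      "holomorphic_mv_on (\<lambda>u. \<i> * (u $ 1 - (u $ 2 + \<beta> (u $ 1))) * (1 / 2)) W"
      by (intro hb holomorphic_mv_on_mult holomorphic_mv_on_add holomorphic_mv_on_diff holomorphic_mv_on_const holomorphic_mv_on_nth)+
    then show ?thesis unfolding \<psi>_def vec3
      by (cases "j = 1"; cases "j = 2") (auto intro: holomorphic_mv_on_nth)
  qed
  have contI: "continuous_on S f" if "\<And>j. holomorphic_mv_on (\<lambda>w. f w $ j) S" for f :: "complex ^ 3 \<Rightarrow> complex ^ 3" and S
  proof -
    have "continuous_on S (\<lambda>w. f w $ j)" for j
      unfolding continuous_on_eq_continuous_within
    proof
      fix x assume "x \<in> S"
      then show "continuous (at x within S) (\<lambda>w. f w $ j)"
        using that[of j] has_derivative_continuous continuous_at_imp_continuous_at_within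
        unfolding holomorphic_mv_on_def by meson
    qed
    then have "continuous_on S (\<lambda>w. \<chi> j. f w $ j)" by (rule continuous_on_vec_lambda)
    then show ?thesis by (simp add: vec_nth_inverse)
  qed
  have homeo: "homeomorphism V W \<phi> \<psi>"
    by (rule homeomorphismI) (use contI[OF hol\<phi>] contI[OF hol\<psi>] \<phi>V \<psi>W \<phi>\<psi> \<psi>\<phi> in auto)
  have AV: "w \<in> A \<longleftrightarrow> bv w = \<beta> (av w)" if "w \<in> V" "w $ 3 = 0" for w
    using A[of w] that by (simp add: V_def D_def av_def bv_def)
  have img: "\<phi> ` (A \<inter> {w. w $ 3 = 0} \<inter> V) = {u \<in> W. \<forall>j. j \<notin> {1} \<longrightarrow> u $ j = 0}"
  proof (rule Set.set_eqI)
    fix u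
    have "u \<in> \<phi> ` (A \<inter> {w. w $ 3 = 0} \<inter> V) \<longleftrightarrow> \<psi> u \<in> A \<inter> {w. w $ 3 = 0} \<inter> V"
    proof
      assume "u \<in> \<phi> ` (A \<inter> {w. w $ 3 = 0} \<inter> V)"
      then obtain w where "u = \<phi> w" "w \<in> A \<inter> {w. w $ 3 = 0} \<inter> V" by (rule imageE)
      then show "\<psi> u \<in> A \<inter> {w. w $ 3 = 0} \<inter> V" by (simp only: \<psi>\<phi>)
    next
      assume "\<psi> u \<in> A \<inter> {w. w $ 3 = 0} \<inter> V"
      from imageI[OF this, of \<phi>] show "u \<in> \<phi> ` (A \<inter> {w. w $ 3 = 0} \<inter> V)" by (simp only: \<phi>\<psi>)
    qed
    also have "\<dots> \<longleftrightarrow> u \<in> W \<and> u $ 3 = 0 \<and> u $ 2 = 0"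
      using AV[of "\<psi> u"] by (auto simp: \<psi>W ab\<psi>)
    also have "\<dots> \<longleftrightarrow> u \<in> {u \<in> W. \<forall>j. j \<notin> {1} \<longrightarrow> u $ j = 0}" by (auto simp: forall_3)
    finally show "u \<in> \<phi> ` (A \<inter> {w. w $ 3 = 0} \<inter> V) \<longleftrightarrow> u \<in> {u \<in> W. \<forall>j. j \<notin> {1} \<longrightarrow> u $ j = 0}" .
  qed
  define p where "p = \<psi> (vector [a0, 0, 0])"
  have pW: "vector [a0, 0, 0] \<in> W" using D(2) \<beta>(2)[of a0] by (simp add: W_def D_def)
  then have pV: "p \<in> V" by (simp add: p_def \<psi>W)
  have "p \<in> A \<inter> {w. w $ 3 = 0}" using AV[OF pV] by (simp add: p_def ab\<psi>)
  then show ?thesis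
    unfolding regular_point_def using \<open>open V\<close> \<open>open W\<close> pV homeo hol\<phi> hol\<psi> img
    by (intro exI[of _ p] conjI exI[of _ V] exI[of _ W] exI[of _ \<phi>] exI[of _ \<psi>] exI[of _ "{1}"]) auto
qed

text \<open>The discreteness of \<open>\<kappa>\<close>, its isolated zero \<open>z\<close>, and the existence of arbitrarily large points \<open>a\<close> at
  a fixed distance from the family \<open>- cnj \<kappa>\<close> are all that the argument uses of the dual lattice.\<close>

theorem dirac_spectrum_analytic:
  fixes N :: "'i ell2 \<Rightarrow>\<^sub>L 'i ell2" and \<kappa> :: "'i \<Rightarrow> complex"
  assumes N: "complex_linear_op N" and fin: "\<And>R. finite {i. cmod (\<kappa> i) \<le> R}"
    and z: "\<kappa> z = 0" and \<delta>: "\<delta> > 0" "\<And>i. i \<noteq> z \<Longrightarrow> cmod (\<kappa> i) \<ge> \<delta>"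
    and \<rho>: "\<rho> > 0" and gap: "\<And>R. \<exists>a. cmod a \<ge> R \<and> (\<forall>i. cmod (a + cnj (\<kappa> i)) \<ge> 2 * \<rho>)"
  defines "Q \<equiv> dirac_spectrum N \<kappa>"
  shows "analytic_set Q" "analytic_codim Q > 0" "analytic_set (Q \<inter> {w. w $ 3 = 0})"
    "analytic_dim (Q \<inter> {w. w $ 3 = 0}) = 1"
proof -
  have hyp: "hypersurface Q" unfolding Q_def by (rule hypersurface_dirac_spectrum[OF N fin])
  show "analytic_set Q" using analytic_set_hypersurface_Int[OF hyp, of "{}"] by simp
  show "analytic_set (Q \<inter> {w. w $ 3 = 0})"
    using analytic_set_hypersurface_Int[OF hyp, of "{\<lambda>w. w $ 3}"] by (simp add: holomorphic_mv_on_nth)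
  have "vector [0, 0, \<i> * complex_of_real (norm N + 1)] \<notin> Q"
    unfolding Q_def by (rule dirac_spectrum_excludes_imaginary_energy[where t = "norm N + 1"]) simp_all
  then have "Q \<noteq> UNIV" by blast
  then have "e \<le> 2" if "regular_point Q e p" for e p
    using hypersurface_dim_less[OF hyp _ that] by simp
  then have "analytic_dim Q \<le> ereal (real 2)" by (rule analytic_dim_le)
  then have "ereal 3 - ereal (real 2) \<le> ereal 3 - analytic_dim Q" by (rule ereal_minus_mono[OF order_refl])
  then have "ereal 1 \<le> ereal 3 - analytic_dim Q" by simp
  moreover have "(0 :: ereal) < ereal 1" by simp
  ultimately have "0 < ereal 3 - analytic_dim Q" by (rule less_le_trans[rotated])
  then show "analytic_codim Q > 0" unfolding analytic_codim_def by simp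
  obtain a0 r \<beta> where g: "r > 0" "\<beta> holomorphic_on ball a0 \<rho>" "\<And>a. a \<in> ball a0 \<rho> \<Longrightarrow> cmod (\<beta> a) < r"
    "\<And>a b. a \<in> ball a0 \<rho> \<Longrightarrow> cmod b < r \<Longrightarrow> zero_mode_pair N \<kappa> a b \<longleftrightarrow> b = \<beta> a"
    by (rule zero_energy_graph[OF N fin z \<delta> \<rho> gap], assumption) (rule that; assumption)
  have slice: "w \<in> Q \<longleftrightarrow> zero_mode_pair N \<kappa> (w $ 1 - \<i> * w $ 2) (w $ 1 + \<i> * w $ 2)" if "w $ 3 = 0" for w
    unfolding Q_def dirac_spectrum_def zero_mode_pair_def by (simp add: that)
  have graph: "w \<in> Q \<longleftrightarrow> w $ 1 + \<i> * w $ 2 = \<beta> (w $ 1 - \<i> * w $ 2)"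
    if "w $ 1 - \<i> * w $ 2 \<in> ball a0 \<rho>" "cmod (w $ 1 + \<i> * w $ 2) < r" "w $ 3 = 0" for w
    using g(4)[OF that(1,2)] slice[OF that(3)] by simp
  obtain p where p: "regular_point (Q \<inter> {w. w $ 3 = 0}) 1 p"
    using regular_point_graph[OF g(2,3) \<rho> g(1) graph] by blast
  have "{k :: complex ^ 2. vector [k $ 1, k $ 2, 0] \<in> Q} \<noteq> UNIV"
  proof -
    \<comment> \<open>Over the single point \<open>a0\<close> any \<open>b\<close> of modulus less than \<open>r\<close> other than \<open>\<beta> a0\<close> is outside of the slice.\<close>
    define b where "b = (if \<beta> a0 = 0 then complex_of_real (r / 2) else 0)"
    have b: "b \<noteq> \<beta> a0" "cmod b < r" using g(1) by (auto simp: b_def)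
    define k :: "complex ^ 2" where "k = vector [(a0 + b) / 2, \<i> * (a0 - b) / 2]"
    let ?w = "vector [k $ 1, k $ 2, 0] :: complex ^ 3"
    have w: "?w $ 1 - \<i> * ?w $ 2 = a0" "?w $ 1 + \<i> * ?w $ 2 = b" "?w $ 3 = 0"
      by (simp_all add: k_def field_simps)
    have "?w \<notin> Q" using graph[of ?w] w b \<rho> by simp
    then show ?thesis by blast
  qed
  then have "interior {k :: complex ^ 2. vector [k $ 1, k $ 2, 0] \<in> Q} = {}"
    using hypersurface_eq_UNIV_if_interior[OF hypersurface_slice[OF hyp]] by blast
  then have "e \<le> 1" if "regular_point (Q \<inter> {w. w $ 3 = 0}) e p" for e p
    using slice_interior_if_regular_dim_2[OF that] by (cases "e \<ge> 2") auto
  then have "analytic_dim (Q \<inter> {w. w $ 3 = 0}) \<le> ereal (real 1)" by (rule analytic_dim_le)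
  moreover have "ereal (real 1) \<le> analytic_dim (Q \<inter> {w. w $ 3 = 0})"
    unfolding analytic_dim_def by (rule SUP_upper) (use p in auto)
  ultimately show "analytic_dim (Q \<inter> {w. w $ 3 = 0}) = 1" by (simp add: one_ereal_def)
qed

section \<open>Orthonormal bases of square-integrable functions\<close>

lemma borel_measurable_cnj [measurable (raw)]:
  assumes "f \<in> borel_measurable M"
  shows "(\<lambda>x. cnj (f x)) \<in> borel_measurable M"
  by (rule measurable_compose[OF assms borel_measurable_continuous_onI]) (intro continuous_intros)

definition square_integrable :: "'a measure \<Rightarrow> ('a \<Rightarrow> complex) \<Rightarrow> bool" where
  "square_integrable M f \<longleftrightarrow> f \<in> borel_measurable M \<and> integrable M (\<lambda>x. (cmod (f x))\<^sup>2)"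

lemma square_integrableD:
  "square_integrable M f \<Longrightarrow> f \<in> borel_measurable M"
  "square_integrable M f \<Longrightarrow> integrable M (\<lambda>x. (cmod (f x))\<^sup>2)"
  by (auto simp: square_integrable_def)

lemma cmod_add_square_le: "(cmod (a + b))\<^sup>2 \<le> 2 * (cmod a)\<^sup>2 + 2 * (cmod b)\<^sup>2"
proof -
  have "(cmod (a + b))\<^sup>2 \<le> (cmod a + cmod b)\<^sup>2" by (intro power_mono norm_triangle_ineq) auto
  also have "\<dots> \<le> 2 * (cmod a)\<^sup>2 + 2 * (cmod b)\<^sup>2"
    using zero_le_power2[of "cmod a - cmod b"] by (simp add: power2_eq_square algebra_simps)
  finally show ?thesis .
qed

lemma square_integrable_add:
  assumes f: "square_integrable M f" and g: "square_integrable M g"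
  shows "square_integrable M (\<lambda>x. f x + g x)"
  unfolding square_integrable_def
proof
  show m: "(\<lambda>x. f x + g x) \<in> borel_measurable M"
    using square_integrableD(1)[OF f] square_integrableD(1)[OF g] by measurable
  have "integrable M (\<lambda>x. 2 * (cmod (f x))\<^sup>2 + 2 * (cmod (g x))\<^sup>2)"
    using square_integrableD(2)[OF f] square_integrableD(2)[OF g] by simp
  then show "integrable M (\<lambda>x. (cmod (f x + g x))\<^sup>2)"
    by (rule Bochner_Integration.integrable_bound) (use m in \<open>auto simp: cmod_add_square_le\<close>)
qed

lemma square_integrable_mult_bounded:
  assumes f: "square_integrable M f" and h: "h \<in> borel_measurable M" and C: "\<And>x. cmod (h x) \<le> C"
  shows "square_integrable M (\<lambda>x. h x * f x)"
    and "(\<integral>x. (cmod (h x * f x))\<^sup>2 \<partial>M) \<le> C\<^sup>2 * (\<integral>x. (cmod (f x))\<^sup>2 \<partial>M)"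
proof -
  have m: "(\<lambda>x. h x * f x) \<in> borel_measurable M" using square_integrableD(1)[OF f] h by measurable
  have b: "(cmod (h x * f x))\<^sup>2 \<le> C\<^sup>2 * (cmod (f x))\<^sup>2" for x
    unfolding norm_mult power_mult_distrib by (intro mult_right_mono power_mono C) auto
  have i: "integrable M (\<lambda>x. C\<^sup>2 * (cmod (f x))\<^sup>2)" using square_integrableD(2)[OF f] by simp
  have j: "integrable M (\<lambda>x. (cmod (h x * f x))\<^sup>2)"
    by (rule Bochner_Integration.integrable_bound[OF i]) (use m b in auto)
  show "square_integrable M (\<lambda>x. h x * f x)" unfolding square_integrable_def using m j by blast
  have "(\<integral>x. (cmod (h x * f x))\<^sup>2 \<partial>M) \<le> (\<integral>x. C\<^sup>2 * (cmod (f x))\<^sup>2 \<partial>M)"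
    by (rule integral_mono[OF j i b])
  then show "(\<integral>x. (cmod (h x * f x))\<^sup>2 \<partial>M) \<le> C\<^sup>2 * (\<integral>x. (cmod (f x))\<^sup>2 \<partial>M)" by simp
qed

lemma square_integrable_cmult: "square_integrable M f \<Longrightarrow> square_integrable M (\<lambda>x. c * f x)"
  using square_integrable_mult_bounded(1)[of M f "\<lambda>_. c" "cmod c"] by simp

lemma square_integrable_diff:
  "square_integrable M f \<Longrightarrow> square_integrable M g \<Longrightarrow> square_integrable M (\<lambda>x. f x - g x)"
  using square_integrable_add[of M f "\<lambda>x. - 1 * g x"] square_integrable_cmult[of M g "- 1"] by simp

lemma square_integrable_zero: "square_integrable M (\<lambda>x. 0)"
  by (simp add: square_integrable_def)

lemma square_integrable_sum:
  "(\<And>i. i \<in> S \<Longrightarrow> square_integrable M (f i)) \<Longrightarrow> square_integrable M (\<lambda>x. \<Sum>i\<in>S. f i x)"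
  by (induction S rule: infinite_finite_induct) (auto intro: square_integrable_add square_integrable_zero)

lemma integrable_mult_cnj:
  assumes f: "square_integrable M f" and g: "square_integrable M g"
  shows "integrable M (\<lambda>x. f x * cnj (g x))"
proof (rule Bochner_Integration.integrable_bound)
  show "integrable M (\<lambda>x. (cmod (f x))\<^sup>2 + (cmod (g x))\<^sup>2)"
    using square_integrableD(2)[OF f] square_integrableD(2)[OF g] by simp
  show "(\<lambda>x. f x * cnj (g x)) \<in> borel_measurable M"
    using square_integrableD(1)[OF f] square_integrableD(1)[OF g] by measurable
  have "a * b \<le> a\<^sup>2 + b\<^sup>2" for a b :: real
  proof -
    have "2 * (a * b) \<le> a\<^sup>2 + b\<^sup>2" using zero_le_power2[of "a - b"] by (simp add: power2_eq_square algebra_simps)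
    moreover have "0 \<le> a\<^sup>2 + b\<^sup>2" by simp
    ultimately show ?thesis by linarith
  qed
  then show "AE x in M. norm (f x * cnj (g x)) \<le> norm ((cmod (f x))\<^sup>2 + (cmod (g x))\<^sup>2)"
    by (simp add: norm_mult)
qed

text \<open>An orthonormal basis of the square-integrable functions, consisting of bounded functions on a finite
  measure space. Functions are not identified when they agree almost everywhere; completeness says that
  the coefficients determine a function up to a null set.\<close>

locale orthonormal_basis = finite_measure M for M :: "'a measure" +
  fixes e :: "'i \<Rightarrow> 'a \<Rightarrow> complex"
  assumes basis_measurable [measurable]: "\<And>i. e i \<in> borel_measurable M"
    and basis_bounded: "\<And>i. \<exists>K. \<forall>x. cmod (e i x) \<le> K"
    and orthonormal: "\<And>i j. (\<integral>x. e i x * cnj (e j x) \<partial>M) = (if i = j then 1 else 0)"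
    and complete: "\<And>f. square_integrable M f \<Longrightarrow> (\<And>i. (\<integral>x. f x * cnj (e i x) \<partial>M) = 0) \<Longrightarrow> AE x in M. f x = 0"
begin

definition coef :: "('a \<Rightarrow> complex) \<Rightarrow> 'i \<Rightarrow> complex" where
  "coef f i = (\<integral>x. f x * cnj (e i x) \<partial>M)"

definition partial_sum :: "'i set \<Rightarrow> ('i \<Rightarrow> complex) \<Rightarrow> 'a \<Rightarrow> complex" where
  "partial_sum S c x = (\<Sum>i\<in>S. c i * e i x)"

lemma square_integrable_bounded:
  assumes "f \<in> borel_measurable M" "\<And>x. cmod (f x) \<le> K"
  shows "square_integrable M f"
  unfolding square_integrable_def
proof (intro conjI assms(1) integrable_const_bound[where B = "K\<^sup>2"])
  show "AE x in M. norm ((cmod (f x))\<^sup>2) \<le> K\<^sup>2" using assms(2) by (auto intro!: power_mono)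
qed (use assms(1) in measurable)

lemma basis_square_integrable: "square_integrable M (e i)"
  using basis_bounded[of i] square_integrable_bounded[OF basis_measurable] by blast

lemma partial_sum_square_integrable: "square_integrable M (partial_sum S c)"
  unfolding partial_sum_def by (intro square_integrable_sum square_integrable_cmult basis_square_integrable)

lemma square_integrable_imp_integrable_M:
  assumes "square_integrable M f" shows "integrable M f"
  using integrable_mult_cnj[OF assms square_integrable_bounded[of "\<lambda>_. 1" 1]] by simp

lemma integrable_coef: "square_integrable M f \<Longrightarrow> integrable M (\<lambda>x. f x * cnj (e i x))"
  by (rule integrable_mult_cnj[OF _ basis_square_integrable])

lemma coef_add: "square_integrable M f \<Longrightarrow> square_integrable M g \<Longrightarrow> coef (\<lambda>x. f x + g x) i = coef f i + coef g i"
  unfolding coef_def by (simp add: distrib_right integrable_coef)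

lemma coef_diff: "square_integrable M f \<Longrightarrow> square_integrable M g \<Longrightarrow> coef (\<lambda>x. f x - g x) i = coef f i - coef g i"
  unfolding coef_def by (simp add: left_diff_distrib integrable_coef)

lemma coef_cmult: "coef (\<lambda>x. c * f x) i = c * coef f i"
  unfolding coef_def by (simp add: mult.assoc)

lemma coef_cong_AE:
  assumes "AE x in M. f x = g x" "f \<in> borel_measurable M" "g \<in> borel_measurable M"
  shows "coef f i = coef g i"
proof -
  have [measurable]: "f \<in> borel_measurable M" "g \<in> borel_measurable M" by fact+
  show ?thesis unfolding coef_def
  proof (rule integral_cong_AE)
    show "AE x in M. f x * cnj (e i x) = g x * cnj (e i x)" using assms(1) by eventually_elim simp
  qed measurable
qed

lemma coef_partial_sum: "finite S \<Longrightarrow> coef (partial_sum S c) i = (if i \<in> S then c i else 0)"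
proof -
  assume S: "finite S"
  have "coef (partial_sum S c) i = (\<integral>x. (\<Sum>j\<in>S. c j * (e j x * cnj (e i x))) \<partial>M)"
    unfolding coef_def partial_sum_def by (simp add: sum_distrib_right mult.assoc)
  also have "\<dots> = (\<Sum>j\<in>S. c j * (\<integral>x. e j x * cnj (e i x) \<partial>M))"
    by (subst Bochner_Integration.integral_sum)
       (auto intro!: Bochner_Integration.integrable_mult_right integrable_coef basis_square_integrable)
  also have "\<dots> = (if i \<in> S then c i else 0)"
    using S by (simp add: orthonormal if_distrib cong: if_cong)
  finally show ?thesis .
qed

lemma integral_mult_cnj_partial_sum:
  assumes "square_integrable M f"
  shows "(\<integral>x. f x * cnj (partial_sum S c x) \<partial>M) = (\<Sum>i\<in>S. cnj (c i) * coef f i)"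
proof -
  have "(\<integral>x. f x * cnj (partial_sum S c x) \<partial>M) = (\<integral>x. (\<Sum>i\<in>S. cnj (c i) * (f x * cnj (e i x))) \<partial>M)"
    unfolding partial_sum_def by (simp add: sum_distrib_left mult_ac)
  also have "\<dots> = (\<Sum>i\<in>S. cnj (c i) * coef f i)"
    unfolding coef_def 
    by (subst Bochner_Integration.integral_sum) (auto intro!: Bochner_Integration.integrable_mult_right integrable_coef assms)
  finally show ?thesis .
qed

lemma integral_square_eq:
  assumes "square_integrable M f"
  shows "complex_of_real (\<integral>x. (cmod (f x))\<^sup>2 \<partial>M) = (\<integral>x. f x * cnj (f x) \<partial>M)"
proof -
  have "(\<integral>x. f x * cnj (f x) \<partial>M) = (\<integral>x. complex_of_real ((cmod (f x))\<^sup>2) \<partial>M)"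
    by (simp only: complex_norm_square)
  also have "\<dots> = complex_of_real (\<integral>x. (cmod (f x))\<^sup>2 \<partial>M)" by (rule integral_complex_of_real)
  finally show ?thesis by (rule sym)
qed

lemma norm_partial_sum:
  assumes "finite S"
  shows "(\<integral>x. (cmod (partial_sum S c x))\<^sup>2 \<partial>M) = (\<Sum>i\<in>S. (cmod (c i))\<^sup>2)"
proof -
  have "complex_of_real (\<integral>x. (cmod (partial_sum S c x))\<^sup>2 \<partial>M) = (\<Sum>i\<in>S. cnj (c i) * c i)"
    unfolding integral_square_eq[OF partial_sum_square_integrable]
    unfolding integral_mult_cnj_partial_sum[OF partial_sum_square_integrable]
    by (rule sum.cong) (auto simp: coef_partial_sum[OF assms])
  also have "\<dots> = complex_of_real (\<Sum>i\<in>S. (cmod (c i))\<^sup>2)"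
    by (simp add: complex_norm_square mult.commute del: of_real_power)
  finally show ?thesis using of_real_eq_iff by blast
qed

lemma bessel:
  assumes f: "square_integrable M f" and S: "finite S"
  shows "(\<Sum>i\<in>S. (cmod (coef f i))\<^sup>2) \<le> (\<integral>x. (cmod (f x))\<^sup>2 \<partial>M)"
proof -
  let ?p = "partial_sum S (coef f)"
  note p = partial_sum_square_integrable[of S "coef f"]
  have eq: "(cmod (a - b))\<^sup>2 = (cmod a)\<^sup>2 - 2 * Re (a * cnj b) + (cmod b)\<^sup>2" for a b
    unfolding cmod_power2 by (simp add: power2_eq_square algebra_simps)
  have "0 \<le> (\<integral>x. (cmod (f x - ?p x))\<^sup>2 \<partial>M)" by simp
  also have "\<dots> = (\<integral>x. (cmod (f x))\<^sup>2 \<partial>M) - 2 * Re (\<integral>x. f x * cnj (?p x) \<partial>M) + (\<integral>x. (cmod (?p x))\<^sup>2 \<partial>M)"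
  proof -
    define h where "h x = f x * cnj (?p x)" for x
    have h: "integrable M h" unfolding h_def by (rule integrable_mult_cnj[OF f p])
    show ?thesis unfolding eq h_def[symmetric]
      using square_integrableD(2)[OF f] square_integrableD(2)[OF p] integrable_Re[OF h] integral_Re[OF h] by simp
  qed
  also have "(\<integral>x. f x * cnj (?p x) \<partial>M) = complex_of_real (\<Sum>i\<in>S. (cmod (coef f i))\<^sup>2)"
    unfolding integral_mult_cnj_partial_sum[OF f] by (simp add: complex_norm_square mult.commute del: of_real_power)
  finally show ?thesis unfolding norm_partial_sum[OF S] by simp
qed

lemma coef_ell2:
  assumes f: "square_integrable M f"
  shows "\<exists>c. coord c = coef f \<and> (norm c)\<^sup>2 \<le> (\<integral>x. (cmod (f x))\<^sup>2 \<partial>M)"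
proof -
  have "L2_set (\<lambda>i. cmod (coef f i)) S \<le> sqrt (\<integral>x. (cmod (f x))\<^sup>2 \<partial>M)" if "finite S" for S
    unfolding L2_set_def by (intro real_sqrt_le_mono bessel f that)
  from ell2_of_bounded[OF this] obtain c where c: "coord c = coef f" "norm c \<le> sqrt (\<integral>x. (cmod (f x))\<^sup>2 \<partial>M)" by blast
  have "(norm c)\<^sup>2 \<le> (sqrt (\<integral>x. (cmod (f x))\<^sup>2 \<partial>M))\<^sup>2" by (rule power_mono[OF c(2)]) simp
  then show ?thesis using c(1) by auto
qed

text \<open>The inequality between arithmetic and geometric mean with a free weight \<open>t\<close>; it does the work of the
  Cauchy-Schwarz inequality without square roots of integrals.\<close>

lemma integral_cmod_le:
  assumes f: "square_integrable M f" and t: "t > 0"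
  shows "(\<integral>x. cmod (f x) \<partial>M) \<le> (t * measure M (space M) + (\<integral>x. (cmod (f x))\<^sup>2 \<partial>M) / t) / 2"
proof -
  have b: "cmod (f x) \<le> (t + (cmod (f x))\<^sup>2 / t) / 2" for x
  proof -
    have "0 \<le> (t - cmod (f x))\<^sup>2 / t" using t by simp
    also have "\<dots> = t - 2 * cmod (f x) + (cmod (f x))\<^sup>2 / t"
      using t by (simp add: power2_eq_square field_simps)
    finally show ?thesis by simp
  qed
  have "(\<integral>x. cmod (f x) \<partial>M) \<le> (\<integral>x. (t + (cmod (f x))\<^sup>2 / t) / 2 \<partial>M)"
    by (rule integral_mono) (use b square_integrable_imp_integrable_M[OF f] square_integrableD(2)[OF f] in auto)
  also have "\<dots> = (t * measure M (space M) + (\<integral>x. (cmod (f x))\<^sup>2 \<partial>M) / t) / 2"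
    using square_integrableD(2)[OF f] by (simp add: mult.commute)
  finally show ?thesis .
qed

text \<open>Partial sums that exhaust \<open>x\<close> form a Cauchy sequence in mean square, hence in mean, so that a
  subsequence converges almost everywhere. Fatou's lemma carries the mean-square bounds to the limit.\<close>

lemma riesz_fischer:
  fixes x :: "'i ell2"
  obtains f where "square_integrable M f" "coef f = coord x" "(\<integral>z. (cmod (f z))\<^sup>2 \<partial>M) \<le> (norm x)\<^sup>2"
proof -
  have "\<exists>S. finite S \<and> (\<forall>F. finite F \<longrightarrow> F \<inter> S = {} \<longrightarrow> (\<Sum>i\<in>F. (cmod (coord x i))\<^sup>2) \<le> 1 / real (Suc n))" for n
    using nonneg_summable_tail[OF coord_mem[of x], of "1 / real (Suc n)"] by (metis of_nat_0_less_iff zero_le_power2 zero_less_Suc zero_less_divide_1_iff)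
  then obtain S where S: "\<And>n. finite (S n)" "\<And>n F. finite F \<Longrightarrow> F \<inter> S n = {} \<Longrightarrow> (\<Sum>i\<in>F. (cmod (coord x i))\<^sup>2) \<le> 1 / real (Suc n)"
    by metis
  define p where "p n = partial_sum (S n) (coord x)" for n
  have p: "square_integrable M (p n)" for n unfolding p_def by (rule partial_sum_square_integrable)
  have pm [measurable]: "p n \<in> borel_measurable M" for n by (rule square_integrableD(1)[OF p])
  have pp: "(\<integral>z. (cmod (p n z - p m z))\<^sup>2 \<partial>M) \<le> 1 / real (Suc n) + 1 / real (Suc m)" for n m
  proof -
    define c where "c i = (if i \<in> S n then coord x i else 0) - (if i \<in> S m then coord x i else 0)" for i
    have fin: "finite (S n \<union> S m)" using S(1) by simp
    have "p n z - p m z = partial_sum (S n \<union> S m) c z" for z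
    proof -
      have "p k z = (\<Sum>i\<in>S n \<union> S m. (if i \<in> S k then coord x i else 0) * e i z)" if "k = n \<or> k = m" for k
        unfolding p_def partial_sum_def using that S(1) by (intro sum.mono_neutral_cong_left) auto
      then show ?thesis by (simp add: partial_sum_def c_def left_diff_distrib sum_subtractf)
    qed
    then have "(\<integral>z. (cmod (p n z - p m z))\<^sup>2 \<partial>M) = (\<Sum>i\<in>S n \<union> S m. (cmod (c i))\<^sup>2)"
      by (simp add: norm_partial_sum[OF fin])
    also have "\<dots> = (\<Sum>i\<in>(S n - S m) \<union> (S m - S n). (cmod (coord x i))\<^sup>2)"
      using S(1) by (intro sum.mono_neutral_cong_right) (auto simp: c_def)
    also have "\<dots> = (\<Sum>i\<in>S n - S m. (cmod (coord x i))\<^sup>2) + (\<Sum>i\<in>S m - S n. (cmod (coord x i))\<^sup>2)"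
      using S(1) by (intro sum.union_disjoint) auto
    also have "\<dots> \<le> 1 / real (Suc m) + 1 / real (Suc n)"
      by (intro add_mono S(2)) (use S(1) in auto)
    finally show ?thesis by simp
  qed
  have L1: "\<exists>N. \<forall>i\<ge>N. \<forall>j\<ge>N. (LINT z|M. norm (p i z - p j z)) < d" if d: "d > 0" for d
  proof -
    define t where "t = d / (measure M (space M) + 1)"
    have t: "t > 0" using d by (simp add: t_def add_nonneg_pos)
    have tm: "t * measure M (space M) < d"
    proof -
      have "t * measure M (space M) < t * (measure M (space M) + 1)" using t by simp
      also have "\<dots> = d" using measure_nonneg[of M "space M"] unfolding t_def by (simp add: add_nonneg_eq_0_iff)
      finally show ?thesis .
    qed
    obtain N where N: "2 / real (Suc N) < d * t"
    proof -
      obtain N where "2 / (d * t) < real N" using reals_Archimedean2 by blast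
      then have "2 / (d * t) < real (Suc N)" by simp
      then have "2 / real (Suc N) < d * t" using d t by (simp add: field_simps)
      then show thesis by (rule that)
    qed
    have "(LINT z|M. norm (p i z - p j z)) < d" if ij: "i \<ge> N" "j \<ge> N" for i j
    proof -
      have "(\<integral>z. (cmod (p i z - p j z))\<^sup>2 \<partial>M) \<le> 1 / real (Suc i) + 1 / real (Suc j)" by (rule pp)
      also have "\<dots> \<le> 1 / real (Suc N) + 1 / real (Suc N)" by (intro add_mono divide_left_mono) (use ij in auto)
      also have "\<dots> < d * t" using N by simp
      finally have l: "(\<integral>z. (cmod (p i z - p j z))\<^sup>2 \<partial>M) / t < d" using t by (simp add: pos_divide_less_eq)
      have "(LINT z|M. norm (p i z - p j z)) \<le> (t * measure M (space M) + (\<integral>z. (cmod (p i z - p j z))\<^sup>2 \<partial>M) / t) / 2"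
        by (rule integral_cmod_le[OF square_integrable_diff[OF p[of i] p[of j]] t])
      also have "\<dots> < (d + d) / 2" by (intro divide_strict_right_mono add_strict_mono tm l) simp
      finally show ?thesis by simp
    qed
    then show ?thesis by blast
  qed
  obtain r where r: "strict_mono r" "AE z in M. Cauchy (\<lambda>n. p (r n) z)"
    using cauchy_L1_AE_cauchy_subseq[OF square_integrable_imp_integrable_M[OF p] L1] by blast
  define f where "f z = lim (\<lambda>n. p (r n) z)" for z
  have fm [measurable]: "f \<in> borel_measurable M" unfolding f_def by (rule borel_measurable_lim_metric) simp
  have lim: "AE z in M. (\<lambda>n. p (r n) z) \<longlonglongrightarrow> f z"
    using r(2) by eventually_elim (simp add: f_def Cauchy_convergent_iff convergent_LIMSEQ_iff)
  \<comment> \<open>Used twice: with \<open>q = p m\<close> it gives the convergence in mean square, with \<open>q = 0\<close> the bound by the norm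
    of \<open>x\<close>.\<close>
  have fatou: "square_integrable M (\<lambda>z. f z - q z) \<and> (\<integral>z. (cmod (f z - q z))\<^sup>2 \<partial>M) \<le> B"
    if q: "square_integrable M q" and B: "\<forall>\<^sub>F n in sequentially. (\<integral>z. (cmod (p (r n) z - q z))\<^sup>2 \<partial>M) \<le> B" and "B \<ge> 0" for q B
  proof -
    have qm [measurable]: "q \<in> borel_measurable M" by (rule square_integrableD(1)[OF q])
    have "(\<integral>\<^sup>+z. ennreal ((cmod (f z - q z))\<^sup>2) \<partial>M) = (\<integral>\<^sup>+z. liminf (\<lambda>n. ennreal ((cmod (p (r n) z - q z))\<^sup>2)) \<partial>M)"
    proof (rule nn_integral_cong_AE, use lim in eventually_elim)
      fix z assume "(\<lambda>n. p (r n) z) \<longlonglongrightarrow> f z"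
      then have "(\<lambda>n. ennreal ((cmod (p (r n) z - q z))\<^sup>2)) \<longlonglongrightarrow> ennreal ((cmod (f z - q z))\<^sup>2)"
        by (intro tendsto_intros tendsto_ennrealI)
      from lim_imp_Liminf[OF sequentially_bot this]
      show "ennreal ((cmod (f z - q z))\<^sup>2) = liminf (\<lambda>n. ennreal ((cmod (p (r n) z - q z))\<^sup>2))" by (rule sym)
    qed
    also have "\<dots> \<le> liminf (\<lambda>n. \<integral>\<^sup>+z. ennreal ((cmod (p (r n) z - q z))\<^sup>2) \<partial>M)"
      by (rule nn_integral_liminf) measurable
    also have "\<dots> \<le> liminf (\<lambda>n. ennreal B)"
    proof (rule Liminf_mono, use B in eventually_elim)
      fix n assume "(\<integral>z. (cmod (p (r n) z - q z))\<^sup>2 \<partial>M) \<le> B"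
      then show "(\<integral>\<^sup>+z. ennreal ((cmod (p (r n) z - q z))\<^sup>2) \<partial>M) \<le> ennreal B"
        using nn_integral_eq_integral[OF square_integrableD(2)[OF square_integrable_diff[OF p[of "r n"] q]]]
        by (simp add: ennreal_leI)
    qed
    also have "\<dots> = ennreal B" by (simp add: Liminf_const)
    finally have le: "(\<integral>\<^sup>+z. ennreal ((cmod (f z - q z))\<^sup>2) \<partial>M) \<le> ennreal B" .
    have int: "integrable M (\<lambda>z. (cmod (f z - q z))\<^sup>2)"
      by (rule integrableI_nonneg) (use le in \<open>auto simp: le_less_trans\<close>)
    then have "ennreal (\<integral>z. (cmod (f z - q z))\<^sup>2 \<partial>M) \<le> ennreal B"
      using le nn_integral_eq_integral[OF int] by simp
    then show ?thesis using int \<open>B \<ge> 0\<close> by (simp add: square_integrable_def)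
  qed
  have rn: "r n \<ge> n" for n using seq_suble[OF r(1)] .
  have fp: "square_integrable M (\<lambda>z. f z - p m z) \<and> (\<integral>z. (cmod (f z - p m z))\<^sup>2 \<partial>M) \<le> 2 / real (Suc m)" for m
  proof (rule fatou[OF p])
    show "\<forall>\<^sub>F n in sequentially. (\<integral>z. (cmod (p (r n) z - p m z))\<^sup>2 \<partial>M) \<le> 2 / real (Suc m)"
    proof (rule eventually_sequentiallyI[of m])
      fix n assume "n \<ge> m"
      then have "r n \<ge> m" using rn[of n] by simp
      then have "1 / real (Suc (r n)) \<le> 1 / real (Suc m)" by (intro divide_left_mono) auto
      then show "(\<integral>z. (cmod (p (r n) z - p m z))\<^sup>2 \<partial>M) \<le> 2 / real (Suc m)" using pp[of "r n" m] by simp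
    qed
  qed simp
  have f0: "square_integrable M (\<lambda>z. f z - 0) \<and> (\<integral>z. (cmod (f z - 0))\<^sup>2 \<partial>M) \<le> (norm x)\<^sup>2"
  proof (rule fatou[OF square_integrable_zero])
    have "(\<integral>z. (cmod (p n z))\<^sup>2 \<partial>M) \<le> (norm x)\<^sup>2" for n
    proof -
      have "sqrt (\<Sum>i\<in>S n. (cmod (coord x i))\<^sup>2) \<le> norm x"
        using L2_set_le_norm_ell2[OF S(1), of x n] by (simp add: L2_set_def)
      then show ?thesis unfolding p_def norm_partial_sum[OF S(1)] by (rule sqrt_le_D)
    qed
    then show "\<forall>\<^sub>F n in sequentially. (\<integral>z. (cmod (p (r n) z - 0))\<^sup>2 \<partial>M) \<le> (norm x)\<^sup>2" by simp
  qed simp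
  have f: "square_integrable M f" using f0 by simp
  have "coef f i = coord x i" for i
  proof -
    have b: "cmod (coef f i - coord x i) \<le> 2 * sqrt (2 / real (Suc m))" for m
    proof -
      have "(cmod (coef (\<lambda>z. f z - p m z) i))\<^sup>2 \<le> 2 / real (Suc m)"
        using bessel[of "\<lambda>z. f z - p m z" "{i}"] fp[of m] by simp
      then have 1: "cmod (coef f i - coef (p m) i) \<le> sqrt (2 / real (Suc m))"
        by (simp add: coef_diff[OF f p] real_le_rsqrt)
      have "(cmod (coef (p m) i - coord x i))\<^sup>2 \<le> 2 / real (Suc m)"
      proof (cases "i \<in> S m")
        case False
        then have "(cmod (coord x i))\<^sup>2 \<le> 1 / real (Suc m)" using S(2)[of "{i}" m] by simp
        also have "\<dots> \<le> 2 / real (Suc m)" by (intro divide_right_mono) auto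
        finally show ?thesis using False by (simp add: p_def coef_partial_sum[OF S(1)])
      qed (simp add: p_def coef_partial_sum[OF S(1)])
      then have 2: "cmod (coef (p m) i - coord x i) \<le> sqrt (2 / real (Suc m))" by (rule real_le_rsqrt)
      show ?thesis using 1 2 norm_triangle_ineq[of "coef f i - coef (p m) i" "coef (p m) i - coord x i"] by simp
    qed
    have "(\<lambda>m. 2 * sqrt (2 * (1 / real (Suc m)))) \<longlonglongrightarrow> 2 * sqrt (2 * 0)"
      by (intro tendsto_intros LIMSEQ_Suc[OF lim_1_over_n])
    then have "cmod (coef f i - coord x i) \<le> 2 * sqrt (2 * 0)"
      by (rule LIMSEQ_le_const) (use b in auto)
    then show ?thesis by simp
  qed
  then show thesis using that[of f] f f0 by auto
qed

lemma coef_eq_imp_AE_eq: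
  assumes "square_integrable M f" "square_integrable M g" "coef f = coef g"
  shows "AE x in M. f x = g x"
proof -
  have "AE x in M. f x - g x = 0"
  proof (rule complete[OF square_integrable_diff[OF assms(1,2)]])
    fix i show "(\<integral>x. (f x - g x) * cnj (e i x) \<partial>M) = 0"
      using coef_diff[OF assms(1,2), of i] assms(3) by (simp add: coef_def)
  qed
  then show ?thesis by simp
qed

text \<open>By completeness the remainder agrees almost everywhere with the function that \<open>riesz_fischer\<close> provides
  for the tail of the coefficients, whose norm is controlled by the tail.\<close>

lemma partial_sum_approx:
  assumes f: "square_integrable M f" and \<epsilon>: "\<epsilon> > 0"
  obtains S0 where "finite S0"
    "\<And>S. finite S \<Longrightarrow> S0 \<subseteq> S \<Longrightarrow> (\<integral>z. (cmod (f z - partial_sum S (coef f) z))\<^sup>2 \<partial>M) \<le> \<epsilon>"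
proof -
  obtain x where x: "coord x = coef f" using coef_ell2[OF f] by blast
  obtain S0 where S0: "finite S0" "\<And>S. finite S \<Longrightarrow> S0 \<subseteq> S \<Longrightarrow> norm (x - trunc S x) \<le> sqrt \<epsilon>"
    using trunc_approx[of "sqrt \<epsilon>" x] \<epsilon> by auto
  have "(\<integral>z. (cmod (f z - partial_sum S (coef f) z))\<^sup>2 \<partial>M) \<le> \<epsilon>" if S: "finite S" "S0 \<subseteq> S" for S
  proof -
    obtain g where g: "square_integrable M g" "coef g = coord (x - trunc S x)" "(\<integral>z. (cmod (g z))\<^sup>2 \<partial>M) \<le> (norm (x - trunc S x))\<^sup>2"
      by (rule riesz_fischer[of "x - trunc S x"])
    note p = partial_sum_square_integrable[of S "coef f"]
    have ae: "AE z in M. g z = f z - partial_sum S (coef f) z"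
    proof (rule coef_eq_imp_AE_eq[OF g(1) square_integrable_diff[OF f p]], rule ext)
      fix i show "coef g i = coef (\<lambda>z. f z - partial_sum S (coef f) z) i"
        unfolding coef_diff[OF f p] coef_partial_sum[OF S(1)] g(2) using x S(1) by (simp add: coord_trunc)
    qed
    have [measurable]: "g \<in> borel_measurable M" "f \<in> borel_measurable M" "partial_sum S (coef f) \<in> borel_measurable M"
      using square_integrableD(1) f g(1) p by blast+
    have "(\<integral>z. (cmod (f z - partial_sum S (coef f) z))\<^sup>2 \<partial>M) = (\<integral>z. (cmod (g z))\<^sup>2 \<partial>M)"
      by (rule integral_cong_AE) (use ae in auto)
    also have "\<dots> \<le> (sqrt \<epsilon>)\<^sup>2" by (rule order_trans[OF g(3) power_mono[OF S0(2)[OF S]]]) simp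
    finally show ?thesis using \<epsilon> by simp
  qed
  then show thesis using that[OF S0(1)] by blast
qed

text \<open>Multiplication by a bounded function, transported to coefficients: synthesis by \<open>riesz_fischer\<close>,
  multiplication, then analysis. The choice of the representing function does not matter, since
  coefficients ignore null sets.\<close>

lemma multiplication_operator:
  assumes U: "U \<in> borel_measurable M" "\<And>z. cmod (U z) \<le> C"
  obtains N :: "'i ell2 \<Rightarrow>\<^sub>L 'i ell2" where "complex_linear_op N"
    "\<And>f x. square_integrable M f \<Longrightarrow> coord x = coef f \<Longrightarrow> coord (blinfun_apply N x) = coef (\<lambda>z. U z * f z)"
proof -
  have C: "C \<ge> 0" using U(2) norm_ge_zero order_trans by blast
  define g where "g x = (SOME f. square_integrable M f \<and> coef f = coord x \<and> (\<integral>z. (cmod (f z))\<^sup>2 \<partial>M) \<le> (norm x)\<^sup>2)" for x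
  have g: "square_integrable M (g x) \<and> coef (g x) = coord x \<and> (\<integral>z. (cmod (g x z))\<^sup>2 \<partial>M) \<le> (norm x)\<^sup>2" for x
  proof -
    have "\<exists>f. square_integrable M f \<and> coef f = coord x \<and> (\<integral>z. (cmod (f z))\<^sup>2 \<partial>M) \<le> (norm x)\<^sup>2"
      by (rule riesz_fischer[of x]) blast
    from someI_ex[OF this] show ?thesis unfolding g_def .
  qed
  define T where "T x = (SOME c. coord c = coef (\<lambda>z. U z * g x z) \<and> (norm c)\<^sup>2 \<le> (\<integral>z. (cmod (U z * g x z))\<^sup>2 \<partial>M))" for x
  have Ug: "square_integrable M (\<lambda>z. U z * g x z)" for x
    using square_integrable_mult_bounded(1)[OF _ U] g by blast
  have T: "coord (T x) = coef (\<lambda>z. U z * g x z) \<and> (norm (T x))\<^sup>2 \<le> (\<integral>z. (cmod (U z * g x z))\<^sup>2 \<partial>M)" for x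
    unfolding T_def using someI_ex[OF coef_ell2[OF Ug]] .
  have key: "coord (T x) = coef (\<lambda>z. U z * f z)" if f: "square_integrable M f" "coord x = coef f" for f x
  proof -
    have ae: "AE z in M. g x z = f z" by (rule coef_eq_imp_AE_eq) (use f g[of x] in auto)
    have [measurable]: "f \<in> borel_measurable M" "g x \<in> borel_measurable M" "U \<in> borel_measurable M"
      using square_integrableD(1) f(1) g[of x] U(1) by blast+
    have "coef (\<lambda>z. U z * g x z) = coef (\<lambda>z. U z * f z)"
      by (rule ext, rule coef_cong_AE) (use ae in auto)
    then show ?thesis using T[of x] by simp
  qed
  have bl: "bounded_linear T"
  proof (rule bounded_linear_intro[where K = C])
    fix x y :: "'i ell2" and a :: real
    show "T (x + y) = T x + T y"
    proof (rule coord_ext)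
      fix i
      have "coord (x + y) = coef (\<lambda>z. g x z + g y z)" using g by (auto simp: fun_eq_iff coef_add)
      then have "coord (T (x + y)) i = coef (\<lambda>z. U z * g x z + U z * g y z) i"
        using key[of "\<lambda>z. g x z + g y z" "x + y"] g by (simp add: square_integrable_add distrib_left)
      then show "coord (T (x + y)) i = coord (T x + T y) i"
        using T[of x] T[of y] by (simp add: coef_add[OF Ug Ug])
    qed
    show "T (a *\<^sub>R x) = a *\<^sub>R T x"
    proof (rule coord_ext)
      fix i
      have "coord (a *\<^sub>R x) = coef (\<lambda>z. of_real a * g x z)" using g by (auto simp: fun_eq_iff coef_cmult scaleR_conv_of_real)
      then have "coord (T (a *\<^sub>R x)) i = coef (\<lambda>z. of_real a * (U z * g x z)) i"
        using key[of "\<lambda>z. of_real a * g x z" "a *\<^sub>R x"] g by (simp add: square_integrable_cmult mult_ac)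
      then show "coord (T (a *\<^sub>R x)) i = coord (a *\<^sub>R T x) i"
        using T[of x] by (simp only: coef_cmult coord_scaleR scaleR_conv_of_real)
    qed
    have "(norm (T x))\<^sup>2 \<le> C\<^sup>2 * (\<integral>z. (cmod (g x z))\<^sup>2 \<partial>M)"
      using T[of x] square_integrable_mult_bounded(2)[OF _ U, of "g x"] g[of x] by (meson order_trans)
    also have "\<dots> \<le> C\<^sup>2 * (norm x)\<^sup>2" using g[of x] by (intro mult_left_mono) auto
    finally have "(norm (T x))\<^sup>2 \<le> (norm x * C)\<^sup>2" by (simp add: power_mult_distrib mult.commute)
    then show "norm (T x) \<le> norm x * C" by (rule power2_le_imp_le) (use C in simp)
  qed
  have ap: "blinfun_apply (Blinfun T) = T" by (rule bounded_linear_Blinfun_apply[OF bl])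
  have lin: "complex_linear_op (Blinfun T)"
    unfolding complex_linear_op_def ap
  proof (intro allI coord_ext)
    fix c x i
    have "coord (cscale c x) = coef (\<lambda>z. c * g x z)" using g by (auto simp: fun_eq_iff coef_cmult)
    then have "coord (T (cscale c x)) i = coef (\<lambda>z. c * (U z * g x z)) i"
      using key[of "\<lambda>z. c * g x z" "cscale c x"] g by (simp add: square_integrable_cmult mult_ac)
    then show "coord (T (cscale c x)) i = coord (cscale c (T x)) i"
      using T[of x] by (simp only: coef_cmult coord_cscale)
  qed
  show thesis by (rule that[OF lin]) (simp only: ap key)
qed

end

section \<open>Integration by parts in the plane\<close>

lemma distr_lebesgue_translation:
  fixes c :: "'a::euclidean_space"
  shows "distr lebesgue lebesgue (\<lambda>z. z + c) = lebesgue"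
    and measurable_lebesgue_translation: "(\<lambda>z. z + c) \<in> measurable lebesgue lebesgue"
proof -
  have vim: "(\<lambda>z. z + c) -` A = (\<lambda>z. - c + z) ` A" for A
    by (auto simp: image_iff) (metis add.commute add_diff_cancel_right' uminus_add_conv_diff)
  have s: "(\<lambda>z. z + c) -` A \<in> sets lebesgue" if "A \<in> sets lebesgue" for A
    unfolding vim by (rule lebesgue_sets_translation[OF that])
  show m: "(\<lambda>z. z + c) \<in> measurable lebesgue lebesgue"
    by (rule measurableI) (use s in auto)
  show "distr lebesgue lebesgue (\<lambda>z. z + c) = lebesgue"
  proof (rule measure_eqI)
    fix A :: "'a set" assume "A \<in> sets (distr lebesgue lebesgue (\<lambda>z. z + c))"
    then have A: "A \<in> sets lebesgue" by simp
    have "emeasure (distr lebesgue lebesgue (\<lambda>z. z + c)) A = emeasure lebesgue ((\<lambda>z. z + c) -` A)"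
      using A by (subst emeasure_distr[OF m]) auto
    also have "\<dots> = emeasure lebesgue A"
      unfolding vim using emeasure_lebesgue_affine[of 1 "- c" A] by (simp add: add.commute)
    finally show "emeasure (distr lebesgue lebesgue (\<lambda>z. z + c)) A = emeasure lebesgue A" .
  qed simp
qed

lemma lebesgue_integral_translation:
  fixes f :: "'a::euclidean_space \<Rightarrow> 'b::{banach, second_countable_topology}"
  assumes "f \<in> borel_measurable lebesgue"
  shows "(\<integral>z. f (z + c) \<partial>lebesgue) = (\<integral>z. f z \<partial>lebesgue)"
    and "integrable lebesgue (\<lambda>z. f (z + c)) \<longleftrightarrow> integrable lebesgue f"
    and "(\<lambda>z. f (z + c)) \<in> borel_measurable lebesgue"
  using integral_distr[OF measurable_lebesgue_translation assms, of c]
    integrable_distr_eq[OF measurable_lebesgue_translation assms, of c]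
    measurable_compose[OF measurable_lebesgue_translation assms, of c]
  by (simp_all add: distr_lebesgue_translation)

lemma AE_lebesgue_translation:
  fixes c :: "'a::euclidean_space"
  assumes "AE z in lebesgue. P z"
  shows "AE z in lebesgue. P (z + c)"
proof -
  have "AE z in distr lebesgue lebesgue (\<lambda>z. z + c). P z" by (subst distr_lebesgue_translation(1)) (rule assms)
  then show ?thesis by (rule AE_distrD[OF measurable_lebesgue_translation])
qed

lemma partials_eq:
  assumes "(\<phi> has_derivative D) (at z)"
  shows "partial1 \<phi> z = D 1" "partial2 \<phi> z = D \<i>"
proof -
  interpret D: bounded_linear D by (rule has_derivative_bounded_linear[OF assms])
  have *: "vector_derivative (\<lambda>t. \<phi> (z + d * of_real t)) (at 0) = D d" for d
  proof (rule vector_derivative_at)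
    have "((\<lambda>t. z + d * of_real t) has_derivative (\<lambda>h. d * of_real h)) (at 0)"
      by (auto intro!: derivative_eq_intros)
    from has_derivative_compose[OF this, of \<phi> D] assms
    have "((\<lambda>t. \<phi> (z + d * of_real t)) has_derivative (\<lambda>h. D (d * of_real h))) (at 0)" by simp
    moreover have "D (d * of_real h) = h *\<^sub>R D d" for h
      using D.scaleR[of h d] by (simp add: scaleR_conv_of_real mult.commute)
    ultimately show "((\<lambda>t. \<phi> (z + d * of_real t)) has_vector_derivative D d) (at 0)"
      by (simp add: has_vector_derivative_def)
  qed
  show "partial1 \<phi> z = D 1" using *[of 1] by (simp add: partial1_def)
  show "partial2 \<phi> z = D \<i>" using *[of \<i>] by (simp add: partial2_def)
qed

lemma has_derivative_partials:
  assumes "\<phi> differentiable (at z)"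
  shows "(\<phi> has_derivative (\<lambda>h. of_real (Re h) * partial1 \<phi> z + of_real (Im h) * partial2 \<phi> z)) (at z)"
proof -
  obtain D where D: "(\<phi> has_derivative D) (at z)" using assms by (auto simp: differentiable_def)
  interpret D: bounded_linear D by (rule has_derivative_bounded_linear[OF D])
  have "D h = of_real (Re h) * partial1 \<phi> z + of_real (Im h) * partial2 \<phi> z" for h
  proof -
    have "h = Re h *\<^sub>R 1 + Im h *\<^sub>R \<i>" by (simp add: complex_eq_iff)
    then have "D h = Re h *\<^sub>R D 1 + Im h *\<^sub>R D \<i>" by (metis D.add D.scaleR)
    then show ?thesis by (simp add: partials_eq[OF D] scaleR_conv_of_real)
  qed
  then show ?thesis using D by (metis (no_types, lifting) ext)
qed

text \<open>The function \<open>exp (- 1 / x)\<close>, extended by 0 to the left, and its quotients by powers of \<open>x\<close>. Their linear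
  span is closed under differentiation.\<close>

definition flat_exp :: "nat \<Rightarrow> real \<Rightarrow> real" where
  "flat_exp n x = (if x > 0 then exp (- 1 / x) / x ^ n else 0)"

lemma flat_exp_tendsto_0: "(flat_exp n \<longlongrightarrow> 0) (at 0)"
proof -
  have "((\<lambda>y :: real. y ^ n / exp y) \<longlongrightarrow> 0) at_top" by (rule tendsto_power_div_exp_0)
  then have "((\<lambda>x :: real. (inverse x) ^ n / exp (inverse x)) \<longlongrightarrow> 0) (at_right 0)"
    by (rule filterlim_compose[OF _ filterlim_inverse_at_top_right])
  then have r: "(flat_exp n \<longlongrightarrow> 0) (at_right 0)"
  proof (rule Lim_transform_eventually)
    show "\<forall>\<^sub>F x in at_right 0. (inverse x) ^ n / exp (inverse x) = flat_exp n x"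
      unfolding eventually_at_filter
      by (auto simp: flat_exp_def exp_minus field_simps intro!: always_eventually)
  qed
  have l: "(flat_exp n \<longlongrightarrow> 0) (at_left 0)"
    by (rule tendsto_eventually) (auto simp: eventually_at_filter flat_exp_def intro!: always_eventually)
  show ?thesis by (rule filterlim_split_at[OF l r])
qed

lemma flat_exp_has_real_derivative:
  "(flat_exp n has_real_derivative (flat_exp (n + 2) x - real n * flat_exp (n + 1) x)) (at x)"
proof (cases x "0 :: real" rule: linorder_cases)
  case less
  have "((\<lambda>_. 0) has_real_derivative 0) (at x)" by simp
  then have "(flat_exp n has_real_derivative 0) (at x)"
    by (rule has_field_derivative_transform_within_open[where S = "{..<0}"]) (use less in \<open>auto simp: flat_exp_def\<close>)
  then show ?thesis using less by (simp add: flat_exp_def)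
next
  case greater
  have "((\<lambda>x. exp (- 1 / x) / x ^ n) has_real_derivative
      ((exp (- 1 / x) * (1 / x\<^sup>2)) * x ^ n - exp (- 1 / x) * (real n * x ^ (n - 1))) / (x ^ n * x ^ n)) (at x)"
    using greater by (auto intro!: derivative_eq_intros simp: power2_eq_square)
  also have "((exp (- 1 / x) * (1 / x\<^sup>2)) * x ^ n - exp (- 1 / x) * (real n * x ^ (n - 1))) / (x ^ n * x ^ n)
      = flat_exp (n + 2) x - real n * flat_exp (n + 1) x"
    using greater by (cases n) (auto simp: flat_exp_def field_simps power2_eq_square)
  finally show ?thesis
    by (rule has_field_derivative_transform_within_open[where S = "{0<..}"]) (use greater in \<open>auto simp: flat_exp_def\<close>)
next
  case equal
  have "((\<lambda>h. (flat_exp n (0 + h) - flat_exp n 0) / h) \<longlongrightarrow> 0) (at 0)"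
  proof (rule Lim_transform_eventually[OF flat_exp_tendsto_0[of "Suc n"]])
    show "\<forall>\<^sub>F h in at 0. flat_exp (Suc n) h = (flat_exp n (0 + h) - flat_exp n 0) / h"
      unfolding eventually_at_filter by (auto simp: flat_exp_def field_simps intro!: always_eventually)
  qed
  then show ?thesis using equal by (simp add: DERIV_def flat_exp_def)
qed

text \<open>A class of functions that is closed under partial differentiation for syntactic reasons, so that its
  members are differentiable to any order without an explicit formula for the derivatives. It contains
  the cutoff functions and exponentials that serve as test functions.\<close>

inductive smooth :: "(complex \<Rightarrow> complex) \<Rightarrow> bool" where
  const: "smooth (\<lambda>z. c)"
| flat: "smooth (\<lambda>z. of_real (flat_exp n (Re (cnj a * z) + c)))"
| exponential: "smooth (\<lambda>z. exp (\<alpha> * of_real (Re z) + \<beta> * of_real (Im z)))"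
| add: "smooth f \<Longrightarrow> smooth g \<Longrightarrow> smooth (\<lambda>z. f z + g z)"
| mult: "smooth f \<Longrightarrow> smooth g \<Longrightarrow> smooth (\<lambda>z. f z * g z)"
| inverse: "smooth f \<Longrightarrow> (\<And>z. f z \<noteq> 0) \<Longrightarrow> smooth (\<lambda>z. inverse (f z))"

lemma smooth_has_derivative:
  assumes "smooth f"
  shows "\<exists>f1 f2. smooth f1 \<and> smooth f2 \<and>
    (\<forall>z. (f has_derivative (\<lambda>h. of_real (Re h) * f1 z + of_real (Im h) * f2 z)) (at z))"
  using assms
proof induction
  case (const c)
  show ?case by (intro exI[of _ "\<lambda>_. 0"]) (auto intro: smooth.const)
next
  case (flat n a c)
  let ?d = "\<lambda>z. of_real (flat_exp (n + 2) (Re (cnj a * z) + c)) + (- of_nat n) * of_real (flat_exp (n + 1) (Re (cnj a * z) + c)) :: complex"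
  have "((\<lambda>z. complex_of_real (flat_exp n (Re (cnj a * z) + c))) has_derivative
      (\<lambda>h. of_real (Re h) * (of_real (Re a) * ?d z) + of_real (Im h) * (of_real (Im a) * ?d z))) (at z)" for z
  proof -
    have "((\<lambda>z. Re (cnj a * z) + c) has_derivative (\<lambda>h. Re (cnj a * h))) (at z)"
      by (auto intro!: derivative_eq_intros)
    from has_derivative_compose[OF this flat_exp_has_real_derivative[of n "Re (cnj a * z) + c", unfolded has_field_derivative_def]]
    have "((\<lambda>z. flat_exp n (Re (cnj a * z) + c)) has_derivative
        (\<lambda>h. (flat_exp (n + 2) (Re (cnj a * z) + c) - real n * flat_exp (n + 1) (Re (cnj a * z) + c)) * Re (cnj a * h))) (at z)" .
    from has_derivative_of_real[OF this]
    show ?thesis by (rule has_derivative_eq_rhs) (auto simp: algebra_simps)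
  qed
  moreover have "smooth (\<lambda>z. of_real b * ?d z)" for b
    by (intro smooth.mult smooth.const smooth.add smooth.flat)
  ultimately show ?case by blast
next
  case (exponential \<alpha> \<beta>)
  let ?E = "\<lambda>z. exp (\<alpha> * of_real (Re z) + \<beta> * of_real (Im z))"
  have "(?E has_derivative (\<lambda>h. of_real (Re h) * (\<alpha> * ?E z) + of_real (Im h) * (\<beta> * ?E z))) (at z)" for z
  proof -
    have "((\<lambda>z. \<alpha> * of_real (Re z) + \<beta> * of_real (Im z)) has_derivative (\<lambda>h. \<alpha> * of_real (Re h) + \<beta> * of_real (Im h))) (at z)"
      by (auto intro!: derivative_eq_intros)
    from has_derivative_compose[OF this DERIV_exp[unfolded has_field_derivative_def]]
    show ?thesis by (rule has_derivative_eq_rhs) (auto simp: algebra_simps)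
  qed
  moreover have "smooth (\<lambda>z. b * ?E z)" for b by (intro smooth.mult smooth.const smooth.exponential)
  ultimately show ?case by blast
next
  case (add f g)
  then obtain f1 f2 g1 g2 where *: "smooth f1" "smooth f2" "smooth g1" "smooth g2"
    and f: "\<And>z. (f has_derivative (\<lambda>h. of_real (Re h) * f1 z + of_real (Im h) * f2 z)) (at z)"
    and g: "\<And>z. (g has_derivative (\<lambda>h. of_real (Re h) * g1 z + of_real (Im h) * g2 z)) (at z)" by blast
  have "((\<lambda>z. f z + g z) has_derivative (\<lambda>h. of_real (Re h) * (f1 z + g1 z) + of_real (Im h) * (f2 z + g2 z))) (at z)" for z
    by (rule has_derivative_eq_rhs[OF has_derivative_add[OF f g]]) (auto simp: algebra_simps)
  moreover have "smooth (\<lambda>z. f1 z + g1 z)" "smooth (\<lambda>z. f2 z + g2 z)" by (intro smooth.add *)+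
  ultimately show ?case by blast
next
  case (mult f g)
  then obtain f1 f2 g1 g2 where *: "smooth f1" "smooth f2" "smooth g1" "smooth g2"
    and f: "\<And>z. (f has_derivative (\<lambda>h. of_real (Re h) * f1 z + of_real (Im h) * f2 z)) (at z)"
    and g: "\<And>z. (g has_derivative (\<lambda>h. of_real (Re h) * g1 z + of_real (Im h) * g2 z)) (at z)" by blast
  have "((\<lambda>z. f z * g z) has_derivative (\<lambda>h. of_real (Re h) * (f z * g1 z + f1 z * g z) + of_real (Im h) * (f z * g2 z + f2 z * g z))) (at z)" for z
    by (rule has_derivative_eq_rhs[OF has_derivative_mult[OF f g]]) (auto simp: algebra_simps)
  moreover have "smooth (\<lambda>z. f z * g1 z + f1 z * g z)" "smooth (\<lambda>z. f z * g2 z + f2 z * g z)"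
    by (intro smooth.add smooth.mult * mult.hyps)+
  ultimately show ?case by blast
next
  case (inverse f)
  then obtain f1 f2 where *: "smooth f1" "smooth f2"
    and f: "\<And>z. (f has_derivative (\<lambda>h. of_real (Re h) * f1 z + of_real (Im h) * f2 z)) (at z)" by blast
  have "((\<lambda>z. inverse (f z)) has_derivative
      (\<lambda>h. of_real (Re h) * (- 1 * (inverse (f z) * f1 z * inverse (f z))) + of_real (Im h) * (- 1 * (inverse (f z) * f2 z * inverse (f z))))) (at z)" for z
    by (rule has_derivative_eq_rhs[OF Deriv.has_derivative_inverse[OF inverse.hyps(2) f]]) (auto simp: algebra_simps)
  moreover have "smooth (\<lambda>z. - 1 * (inverse (f z) * f1 z * inverse (f z)))" "smooth (\<lambda>z. - 1 * (inverse (f z) * f2 z * inverse (f z)))"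
    by (intro smooth.mult smooth.const smooth.inverse * inverse.hyps)+
  ultimately show ?case by blast
qed

lemma smooth_imp_Ck: "smooth f \<Longrightarrow> Ck k f"
proof (induction k arbitrary: f)
  case 0
  from smooth_has_derivative[OF 0] have "\<forall>z. \<exists>D. (f has_derivative D) (at z)" by blast
  then show ?case by (auto simp: continuous_on_eq_continuous_within intro: has_derivative_continuous)
next
  case (Suc k)
  from smooth_has_derivative[OF Suc.prems] obtain f1 f2 where *: "smooth f1" "smooth f2"
    and f: "\<And>z. (f has_derivative (\<lambda>h. of_real (Re h) * f1 z + of_real (Im h) * f2 z)) (at z)" by blast
  have "partial1 f = f1" "partial2 f = f2" using partials_eq[OF f] by (auto simp: fun_eq_iff)
  moreover have "f differentiable (at z)" for z using f[of z] by (auto simp: differentiable_def)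
  ultimately show ?case using Suc.IH * by simp
qed

lemma continuous_lebesgue_measurable:
  "continuous_on UNIV f \<Longrightarrow> (f :: complex \<Rightarrow> complex) \<in> borel_measurable lebesgue"
  by (simp add: borel_measurable_continuous_onI measurable_completion)

text \<open>The difference quotients in the direction \<open>d\<close> have integral 0 by translation invariance, and they
  converge dominatedly to the derivative.\<close>

lemma integral_directional_derivative_eq_0:
  fixes \<psi> :: "complex \<Rightarrow> complex"
  assumes der: "\<And>z. (\<psi> has_derivative \<psi>' z) (at z)" and cont: "continuous_on UNIV (\<lambda>z. \<psi>' z d)"
    and supp: "\<And>z. cmod z \<ge> R \<Longrightarrow> \<psi> z = 0"
  shows "(\<integral>z. \<psi>' z d \<partial>lebesgue) = 0"
proof -
  have psi_cont: "continuous_on UNIV \<psi>" using has_derivative_continuous[OF der] by (simp add: continuous_on_eq_continuous_within)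
  have supp': "\<psi>' z d = 0" if z: "cmod z > R" for z
  proof -
    have "((\<lambda>_. 0) has_derivative (\<lambda>_. 0)) (at z)" by simp
    then have "(\<psi> has_derivative (\<lambda>_. 0)) (at z)"
    proof (rule has_derivative_transform_within_open[where s = "{z. R < cmod z}"])
      show "open {z. R < cmod z}" by (intro open_Collect_less continuous_intros)
    qed (use z supp in auto)
    then have "\<psi>' z = (\<lambda>_. 0)" using has_derivative_unique der by blast
    then show ?thesis by simp
  qed
  have "compact ((\<lambda>z. \<psi>' z d) ` cball 0 R)"
    by (intro compact_continuous_image compact_cball continuous_on_subset[OF cont]) auto
  then obtain K where K: "\<And>z. z \<in> cball 0 R \<Longrightarrow> cmod (\<psi>' z d) \<le> K"
    using compact_imp_bounded bounded_iff by (metis imageI)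
  define B where "B = max K 0"
  have B: "cmod (\<psi>' z d) \<le> B" "B \<ge> 0" for z
    using K[of z] supp'[of z] by (auto simp: B_def) (smt (verit) norm_zero)
  define D where "D n z = (\<psi> (z + d / of_nat (Suc n)) - \<psi> z) * of_nat (Suc n)" for n :: nat and z
  have Dlim: "(\<lambda>n. D n z) \<longlonglongrightarrow> \<psi>' z d" for z
  proof -
    interpret p: bounded_linear "\<psi>' z" by (rule has_derivative_bounded_linear[OF der])
    have "((\<lambda>t. z + d * of_real t) has_derivative (\<lambda>h. d * of_real h)) (at 0)"
      by (auto intro!: derivative_eq_intros)
    from has_derivative_compose[OF this, of \<psi> "\<psi>' z"] der[of z]
    have "((\<lambda>t. \<psi> (z + d * of_real t)) has_derivative (\<lambda>h. \<psi>' z (d * of_real h))) (at 0)" by simp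
    moreover have "\<psi>' z (d * of_real h) = h *\<^sub>R \<psi>' z d" for h
      using p.scaleR[of h d] by (simp add: scaleR_conv_of_real mult.commute)
    ultimately have "((\<lambda>t. \<psi> (z + d * of_real t)) has_derivative (\<lambda>h. h *\<^sub>R \<psi>' z d)) (at 0)"
      by simp
    then have "((\<lambda>h. norm (\<psi> (z + d * of_real h) - \<psi> z - h *\<^sub>R \<psi>' z d) / norm h) \<longlongrightarrow> 0) (at 0)"
      by (simp add: has_derivative_at)
    then have "((\<lambda>t. norm ((\<psi> (z + d * of_real t) - \<psi> z) /\<^sub>R t - \<psi>' z d)) \<longlongrightarrow> 0) (at 0)"
    proof (rule Lim_transform_eventually)
      show "\<forall>\<^sub>F h in at 0. norm (\<psi> (z + d * of_real h) - \<psi> z - h *\<^sub>R \<psi>' z d) / norm h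
          = norm ((\<psi> (z + d * of_real h) - \<psi> z) /\<^sub>R h - \<psi>' z d)"
        unfolding eventually_at_filter
      proof (intro always_eventually allI impI)
        fix h :: real assume h: "h \<noteq> 0"
        have "(\<psi> (z + d * of_real h) - \<psi> z) /\<^sub>R h - \<psi>' z d = (\<psi> (z + d * of_real h) - \<psi> z - h *\<^sub>R \<psi>' z d) /\<^sub>R h"
          using h by (simp add: scaleR_diff_right)
        then show "norm (\<psi> (z + d * of_real h) - \<psi> z - h *\<^sub>R \<psi>' z d) / norm h
          = norm ((\<psi> (z + d * of_real h) - \<psi> z) /\<^sub>R h - \<psi>' z d)"
          by (simp add: divide_inverse mult.commute)
      qed
    qed
    then have "((\<lambda>t. (\<psi> (z + d * of_real t) - \<psi> z) /\<^sub>R t) \<longlongrightarrow> \<psi>' z d) (at 0)"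
      by (rule LIM_zero_cancel[OF tendsto_norm_zero_cancel])
    moreover have "filterlim (\<lambda>n. 1 / real (Suc n)) (at 0) sequentially"
    proof -
      have "(\<lambda>n. 1 / real n) \<longlonglongrightarrow> 0" by (rule lim_1_over_n)
      from LIMSEQ_Suc[OF this] show ?thesis by (simp add: filterlim_at)
    qed
    ultimately have "(\<lambda>n. (\<psi> (z + d * of_real (1 / real (Suc n))) - \<psi> z) /\<^sub>R (1 / real (Suc n))) \<longlonglongrightarrow> \<psi>' z d"
      by (rule filterlim_compose)
    then show ?thesis by (simp add: D_def scaleR_conv_of_real mult.commute)
  qed
  have Db: "cmod (D n z) \<le> B" for n z
  proof -
    have "norm (\<psi> (z + d * of_real (1 / real (Suc n))) - \<psi> (z + d * of_real 0)) \<le> B * norm (1 / real (Suc n) - 0)"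
    proof (rule differentiable_bound[where S = UNIV and f = "\<lambda>t. \<psi> (z + d * of_real t)" and f' = "\<lambda>t h. h *\<^sub>R \<psi>' (z + d * of_real t) d"])
      fix t :: real
      interpret p: bounded_linear "\<psi>' (z + d * of_real t)" by (rule has_derivative_bounded_linear[OF der])
      have "((\<lambda>t. z + d * of_real t) has_derivative (\<lambda>h. d * of_real h)) (at t)"
        by (auto intro!: derivative_eq_intros)
      from has_derivative_compose[OF this der]
      have "((\<lambda>t. \<psi> (z + d * of_real t)) has_derivative (\<lambda>h. \<psi>' (z + d * of_real t) (d * of_real h))) (at t)" .
      moreover have "\<psi>' (z + d * of_real t) (d * of_real h) = h *\<^sub>R \<psi>' (z + d * of_real t) d" for h
        using p.scaleR[of h d] by (simp add: scaleR_conv_of_real mult.commute)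
      ultimately show "((\<lambda>t. \<psi> (z + d * of_real t)) has_derivative (\<lambda>h. h *\<^sub>R \<psi>' (z + d * of_real t) d)) (at t within UNIV)"
        by simp
      show "onorm (\<lambda>h. h *\<^sub>R \<psi>' (z + d * of_real t) d) \<le> B"
      proof (rule onorm_le)
        fix h :: real
        have "\<bar>h\<bar> * cmod (\<psi>' (z + d * of_real t) d) \<le> \<bar>h\<bar> * B" by (rule mult_left_mono[OF B(1)]) simp
        then show "norm (h *\<^sub>R \<psi>' (z + d * of_real t) d) \<le> B * norm h" by (simp add: mult.commute)
      qed
    qed auto
    then have "cmod (\<psi> (z + d / of_nat (Suc n)) - \<psi> z) \<le> B * (1 / real (Suc n))" by simp
    from mult_right_mono[OF this, of "real (Suc n)"] show ?thesis
      by (simp add: D_def norm_mult del: of_nat_Suc)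
  qed
  have Ds: "D n z = 0" if z: "z \<notin> cball 0 (\<bar>R\<bar> + cmod d)" for n z
  proof -
    have "cmod d * 1 \<le> cmod d * real (Suc n)" by (intro mult_left_mono) auto
    then have "cmod (d / of_nat (Suc n)) \<le> cmod d" by (simp add: norm_divide divide_le_eq del: of_nat_Suc)
    then have "cmod (z + d / of_nat (Suc n)) \<ge> R" "cmod z \<ge> R"
      using z norm_diff_ineq[of z "d / of_nat (Suc n)"] norm_ge_zero[of d] abs_ge_self[of R]
      unfolding mem_cball_0 by linarith+
    then show ?thesis by (simp add: D_def supp)
  qed
  have Dm: "D n \<in> borel_measurable lebesgue" for n
    unfolding D_def by (intro continuous_lebesgue_measurable continuous_intros continuous_on_compose2[OF psi_cont]; simp)
  have psi_int: "integrable lebesgue \<psi>"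
  proof -
    have "integrable lborel (\<lambda>z. indicator (cball 0 \<bar>R\<bar>) z *\<^sub>R \<psi> z)"
      by (rule borel_integrable_compact[OF compact_cball continuous_on_subset[OF psi_cont]]) simp
    also have "(\<lambda>z. indicator (cball 0 \<bar>R\<bar>) z *\<^sub>R \<psi> z) = \<psi>"
      using supp by (auto simp: fun_eq_iff indicator_def)
    finally show ?thesis by (simp add: integrable_completion)
  qed
  have D0: "(\<integral>z. D n z \<partial>lebesgue) = 0" for n
  proof -
    have m: "\<psi> \<in> borel_measurable lebesgue" using psi_int by simp
    have "(\<integral>z. D n z \<partial>lebesgue) = ((\<integral>z. \<psi> (z + d / of_nat (Suc n)) \<partial>lebesgue) - (\<integral>z. \<psi> z \<partial>lebesgue)) * of_nat (Suc n)"
      unfolding D_def using psi_int lebesgue_integral_translation(2)[OF m] by (simp del: of_nat_Suc)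
    then show ?thesis unfolding lebesgue_integral_translation(1)[OF m] by simp
  qed
  have "(\<lambda>n. \<integral>z. D n z \<partial>lebesgue) \<longlonglongrightarrow> (\<integral>z. \<psi>' z d \<partial>lebesgue)"
  proof (rule integral_dominated_convergence[where w = "\<lambda>z. indicator (cball 0 (\<bar>R\<bar> + cmod d)) z *\<^sub>R B"])
    show "integrable lebesgue (\<lambda>z. indicator (cball 0 (\<bar>R\<bar> + cmod d)) z *\<^sub>R B)"
      using borel_integrable_compact[OF compact_cball continuous_on_const] integrable_completion by blast
    show "(\<lambda>z. \<psi>' z d) \<in> borel_measurable lebesgue"
      by (rule continuous_lebesgue_measurable[OF cont])
    show "AE z in lebesgue. norm (D n z) \<le> indicator (cball 0 (\<bar>R\<bar> + cmod d)) z *\<^sub>R B" for n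
      using Db[of n] Ds[of _ n] by (intro AE_I2) (auto simp: indicator_def)
  qed (use Dlim Dm in auto)
  then have "(\<lambda>n. 0) \<longlonglongrightarrow> (\<integral>z. \<psi>' z d \<partial>lebesgue)" by (simp only: D0)
  then show ?thesis using LIMSEQ_unique tendsto_const by blast
qed

text \<open>The quasimomenta may be complex, so a wave need not be bounded.\<close>

definition wave :: "complex \<Rightarrow> complex \<Rightarrow> complex \<Rightarrow> complex" where
  "wave p q z = exp (2 * pi * \<i> * (p * of_real (Re z) + q * of_real (Im z)))"

text \<open>Integration by parts: \<open>wave p q z * \<phi> z\<close> has compact support, so its partial derivatives have
  integral 0, and the wave is an eigenfunction of both partial derivatives.\<close>

lemma integral_wave_del:
  assumes \<phi>: "\<And>z. \<phi> differentiable (at z)" "continuous_on UNIV (partial1 \<phi>)" "continuous_on UNIV (partial2 \<phi>)"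
    and supp: "\<And>z. cmod z \<ge> R \<Longrightarrow> \<phi> z = 0"
  shows "(\<integral>z. wave p q z * del \<phi> z \<partial>lebesgue) = - (pi * \<i> * (p - \<i> * q)) * (\<integral>z. wave p q z * \<phi> z \<partial>lebesgue)"
    and "(\<integral>z. wave p q z * delbar \<phi> z \<partial>lebesgue) = - (pi * \<i> * (p + \<i> * q)) * (\<integral>z. wave p q z * \<phi> z \<partial>lebesgue)"
proof -
  let ?D = "\<lambda>z h. wave p q z * (of_real (Re h) * partial1 \<phi> z + of_real (Im h) * partial2 \<phi> z)
       + (of_real (Re h) * (2 * pi * \<i> * p * wave p q z) + of_real (Im h) * (2 * pi * \<i> * q * wave p q z)) * \<phi> z"
  have w: "(wave p q has_derivative (\<lambda>h. of_real (Re h) * (2 * pi * \<i> * p * wave p q z) + of_real (Im h) * (2 * pi * \<i> * q * wave p q z))) (at z)" for z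
  proof -
    have "((\<lambda>z. 2 * pi * \<i> * (p * of_real (Re z) + q * of_real (Im z))) has_derivative (\<lambda>h. 2 * pi * \<i> * (p * of_real (Re h) + q * of_real (Im h)))) (at z)"
      by (auto intro!: derivative_eq_intros)
    from has_derivative_compose[OF this DERIV_exp[unfolded has_field_derivative_def]]
    show ?thesis unfolding wave_def[abs_def] by (rule has_derivative_eq_rhs) (auto simp: algebra_simps)
  qed
  have wc: "continuous_on UNIV (wave p q)" unfolding wave_def[abs_def] by (intro continuous_intros)
  have der: "((\<lambda>z. wave p q z * \<phi> z) has_derivative ?D z) (at z)" for z
    by (rule has_derivative_mult[OF w has_derivative_partials[OF \<phi>(1)]])
  have \<phi>c: "continuous_on UNIV \<phi>"
    using \<phi>(1) differentiable_imp_continuous_within by (auto simp: continuous_on_eq_continuous_within)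
  have cont: "continuous_on UNIV (\<lambda>z. ?D z d)" for d
    by (intro continuous_intros wc \<phi> \<phi>c)
  have z: "(\<integral>z. ?D z d \<partial>lebesgue) = 0" for d
  proof (rule integral_directional_derivative_eq_0[where \<psi> = "\<lambda>z. wave p q z * \<phi> z" and \<psi>' = ?D and R = R])
    show "wave p q z * \<phi> z = 0" if "cmod z \<ge> R" for z using supp[OF that] by simp
  qed (rule der, rule cont)
  have pint: "integrable lebesgue f" if c: "continuous_on UNIV f" and s: "\<And>z. cmod z > R \<Longrightarrow> f z = 0" for f :: "complex \<Rightarrow> complex"
  proof -
    have "integrable lborel (\<lambda>z. indicator (cball 0 R) z *\<^sub>R f z)"
      by (rule borel_integrable_compact[OF compact_cball continuous_on_subset[OF c]]) simp
    also have "(\<lambda>z. indicator (cball 0 R) z *\<^sub>R f z) = f"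
      using s by (auto simp: fun_eq_iff indicator_def)
    finally show ?thesis by (simp add: integrable_completion)
  qed
  have \<phi>0: "partial1 \<phi> z = 0 \<and> partial2 \<phi> z = 0" if z: "cmod z > R" for z
  proof -
    have "((\<lambda>_. 0) has_derivative (\<lambda>_. 0)) (at z)" by simp
    then have "(\<phi> has_derivative (\<lambda>_. 0)) (at z)"
    proof (rule has_derivative_transform_within_open[where s = "{z. R < cmod z}"])
      show "open {z. R < cmod z}" by (intro open_Collect_less continuous_intros)
    qed (use z supp in auto)
    from partials_eq[OF this] show ?thesis by simp
  qed
  let ?I = "\<integral>z. wave p q z * \<phi> z \<partial>lebesgue"
  let ?I1 = "\<integral>z. wave p q z * partial1 \<phi> z \<partial>lebesgue"
  let ?I2 = "\<integral>z. wave p q z * partial2 \<phi> z \<partial>lebesgue"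
  have i: "integrable lebesgue (\<lambda>z. wave p q z * \<phi> z)" "integrable lebesgue (\<lambda>z. wave p q z * partial1 \<phi> z)"
    "integrable lebesgue (\<lambda>z. wave p q z * partial2 \<phi> z)"
    by (rule pint; (intro continuous_on_mult wc \<phi> \<phi>c)?; (simp add: supp \<phi>0)?)+
  have 1: "?I1 = - (2 * pi * \<i> * p) * ?I"
  proof -
    have "0 = (\<integral>z. wave p q z * partial1 \<phi> z + 2 * pi * \<i> * p * (wave p q z * \<phi> z) \<partial>lebesgue)"
      using z[of 1] by (simp add: mult.assoc)
    also have "\<dots> = ?I1 + 2 * pi * \<i> * p * ?I"
      by (subst Bochner_Integration.integral_add) (use i in auto)
    finally show ?thesis by (simp add: eq_neg_iff_add_eq_0)
  qed
  have 2: "?I2 = - (2 * pi * \<i> * q) * ?I"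
  proof -
    have "0 = (\<integral>z. wave p q z * partial2 \<phi> z + 2 * pi * \<i> * q * (wave p q z * \<phi> z) \<partial>lebesgue)"
      using z[of \<i>] by (simp add: mult.assoc)
    also have "\<dots> = ?I2 + 2 * pi * \<i> * q * ?I"
      by (subst Bochner_Integration.integral_add) (use i in auto)
    finally show ?thesis by (simp add: eq_neg_iff_add_eq_0)
  qed
  have "(\<integral>z. wave p q z * del \<phi> z \<partial>lebesgue) = (\<integral>z. (wave p q z * partial1 \<phi> z - \<i> * (wave p q z * partial2 \<phi> z)) * (1 / 2) \<partial>lebesgue)"
    by (rule Bochner_Integration.integral_cong) (auto simp: del_def field_simps)
  also have "\<dots> = (?I1 - \<i> * ?I2) * (1 / 2)"
    using i by simp
  finally have "(\<integral>z. wave p q z * del \<phi> z \<partial>lebesgue) = (?I1 - \<i> * ?I2) * (1 / 2)" .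
  also have "\<dots> = - (pi * \<i> * (p - \<i> * q)) * ?I"
    unfolding 1 2 by (simp add: algebra_simps)
  finally show "(\<integral>z. wave p q z * del \<phi> z \<partial>lebesgue) = - (pi * \<i> * (p - \<i> * q)) * ?I" .
  have "(\<integral>z. wave p q z * delbar \<phi> z \<partial>lebesgue) = (\<integral>z. (wave p q z * partial1 \<phi> z + \<i> * (wave p q z * partial2 \<phi> z)) * (1 / 2) \<partial>lebesgue)"
    by (rule Bochner_Integration.integral_cong) (auto simp: delbar_def field_simps)
  also have "\<dots> = (?I1 + \<i> * ?I2) * (1 / 2)"
    using i by simp
  finally have "(\<integral>z. wave p q z * delbar \<phi> z \<partial>lebesgue) = (?I1 + \<i> * ?I2) * (1 / 2)" .
  also have "\<dots> = - (pi * \<i> * (p + \<i> * q)) * ?I"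
    unfolding 1 2 by (simp add: algebra_simps)
  finally show "(\<integral>z. wave p q z * delbar \<phi> z \<partial>lebesgue) = - (pi * \<i> * (p + \<i> * q)) * ?I" .
qed

section \<open>Lattice cells and cutoff functions\<close>

definition smooth_step :: "real \<Rightarrow> real" where
  "smooth_step x = flat_exp 0 x / (flat_exp 0 x + flat_exp 0 (1 - x))"

lemma flat_exp_0: "flat_exp 0 x \<ge> 0" "flat_exp 0 x > 0 \<longleftrightarrow> x > 0" "flat_exp 0 x = 0 \<longleftrightarrow> x \<le> 0"
  by (auto simp: flat_exp_def)

lemma smooth_step_denominator: "flat_exp 0 x + flat_exp 0 (1 - x) > 0"
  using flat_exp_0[of x] flat_exp_0[of "1 - x"] by (cases "x > 0") (auto intro: add_pos_nonneg add_nonneg_pos)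

lemma smooth_step_0: "x \<le> 0 \<Longrightarrow> smooth_step x = 0"
  and smooth_step_1: "x \<ge> 1 \<Longrightarrow> smooth_step x = 1"
  using flat_exp_0[of x] flat_exp_0[of "1 - x"] by (auto simp: smooth_step_def)

lemma smooth_smooth_step: "smooth (\<lambda>z. of_real (smooth_step (Re (cnj a * z) + c)))"
proof -
  have eq: "1 - (Re (cnj a * z) + c) = Re (cnj (- a) * z) + (1 - c)" for z by simp
  let ?d = "\<lambda>z. complex_of_real (flat_exp 0 (Re (cnj a * z) + c)) + of_real (flat_exp 0 (Re (cnj (- a) * z) + (1 - c)))"
  have nz: "?d z \<noteq> 0" for z
  proof -
    have "?d z = of_real (flat_exp 0 (Re (cnj a * z) + c) + flat_exp 0 (1 - (Re (cnj a * z) + c)))"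
      by (simp only: eq of_real_add)
    then show ?thesis using smooth_step_denominator[of "Re (cnj a * z) + c"] by (simp only: of_real_eq_0_iff)
  qed
  have "smooth (\<lambda>z. complex_of_real (flat_exp 0 (Re (cnj a * z) + c)) * inverse (?d z))"
    by (intro smooth.mult smooth.inverse smooth.add smooth.flat nz)
  moreover have "complex_of_real (smooth_step (Re (cnj a * z) + c)) = complex_of_real (flat_exp 0 (Re (cnj a * z) + c)) * inverse (?d z)" for z
    unfolding smooth_step_def eq by (simp only: of_real_divide of_real_add of_real_mult of_real_inverse divide_inverse)
  ultimately show ?thesis by (simp only:)
qed

lemma smooth_diff: "smooth f \<Longrightarrow> smooth g \<Longrightarrow> smooth (\<lambda>z. f z - g z)"
  using smooth.add[of f "\<lambda>z. - 1 * g z"] smooth.mult[OF smooth.const[of "- 1"], of g] by simp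

lemma test_functionD:
  assumes "test_function \<phi>"
  obtains R where "\<And>z. \<phi> differentiable (at z)" "continuous_on UNIV \<phi>" "continuous_on UNIV (partial1 \<phi>)" "continuous_on UNIV (partial2 \<phi>)"
    "\<And>z. cmod z \<ge> R \<Longrightarrow> \<phi> z = 0"
proof -
  have C: "Ck k \<phi>" for k using assms by (simp add: test_function_def)
  have cont: "continuous_on UNIV f" if "Ck 0 f" for f using that by simp
  have d: "\<And>z. \<phi> differentiable (at z)" "Ck 0 (partial1 \<phi>)" "Ck 0 (partial2 \<phi>)" using C[of "Suc 0"] by simp_all
  have "bounded (closure {z. \<phi> z \<noteq> 0})" using assms by (simp add: test_function_def compact_imp_bounded)
  then obtain B where B: "\<And>z. z \<in> closure {z. \<phi> z \<noteq> 0} \<Longrightarrow> norm z \<le> B" by (auto simp: bounded_iff)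
  have s: "\<phi> z = 0" if "cmod z \<ge> B + 1" for z
  proof (rule ccontr)
    assume "\<phi> z \<noteq> 0"
    then have "z \<in> {z. \<phi> z \<noteq> 0}" by simp
    then have "z \<in> closure {z. \<phi> z \<noteq> 0}" by (rule subsetD[OF closure_subset])
    then show False using B[of z] that by simp
  qed
  show thesis by (rule that[OF d(1) cont[OF C[of 0]] cont[OF d(2)] cont[OF d(3)] s])
qed

text \<open>A basis \<open>\<omega>1\<close>, \<open>\<omega>2\<close> of the lattice together with the dual basis \<open>\<sigma>\<close>, \<open>\<tau>\<close> with respect to the real inner product
  \<open>Re (cnj a * z)\<close>. The dual basis provides the coordinates \<open>s\<close>, \<open>t\<close> and the frequencies.\<close>

locale lattice_frame =
  fixes \<omega>1 \<omega>2 \<sigma> \<tau> :: complex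
  assumes dual: "Re (cnj \<sigma> * \<omega>1) = 1" "Re (cnj \<sigma> * \<omega>2) = 0" "Re (cnj \<tau> * \<omega>1) = 0" "Re (cnj \<tau> * \<omega>2) = 1"
    and expand: "\<And>z. z = of_real (Re (cnj \<sigma> * z)) * \<omega>1 + of_real (Re (cnj \<tau> * z)) * \<omega>2"
begin

definition s :: "complex \<Rightarrow> real" where "s z = Re (cnj \<sigma> * z)"
definition t :: "complex \<Rightarrow> real" where "t z = Re (cnj \<tau> * z)"

definition shift :: "int \<times> int \<Rightarrow> complex" where
  "shift p = of_int (fst p) * \<omega>1 + of_int (snd p) * \<omega>2"

definition freq :: "int \<times> int \<Rightarrow> complex" where
  "freq p = of_int (fst p) * \<sigma> + of_int (snd p) * \<tau>"

definition cell :: "complex set" where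
  "cell = {z. 0 \<le> s z \<and> s z < 1 \<and> 0 \<le> t z \<and> t z < 1}"

lemma s_add: "s (x + y) = s x + s y" and t_add: "t (x + y) = t x + t y"
  by (simp_all add: s_def t_def algebra_simps)

lemma s_shift [simp]: "s (shift p) = of_int (fst p)" and t_shift [simp]: "t (shift p) = of_int (snd p)"
proof -
  have lin: "Re (cnj a * (of_int m * x + of_int n * y)) = of_int m * Re (cnj a * x) + of_int n * Re (cnj a * y)" for a m x n y
    by (simp add: algebra_simps)
  show "s (shift p) = of_int (fst p)" "t (shift p) = of_int (snd p)"
    unfolding s_def t_def shift_def lin dual by simp_all
qed

lemma z_eq: "z = of_real (s z) * \<omega>1 + of_real (t z) * \<omega>2"
  unfolding s_def t_def by (rule expand)

lemma Re_freq: "Re (cnj (freq p) * z) = of_int (fst p) * s z + of_int (snd p) * t z"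
  by (simp add: freq_def s_def t_def algebra_simps)

lemma s_cont: "continuous_on A s" and t_cont: "continuous_on A t"
  unfolding s_def[abs_def] t_def[abs_def] by (intro continuous_intros)+

lemma s_meas [measurable]: "s \<in> borel_measurable borel" and t_meas [measurable]: "t \<in> borel_measurable borel"
  by (intro borel_measurable_continuous_onI s_cont t_cont)+

lemma cell_borel: "cell \<in> sets borel"
proof -
  have "cell = {z \<in> space borel. 0 \<le> s z \<and> s z < 1 \<and> 0 \<le> t z \<and> t z < 1}" by (simp add: cell_def)
  also have "\<dots> \<in> sets borel" by measurable
  finally show ?thesis .
qed

lemma cell_lebesgue [measurable]: "cell \<in> sets lebesgue"
  using cell_borel by simp

lemma cmod_le_coordinates: "cmod z \<le> \<bar>s z\<bar> * cmod \<omega>1 + \<bar>t z\<bar> * cmod \<omega>2"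
  by (subst z_eq) (rule norm_triangle_le, simp add: norm_mult)

lemma cell_bound: "z \<in> cell \<Longrightarrow> cmod z \<le> cmod \<omega>1 + cmod \<omega>2"
  using cmod_le_coordinates[of z] mult_right_mono[of "\<bar>s z\<bar>" 1 "cmod \<omega>1"] mult_right_mono[of "\<bar>t z\<bar>" 1 "cmod \<omega>2"]
  by (auto simp: cell_def)

lemma cell_bounded: "bounded cell"
  unfolding bounded_iff using cell_bound by blast

lemma cell_lmeasurable: "cell \<in> lmeasurable"
  by (rule bounded_set_imp_lmeasurable[OF cell_bounded cell_lebesgue])

definition area :: real where "area = measure lebesgue cell"

lemma area_pos: "area > 0"
proof -
  let ?O = "{z. 0 < s z \<and> s z < 1 \<and> 0 < t z \<and> t z < 1}"
  have o: "open ?O" by (intro open_Collect_conj open_Collect_less s_cont t_cont continuous_intros)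
  have st: "s (of_real x * \<omega>1 + of_real y * \<omega>2) = x" "t (of_real x * \<omega>1 + of_real y * \<omega>2) = y" for x y
  proof -
    have lin: "Re (cnj a * (of_real x * u + of_real y * v)) = x * Re (cnj a * u) + y * Re (cnj a * v)" for a u v
      by (simp add: algebra_simps)
    show "s (of_real x * \<omega>1 + of_real y * \<omega>2) = x" "t (of_real x * \<omega>1 + of_real y * \<omega>2) = y"
      unfolding s_def t_def lin dual by simp_all
  qed
  have ne: "?O \<noteq> {}" using st[of "1/2" "1/2"] by (auto intro!: exI[of _ "of_real (1/2) * \<omega>1 + of_real (1/2) * \<omega>2"])
  have sub: "?O \<subseteq> cell" by (auto simp: cell_def)
  have "\<not> negligible cell"
    using open_not_negligible[OF o ne] negligible_subset[OF _ sub] by blast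
  then have "measure lebesgue cell \<noteq> 0" using negligible_iff_measure cell_lmeasurable by blast
  then show ?thesis unfolding area_def using measure_nonneg[of lebesgue cell] by linarith
qed

text \<open>A difference of two shifted smooth steps: it vanishes outside of the interval from -1 to 1, and its
  integer translates telescope to 1.\<close>

definition cutoff_profile :: "real \<Rightarrow> real" where
  "cutoff_profile x = smooth_step (x + 1) - smooth_step x"

definition cutoff :: "complex \<Rightarrow> complex" where
  "cutoff z = of_real (cutoff_profile (s z)) * of_real (cutoff_profile (t z))"

text \<open>Where both coordinates lie between -1 and 2, which is a neighbourhood of the cell, the translates of
  \<open>cutoff\<close> by lattice vectors with index outside of this set vanish.\<close>

definition window :: "(int \<times> int) set" where
  "window = {-2..1} \<times> {-2..1}"

lemma finite_window: "finite window" by (simp add: window_def)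

lemma cutoff_profile_support: "\<bar>x\<bar> \<ge> 1 \<Longrightarrow> cutoff_profile x = 0"
  unfolding cutoff_profile_def by (cases "x \<ge> 0") (simp_all add: smooth_step_0 smooth_step_1)

lemma cutoff_profile_sum: "x \<in> {-1..2} \<Longrightarrow> (\<Sum>j\<in>{-2..1::int}. cutoff_profile (x + of_int j)) = 1"
proof -
  assume x: "x \<in> {-1..2}"
  have i: "{-2..1::int} = {-2, -1, 0, 1}" by auto
  have "(\<Sum>j\<in>{-2..1::int}. cutoff_profile (x + of_int j)) = smooth_step (x + 2) - smooth_step (x - 2)"
    unfolding i by (simp add: cutoff_profile_def algebra_simps)
  then show ?thesis using x by (simp add: smooth_step_0 smooth_step_1)
qed

lemma smooth_cutoff: "smooth cutoff"
proof -
  have "smooth (\<lambda>z. of_real (cutoff_profile (Re (cnj a * z))))" for a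
    using smooth_diff[OF smooth_smooth_step[of a 1] smooth_smooth_step[of a 0]]
    by (simp add: cutoff_profile_def)
  from smooth.mult[OF this[of \<sigma>] this[of \<tau>]] show ?thesis by (simp add: cutoff_def[abs_def] s_def t_def)
qed

lemma cutoff_support: "cutoff z \<noteq> 0 \<Longrightarrow> \<bar>s z\<bar> < 1 \<and> \<bar>t z\<bar> < 1"
proof -
  assume "cutoff z \<noteq> 0"
  then have "cutoff_profile (s z) \<noteq> 0" "cutoff_profile (t z) \<noteq> 0" by (auto simp: cutoff_def)
  then have "\<not> \<bar>s z\<bar> \<ge> 1" "\<not> \<bar>t z\<bar> \<ge> 1" using cutoff_profile_support by blast+
  then show ?thesis by simp
qed

lemma cutoff_sum:
  assumes "s z \<in> {-1..2}" "t z \<in> {-1..2}"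
  shows "(\<Sum>p\<in>window. cutoff (z + shift p)) = 1"
proof -
  have "(\<Sum>p\<in>window. cutoff (z + shift p)) =
     (\<Sum>i\<in>{-2..1::int}. \<Sum>j\<in>{-2..1::int}. of_real (cutoff_profile (s z + of_int i)) * of_real (cutoff_profile (t z + of_int j)))"
    unfolding window_def cutoff_def by (simp add: sum.cartesian_product s_add t_add case_prod_beta)
  also have "\<dots> = of_real (\<Sum>i\<in>{-2..1::int}. cutoff_profile (s z + of_int i)) * of_real (\<Sum>j\<in>{-2..1::int}. cutoff_profile (t z + of_int j))"
    by (simp add: sum_product of_real_sum)
  finally show ?thesis unfolding cutoff_profile_sum[OF assms(1)] cutoff_profile_sum[OF assms(2)] by simp
qed

lemma cutoff_bound: "cmod z \<ge> cmod \<omega>1 + cmod \<omega>2 + 1 \<Longrightarrow> cutoff z = 0"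
proof (rule ccontr)
  assume a: "cmod z \<ge> cmod \<omega>1 + cmod \<omega>2 + 1" and "cutoff z \<noteq> 0"
  from cutoff_support[OF this(2)] have "\<bar>s z\<bar> \<le> 1" "\<bar>t z\<bar> \<le> 1" by auto
  then have "cmod z \<le> cmod \<omega>1 + cmod \<omega>2"
    using cmod_le_coordinates[of z] mult_right_mono[of "\<bar>s z\<bar>" 1 "cmod \<omega>1"] mult_right_mono[of "\<bar>t z\<bar>" 1 "cmod \<omega>2"] by simp
  then show False using a by simp
qed

lemma smooth_mult_cutoff_test: "smooth f \<Longrightarrow> test_function (\<lambda>z. f z * cutoff z)"
  unfolding test_function_def
proof
  assume f: "smooth f"
  show "\<forall>k. Ck k (\<lambda>z. f z * cutoff z)" using smooth_imp_Ck[OF smooth.mult[OF f smooth_cutoff]] by blast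
  have "{z. f z * cutoff z \<noteq> 0} \<subseteq> cball 0 (cmod \<omega>1 + cmod \<omega>2 + 1)"
  proof
    fix z assume "z \<in> {z. f z * cutoff z \<noteq> 0}"
    then have "cutoff z \<noteq> 0" by simp
    then have "\<not> cmod z \<ge> cmod \<omega>1 + cmod \<omega>2 + 1" using cutoff_bound by blast
    then show "z \<in> cball 0 (cmod \<omega>1 + cmod \<omega>2 + 1)" by simp
  qed
  then have "closure {z. f z * cutoff z \<noteq> 0} \<subseteq> cball 0 (cmod \<omega>1 + cmod \<omega>2 + 1)" by (rule closure_minimal) simp
  then show "compact (closure {z. f z * cutoff z \<noteq> 0})"
    using bounded_subset[OF bounded_cball] by (simp add: compact_eq_bounded_closed)
qed

text \<open>The cells translated by the window tile the region in which both coordinates lie between -2 and 2.\<close>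

lemma window_unique:
  assumes "s z \<in> {-2..<2}" "t z \<in> {-2..<2}"
  shows "(\<Sum>p\<in>window. indicator cell (z - shift p)) = (1 :: real)"
proof -
  let ?q = "(\<lfloor>s z\<rfloor>, \<lfloor>t z\<rfloor>)"
  have q: "?q \<in> window" using assms by (auto simp: window_def floor_less_iff le_floor_iff floor_le_iff)
  have sd: "s (z - w) = s z - s w" "t (z - w) = t z - t w" for w
    using s_add[of "z - w" w] t_add[of "z - w" w] by simp_all
  have "indicator cell (z - shift p) = (if p = ?q then 1 else 0 :: real)" for p
    by (cases p) (auto simp: cell_def sd indicator_def, linarith+)
  then show ?thesis using q finite_window by simp
qed

text \<open>The plane integral is cut into integrals over translated cells, and each is translated back to the cell,
  where periodicity removes the shift of \<open>h\<close>.\<close>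

lemma unfold_cell:
  fixes h \<psi> :: "complex \<Rightarrow> complex"
  assumes int: "integrable lebesgue (\<lambda>z. h z * \<psi> z)" and h: "h \<in> borel_measurable lebesgue" and \<psi>: "\<psi> \<in> borel_measurable lebesgue"
    and supp: "\<And>z. \<psi> z \<noteq> 0 \<Longrightarrow> s z \<in> {-2..<2} \<and> t z \<in> {-2..<2}"
    and per: "\<And>p. p \<in> window \<Longrightarrow> AE z in lebesgue. h (z + shift p) = h z"
  shows "(\<integral>z. h z * \<psi> z \<partial>lebesgue) = (\<integral>z. h z * (\<Sum>p\<in>window. \<psi> (z + shift p)) \<partial>lebesgue_on cell)"
proof -
  have i1: "integrable lebesgue (\<lambda>z. indicator cell (z - shift p) *\<^sub>R (h z * \<psi> z))" for p
  proof -
    have "{z. z - shift p \<in> cell} \<in> sets lebesgue"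
    proof -
      have "(\<lambda>z. shift p + z) ` cell = {z. z - shift p \<in> cell}" by (auto simp: image_iff) (metis add_diff_cancel_left' diff_add_cancel add.commute)
      then show ?thesis using lebesgue_sets_translation[OF cell_lebesgue, of "shift p"] by simp
    qed
    from integrable_mult_indicator[OF this int] show ?thesis by (simp add: indicator_def)
  qed
  have i2: "integrable lebesgue (\<lambda>z. indicator cell z *\<^sub>R (h (z + shift p) * \<psi> (z + shift p)))"
    and e2: "(\<integral>z. indicator cell z *\<^sub>R (h (z + shift p) * \<psi> (z + shift p)) \<partial>lebesgue) = (\<integral>z. indicator cell (z - shift p) *\<^sub>R (h z * \<psi> z) \<partial>lebesgue)" for p
    using lebesgue_integral_translation[OF borel_measurable_integrable[OF i1[of p]], of "shift p"] i1[of p] by simp_all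
  have hs: "(\<lambda>z. h (z + shift p)) \<in> borel_measurable lebesgue" "(\<lambda>z. \<psi> (z + shift p)) \<in> borel_measurable lebesgue" for p
    by (rule lebesgue_integral_translation(3)[OF h] lebesgue_integral_translation(3)[OF \<psi>])+
  have im: "(\<lambda>z. indicator cell z :: real) \<in> borel_measurable lebesgue" using cell_lebesgue by simp
  have ae: "AE z in lebesgue. indicator cell z *\<^sub>R (h (z + shift p) * \<psi> (z + shift p)) = indicator cell z *\<^sub>R (h z * \<psi> (z + shift p))"
    if "p \<in> window" for p
    using per[OF that] by eventually_elim simp
  have m1: "(\<lambda>z. indicator cell z *\<^sub>R (h (z + shift p) * \<psi> (z + shift p))) \<in> borel_measurable lebesgue"
    and m2: "(\<lambda>z. indicator cell z *\<^sub>R (h z * \<psi> (z + shift p))) \<in> borel_measurable lebesgue" for p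
    by (intro borel_measurable_scaleR im borel_measurable_times hs h)+
  have i3: "integrable lebesgue (\<lambda>z. indicator cell z *\<^sub>R (h z * \<psi> (z + shift p)))" if "p \<in> window" for p
    using integrable_cong_AE[OF m1 m2 ae[OF that]] i2 by blast
  have e3: "(\<integral>z. indicator cell z *\<^sub>R (h (z + shift p) * \<psi> (z + shift p)) \<partial>lebesgue) = (\<integral>z. indicator cell z *\<^sub>R (h z * \<psi> (z + shift p)) \<partial>lebesgue)"
    if "p \<in> window" for p by (rule integral_cong_AE[OF m1 m2 ae[OF that]])
  have "h z * \<psi> z = (\<Sum>p\<in>window. indicator cell (z - shift p) *\<^sub>R (h z * \<psi> z))" for z
    using window_unique[of z] supp[of z] by (cases "\<psi> z = 0") (simp_all add: scaleR_left.sum[symmetric])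
  then have "(\<integral>z. h z * \<psi> z \<partial>lebesgue) = (\<integral>z. (\<Sum>p\<in>window. indicator cell (z - shift p) *\<^sub>R (h z * \<psi> z)) \<partial>lebesgue)"
    by simp
  also have "\<dots> = (\<Sum>p\<in>window. \<integral>z. indicator cell (z - shift p) *\<^sub>R (h z * \<psi> z) \<partial>lebesgue)"
    by (rule Bochner_Integration.integral_sum) (rule i1)
  also have "\<dots> = (\<Sum>p\<in>window. \<integral>z. indicator cell z *\<^sub>R (h z * \<psi> (z + shift p)) \<partial>lebesgue)"
    by (rule sum.cong) (simp_all add: e2[symmetric] e3)
  also have "\<dots> = (\<integral>z. (\<Sum>p\<in>window. indicator cell z *\<^sub>R (h z * \<psi> (z + shift p))) \<partial>lebesgue)"
    by (rule Bochner_Integration.integral_sum[symmetric]) (rule i3)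
  also have "\<dots> = (\<integral>z. indicator cell z *\<^sub>R (h z * (\<Sum>p\<in>window. \<psi> (z + shift p))) \<partial>lebesgue)"
    by (simp add: scaleR_right.sum[symmetric] sum_distrib_left)
  also have "\<dots> = (\<integral>z. h z * (\<Sum>p\<in>window. \<psi> (z + shift p)) \<partial>lebesgue_on cell)"
    by (rule integral_restrict_space[symmetric]) simp
  finally show ?thesis .
qed

text \<open>The translates of the cutoff add up to 1 in a neighbourhood of the cell, so their derivatives add up
  to 0 on the cell.\<close>

lemma cutoff_derivative_sum:
  assumes z: "z \<in> cell"
  shows "(\<Sum>p\<in>window. partial1 cutoff (z + shift p)) = 0" "(\<Sum>p\<in>window. partial2 cutoff (z + shift p)) = 0"
proof -
  have diff: "cutoff differentiable (at z)" for z using smooth_imp_Ck[OF smooth_cutoff, of "Suc 0"] by simp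
  let ?D = "\<lambda>h. \<Sum>p\<in>window. (of_real (Re h) * partial1 cutoff (z + shift p) + of_real (Im h) * partial2 cutoff (z + shift p))"
  have "((\<lambda>z. cutoff (z + shift p)) has_derivative
      (\<lambda>h. of_real (Re h) * partial1 cutoff (z + shift p) + of_real (Im h) * partial2 cutoff (z + shift p))) (at z)" for p
  proof -
    have "((\<lambda>z. z + shift p) has_derivative (\<lambda>h. h)) (at z)" by (auto intro!: derivative_eq_intros)
    from has_derivative_compose[OF this has_derivative_partials[OF diff]] show ?thesis .
  qed
  then have 1: "((\<lambda>z. \<Sum>p\<in>window. cutoff (z + shift p)) has_derivative ?D) (at z)"
    by (intro has_derivative_sum)
  have 2: "((\<lambda>z. \<Sum>p\<in>window. cutoff (z + shift p)) has_derivative (\<lambda>_. 0)) (at z)"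
  proof (rule has_derivative_transform_within_open[where s = "{z. -1 < s z \<and> s z < 2 \<and> -1 < t z \<and> t z < 2}"])
    show "((\<lambda>_. 1) has_derivative (\<lambda>_. 0)) (at z)" by simp
    show "open {z. -1 < s z \<and> s z < 2 \<and> -1 < t z \<and> t z < 2}"
      by (intro open_Collect_conj open_Collect_less s_cont t_cont continuous_intros)
  qed (use z cutoff_sum in \<open>auto simp: cell_def\<close>)
  have "?D h = 0" for h using has_derivative_unique[OF 1 2] by (simp add: fun_eq_iff)
  from this[of 1] this[of \<i>] show "(\<Sum>p\<in>window. partial1 cutoff (z + shift p)) = 0" "(\<Sum>p\<in>window. partial2 cutoff (z + shift p)) = 0"
    by simp_all
qed

end

section \<open>Fourier modes of the lattice\<close>

context lattice_frame
begin

lemma freq_coordinates_le: "\<bar>of_int (fst p)\<bar> \<le> cmod (freq p) * cmod \<omega>1" "\<bar>of_int (snd p)\<bar> \<le> cmod (freq p) * cmod \<omega>2"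
proof -
  have s1: "s \<omega>1 = 1" "t \<omega>1 = 0" "s \<omega>2 = 0" "t \<omega>2 = 1" using dual by (simp_all only: s_def t_def)
  have "\<bar>Re (cnj (freq p) * w)\<bar> \<le> cmod (freq p) * cmod w" for w
    using abs_Re_le_cmod[of "cnj (freq p) * w"] by (simp only: norm_mult complex_mod_cnj)
  from this[of \<omega>1] this[of \<omega>2] show "\<bar>of_int (fst p)\<bar> \<le> cmod (freq p) * cmod \<omega>1" "\<bar>of_int (snd p)\<bar> \<le> cmod (freq p) * cmod \<omega>2"
    unfolding Re_freq s1 by simp_all
qed

lemma omega_nonzero: "\<omega>1 \<noteq> 0" "\<omega>2 \<noteq> 0"
  using dual by auto

lemma finite_freq_le: "finite {p. cmod (freq p) \<le> R}"
proof (rule finite_subset)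
  let ?m = "\<lceil>\<bar>R\<bar> * (cmod \<omega>1 + cmod \<omega>2)\<rceil>"
  show "{p. cmod (freq p) \<le> R} \<subseteq> {- ?m..?m} \<times> {- ?m..?m}"
  proof
    fix p assume "p \<in> {p. cmod (freq p) \<le> R}"
    then have R: "cmod (freq p) \<le> \<bar>R\<bar>" by simp
    have "cmod (freq p) * cmod \<omega>1 \<le> \<bar>R\<bar> * (cmod \<omega>1 + cmod \<omega>2)" "cmod (freq p) * cmod \<omega>2 \<le> \<bar>R\<bar> * (cmod \<omega>1 + cmod \<omega>2)"
      by (intro mult_mono R; simp)+
    then have "\<bar>of_int (fst p)\<bar> \<le> \<bar>R\<bar> * (cmod \<omega>1 + cmod \<omega>2)" "\<bar>of_int (snd p)\<bar> \<le> \<bar>R\<bar> * (cmod \<omega>1 + cmod \<omega>2)"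
      using freq_coordinates_le[of p] by linarith+
    then have "\<bar>fst p\<bar> \<le> ?m" "\<bar>snd p\<bar> \<le> ?m" by linarith+
    then show "p \<in> {- ?m..?m} \<times> {- ?m..?m}" by (cases p) auto
  qed
qed simp

lemma freq_gap:
  assumes "p \<noteq> (0, 0)"
  shows "cmod (freq p) \<ge> 1 / (cmod \<omega>1 + cmod \<omega>2)"
proof -
  have pos: "cmod \<omega>1 + cmod \<omega>2 > 0" using omega_nonzero by (simp add: add_pos_pos)
  have "1 \<le> \<bar>real_of_int (fst p)\<bar> \<or> 1 \<le> \<bar>real_of_int (snd p)\<bar>"
    using assms by (cases p) (auto simp: of_int_abs[symmetric] simp del: of_int_abs)
  then have "1 \<le> cmod (freq p) * cmod \<omega>1 \<or> 1 \<le> cmod (freq p) * cmod \<omega>2"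
    using freq_coordinates_le[of p] by linarith
  moreover have "cmod (freq p) * cmod \<omega>1 \<le> cmod (freq p) * (cmod \<omega>1 + cmod \<omega>2)"
    "cmod (freq p) * cmod \<omega>2 \<le> cmod (freq p) * (cmod \<omega>1 + cmod \<omega>2)" by (intro mult_left_mono; simp)+
  ultimately have "1 \<le> cmod (freq p) * (cmod \<omega>1 + cmod \<omega>2)" by linarith
  then show ?thesis using pos by (simp add: pos_divide_le_eq)
qed

lemma freq_0: "freq (0, 0) = 0" by (simp add: freq_def)

text \<open>Points \<open>x * cnj \<sigma>\<close> for which \<open>x\<close> is half of an odd integer: their first coordinate differs by at least 1/2
  from that of every point of the conjugate dual lattice.\<close>

lemma half_integer_gap:
  "\<exists>a. cmod a \<ge> R \<and> (\<forall>p. cmod (a + cnj (freq p)) \<ge> 2 * (1 / (4 * cmod \<omega>1)))"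
proof -
  have w: "cmod \<omega>1 > 0" using omega_nonzero by simp
  have key: "\<bar>of_int m + x\<bar> \<le> cmod (of_real x * cnj \<sigma> + cnj (freq (m, n))) * cmod \<omega>1" for m n and x :: real
  proof -
    have s1: "s \<omega>1 = 1" "t \<omega>1 = 0" using dual by (simp_all only: s_def t_def)
    have "Re ((of_real x * cnj \<sigma> + cnj (freq (m, n))) * \<omega>1) = x * s \<omega>1 + Re (cnj (freq (m, n)) * \<omega>1)"
      by (simp add: s_def algebra_simps)
    also have "\<dots> = of_int m + x" unfolding Re_freq s1 by simp
    finally show ?thesis
      using abs_Re_le_cmod[of "(of_real x * cnj \<sigma> + cnj (freq (m, n))) * \<omega>1"] by (simp only: norm_mult)
  qed
  obtain j :: nat where j: "real j \<ge> \<bar>R\<bar> * cmod \<omega>1" using real_arch_simple by blast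
  let ?x = "real j + 1 / 2"
  have "cmod (of_real ?x * cnj \<sigma>) \<ge> R"
  proof -
    have "?x \<le> cmod (of_real ?x * cnj \<sigma>) * cmod \<omega>1" using key[of 0 ?x 0] by (simp add: freq_0)
    then have "\<bar>R\<bar> * cmod \<omega>1 \<le> cmod (of_real ?x * cnj \<sigma>) * cmod \<omega>1" using j by linarith
    then have "\<bar>R\<bar> \<le> cmod (of_real ?x * cnj \<sigma>)" using w by (simp only: mult_le_cancel_right_pos)
    then show ?thesis by linarith
  qed
  moreover have "cmod (of_real ?x * cnj \<sigma> + cnj (freq p)) \<ge> 2 * (1 / (4 * cmod \<omega>1))" for p
  proof -
    have "1 / 2 \<le> \<bar>real_of_int (fst p) + ?x\<bar>"
    proof -
      have "real_of_int (2 * (fst p + int j) + 1) = 2 * (real_of_int (fst p) + ?x)" by simp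
      then have "2 * \<bar>real_of_int (fst p) + ?x\<bar> = \<bar>real_of_int (2 * (fst p + int j) + 1)\<bar>"
        by (simp only: abs_mult abs_numeral)
      also have "\<dots> \<ge> 1" by (simp only: of_int_abs[symmetric] of_int_1_le_iff) presburger
      finally show ?thesis by simp
    qed
    also have "\<dots> \<le> cmod (of_real ?x * cnj \<sigma> + cnj (freq p)) * cmod \<omega>1" using key[of "fst p" ?x "snd p"] by simp
    finally show ?thesis using w by (simp add: field_simps)
  qed
  ultimately show ?thesis by blast
qed

definition mode :: "int \<times> int \<Rightarrow> complex \<Rightarrow> complex" where
  "mode p = wave (of_real (Re (freq p))) (of_real (Im (freq p)))"

lemma mode_eq: "mode p z = exp (2 * pi * \<i> * of_real (of_int (fst p) * s z + of_int (snd p) * t z))"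
  unfolding mode_def wave_def Re_freq[symmetric] by simp

lemma mode_cis: "mode p z = cis (2 * pi * (of_int (fst p) * s z + of_int (snd p) * t z))"
  unfolding mode_eq cis_conv_exp by (simp add: mult_ac)

lemma cmod_mode [simp]: "cmod (mode p z) = 1"
  by (simp add: mode_cis)

lemma mode_mult: "mode p z * mode q z = mode (p + q) z"
  by (simp add: mode_cis cis_mult algebra_simps)

lemma cnj_mode: "cnj (mode p z) = mode (- p) z"
  by (simp add: mode_cis cis_cnj algebra_simps)

lemma mode_shift: "mode p (z + shift q) = mode p z"
proof -
  have "mode p (z + shift q) = mode p z * cis (2 * pi * of_int (fst p * fst q + snd p * snd q))"
    by (simp add: mode_cis cis_mult s_add t_add algebra_simps)
  also have "cis (2 * pi * of_int (fst p * fst q + snd p * snd q)) = 1"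
    by (rule cis_multiple_2pi) simp
  finally show ?thesis by simp
qed

lemma mode_continuous: "continuous_on A (mode p)"
  unfolding mode_def wave_def[abs_def] by (intro continuous_intros)

lemma mode_measurable [measurable]: "mode p \<in> borel_measurable lebesgue"
  by (rule continuous_lebesgue_measurable[OF mode_continuous])

lemma cutoff_del:
  "cutoff differentiable (at z)" "continuous_on UNIV cutoff" "continuous_on UNIV (partial1 cutoff)" "continuous_on UNIV (partial2 cutoff)"
  "continuous_on UNIV (del cutoff)" "continuous_on UNIV (delbar cutoff)"
proof -
  have C: "Ck (Suc 0) cutoff" "Ck 0 cutoff" by (rule smooth_imp_Ck[OF smooth_cutoff])+
  then show *: "cutoff differentiable (at z)" "continuous_on UNIV cutoff" "continuous_on UNIV (partial1 cutoff)" "continuous_on UNIV (partial2 cutoff)"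
    by simp_all
  show "continuous_on UNIV (del cutoff)" "continuous_on UNIV (delbar cutoff)"
    unfolding del_def[abs_def] delbar_def[abs_def] by (intro continuous_intros *; simp)+
qed

lemma partial_cutoff_support:
  assumes "partial1 cutoff z \<noteq> 0 \<or> partial2 cutoff z \<noteq> 0"
  shows "s z \<in> {-2..<2} \<and> t z \<in> {-2..<2}"
proof (rule ccontr)
  assume a: "\<not> ?thesis"
  let ?O = "{z. 1 < \<bar>s z\<bar>} \<union> {z. 1 < \<bar>t z\<bar>}"
  have z: "z \<in> ?O" using a by auto
  have "(cutoff has_derivative (\<lambda>_. 0)) (at z)"
  proof (rule has_derivative_transform_within_open[where s = ?O])
    show "((\<lambda>_. 0) has_derivative (\<lambda>_. 0)) (at z)" by simp
    show "open ?O" by (intro open_Un open_Collect_less continuous_intros s_cont t_cont)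
    show "0 = cutoff x" if "x \<in> ?O" for x using cutoff_support[of x] that by force
  qed (rule z)
  from partials_eq[OF this] show False using assms by simp
qed

lemma integral_cutoff_eq_cell:
  assumes h: "h \<in> borel_measurable lebesgue" and int: "integrable lebesgue (\<lambda>z. h z * cutoff z)"
    and per: "\<And>p. p \<in> window \<Longrightarrow> AE z in lebesgue. h (z + shift p) = h z"
  shows "(\<integral>z. h z * cutoff z \<partial>lebesgue) = (\<integral>z. h z \<partial>lebesgue_on cell)"
proof -
  have "(\<integral>z. h z * cutoff z \<partial>lebesgue) = (\<integral>z. h z * (\<Sum>p\<in>window. cutoff (z + shift p)) \<partial>lebesgue_on cell)"
    by (rule unfold_cell[OF int h continuous_lebesgue_measurable[OF cutoff_del(2)] _ per]) (use cutoff_support in force)+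
  also have "\<dots> = (\<integral>z. h z \<partial>lebesgue_on cell)"
    by (rule Bochner_Integration.integral_cong) (auto simp: cutoff_sum cell_def)
  finally show ?thesis .
qed

lemma integral_del_cutoff_eq_0:
  assumes h: "h \<in> borel_measurable lebesgue" and int: "integrable lebesgue (\<lambda>z. h z * del cutoff z)" "integrable lebesgue (\<lambda>z. h z * delbar cutoff z)"
    and per: "\<And>p. p \<in> window \<Longrightarrow> AE z in lebesgue. h (z + shift p) = h z"
  shows "(\<integral>z. h z * del cutoff z \<partial>lebesgue) = 0" "(\<integral>z. h z * delbar cutoff z \<partial>lebesgue) = 0"
proof -
  have "(\<integral>z. h z * del cutoff z \<partial>lebesgue) = (\<integral>z. h z * (\<Sum>p\<in>window. del cutoff (z + shift p)) \<partial>lebesgue_on cell)"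
    by (rule unfold_cell[OF int(1) h continuous_lebesgue_measurable[OF cutoff_del(5)] _ per])
       (use partial_cutoff_support in \<open>force simp: del_def\<close>)+
  also have "\<dots> = (\<integral>z. 0 \<partial>lebesgue_on cell)"
  proof (rule Bochner_Integration.integral_cong)
    fix z assume "z \<in> space (lebesgue_on cell)"
    then have z: "z \<in> cell" by simp
    have "(\<Sum>p\<in>window. del cutoff (z + shift p))
       = ((\<Sum>p\<in>window. partial1 cutoff (z + shift p)) - \<i> * (\<Sum>p\<in>window. partial2 cutoff (z + shift p))) / 2"
      by (simp add: del_def sum_subtractf sum_distrib_left sum_divide_distrib[symmetric])
    then show "h z * (\<Sum>p\<in>window. del cutoff (z + shift p)) = 0" by (simp add: cutoff_derivative_sum[OF z])
  qed simp
  finally show "(\<integral>z. h z * del cutoff z \<partial>lebesgue) = 0" by simp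
  have "(\<integral>z. h z * delbar cutoff z \<partial>lebesgue) = (\<integral>z. h z * (\<Sum>p\<in>window. delbar cutoff (z + shift p)) \<partial>lebesgue_on cell)"
    by (rule unfold_cell[OF int(2) h continuous_lebesgue_measurable[OF cutoff_del(6)] _ per])
       (use partial_cutoff_support in \<open>force simp: delbar_def\<close>)+
  also have "\<dots> = (\<integral>z. 0 \<partial>lebesgue_on cell)"
  proof (rule Bochner_Integration.integral_cong)
    fix z assume "z \<in> space (lebesgue_on cell)"
    then have z: "z \<in> cell" by simp
    have "(\<Sum>p\<in>window. delbar cutoff (z + shift p))
       = ((\<Sum>p\<in>window. partial1 cutoff (z + shift p)) + \<i> * (\<Sum>p\<in>window. partial2 cutoff (z + shift p))) / 2"
      by (simp add: delbar_def sum.distrib sum_distrib_left sum_divide_distrib[symmetric])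
    then show "h z * (\<Sum>p\<in>window. delbar cutoff (z + shift p)) = 0" by (simp add: cutoff_derivative_sum[OF z])
  qed simp
  finally show "(\<integral>z. h z * delbar cutoff z \<partial>lebesgue) = 0" by simp
qed

lemma integrable_mult_compact_support:
  fixes h \<psi> :: "complex \<Rightarrow> complex"
  assumes h: "integrable (lebesgue_on (cball 0 R)) h" and \<psi>: "continuous_on UNIV \<psi>" "\<And>z. cmod z > R \<Longrightarrow> \<psi> z = 0"
  shows "integrable lebesgue (\<lambda>z. h z * \<psi> z)"
proof -
  have "compact (\<psi> ` cball 0 R)"
    by (intro compact_continuous_image compact_cball continuous_on_subset[OF \<psi>(1)]) auto
  then obtain K where K: "\<And>z. z \<in> cball 0 R \<Longrightarrow> cmod (\<psi> z) \<le> K"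
    using compact_imp_bounded bounded_iff by (metis imageI)
  have hi: "integrable lebesgue (\<lambda>z. indicator (cball 0 R) z *\<^sub>R h z)"
    using h by (simp add: integrable_restrict_space)
  have "integrable lebesgue (\<lambda>z. (indicator (cball 0 R) z *\<^sub>R h z) * \<psi> z)"
  proof (rule Bochner_Integration.integrable_bound[OF Bochner_Integration.integrable_mult_right[OF integrable_norm[OF hi], of K]])
    show "(\<lambda>z. (indicator (cball 0 R) z *\<^sub>R h z) * \<psi> z) \<in> borel_measurable lebesgue"
      by (intro borel_measurable_times borel_measurable_integrable[OF hi] continuous_lebesgue_measurable \<psi>(1))
    show "AE z in lebesgue. norm ((indicator (cball 0 R) z *\<^sub>R h z) * \<psi> z) \<le> norm (K * norm (indicator (cball 0 R) z *\<^sub>R h z))"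
    proof (rule AE_I2)
      fix z
      show "norm ((indicator (cball 0 R) z *\<^sub>R h z) * \<psi> z) \<le> norm (K * norm (indicator (cball 0 R) z *\<^sub>R h z))"
      proof (cases "z \<in> cball 0 R")
        case True
        have "cmod (h z) * cmod (\<psi> z) \<le> cmod (h z) * K" by (rule mult_left_mono[OF K[OF True]]) simp
        also have "\<dots> \<le> \<bar>K\<bar> * cmod (h z)" by (simp add: mult.commute mult_right_mono)
        finally show ?thesis using True by (simp add: norm_mult abs_mult)
      qed simp
    qed
  qed
  moreover have "(indicator (cball 0 R) z *\<^sub>R h z) * \<psi> z = h z * \<psi> z" for z
    using \<psi>(2)[of z] by (cases "z \<in> cball 0 R") auto
  ultimately show ?thesis by simp
qed

lemma del_cutoff_bound:
  assumes "cmod z > cmod \<omega>1 + cmod \<omega>2 + 1"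
  shows "del cutoff z = 0" "delbar cutoff z = 0"
proof -
  have "(cutoff has_derivative (\<lambda>_. 0)) (at z)"
  proof (rule has_derivative_transform_within_open[where s = "{z. cmod \<omega>1 + cmod \<omega>2 + 1 < cmod z}"])
    show "((\<lambda>_. 0) has_derivative (\<lambda>_. 0)) (at z)" by simp
    show "open {z. cmod \<omega>1 + cmod \<omega>2 + 1 < cmod z}" by (intro open_Collect_less continuous_intros)
    show "0 = cutoff x" if "x \<in> {z. cmod \<omega>1 + cmod \<omega>2 + 1 < cmod z}" for x using cutoff_bound[of x] that by simp
  qed (use assms in simp)
  from partials_eq[OF this] show "del cutoff z = 0" "delbar cutoff z = 0" by (simp_all add: del_def delbar_def)
qed

text \<open>The integral over the cell is the integral over the plane against the cutoff. Integration by parts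
  multiplies it by a nonzero factor and moves \<open>\<partial>\<close> to the cutoff, where it gives 0.\<close>

lemma integral_mode_cell:
  assumes "p \<noteq> (0, 0)"
  shows "(\<integral>z. mode p z \<partial>lebesgue_on cell) = 0"
proof -
  let ?R = "cmod \<omega>1 + cmod \<omega>2 + 1"
  have ic: "integrable (lebesgue_on (cball 0 ?R)) (mode p)"
  proof -
    have "integrable lborel (\<lambda>z. indicator (cball 0 ?R) z *\<^sub>R mode p z)"
      by (rule borel_integrable_compact[OF compact_cball mode_continuous])
    then show ?thesis by (simp add: integrable_restrict_space integrable_completion)
  qed
  have per: "AE z in lebesgue. mode p (z + shift q) = mode p z" for q by (simp add: mode_shift)
  have i: "integrable lebesgue (\<lambda>z. mode p z * cutoff z)" "integrable lebesgue (\<lambda>z. mode p z * del cutoff z)" "integrable lebesgue (\<lambda>z. mode p z * delbar cutoff z)"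
    by (rule integrable_mult_compact_support[OF ic], rule cutoff_del, simp add: cutoff_bound del_cutoff_bound)+
  have "(\<integral>z. mode p z \<partial>lebesgue_on cell) = (\<integral>z. mode p z * cutoff z \<partial>lebesgue)"
    by (rule integral_cutoff_eq_cell[OF mode_measurable i(1) per, symmetric])
  moreover have "0 = - (pi * \<i> * (of_real (Re (freq p)) - \<i> * of_real (Im (freq p)))) * (\<integral>z. mode p z * cutoff z \<partial>lebesgue)"
  proof -
    have "(\<integral>z. mode p z * del cutoff z \<partial>lebesgue) = 0" by (rule integral_del_cutoff_eq_0[OF mode_measurable i(2,3) per])
    moreover have "(\<integral>z. mode p z * del cutoff z \<partial>lebesgue) = - (pi * \<i> * (of_real (Re (freq p)) - \<i> * of_real (Im (freq p)))) * (\<integral>z. mode p z * cutoff z \<partial>lebesgue)"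
      unfolding mode_def by (rule integral_wave_del(1)[OF cutoff_del(1,3,4) cutoff_bound])
    ultimately show ?thesis by simp
  qed
  moreover have "of_real (Re (freq p)) - \<i> * of_real (Im (freq p)) \<noteq> 0"
  proof -
    have "0 < 1 / (cmod \<omega>1 + cmod \<omega>2)" using omega_nonzero by (simp add: add_pos_pos)
    then have "freq p \<noteq> 0" using freq_gap[OF assms] by auto
    then show ?thesis by (auto simp: complex_eq_iff)
  qed
  ultimately show ?thesis by auto
qed

definition basis :: "int \<times> int \<Rightarrow> complex \<Rightarrow> complex" where
  "basis p z = mode p z / sqrt area"

text \<open>Trigonometric polynomials.\<close>

inductive trig :: "(complex \<Rightarrow> complex) \<Rightarrow> bool" where
  mode: "trig (\<lambda>z. c * mode p z)"
| add: "trig f \<Longrightarrow> trig g \<Longrightarrow> trig (\<lambda>z. f z + g z)"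

lemma trig_mult_mode: "trig f \<Longrightarrow> trig (\<lambda>z. c * mode p z * f z)"
proof (induction rule: trig.induct)
  case (mode d q)
  have eq: "(\<lambda>z. c * mode p z * (d * mode q z)) = (\<lambda>z. (c * d) * mode (p + q) z)"
    by (simp only: mode_mult[symmetric] mult_ac)
  show ?case unfolding eq by (rule trig.mode)
next
  case (add f g)
  then show ?case using trig.add by (simp add: distrib_left)
qed

lemma trig_mult: "trig f \<Longrightarrow> trig g \<Longrightarrow> trig (\<lambda>z. f z * g z)"
proof (induction rule: trig.induct)
  case (mode d q)
  then show ?case by (simp add: trig_mult_mode)
next
  case (add f1 f2)
  then show ?case using trig.add by (simp add: distrib_right)
qed

lemma trig_cmult: "trig f \<Longrightarrow> trig (\<lambda>z. c * f z)"
  using trig_mult_mode[of f c "(0, 0)"] by (simp add: mode_cis)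

lemma trig_const: "trig (\<lambda>z. c)"
  using trig.mode[of c "(0, 0)"] by (simp add: mode_cis)

text \<open>The quotient of the plane by the lattice as a subset of the product of two circles. A continuous
  function on this product that is composed with it is a continuous periodic function.\<close>

definition torus_map :: "complex \<Rightarrow> complex \<times> complex" where
  "torus_map z = (mode (1, 0) z, mode (0, 1) z)"

lemma trig_polynomial:
  "real_polynomial_function g \<Longrightarrow> trig (\<lambda>z. of_real (g (torus_map z)))"
proof (induction rule: real_polynomial_function.induct)
  case (linear g)
  then interpret g: bounded_linear g .
  have e: "g (u, v) = Re u * g (1, 0) + Im u * g (\<i>, 0) + Re v * g (0, 1) + Im v * g (0, \<i>)" for u v
  proof -
    have "(u, v) = Re u *\<^sub>R (1, 0) + Im u *\<^sub>R (\<i>, 0) + Re v *\<^sub>R (0, 1) + Im v *\<^sub>R (0, \<i>)"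
      by (simp add: complex_eq_iff)
    then show ?thesis by (simp only: g.add g.scaleR real_scaleR_def)
  qed
  have re: "trig (\<lambda>z. of_real (Re (mode p z)))" and im: "trig (\<lambda>z. of_real (Im (mode p z)))" for p
  proof -
    have "complex_of_real (Re w) = (1/2) * w + (1/2) * cnj w" "complex_of_real (Im w) = (- \<i> / 2) * w + (\<i> / 2) * cnj w" for w
      by (simp_all add: complex_eq_iff)
    then show "trig (\<lambda>z. of_real (Re (mode p z)))" "trig (\<lambda>z. of_real (Im (mode p z)))"
      by (simp_all only: cnj_mode) (intro trig.add trig.mode)+
  qed
  have "trig (\<lambda>z. of_real (g (1, 0)) * of_real (Re (mode (1, 0) z)) + of_real (g (\<i>, 0)) * of_real (Im (mode (1, 0) z))
     + of_real (g (0, 1)) * of_real (Re (mode (0, 1) z)) + of_real (g (0, \<i>)) * of_real (Im (mode (0, 1) z)))"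
    by (intro trig.add trig_cmult re im)
  moreover have "complex_of_real (g (torus_map z)) = of_real (g (1, 0)) * of_real (Re (mode (1, 0) z)) + of_real (g (\<i>, 0)) * of_real (Im (mode (1, 0) z))
     + of_real (g (0, 1)) * of_real (Re (mode (0, 1) z)) + of_real (g (0, \<i>)) * of_real (Im (mode (0, 1) z))" for z
    unfolding torus_map_def by (subst e) (simp add: mult.commute)
  ultimately show ?case by (simp only:)
next
  case (const c)
  show ?case by (rule trig_const)
next
  case (add f g)
  then show ?case using trig.add by simp
next
  case (mult f g)
  then show ?case using trig_mult by simp
qed

lemma torus_map_inj: "inj_on torus_map cell"
proof (rule inj_onI)
  fix x y assume xy: "x \<in> cell" "y \<in> cell" "torus_map x = torus_map y"
  have uniq: "a = b" if "cis (2 * pi * a) = cis (2 * pi * b)" "0 \<le> a" "a < 1" "0 \<le> b" "b < 1" for a b :: real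
  proof -
    have "cis (2 * pi * a - 2 * pi * b) = 1" using that(1) by (simp add: cis_divide[symmetric])
    then have "cos (2 * pi * (a - b)) = 1" by (simp add: complex_eq_iff right_diff_distrib)
    then obtain n :: int where "2 * pi * (a - b) = of_int n * 2 * pi" using cos_one_2pi_int by blast
    then have "a - b = of_int n" by simp
    moreover have "\<bar>a - b\<bar> < 1" using that by auto
    ultimately have "n = 0" by linarith
    then show ?thesis using \<open>a - b = of_int n\<close> by simp
  qed
  have "s x = s y" "t x = t y" using xy by (auto simp: torus_map_def mode_cis cell_def intro!: uniq)
  then show "x = y" using z_eq[of x] z_eq[of y] by simp
qed

lemma torus_map_continuous: "continuous_on A torus_map"
  unfolding torus_map_def[abs_def] by (intro continuous_on_Pair mode_continuous)

end

section \<open>Completeness of the Fourier modes\<close>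

context lattice_frame
begin

lemma finite_measure_cell: "finite_measure (lebesgue_on cell)"
  by (rule finite_measure_lebesgue_on[OF cell_lmeasurable])

lemma measurable_on_cell: "f \<in> borel_measurable lebesgue \<Longrightarrow> f \<in> borel_measurable (lebesgue_on cell)"
  by (rule measurable_restrict_space1)

lemma cell_integrable_if_square_integrable:
  assumes "square_integrable (lebesgue_on cell) f"
  shows "integrable (lebesgue_on cell) f"
proof -
  interpret finite_measure "lebesgue_on cell" by (rule finite_measure_cell)
  have "square_integrable (lebesgue_on cell) (\<lambda>_. 1)" by (simp add: square_integrable_def)
  from integrable_mult_cnj[OF assms this] show ?thesis by simp
qed

text \<open>A function orthogonal to all modes is orthogonal to trigonometric polynomials and, by the
  Stone-Weierstrass theorem on the torus, to all continuous functions of \<open>torus_map\<close>. Indicators of compact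
  subsets of the cell are pointwise limits of these, and inner regularity extends the orthogonality to
  indicators of all measurable subsets, so that the function vanishes almost everywhere.\<close>

lemma fourier_complete:
  assumes f: "square_integrable (lebesgue_on cell) f"
    and zero: "\<And>p. (\<integral>z. f z * cnj (basis p z) \<partial>lebesgue_on cell) = 0"
  shows "AE z in lebesgue_on cell. f z = 0"
proof -
  let ?M = "lebesgue_on cell"
  interpret finite_measure ?M by (rule finite_measure_cell)
  note fi = cell_integrable_if_square_integrable[OF f]
  have fm [measurable]: "f \<in> borel_measurable ?M" by (rule square_integrableD(1)[OF f])
  have sp: "space ?M = cell" by simp
  have mm: "mode p \<in> borel_measurable ?M" for p by (rule measurable_on_cell[OF mode_measurable])
  have fmode: "integrable ?M (\<lambda>z. f z * mode p z)" for p
    by (rule Bochner_Integration.integrable_bound[OF fi]) (use fm mm in \<open>auto simp: norm_mult\<close>)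
  have mode0: "(\<integral>z. f z * mode p z \<partial>?M) = 0" for p
  proof -
    have "f z * cnj (basis (- p) z) = (f z * mode p z) * (1 / sqrt area)" for z
      by (simp add: basis_def cnj_mode)
    then have "(\<integral>z. f z * mode p z \<partial>?M) * (1 / sqrt area) = 0"
      using zero[of "- p"] fmode[of p] by simp
    then show ?thesis using area_pos by simp
  qed
  have trig0: "integrable ?M (\<lambda>z. f z * T z) \<and> (\<integral>z. f z * T z \<partial>?M) = 0" if "trig T" for T
    using that
  proof induction
    case (mode c p)
    have eq: "(\<lambda>z. f z * (c * mode p z)) = (\<lambda>z. c * (f z * mode p z))" by (rule ext) (simp only: mult.left_commute)
    show ?case unfolding eq using fmode[of p] mode0[of p] by simp
  next
    case (add S T)
    then show ?case by (simp add: distrib_left)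
  qed
  have cont0: "(\<integral>z. f z * of_real (h (torus_map z)) \<partial>?M) = 0" if h: "continuous_on UNIV h" for h :: "complex \<times> complex \<Rightarrow> real"
  proof -
    let ?S = "sphere 0 1 \<times> sphere 0 1 :: (complex \<times> complex) set"
    have S: "compact ?S" by (intro compact_Times compact_sphere)
    have tS: "torus_map z \<in> ?S" for z by (simp add: torus_map_def)
    have hS: "continuous_on ?S h" using h by (rule continuous_on_subset) simp
    have hm: "(\<lambda>z. complex_of_real (h (torus_map z))) \<in> borel_measurable ?M"
      by (intro measurable_on_cell continuous_lebesgue_measurable continuous_on_of_real continuous_on_compose2[OF h] torus_map_continuous) simp
    have "cmod (\<integral>z. f z * of_real (h (torus_map z)) \<partial>?M) \<le> e * (\<integral>z. cmod (f z) \<partial>?M)" if e: "e > 0" for e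
    proof -
      obtain g where g: "real_polynomial_function g" "\<And>x. x \<in> ?S \<Longrightarrow> \<bar>h x - g x\<bar> < e"
        by (rule Stone_Weierstrass_real_polynomial_function[OF S hS e]) (rule that; assumption)
      note T = trig_polynomial[OF g(1)]
      have gi: "integrable ?M (\<lambda>z. f z * of_real (g (torus_map z)))" using trig0[OF T] by blast
      have d: "cmod (f z * of_real (h (torus_map z)) - f z * of_real (g (torus_map z))) \<le> e * cmod (f z)" for z
      proof -
        have "f z * of_real (h (torus_map z)) - f z * of_real (g (torus_map z)) = of_real (h (torus_map z) - g (torus_map z)) * f z"
          by (simp add: algebra_simps)
        then have "cmod (f z * of_real (h (torus_map z)) - f z * of_real (g (torus_map z))) = \<bar>h (torus_map z) - g (torus_map z)\<bar> * cmod (f z)"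
          by (simp only: norm_mult norm_of_real)
        also have "\<dots> \<le> e * cmod (f z)" by (rule mult_right_mono) (use g(2)[OF tS[of z]] in auto)
        finally show ?thesis .
      qed
      have ei: "integrable ?M (\<lambda>z. e * cmod (f z))" using fi by simp
      have di: "integrable ?M (\<lambda>z. f z * of_real (h (torus_map z)) - f z * of_real (g (torus_map z)))"
        by (rule Bochner_Integration.integrable_bound[OF ei])
           (use d e fm hm borel_measurable_integrable[OF gi] in auto)
      have "(\<integral>z. f z * of_real (h (torus_map z)) \<partial>?M)
          = (\<integral>z. (f z * of_real (h (torus_map z)) - f z * of_real (g (torus_map z))) + f z * of_real (g (torus_map z)) \<partial>?M)" by simp
      also have "\<dots> = (\<integral>z. f z * of_real (h (torus_map z)) - f z * of_real (g (torus_map z)) \<partial>?M)"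
        using trig0[OF T] by (subst Bochner_Integration.integral_add[OF di gi]) simp
      finally have "cmod (\<integral>z. f z * of_real (h (torus_map z)) \<partial>?M)
          \<le> (\<integral>z. cmod (f z * of_real (h (torus_map z)) - f z * of_real (g (torus_map z))) \<partial>?M)"
        by (simp only: integral_norm_bound)
      also have "\<dots> \<le> (\<integral>z. e * cmod (f z) \<partial>?M)" by (rule integral_mono[OF integrable_norm[OF di] ei d])
      finally show ?thesis by simp
    qed
    note b = this
    have "cmod (\<integral>z. f z * of_real (h (torus_map z)) \<partial>?M) \<le> 0"
    proof (rule field_le_epsilon)
      fix e :: real assume e: "e > 0"
      let ?F = "\<integral>z. cmod (f z) \<partial>?M"
      have F: "?F \<ge> 0" by simp
      then have "e / (?F + 1) > 0" using e by (simp add: add_nonneg_pos)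
      from b[OF this] have "cmod (\<integral>z. f z * of_real (h (torus_map z)) \<partial>?M) \<le> e / (?F + 1) * ?F" .
      also have "\<dots> \<le> e / (?F + 1) * (?F + 1)" by (rule mult_left_mono) (use e F in auto)
      also have "\<dots> = e" using F by (simp add: add_nonneg_eq_0_iff)
      finally show "cmod (\<integral>z. f z * of_real (h (torus_map z)) \<partial>?M) \<le> 0 + e" by simp
    qed
    then show ?thesis by simp
  qed
  have compact0: "(\<integral>z. indicator K z *\<^sub>R f z \<partial>?M) = 0" if K: "compact K" "K \<subseteq> cell" for K
  proof (cases "K = {}")
    case False
    let ?E = "torus_map ` K"
    have E: "closed ?E" "?E \<noteq> {}"
      using compact_continuous_image[OF torus_map_continuous K(1)] compact_imp_closed False by auto
    \<comment> \<open>Tents around the image of \<open>K\<close>, which is closed in the torus. As \<open>torus_map\<close> is injective on the cell, no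
      point of the cell outside of \<open>K\<close> is mapped to it.\<close>
    define h where "h n w = max 0 (1 - real n * infdist w ?E)" for n w
    have hc: "continuous_on UNIV (h n)" for n unfolding h_def by (intro continuous_intros)
    have h01: "0 \<le> h n w" "h n w \<le> 1" for n w using infdist_nonneg[of w ?E] by (auto simp: h_def)
    have lim: "(\<lambda>n. h n (torus_map z)) \<longlonglongrightarrow> indicator K z" if z: "z \<in> cell" for z
    proof (cases "z \<in> K")
      case True
      then have "infdist (torus_map z) ?E = 0" by (intro infdist_zero imageI)
      then show ?thesis using True by (simp add: h_def)
    next
      case False
      have "torus_map z \<notin> ?E" using False torus_map_inj z K(2) by (auto simp: inj_on_def)
      then have pos: "infdist (torus_map z) ?E > 0" by (rule infdist_pos_not_in_closed[OF E])
      obtain n0 where n0: "1 / infdist (torus_map z) ?E < real n0" using reals_Archimedean2 by blast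
      have "h n (torus_map z) = 0" if "n \<ge> n0" for n
      proof -
        have "1 / infdist (torus_map z) ?E \<le> real n" using n0 that by linarith
        then have "1 \<le> real n * infdist (torus_map z) ?E" using pos by (simp add: pos_divide_le_eq)
        then show ?thesis by (simp add: h_def)
      qed
      then have "(\<lambda>n. h n (torus_map z)) \<longlonglongrightarrow> 0"
        by (intro tendsto_eventually eventually_sequentiallyI[of n0])
      then show ?thesis using False by simp
    qed
    have "(\<lambda>n. \<integral>z. f z * of_real (h n (torus_map z)) \<partial>?M) \<longlonglongrightarrow> (\<integral>z. indicator K z *\<^sub>R f z \<partial>?M)"
    proof (rule integral_dominated_convergence[where w = "\<lambda>z. cmod (f z)"])
      have "K \<in> sets ?M" using K by (simp add: sets_restrict_space_iff borel_compact)
      then show "(\<lambda>z. indicator K z *\<^sub>R f z) \<in> borel_measurable ?M" by measurable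
      show "(\<lambda>z. f z * of_real (h n (torus_map z))) \<in> borel_measurable ?M" for n
        by (intro borel_measurable_times fm measurable_on_cell continuous_lebesgue_measurable continuous_on_of_real
            continuous_on_compose2[OF hc] torus_map_continuous) simp
      show "AE z in ?M. (\<lambda>n. f z * of_real (h n (torus_map z))) \<longlonglongrightarrow> indicator K z *\<^sub>R f z"
      proof (rule AE_I2)
        fix z assume "z \<in> space ?M"
        then have "(\<lambda>n. f z * of_real (h n (torus_map z))) \<longlonglongrightarrow> f z * of_real (indicator K z)"
          by (intro tendsto_mult tendsto_const tendsto_of_real lim) simp
        then show "(\<lambda>n. f z * of_real (h n (torus_map z))) \<longlonglongrightarrow> indicator K z *\<^sub>R f z"
          by (simp add: scaleR_conv_of_real mult.commute)
      qed
      show "AE z in ?M. norm (f z * of_real (h n (torus_map z))) \<le> cmod (f z)" for n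
        by (rule AE_I2) (use h01 in \<open>simp add: norm_mult mult_left_le\<close>)
    qed (use fi in simp)
    then have "(\<lambda>n. 0) \<longlonglongrightarrow> (\<integral>z. indicator K z *\<^sub>R f z \<partial>?M)" by (simp only: cont0[OF hc])
    from LIMSEQ_unique[OF tendsto_const this] show ?thesis by simp
  qed simp
  show ?thesis
  proof (rule density_zero[OF fi])
    fix A assume A: "A \<in> sets ?M"
    then have Al: "A \<in> sets lebesgue" "A \<subseteq> cell" by (auto simp: sets_restrict_space_iff)
    define Q where "Q = (\<integral>z. (cmod (f z))\<^sup>2 \<partial>?M)"
    have Q: "Q \<ge> 0" by (simp add: Q_def)
    have "cmod (\<integral>z. indicator A z *\<^sub>R f z \<partial>?M) \<le> 0"
    proof (rule field_le_epsilon)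
      fix e :: real assume e: "e > 0"
      \<comment> \<open>The weight of the arithmetic-geometric mean inequality: it makes the contribution of the square of \<open>f\<close>
        at most \<open>e\<close>, and the measure of \<open>A - K\<close> is chosen afterwards.\<close>
      define c where "c = (Q + 1) / e"
      have c: "c > 0" using e Q by (simp add: c_def add_nonneg_pos)
      obtain K where K: "closed K" "K \<subseteq> A" "A - K \<in> lmeasurable" "emeasure lebesgue (A - K) < ennreal (e / c)"
        using sets_lebesgue_inner_closed[OF Al(1), of "e / c"] e c by auto
      have Kc: "compact K" using K(1,2) Al(2) cell_bounded bounded_subset compact_eq_bounded_closed by blast
      have B: "A - K \<in> sets ?M" using A K Kc Al by (auto simp: sets_restrict_space_iff borel_compact)
      have Km: "K \<in> sets ?M" using Kc K(2) Al(2) by (auto simp: sets_restrict_space_iff borel_compact)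
      have i: "integrable ?M (\<lambda>z. indicator K z *\<^sub>R f z)" "integrable ?M (\<lambda>z. indicator (A - K) z *\<^sub>R f z)"
        by (rule integrable_mult_indicator[OF Km fi] integrable_mult_indicator[OF B fi])+
      have mB: "measure ?M (A - K) < e / c"
      proof -
        have "measure ?M (A - K) = measure lebesgue (A - K)"
          using Al(2) by (intro measure_restrict_space) auto
        moreover have "emeasure lebesgue (A - K) = ennreal (measure lebesgue (A - K))"
          using K(3) by (simp add: emeasure_eq_measure2)
        ultimately show ?thesis using K(4) e c by (simp add: ennreal_less_iff)
      qed
      have "(\<integral>z. indicator A z *\<^sub>R f z \<partial>?M) = (\<integral>z. indicator K z *\<^sub>R f z + indicator (A - K) z *\<^sub>R f z \<partial>?M)"
        by (rule Bochner_Integration.integral_cong) (use K(2) in \<open>auto simp: indicator_def\<close>)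
      also have "\<dots> = (\<integral>z. indicator (A - K) z *\<^sub>R f z \<partial>?M)"
        using compact0[OF Kc] K(2) Al(2) by (subst Bochner_Integration.integral_add[OF i]) auto
      finally have "cmod (\<integral>z. indicator A z *\<^sub>R f z \<partial>?M) \<le> (\<integral>z. cmod (indicator (A - K) z *\<^sub>R f z) \<partial>?M)"
        by (simp only: integral_norm_bound)
      also have "\<dots> \<le> (\<integral>z. (c * indicator (A - K) z + (cmod (f z))\<^sup>2 / c) / 2 \<partial>?M)"
      proof (rule integral_mono[OF integrable_norm[OF i(2)]])
        show "integrable ?M (\<lambda>z. (c * indicator (A - K) z + (cmod (f z))\<^sup>2 / c) / 2)"
          using square_integrableD(2)[OF f] B by (auto intro!: integrable_real_indicator simp: less_top[symmetric])
        fix z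
        have "0 \<le> (c - cmod (f z))\<^sup>2 / c" using c by simp
        also have "\<dots> = c - 2 * cmod (f z) + (cmod (f z))\<^sup>2 / c" using c by (simp add: power2_eq_square field_simps)
        finally have "cmod (f z) \<le> (c + (cmod (f z))\<^sup>2 / c) / 2" by simp
        then show "cmod (indicator (A - K) z *\<^sub>R f z) \<le> (c * indicator (A - K) z + (cmod (f z))\<^sup>2 / c) / 2"
          using c by (auto simp: indicator_def)
      qed
      also have "\<dots> = (c * measure ?M (A - K) + Q / c) / 2"
      proof -
        have "(A - K) \<inter> cell = A - K" using Al(2) by auto
        then show ?thesis unfolding Q_def using square_integrableD(2)[OF f] B by (simp add: less_top[symmetric])
      qed
      also have "\<dots> \<le> (e + e) / 2"
      proof (intro divide_right_mono add_mono)
        show "c * measure ?M (A - K) \<le> e" using mB c by (simp add: pos_less_divide_eq mult.commute less_imp_le)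
        have "Q / c = e * (Q / (Q + 1))" using Q e by (simp add: c_def)
        also have "\<dots> \<le> e * 1" by (rule mult_left_mono) (use Q e in auto)
        finally show "Q / c \<le> e" by simp
      qed simp
      finally show "cmod (\<integral>z. indicator A z *\<^sub>R f z \<partial>?M) \<le> 0 + e" by simp
    qed
    then show "set_lebesgue_integral ?M A f = 0" by (simp add: set_lebesgue_integral_def)
  qed
qed

lemma orthonormal_basis_modes: "orthonormal_basis (lebesgue_on cell) basis"
proof -
  interpret finite_measure "lebesgue_on cell" by (rule finite_measure_cell)
  show ?thesis
  proof
    show "basis p \<in> borel_measurable (lebesgue_on cell)" for p
      unfolding basis_def[abs_def] by (intro borel_measurable_divide measurable_on_cell[OF mode_measurable]) simp
    show "\<exists>K. \<forall>z. cmod (basis p z) \<le> K" for p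
      by (intro exI[of _ "1 / sqrt area"]) (use area_pos in \<open>simp add: basis_def norm_divide\<close>)
    show "(\<integral>z. basis p z * cnj (basis q z) \<partial>lebesgue_on cell) = (if p = q then 1 else 0)" for p q
    proof -
      have "basis p z * cnj (basis q z) = mode (p - q) z / of_real area" for z
        using area_pos mode_mult[of p z "- q"]
        by (simp add: basis_def cnj_mode of_real_mult[symmetric] del: of_real_mult)
      then have "(\<integral>z. basis p z * cnj (basis q z) \<partial>lebesgue_on cell) = (\<integral>z. mode (p - q) z \<partial>lebesgue_on cell) / of_real area"
        by simp
      also have "\<dots> = (if p = q then 1 else 0)"
      proof (cases "p = q")
        case True
        have "mode (p - q) z = 1" for z using True by (simp add: mode_cis)
        then have "(\<integral>z. mode (p - q) z \<partial>lebesgue_on cell) = of_real (measure (lebesgue_on cell) cell)"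
          by (simp add: scaleR_conv_of_real)
        also have "measure (lebesgue_on cell) cell = area" unfolding area_def by (rule measure_restrict_space) auto
        finally show ?thesis using True area_pos by simp
      next
        case False
        then have "p - q \<noteq> (0, 0)" by (metis eq_iff_diff_eq_0 zero_prod_def)
        then show ?thesis using False integral_mode_cell by simp
      qed
      finally show ?thesis .
    qed
    show "AE z in lebesgue_on cell. f z = 0"
      if "square_integrable (lebesgue_on cell) f" "\<And>p. (\<integral>z. f z * cnj (basis p z) \<partial>lebesgue_on cell) = 0" for f
      by (rule fourier_complete) (use that in auto)
  qed
qed

sublocale fourier: orthonormal_basis "lebesgue_on cell" basis
  by (rule orthonormal_basis_modes)

end

section \<open>Periodic extension and test functions\<close>

context lattice_frame
begin

text \<open>The index of the lattice vector that moves \<open>z\<close> into the cell.\<close>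

definition cell_index :: "complex \<Rightarrow> int \<times> int" where
  "cell_index z = (- \<lfloor>s z\<rfloor>, - \<lfloor>t z\<rfloor>)"

definition reduce :: "complex \<Rightarrow> complex" where
  "reduce z = z + shift (cell_index z)"

definition periodize :: "(complex \<Rightarrow> complex) \<Rightarrow> complex \<Rightarrow> complex" where
  "periodize h z = h (reduce z)"

lemma shift_add: "shift (p + q) = shift p + shift q"
  by (simp add: shift_def algebra_simps)

lemma mem_cell_shift_iff: "z + shift p \<in> cell \<longleftrightarrow> p = cell_index z"
  by (cases p) (auto simp: cell_def cell_index_def s_add t_add, linarith+)

lemma reduce_in_cell: "reduce z \<in> cell"
  unfolding reduce_def mem_cell_shift_iff ..

lemma shift_0: "shift (0, 0) = 0" by (simp add: shift_def)

lemma reduce_cell: "z \<in> cell \<Longrightarrow> reduce z = z"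
proof -
  assume "z \<in> cell"
  then have "cell_index z = (0, 0)" using mem_cell_shift_iff[of z "(0, 0)"] unfolding shift_0 add_0_right by (rule sym[OF iffD1[rotated]])
  then show ?thesis by (simp add: reduce_def shift_0)
qed

lemma reduce_shift: "reduce (z + shift p) = reduce z"
proof -
  have "cell_index (z + shift p) = cell_index z - p"
    by (cases p) (simp add: cell_index_def s_add t_add)
  then have "shift (cell_index (z + shift p)) + shift p = shift (cell_index z)"
    using shift_add[of "cell_index z - p" p] by simp
  then show ?thesis unfolding reduce_def by (metis add.assoc add.commute)
qed

lemma periodize_shift: "periodize h (z + shift p) = periodize h z"
  by (simp add: periodize_def reduce_shift)

lemma zero_extension_measurable:
  fixes h :: "complex \<Rightarrow> complex"
  assumes "h \<in> borel_measurable (lebesgue_on cell)"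
  shows "(\<lambda>z. indicator cell z *\<^sub>R h z) \<in> borel_measurable lebesgue"
  using assms borel_measurable_restrict_space_iff[of cell lebesgue h] by simp

lemma periodize_measurable:
  assumes h: "h \<in> borel_measurable (lebesgue_on cell)"
  shows "periodize h \<in> borel_measurable lebesgue"
proof (rule borel_measurableI)
  fix S :: "complex set" assume S: "open S"
  let ?g = "\<lambda>z. indicator cell z *\<^sub>R h z"
  have A: "cell \<inter> ?g -` S \<in> sets lebesgue"
  proof -
    have "?g -` S \<inter> space lebesgue \<in> sets lebesgue"
      by (rule measurable_sets[OF zero_extension_measurable[OF h]]) (use S in simp)
    then show ?thesis using cell_lebesgue by auto
  qed
  have "(\<lambda>z. z + shift p) -` (cell \<inter> ?g -` S) \<in> sets lebesgue" for p
    using measurable_sets[OF measurable_lebesgue_translation A, of "shift p"] by simp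
  then have "(\<Union>p. (\<lambda>z. z + shift p) -` (cell \<inter> ?g -` S)) \<in> sets lebesgue" by blast
  also have "(\<Union>p. (\<lambda>z. z + shift p) -` (cell \<inter> ?g -` S)) = periodize h -` S \<inter> space lebesgue"
    by (auto simp: periodize_def reduce_def mem_cell_shift_iff reduce_in_cell[unfolded reduce_def])
  finally show "periodize h -` S \<inter> space lebesgue \<in> sets lebesgue" .
qed

definition cells_meeting :: "real \<Rightarrow> (int \<times> int) set" where
  "cells_meeting R = (let m = \<lceil>(cmod \<sigma> + cmod \<tau>) * R\<rceil> + 1 in {-m..m} \<times> {-m..m})"

lemma finite_cells_meeting: "finite (cells_meeting R)"
  by (simp add: cells_meeting_def Let_def)

lemma cell_index_in_cells_meeting:
  assumes "z \<in> cball 0 R"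
  shows "cell_index z \<in> cells_meeting R"
proof -
  have R: "cmod z \<le> R" using assms by simp
  have "\<bar>s z\<bar> \<le> cmod \<sigma> * cmod z" "\<bar>t z\<bar> \<le> cmod \<tau> * cmod z"
    unfolding s_def t_def using abs_Re_le_cmod[of "cnj \<sigma> * z"] abs_Re_le_cmod[of "cnj \<tau> * z"] by (simp_all only: norm_mult complex_mod_cnj)
  moreover have "cmod \<sigma> * cmod z \<le> (cmod \<sigma> + cmod \<tau>) * R" "cmod \<tau> * cmod z \<le> (cmod \<sigma> + cmod \<tau>) * R"
    by (intro mult_mono R; use R norm_ge_zero[of z] in simp)+
  ultimately have "\<bar>s z\<bar> \<le> (cmod \<sigma> + cmod \<tau>) * R" "\<bar>t z\<bar> \<le> (cmod \<sigma> + cmod \<tau>) * R" by linarith+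
  then have "\<bar>\<lfloor>s z\<rfloor>\<bar> \<le> \<lceil>(cmod \<sigma> + cmod \<tau>) * R\<rceil> + 1" "\<bar>\<lfloor>t z\<rfloor>\<bar> \<le> \<lceil>(cmod \<sigma> + cmod \<tau>) * R\<rceil> + 1" by linarith+
  then show ?thesis by (auto simp: cells_meeting_def Let_def cell_index_def)
qed

text \<open>A ball meets finitely many translated cells, and the periodic extension has the same mean square on
  each of them.\<close>

lemma periodize_square_integrable:
  assumes h: "square_integrable (lebesgue_on cell) h"
  shows "square_integrable (lebesgue_on (cball 0 R)) (periodize h)"
    and "(\<integral>z. (cmod (periodize h z))\<^sup>2 \<partial>lebesgue_on (cball 0 R)) \<le> card (cells_meeting R) * (\<integral>z. (cmod (h z))\<^sup>2 \<partial>lebesgue_on cell)"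
proof -
  let ?g = "\<lambda>z. indicator cell z *\<^sub>R h z"
  let ?B = "cball 0 R :: complex set"
  have hm: "h \<in> borel_measurable (lebesgue_on cell)" by (rule square_integrableD(1)[OF h])
  have gm: "?g \<in> borel_measurable lebesgue" by (rule zero_extension_measurable[OF hm])
  have gsq: "(cmod (?g z))\<^sup>2 = indicator cell z *\<^sub>R (cmod (h z))\<^sup>2" for z by (simp add: indicator_def)
  have gi: "integrable lebesgue (\<lambda>z. (cmod (?g z))\<^sup>2)"
    and ge: "(\<integral>z. (cmod (?g z))\<^sup>2 \<partial>lebesgue) = (\<integral>z. (cmod (h z))\<^sup>2 \<partial>lebesgue_on cell)"
    unfolding gsq using square_integrableD(2)[OF h] by (simp_all add: integrable_restrict_space integral_restrict_space)
  note tr = lebesgue_integral_translation[OF borel_measurable_integrable[OF gi]]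
  have sumi: "integrable lebesgue (\<lambda>z. \<Sum>p\<in>cells_meeting R. (cmod (?g (z + shift p)))\<^sup>2)"
    by (intro Bochner_Integration.integrable_sum) (use tr(2) gi in blast)
  have sume: "(\<integral>z. (\<Sum>p\<in>cells_meeting R. (cmod (?g (z + shift p)))\<^sup>2) \<partial>lebesgue) = card (cells_meeting R) * (\<integral>z. (cmod (h z))\<^sup>2 \<partial>lebesgue_on cell)"
  proof (subst Bochner_Integration.integral_sum)
    show "integrable lebesgue (\<lambda>z. (cmod (?g (z + shift p)))\<^sup>2)" for p using tr(2) gi by blast
    show "(\<Sum>p\<in>cells_meeting R. \<integral>z. (cmod (?g (z + shift p)))\<^sup>2 \<partial>lebesgue) = card (cells_meeting R) * (\<integral>z. (cmod (h z))\<^sup>2 \<partial>lebesgue_on cell)"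
      unfolding tr(1) ge by simp
  qed
  have pm: "periodize h \<in> borel_measurable lebesgue" by (rule periodize_measurable[OF hm])
  have le: "indicator ?B z *\<^sub>R (cmod (periodize h z))\<^sup>2 \<le> (\<Sum>p\<in>cells_meeting R. (cmod (?g (z + shift p)))\<^sup>2)" for z
  proof (cases "z \<in> ?B")
    case True
    have "(cmod (periodize h z))\<^sup>2 = (cmod (?g (z + shift (cell_index z))))\<^sup>2"
      using reduce_in_cell[of z] by (simp add: periodize_def reduce_def)
    also have "\<dots> \<le> (\<Sum>p\<in>cells_meeting R. (cmod (?g (z + shift p)))\<^sup>2)"
      by (rule member_le_sum[OF cell_index_in_cells_meeting[OF True]]) (auto simp: finite_cells_meeting)
    finally show ?thesis using True by simp
  qed (simp add: sum_nonneg)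
  have bi: "integrable lebesgue (\<lambda>z. indicator ?B z *\<^sub>R (cmod (periodize h z))\<^sup>2)"
  proof (rule Bochner_Integration.integrable_bound[OF sumi])
    show "(\<lambda>z. indicator ?B z *\<^sub>R (cmod (periodize h z))\<^sup>2) \<in> borel_measurable lebesgue"
    proof -
      note [measurable] = pm
      have [measurable]: "?B \<in> sets lebesgue" by simp
      show ?thesis by measurable
    qed
    show "AE z in lebesgue. norm (indicator ?B z *\<^sub>R (cmod (periodize h z))\<^sup>2) \<le> norm (\<Sum>p\<in>cells_meeting R. (cmod (?g (z + shift p)))\<^sup>2)"
    proof (rule AE_I2)
      fix z
      have "norm (indicator ?B z *\<^sub>R (cmod (periodize h z))\<^sup>2) = indicator ?B z *\<^sub>R (cmod (periodize h z))\<^sup>2" by simp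
      also have "\<dots> \<le> (\<Sum>p\<in>cells_meeting R. (cmod (?g (z + shift p)))\<^sup>2)" by (rule le)
      also have "\<dots> \<le> norm (\<Sum>p\<in>cells_meeting R. (cmod (?g (z + shift p)))\<^sup>2)" by simp
      finally show "norm (indicator ?B z *\<^sub>R (cmod (periodize h z))\<^sup>2) \<le> norm (\<Sum>p\<in>cells_meeting R. (cmod (?g (z + shift p)))\<^sup>2)" .
    qed
  qed
  show "square_integrable (lebesgue_on ?B) (periodize h)"
    unfolding square_integrable_def using bi measurable_restrict_space1[OF pm] by (simp add: integrable_restrict_space)
  have "(\<integral>z. (cmod (periodize h z))\<^sup>2 \<partial>lebesgue_on ?B) = (\<integral>z. indicator ?B z *\<^sub>R (cmod (periodize h z))\<^sup>2 \<partial>lebesgue)"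
    by (rule integral_restrict_space) simp
  also have "\<dots> \<le> (\<integral>z. (\<Sum>p\<in>cells_meeting R. (cmod (?g (z + shift p)))\<^sup>2) \<partial>lebesgue)"
    by (rule integral_mono[OF bi sumi le])
  finally show "(\<integral>z. (cmod (periodize h z))\<^sup>2 \<partial>lebesgue_on ?B) \<le> card (cells_meeting R) * (\<integral>z. (cmod (h z))\<^sup>2 \<partial>lebesgue_on cell)"
    unfolding sume .
qed

lemma square_integrable_imp_integrable_ball:
  assumes "square_integrable (lebesgue_on (cball 0 R)) h"
  shows "integrable (lebesgue_on (cball (0::complex) R)) h"
proof -
  interpret finite_measure "lebesgue_on (cball (0::complex) R)" by (rule finite_measure_lebesgue_on) simp
  have "square_integrable (lebesgue_on (cball (0::complex) R)) (\<lambda>_. 1)"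
    using integrable_const[of "1 :: real"] by (simp add: square_integrable_def)
  from integrable_mult_cnj[OF assms this] show ?thesis by simp
qed

text \<open>A bilinear pairing of \<open>\<psi>\<close>, a function of compact support in the applications, with the periodic
  extension of a function \<open>h\<close> on the cell.\<close>

definition pairing :: "(complex \<Rightarrow> complex) \<Rightarrow> (complex \<Rightarrow> complex) \<Rightarrow> complex" where
  "pairing \<psi> h = (\<integral>z. periodize h z * \<psi> z \<partial>lebesgue)"

context
  fixes \<psi> :: "complex \<Rightarrow> complex" and R :: real
  assumes \<psi>_continuous: "continuous_on UNIV \<psi>"
    and \<psi>_support: "\<forall>z. cmod z > R \<longrightarrow> \<psi> z = 0"
begin

lemmas \<psi> = \<psi>_continuous \<psi>_support[rule_format]

lemma pairing_integrable:
  "square_integrable (lebesgue_on cell) h \<Longrightarrow> integrable lebesgue (\<lambda>z. periodize h z * \<psi> z)"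
  by (rule integrable_mult_compact_support[OF square_integrable_imp_integrable_ball[OF periodize_square_integrable(1)] \<psi>])

lemma pairing_diff:
  "square_integrable (lebesgue_on cell) h \<Longrightarrow> square_integrable (lebesgue_on cell) g \<Longrightarrow>
    pairing \<psi> (\<lambda>z. h z - g z) = pairing \<psi> h - pairing \<psi> g"
  using pairing_integrable[of h] pairing_integrable[of g]
  by (simp add: pairing_def periodize_def left_diff_distrib)

text \<open>Continuity of the pairing in mean square; the weight \<open>c\<close> balances the two terms of the
  arithmetic-geometric mean inequality.\<close>

lemma pairing_small:
  assumes e: "e > 0"
  obtains d where "d > 0" "\<And>h. square_integrable (lebesgue_on cell) h \<Longrightarrow> (\<integral>z. (cmod (h z))\<^sup>2 \<partial>lebesgue_on cell) \<le> d \<Longrightarrow> cmod (pairing \<psi> h) \<le> e"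
proof -
  let ?B = "cball 0 R :: complex set"
  let ?M = "lebesgue_on ?B"
  have fin: "finite_measure ?M" by (rule finite_measure_lebesgue_on) simp
  have psq: "integrable ?M (\<lambda>z. (cmod (\<psi> z))\<^sup>2)"
  proof -
    have "integrable lborel (\<lambda>z. indicator ?B z *\<^sub>R (cmod (\<psi> z))\<^sup>2)"
      by (rule borel_integrable_compact[OF compact_cball]) (intro continuous_intros continuous_on_subset[OF \<psi>(1)]; simp)
    then show ?thesis by (simp add: integrable_restrict_space integrable_completion)
  qed
  define P where "P = (\<integral>z. (cmod (\<psi> z))\<^sup>2 \<partial>?M)"
  have P: "P \<ge> 0" by (simp add: P_def)
  define c where "c = e / (P + 1)"
  have c: "c > 0" using e P by (simp add: c_def add_nonneg_pos)
  define n where "n = real (card (cells_meeting R)) + 1"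
  have n: "n > 0" by (simp add: n_def add_nonneg_pos)
  define d where "d = c * e / n"
  have d: "d > 0" using c e n by (simp add: d_def)
  have "cmod (pairing \<psi> h) \<le> e" if h: "square_integrable (lebesgue_on cell) h" "(\<integral>z. (cmod (h z))\<^sup>2 \<partial>lebesgue_on cell) \<le> d" for h
  proof -
    note ph = periodize_square_integrable[OF h(1), of R]
    have i: "integrable lebesgue (\<lambda>z. periodize h z * \<psi> z)" by (rule pairing_integrable[OF h(1)])
    have eq: "indicator ?B z *\<^sub>R (periodize h z * \<psi> z) = periodize h z * \<psi> z" for z
      using \<psi>(2)[of z] by (cases "z \<in> ?B") auto
    have i2: "integrable ?M (\<lambda>z. periodize h z * \<psi> z)" using i by (simp add: integrable_restrict_space eq)
    have "pairing \<psi> h = (\<integral>z. periodize h z * \<psi> z \<partial>?M)"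
      unfolding pairing_def by (simp add: integral_restrict_space eq)
    then have "cmod (pairing \<psi> h) \<le> (\<integral>z. cmod (periodize h z * \<psi> z) \<partial>?M)" by (simp only: integral_norm_bound)
    also have "\<dots> \<le> (\<integral>z. (c * (cmod (\<psi> z))\<^sup>2 + (cmod (periodize h z))\<^sup>2 / c) / 2 \<partial>?M)"
    proof (rule integral_mono[OF integrable_norm[OF i2]])
      show "integrable ?M (\<lambda>z. (c * (cmod (\<psi> z))\<^sup>2 + (cmod (periodize h z))\<^sup>2 / c) / 2)"
        using psq square_integrableD(2)[OF ph(1)] by simp
      fix z
      have "0 \<le> (c * cmod (\<psi> z) - cmod (periodize h z))\<^sup>2 / c" using c by simp
      also have "\<dots> = c * (cmod (\<psi> z))\<^sup>2 - 2 * (cmod (periodize h z) * cmod (\<psi> z)) + (cmod (periodize h z))\<^sup>2 / c"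
        using c by (simp add: power2_eq_square field_simps)
      finally show "cmod (periodize h z * \<psi> z) \<le> (c * (cmod (\<psi> z))\<^sup>2 + (cmod (periodize h z))\<^sup>2 / c) / 2"
        by (simp add: norm_mult)
    qed
    also have "\<dots> = (c * P + (\<integral>z. (cmod (periodize h z))\<^sup>2 \<partial>?M) / c) / 2"
      unfolding P_def using psq square_integrableD(2)[OF ph(1)] by simp
    also have "\<dots> \<le> (e + e) / 2"
    proof (intro divide_right_mono add_mono)
      have "c * P \<le> c * (P + 1)" using c by (intro mult_left_mono) auto
      also have "\<dots> = e" using P by (simp add: c_def add_nonneg_eq_0_iff)
      finally show "c * P \<le> e" .
      have "(\<integral>z. (cmod (periodize h z))\<^sup>2 \<partial>?M) \<le> card (cells_meeting R) * (\<integral>z. (cmod (h z))\<^sup>2 \<partial>lebesgue_on cell)" by (rule ph(2))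
      also have "\<dots> \<le> n * d" by (intro mult_mono h(2)) (use n in \<open>auto simp: n_def\<close>)
      also have "\<dots> = e * c" using n by (simp add: d_def)
      finally show "(\<integral>z. (cmod (periodize h z))\<^sup>2 \<partial>?M) / c \<le> e" using c by (simp add: pos_divide_le_eq)
    qed simp
    finally show ?thesis by simp
  qed
  then show thesis using that[OF d] by blast
qed

text \<open>Fourier series converge in mean square, which by \<open>pairing_small\<close> suffices to integrate them termwise
  against a function of compact support.\<close>

lemma pairing_has_sum:
  assumes h: "square_integrable (lebesgue_on cell) h"
  shows "((\<lambda>p. fourier.coef h p * (\<integral>z. basis p z * \<psi> z \<partial>lebesgue)) has_sum pairing \<psi> h) UNIV"
  unfolding has_sum_def
proof (rule tendstoI)
  fix e :: real assume e: "e > 0"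
  obtain d where d: "d > 0" "\<And>h. square_integrable (lebesgue_on cell) h \<Longrightarrow> (\<integral>z. (cmod (h z))\<^sup>2 \<partial>lebesgue_on cell) \<le> d \<Longrightarrow> cmod (pairing \<psi> h) \<le> e / 2"
    by (rule pairing_small[of "e / 2"]) (use e in \<open>auto intro: that\<close>)
  obtain S0 where S0: "finite S0" "\<And>S. finite S \<Longrightarrow> S0 \<subseteq> S \<Longrightarrow>
      (\<integral>z. (cmod (h z - fourier.partial_sum S (fourier.coef h) z))\<^sup>2 \<partial>lebesgue_on cell) \<le> d"
    by (rule fourier.partial_sum_approx[OF h d(1)]) (rule that; assumption)
  have basis_per: "basis p (reduce z) = basis p z" for p z by (simp add: basis_def reduce_def mode_shift)
  have bi: "integrable lebesgue (\<lambda>z. basis p z * \<psi> z)" for p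
    using pairing_integrable[OF fourier.basis_square_integrable, of p] by (simp add: periodize_def basis_per)
  have "dist (\<Sum>p\<in>S. fourier.coef h p * (\<integral>z. basis p z * \<psi> z \<partial>lebesgue)) (pairing \<psi> h) < e"
    if S: "finite S" "S0 \<subseteq> S" for S
  proof -
    let ?p = "fourier.partial_sum S (fourier.coef h)"
    note p = fourier.partial_sum_square_integrable[of S "fourier.coef h"]
    have "periodize ?p z * \<psi> z = (\<Sum>p\<in>S. fourier.coef h p * (basis p z * \<psi> z))" for z
      by (simp add: periodize_def fourier.partial_sum_def basis_per sum_distrib_right mult.assoc)
    then have "pairing \<psi> ?p = (\<Sum>p\<in>S. fourier.coef h p * (\<integral>z. basis p z * \<psi> z \<partial>lebesgue))"
      unfolding pairing_def by (simp add: Bochner_Integration.integral_sum bi)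
    moreover have "cmod (pairing \<psi> (\<lambda>z. h z - ?p z)) \<le> e / 2"
      by (rule d(2)[OF square_integrable_diff[OF h p] S0(2)[OF S]])
    ultimately show ?thesis using e by (simp add: pairing_diff[OF h p] dist_norm norm_minus_commute)
  qed
  then show "\<forall>\<^sub>F S in finite_subsets_at_top UNIV. dist (\<Sum>p\<in>S. fourier.coef h p * (\<integral>z. basis p z * \<psi> z \<partial>lebesgue)) (pairing \<psi> h) < e"
    unfolding eventually_finite_subsets_at_top using S0(1) by blast
qed

end

lemma wave_add: "wave p q z * wave p' q' z = wave (p + p') (q + q') z"
  by (simp add: wave_def exp_add[symmetric] algebra_simps)

lemma wave_continuous: "continuous_on A (wave p q)"
  unfolding wave_def[abs_def] by (intro continuous_intros)

lemma cnj_freq: "of_real (Re (freq p)) - \<i> * of_real (Im (freq p)) = cnj (freq p)"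
  "of_real (Re (freq p)) + \<i> * of_real (Im (freq p)) = freq p"
  by (simp_all add: complex_eq_iff)

lemma integral_basis_wave_del:
  assumes \<phi>: "test_function \<phi>"
  shows "(\<integral>z. basis p z * (wave k l z * del \<phi> z) \<partial>lebesgue)
      = - (pi * \<i> * (k - \<i> * l + cnj (freq p))) * (\<integral>z. basis p z * (wave k l z * \<phi> z) \<partial>lebesgue)"
    and "(\<integral>z. basis p z * (wave k l z * delbar \<phi> z) \<partial>lebesgue)
      = - (pi * \<i> * (k + \<i> * l + freq p)) * (\<integral>z. basis p z * (wave k l z * \<phi> z) \<partial>lebesgue)"
proof -
  obtain R where R: "\<And>z. \<phi> differentiable (at z)" "continuous_on UNIV (partial1 \<phi>)" "continuous_on UNIV (partial2 \<phi>)"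
    "\<And>z. cmod z \<ge> R \<Longrightarrow> \<phi> z = 0"
    by (rule test_functionD[OF \<phi>]) (rule that; assumption)
  have b: "basis p z * (wave k l z * v) = (wave (k + of_real (Re (freq p))) (l + of_real (Im (freq p))) z * v) * (1 / sqrt area)" for z v
    unfolding basis_def mode_def wave_add[symmetric] by simp
  have k1: "k + of_real (Re (freq p)) - \<i> * (l + of_real (Im (freq p))) = k - \<i> * l + cnj (freq p)"
    and k2: "k + of_real (Re (freq p)) + \<i> * (l + of_real (Im (freq p))) = k + \<i> * l + freq p"
    using cnj_freq[of p] by (simp_all add: algebra_simps)
  let ?W = "wave (k + of_real (Re (freq p))) (l + of_real (Im (freq p)))"
  have w1: "(\<integral>z. ?W z * del \<phi> z \<partial>lebesgue) = - (pi * \<i> * (k - \<i> * l + cnj (freq p))) * (\<integral>z. ?W z * \<phi> z \<partial>lebesgue)"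
    unfolding k1[symmetric] by (rule integral_wave_del(1)[OF R])
  have w2: "(\<integral>z. ?W z * delbar \<phi> z \<partial>lebesgue) = - (pi * \<i> * (k + \<i> * l + freq p)) * (\<integral>z. ?W z * \<phi> z \<partial>lebesgue)"
    unfolding k2[symmetric] by (rule integral_wave_del(2)[OF R])
  show "(\<integral>z. basis p z * (wave k l z * del \<phi> z) \<partial>lebesgue)
      = - (pi * \<i> * (k - \<i> * l + cnj (freq p))) * (\<integral>z. basis p z * (wave k l z * \<phi> z) \<partial>lebesgue)"
    unfolding b integral_mult_left_zero w1 by (rule mult.assoc)
  show "(\<integral>z. basis p z * (wave k l z * delbar \<phi> z) \<partial>lebesgue)
      = - (pi * \<i> * (k + \<i> * l + freq p)) * (\<integral>z. basis p z * (wave k l z * \<phi> z) \<partial>lebesgue)"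
    unfolding b integral_mult_left_zero w2 by (rule mult.assoc)
qed

end

section \<open>Floquet functions and mode equations\<close>

lemma wave_translate: "wave p q (z + w) = wave p q z * wave p q w"
  by (simp add: wave_def exp_add[symmetric] algebra_simps)

lemma wave_nonzero: "wave p q z \<noteq> 0"
  by (simp add: wave_def)

lemma exp_quasi_pairing: "exp (2 * of_real pi * \<i> * quasi_pairing k \<gamma>) = wave (k $ 1) (k $ 2) \<gamma>"
  by (simp add: quasi_pairing_def wave_def)

lemma smooth_wave: "smooth (wave p q)"
proof -
  have "wave p q = (\<lambda>z. exp ((2 * pi * \<i> * p) * of_real (Re z) + (2 * pi * \<i> * q) * of_real (Im z)))"
    by (simp add: wave_def fun_eq_iff algebra_simps)
  then show ?thesis using smooth.exponential by metis
qed

lemma del_wave_mult: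
  assumes v: "v differentiable (at z)"
  shows "del (\<lambda>z. wave p q z * v z) z = wave p q z * del v z + pi * \<i> * (p - \<i> * q) * (wave p q z * v z)"
    and "delbar (\<lambda>z. wave p q z * v z) z = wave p q z * delbar v z + pi * \<i> * (p + \<i> * q) * (wave p q z * v z)"
proof -
  have w: "(wave p q has_derivative (\<lambda>h. of_real (Re h) * (2 * pi * \<i> * p * wave p q z) + of_real (Im h) * (2 * pi * \<i> * q * wave p q z))) (at z)"
  proof -
    have "((\<lambda>z. 2 * pi * \<i> * (p * of_real (Re z) + q * of_real (Im z))) has_derivative (\<lambda>h. 2 * pi * \<i> * (p * of_real (Re h) + q * of_real (Im h)))) (at z)"
      by (auto intro!: derivative_eq_intros)
    from has_derivative_compose[OF this DERIV_exp[unfolded has_field_derivative_def]]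
    show ?thesis unfolding wave_def[abs_def] by (rule has_derivative_eq_rhs) (auto simp: algebra_simps)
  qed
  note d = partials_eq[OF has_derivative_mult[OF w has_derivative_partials[OF v]]]
  show "del (\<lambda>z. wave p q z * v z) z = wave p q z * del v z + pi * \<i> * (p - \<i> * q) * (wave p q z * v z)"
    unfolding del_def d by (simp add: field_simps)
  show "delbar (\<lambda>z. wave p q z * v z) z = wave p q z * delbar v z + pi * \<i> * (p + \<i> * q) * (wave p q z * v z)"
    unfolding delbar_def d by (simp add: field_simps)
qed

lemma continuous_bounded_on_cball:
  fixes g :: "complex \<Rightarrow> complex"
  assumes "continuous_on UNIV g"
  obtains C where "C \<ge> 0" "\<And>z. z \<in> cball 0 R \<Longrightarrow> cmod (g z) \<le> C"
proof -
  have "compact (g ` cball 0 R)"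
    by (intro compact_continuous_image compact_cball continuous_on_subset[OF assms]) auto
  then obtain K where K: "\<And>z. z \<in> cball 0 R \<Longrightarrow> cmod (g z) \<le> K"
    using compact_imp_bounded bounded_iff by (metis imageI)
  show thesis by (rule that[of "max K 0"]) (use K in force)+
qed

lemma norm_vector_2: "(norm (v :: complex ^ 2))\<^sup>2 = (cmod (v $ 1))\<^sup>2 + (cmod (v $ 2))\<^sup>2"
  by (simp add: norm_vec_def L2_set_def sum_2)

locale dirac_frame = lattice_frame +
  fixes U :: "complex \<Rightarrow> complex"
  assumes U_continuous: "continuous_on UNIV U" and U_periodic: "\<And>p z. U (z + shift p) = U z"
begin

lemma U_bounded: obtains C where "\<And>z. cmod (U z) \<le> C"
proof -
  obtain C where C: "\<And>z. z \<in> cball 0 (cmod \<omega>1 + cmod \<omega>2) \<Longrightarrow> cmod (U z) \<le> C"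
    by (rule continuous_bounded_on_cball[OF U_continuous]) (rule that; assumption)
  have "cmod (U z) \<le> C" for z
  proof -
    have "U z = U (reduce z)" by (simp add: reduce_def U_periodic)
    then show ?thesis using C[of "reduce z"] cell_bound[OF reduce_in_cell[of z]] by simp
  qed
  then show thesis by (rule that)
qed

lemma U_measurable: "U \<in> borel_measurable lebesgue"
  by (rule continuous_lebesgue_measurable[OF U_continuous])

text \<open>\<open>N\<close> is the operator that multiplication by the potential induces on Fourier coefficients.\<close>

definition represents_U :: "((int \<times> int) ell2 \<Rightarrow>\<^sub>L (int \<times> int) ell2) \<Rightarrow> bool" where
  "represents_U N \<longleftrightarrow> (\<forall>f x. square_integrable (lebesgue_on cell) f \<longrightarrow> coord x = fourier.coef f \<longrightarrow>
      coord (blinfun_apply N x) = fourier.coef (\<lambda>z. U z * f z))"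

lemma U_mult_square_integrable:
  "square_integrable (lebesgue_on cell) f \<Longrightarrow> square_integrable (lebesgue_on cell) (\<lambda>z. U z * f z)"
  by (rule U_bounded) (rule square_integrable_mult_bounded(1)[OF _ measurable_on_cell[OF U_measurable]])

lemma periodize_U: "periodize (\<lambda>z. U z * h z) z = U z * periodize h z"
  by (simp add: periodize_def reduce_def U_periodic)

text \<open>By \<open>riesz_fischer\<close> there are functions on the cell with the given coefficients; their periodic extensions
  times the wave with wave vector \<open>k\<close> form the Floquet function. In the weak equation both sides are
  expanded in modes, and by \<open>integral_basis_wave_del\<close> the derivative of the test function becomes the factor
  of the mode equations.\<close>

lemma floquet_if_mode_equations:
  assumes N: "represents_U N" and nz: "x \<noteq> 0 \<or> y \<noteq> 0"
    and eq1: "\<And>p. pi * \<i> * (k $ 1 + \<i> * k $ 2 + freq p) * coord x p = coord (blinfun_apply N y) p - E * coord y p"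
    and eq2: "\<And>p. pi * \<i> * (k $ 1 - \<i> * k $ 2 + cnj (freq p)) * coord y p = E * coord x p - coord (blinfun_apply N x) p"
  shows "\<exists>f. floquet_function (range shift) U k E f"
proof -
  let ?M = "lebesgue_on cell"
  let ?W = "wave (k $ 1) (k $ 2)"
  obtain g1 where g1: "square_integrable ?M g1" "fourier.coef g1 = coord x" by (rule fourier.riesz_fischer[of x])
  obtain g2 where g2: "square_integrable ?M g2" "fourier.coef g2 = coord y" by (rule fourier.riesz_fischer[of y])
  define f where "f z = (vector [?W z * periodize g1 z, ?W z * periodize g2 z] :: complex ^ 2)" for z
  have f12: "f z $ 1 = ?W z * periodize g1 z" "f z $ 2 = ?W z * periodize g2 z" for z by (simp_all add: f_def)
  have Wm: "?W \<in> borel_measurable lebesgue" by (rule continuous_lebesgue_measurable[OF wave_continuous])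
  have pm: "periodize g1 \<in> borel_measurable lebesgue" "periodize g2 \<in> borel_measurable lebesgue"
    using periodize_measurable square_integrableD(1) g1(1) g2(1) by blast+
  have loc: "loc_square_integrable f"
    unfolding loc_square_integrable_def
  proof (intro conjI allI impI)
    have c: "continuous_on UNIV (\<lambda>p :: complex \<times> complex. vector [fst p, snd p] :: complex ^ 2)"
    proof -
      have eq: "(\<lambda>p :: complex \<times> complex. vector [fst p, snd p] :: complex ^ 2) = (\<lambda>p. \<chi> j :: 2. if j = 1 then fst p else snd p)"
        by (auto simp: fun_eq_iff Finite_Cartesian_Product.vec_eq_iff forall_2)
      have "continuous_on UNIV (\<lambda>p :: complex \<times> complex. \<chi> j :: 2. if j = 1 then fst p else snd p)"
      proof (rule continuous_on_vec_lambda)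
        fix j :: 2
        show "continuous_on UNIV (\<lambda>p :: complex \<times> complex. if j = 1 then fst p else snd p)"
          by (cases "j = 1") (simp_all add: continuous_on_fst continuous_on_snd continuous_on_id)
      qed
      then show ?thesis unfolding eq .
    qed
    have "(\<lambda>z. (?W z * periodize g1 z, ?W z * periodize g2 z)) \<in> borel_measurable lebesgue"
      by (intro borel_measurable_Pair borel_measurable_times Wm pm)
    from measurable_compose[OF this borel_measurable_continuous_onI[OF c]]
    show fm: "f \<in> borel_measurable lebesgue" by (simp add: f_def[abs_def])
    fix K :: "complex set" assume K: "compact K"
    obtain R where "K \<subseteq> ball 0 R" using bounded_subset_ballD[OF compact_imp_bounded[OF K], of 0] by (elim exE conjE)
    then have R: "K \<subseteq> cball 0 R" using ball_subset_cball by (rule order_trans)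
    obtain C where C: "C \<ge> 0" "\<And>z. z \<in> cball 0 R \<Longrightarrow> cmod (?W z) \<le> C"
      by (rule continuous_bounded_on_cball[OF wave_continuous]) (rule that; assumption)
    have i: "integrable lebesgue (\<lambda>z. indicator (cball 0 R) z *\<^sub>R (C\<^sup>2 * (cmod (periodize g1 z))\<^sup>2 + C\<^sup>2 * (cmod (periodize g2 z))\<^sup>2))"
    proof -
      have "integrable (lebesgue_on (cball 0 R)) (\<lambda>z. C\<^sup>2 * (cmod (periodize g1 z))\<^sup>2 + C\<^sup>2 * (cmod (periodize g2 z))\<^sup>2)"
        using square_integrableD(2)[OF periodize_square_integrable(1)[OF g1(1), of R]]
          square_integrableD(2)[OF periodize_square_integrable(1)[OF g2(1), of R]] by simp
      then show ?thesis by (simp add: integrable_restrict_space)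
    qed
    show "set_integrable lebesgue K (\<lambda>z. (norm (f z))\<^sup>2)"
      unfolding set_integrable_def
    proof (rule Bochner_Integration.integrable_bound[OF i])
      have [measurable]: "K \<in> sets lebesgue" using K by (simp add: borel_compact)
      show "(\<lambda>z. indicator K z *\<^sub>R (norm (f z))\<^sup>2) \<in> borel_measurable lebesgue" using fm by measurable
      show "AE z in lebesgue. norm (indicator K z *\<^sub>R (norm (f z))\<^sup>2)
          \<le> norm (indicator (cball 0 R) z *\<^sub>R (C\<^sup>2 * (cmod (periodize g1 z))\<^sup>2 + C\<^sup>2 * (cmod (periodize g2 z))\<^sup>2))"
      proof (rule AE_I2)
        fix z
        show "norm (indicator K z *\<^sub>R (norm (f z))\<^sup>2)
          \<le> norm (indicator (cball 0 R) z *\<^sub>R (C\<^sup>2 * (cmod (periodize g1 z))\<^sup>2 + C\<^sup>2 * (cmod (periodize g2 z))\<^sup>2))"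
        proof (cases "z \<in> K")
          case True
          then have z: "z \<in> cball 0 R" using R by blast
          have "(norm (f z))\<^sup>2 = (cmod (?W z))\<^sup>2 * (cmod (periodize g1 z))\<^sup>2 + (cmod (?W z))\<^sup>2 * (cmod (periodize g2 z))\<^sup>2"
            by (simp add: norm_vector_2 f12 norm_mult power_mult_distrib)
          also have "\<dots> \<le> C\<^sup>2 * (cmod (periodize g1 z))\<^sup>2 + C\<^sup>2 * (cmod (periodize g2 z))\<^sup>2"
            by (intro add_mono mult_right_mono power_mono C(2)[OF z]) auto
          finally show ?thesis using True z by simp
        qed simp
      qed
    qed
  qed
  have ne: "\<not> (AE z in lebesgue. f z = 0)"
  proof
    assume ae: "AE z in lebesgue. f z = 0"
    have zero: "u = 0" if g: "square_integrable ?M g" "fourier.coef g = coord u"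
      and j: "\<And>z. f z = 0 \<Longrightarrow> periodize g z = 0" for g u
    proof -
      have "AE z in ?M. g z = 0"
      proof (subst AE_restrict_space_iff)
        show "AE z in lebesgue. z \<in> cell \<longrightarrow> g z = 0"
          using ae
        proof eventually_elim
          fix z assume "f z = 0"
          then have "periodize g z = 0" by (rule j)
          then show "z \<in> cell \<longrightarrow> g z = 0" using reduce_cell[of z] by (auto simp only: periodize_def)
        qed
      qed simp
      then have "fourier.coef g p = fourier.coef (\<lambda>_. 0) p" for p
        by (rule fourier.coef_cong_AE) (use square_integrableD(1)[OF g(1)] in auto)
      then have "coord u p = 0" for p using g(2) by (simp add: fourier.coef_def)
      then show ?thesis by (intro coord_ext) simp
    qed
    have "?W z * periodize g1 z = 0" "?W z * periodize g2 z = 0" if "f z = 0" for z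
      using f12[of z] that by simp_all
    then have "x = 0" "y = 0" using zero[OF g1] zero[OF g2] wave_nonzero by auto
    then show False using nz by blast
  qed
  have Ug: "square_integrable ?M (\<lambda>z. U z * g1 z)" "square_integrable ?M (\<lambda>z. U z * g2 z)"
    using U_mult_square_integrable g1(1) g2(1) by blast+
  have Eg: "square_integrable ?M (\<lambda>z. E * g1 z)" "square_integrable ?M (\<lambda>z. E * g2 z)"
    using square_integrable_cmult g1(1) g2(1) by blast+
  have cU: "fourier.coef (\<lambda>z. U z * g1 z) = coord (blinfun_apply N x)" "fourier.coef (\<lambda>z. U z * g2 z) = coord (blinfun_apply N y)"
    using N g1 g2 unfolding represents_U_def by auto
  have dirac: "dirac_eq U f (\<lambda>z. E *s f z)"
    unfolding dirac_eq_def
  proof (intro allI impI)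
    fix \<phi> assume \<phi>: "test_function \<phi>"
    obtain R where R: "\<And>z. \<phi> differentiable (at z)" "continuous_on UNIV \<phi>" "continuous_on UNIV (partial1 \<phi>)" "continuous_on UNIV (partial2 \<phi>)"
      "\<And>z. cmod z \<ge> R \<Longrightarrow> \<phi> z = 0"
      by (rule test_functionD[OF \<phi>]) (rule that; assumption)
    have d0: "partial1 \<phi> z = 0 \<and> partial2 \<phi> z = 0" if z: "cmod z > R" for z
    proof -
      have "(\<phi> has_derivative (\<lambda>_. 0)) (at z)"
      proof (rule has_derivative_transform_within_open[where s = "{z. R < cmod z}"])
        show "((\<lambda>_. 0) has_derivative (\<lambda>_. 0)) (at z)" by simp
        show "open {z. R < cmod z}" by (intro open_Collect_less continuous_intros)
        show "0 = \<phi> x" if "x \<in> {z. R < cmod z}" for x using R(5)[of x] that by simp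
      qed (use z in simp)
      from partials_eq[OF this] show ?thesis by simp
    qed
    have c0: "continuous_on UNIV (\<lambda>z. ?W z * \<phi> z)" "\<forall>z. cmod z > R \<longrightarrow> ?W z * \<phi> z = 0"
      using R(5) by (auto intro!: continuous_intros wave_continuous R(2))
    have c1: "continuous_on UNIV (\<lambda>z. ?W z * del \<phi> z)" "\<forall>z. cmod z > R \<longrightarrow> ?W z * del \<phi> z = 0"
      using d0 by (auto intro!: continuous_intros wave_continuous R(3,4) simp: del_def)
    have c2: "continuous_on UNIV (\<lambda>z. ?W z * delbar \<phi> z)" "\<forall>z. cmod z > R \<longrightarrow> ?W z * delbar \<phi> z = 0"
      using d0 by (auto intro!: continuous_intros wave_continuous R(3,4) simp: delbar_def)
    note sum0 = pairing_has_sum[OF c0] and sum1 = pairing_has_sum[OF c1] and sum2 = pairing_has_sum[OF c2]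
    have A: "pairing (\<lambda>z. ?W z * del \<phi> z) g2 = pairing (\<lambda>z. ?W z * \<phi> z) (\<lambda>z. U z * g1 z - E * g1 z)"
    proof -
      have "fourier.coef g2 p * (\<integral>z. basis p z * (?W z * del \<phi> z) \<partial>lebesgue)
          = fourier.coef (\<lambda>z. U z * g1 z - E * g1 z) p * (\<integral>z. basis p z * (?W z * \<phi> z) \<partial>lebesgue)" for p
      proof -
        have c: "fourier.coef g2 p * - (pi * \<i> * (k $ 1 - \<i> * k $ 2 + cnj (freq p))) = fourier.coef (\<lambda>z. U z * g1 z - E * g1 z) p"
          unfolding fourier.coef_diff[OF Ug(1) Eg(1)] fourier.coef_cmult cU g1(2) g2(2) using eq2[of p] by (simp add: algebra_simps)
        show ?thesis unfolding integral_basis_wave_del(1)[OF \<phi>] c[symmetric] by (simp only: mult.assoc)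
      qed
      then show ?thesis using has_sum_unique[OF sum1[OF g2(1)]] sum0[OF square_integrable_diff[OF Ug(1) Eg(1)]] by simp
    qed
    have B: "pairing (\<lambda>z. ?W z * delbar \<phi> z) g1 = pairing (\<lambda>z. ?W z * \<phi> z) (\<lambda>z. E * g2 z - U z * g2 z)"
    proof -
      have "fourier.coef g1 p * (\<integral>z. basis p z * (?W z * delbar \<phi> z) \<partial>lebesgue)
          = fourier.coef (\<lambda>z. E * g2 z - U z * g2 z) p * (\<integral>z. basis p z * (?W z * \<phi> z) \<partial>lebesgue)" for p
      proof -
        have c: "fourier.coef g1 p * - (pi * \<i> * (k $ 1 + \<i> * k $ 2 + freq p)) = fourier.coef (\<lambda>z. E * g2 z - U z * g2 z) p"
          unfolding fourier.coef_diff[OF Eg(2) Ug(2)] fourier.coef_cmult cU g1(2) g2(2) using eq1[of p] by (simp add: algebra_simps)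
        show ?thesis unfolding integral_basis_wave_del(2)[OF \<phi>] c[symmetric] by (simp only: mult.assoc)
      qed
      then show ?thesis using has_sum_unique[OF sum2[OF g1(1)]] sum0[OF square_integrable_diff[OF Eg(2) Ug(2)]] by simp
    qed
    note i0 = pairing_integrable[OF c0] and i1 = pairing_integrable[OF c1] and i2 = pairing_integrable[OF c2]
    have r1: "- (f z $ 2) * del \<phi> z + U z * f z $ 1 * \<phi> z
        = - (periodize g2 z * (?W z * del \<phi> z)) + periodize (\<lambda>z. U z * g1 z) z * (?W z * \<phi> z)" for z
      by (simp add: f12 periodize_U)
    have r2: "f z $ 1 * delbar \<phi> z + U z * f z $ 2 * \<phi> z
        = periodize g1 z * (?W z * delbar \<phi> z) + periodize (\<lambda>z. U z * g2 z) z * (?W z * \<phi> z)" for z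
      by (simp add: f12 periodize_U)
    have e1: "(E *s f z) $ 1 * \<phi> z = periodize (\<lambda>z. E * g1 z) z * (?W z * \<phi> z)" for z
      by (simp add: f12 periodize_def)
    have e2: "(E *s f z) $ 2 * \<phi> z = periodize (\<lambda>z. E * g2 z) z * (?W z * \<phi> z)" for z
      by (simp add: f12 periodize_def)
    have "(LINT z|lebesgue. - (f z $ 2) * del \<phi> z + U z * f z $ 1 * \<phi> z)
       = - pairing (\<lambda>z. ?W z * del \<phi> z) g2 + pairing (\<lambda>z. ?W z * \<phi> z) (\<lambda>z. U z * g1 z)"
      unfolding r1 pairing_def using i1[OF g2(1)] i0[OF Ug(1)] by simp
    also have "\<dots> = pairing (\<lambda>z. ?W z * \<phi> z) (\<lambda>z. E * g1 z)"
      unfolding A pairing_diff[OF c0 Ug(1) Eg(1)] by simp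
    also have "\<dots> = (LINT z|lebesgue. (E *s f z) $ 1 * \<phi> z)" unfolding e1 pairing_def ..
    finally have first: "(LINT z|lebesgue. - (f z $ 2) * del \<phi> z + U z * f z $ 1 * \<phi> z) = (LINT z|lebesgue. (E *s f z) $ 1 * \<phi> z)" .
    have "(LINT z|lebesgue. f z $ 1 * delbar \<phi> z + U z * f z $ 2 * \<phi> z)
       = pairing (\<lambda>z. ?W z * delbar \<phi> z) g1 + pairing (\<lambda>z. ?W z * \<phi> z) (\<lambda>z. U z * g2 z)"
      unfolding r2 pairing_def using i2[OF g1(1)] i0[OF Ug(2)] by simp
    also have "\<dots> = pairing (\<lambda>z. ?W z * \<phi> z) (\<lambda>z. E * g2 z)"
      unfolding B pairing_diff[OF c0 Eg(2) Ug(2)] by simp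
    also have "\<dots> = (LINT z|lebesgue. (E *s f z) $ 2 * \<phi> z)" unfolding e2 pairing_def ..
    finally show "(LINT z|lebesgue. - (f z $ 2) * del \<phi> z + U z * f z $ 1 * \<phi> z) = (LINT z|lebesgue. (E *s f z) $ 1 * \<phi> z) \<and>
       (LINT z|lebesgue. f z $ 1 * delbar \<phi> z + U z * f z $ 2 * \<phi> z) = (LINT z|lebesgue. (E *s f z) $ 2 * \<phi> z)"
      using first by blast
  qed
  have quasi: "\<forall>\<gamma>\<in>range shift. AE z in lebesgue. f (z + \<gamma>) = exp (2 * of_real pi * \<i> * quasi_pairing k \<gamma>) *s f z"
    unfolding exp_quasi_pairing
    by (auto simp: Finite_Cartesian_Product.vec_eq_iff forall_2 f12 wave_translate periodize_shift)
  show ?thesis unfolding floquet_function_def using loc ne dirac quasi by blast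
qed

text \<open>The coefficients of the periodic part \<open>g\<close> of the Floquet function are the solution. To obtain the equation
  of the mode \<open>p\<close>, the weak equation is tested with the conjugate mode, divided by the wave of wave vector
  \<open>k\<close> and multiplied by the cutoff. The derivative of the cutoff does not contribute, since its
  translates add up to 0, and the cutoff itself turns plane integrals into integrals over the cell.\<close>

lemma mode_equations_if_floquet:
  assumes N: "represents_U N" and fl: "floquet_function (range shift) U k E f"
  shows "\<exists>x y. (x \<noteq> 0 \<or> y \<noteq> 0) \<and>
    (\<forall>p. pi * \<i> * (k $ 1 + \<i> * k $ 2 + freq p) * coord x p = coord (blinfun_apply N y) p - E * coord y p) \<and>
    (\<forall>p. pi * \<i> * (k $ 1 - \<i> * k $ 2 + cnj (freq p)) * coord y p = E * coord x p - coord (blinfun_apply N x) p)"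
proof -
  let ?M = "lebesgue_on cell"
  have loc: "loc_square_integrable f" and ne: "\<not> (AE z in lebesgue. f z = 0)"
    and dirac: "dirac_eq U f (\<lambda>z. E *s f z)"
    and quasi: "\<And>p. AE z in lebesgue. f (z + shift p) = wave (k $ 1) (k $ 2) (shift p) *s f z"
    using fl unfolding floquet_function_def exp_quasi_pairing by auto
  have fm: "f \<in> borel_measurable lebesgue" using loc by (simp add: loc_square_integrable_def)
  define g where "g j z = wave (- k $ 1) (- k $ 2) z * f z $ j" for j z
  have Wm: "wave a b \<in> borel_measurable lebesgue" for a b by (rule continuous_lebesgue_measurable[OF wave_continuous])
  have fjm: "(\<lambda>z. f z $ j) \<in> borel_measurable lebesgue" for j
    by (rule measurable_compose[OF fm borel_measurable_continuous_onI]) (intro continuous_intros)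
  have gm: "g j \<in> borel_measurable lebesgue" for j
    unfolding g_def[abs_def] by (intro borel_measurable_times Wm fjm)
  have gball: "square_integrable (lebesgue_on (cball 0 R)) (g j)" for j R
  proof -
    obtain C where C: "C \<ge> 0" "\<And>z. z \<in> cball 0 R \<Longrightarrow> cmod (wave (- k $ 1) (- k $ 2) z) \<le> C"
      by (rule continuous_bounded_on_cball[OF wave_continuous]) (rule that; assumption)
    have i: "integrable lebesgue (\<lambda>z. indicator (cball 0 R) z *\<^sub>R (C\<^sup>2 * (norm (f z))\<^sup>2))"
    proof -
      have "set_integrable lebesgue (cball 0 R) (\<lambda>z. (norm (f z))\<^sup>2)" using loc by (simp add: loc_square_integrable_def)
      then have "integrable lebesgue (\<lambda>z. C\<^sup>2 * (indicator (cball 0 R) z *\<^sub>R (norm (f z))\<^sup>2))"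
        unfolding set_integrable_def by (rule Bochner_Integration.integrable_mult_right)
      then show ?thesis by (simp add: mult.left_commute)
    qed
    have "integrable lebesgue (\<lambda>z. indicator (cball 0 R) z *\<^sub>R (cmod (g j z))\<^sup>2)"
    proof (rule Bochner_Integration.integrable_bound[OF i])
      note [measurable] = gm
      have [measurable]: "cball (0::complex) R \<in> sets lebesgue" by simp
      show "(\<lambda>z. indicator (cball 0 R) z *\<^sub>R (cmod (g j z))\<^sup>2) \<in> borel_measurable lebesgue" by measurable
      show "AE z in lebesgue. norm (indicator (cball 0 R) z *\<^sub>R (cmod (g j z))\<^sup>2) \<le> norm (indicator (cball 0 R) z *\<^sub>R (C\<^sup>2 * (norm (f z))\<^sup>2))"
      proof (rule AE_I2)
        fix z
        show "norm (indicator (cball 0 R) z *\<^sub>R (cmod (g j z))\<^sup>2) \<le> norm (indicator (cball 0 R) z *\<^sub>R (C\<^sup>2 * (norm (f z))\<^sup>2))"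
        proof (cases "z \<in> cball 0 R")
          case True
          have "(cmod (g j z))\<^sup>2 = (cmod (wave (- k $ 1) (- k $ 2) z))\<^sup>2 * (cmod (f z $ j))\<^sup>2"
            by (simp add: g_def norm_mult power_mult_distrib)
          also have "\<dots> \<le> C\<^sup>2 * (norm (f z))\<^sup>2"
            by (intro mult_mono power_mono C(2)[OF True] Finite_Cartesian_Product.norm_nth_le) auto
          finally show ?thesis using True by simp
        qed simp
      qed
    qed
    then show ?thesis unfolding square_integrable_def using measurable_restrict_space1[OF gm] by (simp add: integrable_restrict_space)
  qed
  have gcell: "square_integrable ?M (g j)" for j
  proof -
    let ?R = "cmod \<omega>1 + cmod \<omega>2"
    have "integrable lebesgue (\<lambda>z. indicator (cball 0 ?R) z *\<^sub>R (cmod (g j z))\<^sup>2)"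
      using square_integrableD(2)[OF gball[of ?R j]] by (simp add: integrable_restrict_space)
    from integrable_mult_indicator[OF cell_lebesgue this]
    have "integrable lebesgue (\<lambda>z. indicator cell z *\<^sub>R (indicator (cball 0 ?R) z *\<^sub>R (cmod (g j z))\<^sup>2))" .
    moreover have "indicator cell z *\<^sub>R (indicator (cball 0 ?R) z *\<^sub>R (cmod (g j z))\<^sup>2) = indicator cell z *\<^sub>R (cmod (g j z))\<^sup>2" for z
      using cell_bound[of z] by (auto simp: indicator_def)
    ultimately have "integrable lebesgue (\<lambda>z. indicator cell z *\<^sub>R (cmod (g j z))\<^sup>2)" by (simp only:)
    then show ?thesis unfolding square_integrable_def using measurable_on_cell[OF gm] by (simp add: integrable_restrict_space)
  qed
  have gper: "AE z in lebesgue. g j (z + shift p) = g j z" for j p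
    using quasi[of p]
  proof eventually_elim
    fix z assume "f (z + shift p) = wave (k $ 1) (k $ 2) (shift p) *s f z"
    then have "g j (z + shift p) = (wave (- k $ 1) (- k $ 2) (shift p) * wave (k $ 1) (k $ 2) (shift p)) * g j z"
      by (simp add: g_def wave_translate)
    also have "wave (- k $ 1) (- k $ 2) (shift p) * wave (k $ 1) (k $ 2) (shift p) = 1"
      unfolding wave_add by (simp add: wave_def)
    finally show "g j (z + shift p) = g j z" by simp
  qed
  obtain x where x: "coord x = fourier.coef (g 1)" using fourier.coef_ell2[OF gcell] by blast
  obtain y where y: "coord y = fourier.coef (g 2)" using fourier.coef_ell2[OF gcell] by blast
  have nz: "x \<noteq> 0 \<or> y \<noteq> 0"
  proof (rule ccontr)
    assume "\<not> ?thesis"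
    then have z: "fourier.coef (g j) = fourier.coef (\<lambda>_. 0)" if "j = 1 \<or> j = 2" for j :: 2
      using x y that by (auto simp: fun_eq_iff fourier.coef_def[of "\<lambda>_. 0"] dest!: fun_cong)
    have ae: "AE z in lebesgue. g j z = 0" for j :: 2
    proof -
      have "AE z in ?M. g j z = 0"
        by (rule fourier.coef_eq_imp_AE_eq[OF gcell square_integrable_zero z]) (use exhaust_2 in blast)
      then have c: "AE z in lebesgue. z \<in> cell \<longrightarrow> g j z = 0" by (subst (asm) AE_restrict_space_iff) simp_all
      have "AE z in lebesgue. \<forall>p. (z + shift p \<in> cell \<longrightarrow> g j (z + shift p) = 0) \<and> g j (z + shift p) = g j z"
        unfolding AE_all_countable
      proof
        fix p show "AE z in lebesgue. (z + shift p \<in> cell \<longrightarrow> g j (z + shift p) = 0) \<and> g j (z + shift p) = g j z"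
          using AE_lebesgue_translation[OF c, of "shift p"] gper[of j p] by eventually_elim simp
      qed
      then show ?thesis
      proof eventually_elim
        fix z assume "\<forall>p. (z + shift p \<in> cell \<longrightarrow> g j (z + shift p) = 0) \<and> g j (z + shift p) = g j z"
        then show "g j z = 0" using mem_cell_shift_iff[of z "cell_index z"] by metis
      qed
    qed
    have "AE z in lebesgue. f z = 0"
      using ae[of 1] ae[of 2]
      by eventually_elim (simp add: g_def wave_nonzero Finite_Cartesian_Product.vec_eq_iff forall_2)
    then show False using ne by blast
  qed
  have eqs: "pi * \<i> * (k $ 1 - \<i> * k $ 2 + cnj (freq p)) * coord y p = E * coord x p - coord (blinfun_apply N x) p \<and>
    pi * \<i> * (k $ 1 + \<i> * k $ 2 + freq p) * coord x p = coord (blinfun_apply N y) p - E * coord y p" for p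
  proof -
    let ?P = "- (k $ 1 + complex_of_real (Re (freq p)))" and ?Q = "- (k $ 2 + complex_of_real (Im (freq p)))"
    let ?R = "cmod \<omega>1 + cmod \<omega>2 + 1"
    define \<phi> where "\<phi> z = wave ?P ?Q z * cutoff z" for z
    have \<phi>: "test_function \<phi>" unfolding \<phi>_def[abs_def] by (rule smooth_mult_cutoff_test[OF smooth_wave])
    have PQ: "?P - \<i> * ?Q = - (k $ 1 - \<i> * k $ 2 + cnj (freq p))" "?P + \<i> * ?Q = - (k $ 1 + \<i> * k $ 2 + freq p)"
      using cnj_freq[of p] by (simp_all add: algebra_simps)
    define h where "h j z = g j z * mode (- p) z" for j z
    have wh: "f z $ j * wave ?P ?Q z = h j z" for j z
    proof -
      have "wave ?P ?Q z = wave (- k $ 1) (- k $ 2) z * mode (- p) z"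
        unfolding mode_def wave_add by (simp add: freq_def)
      then show ?thesis by (simp add: h_def g_def)
    qed
    have hm: "h j \<in> borel_measurable lebesgue" for j
      unfolding h_def[abs_def] by (intro borel_measurable_times gm mode_measurable)
    have hper: "AE z in lebesgue. h j (z + shift q) = h j z" for j q
      using gper[of j q] by eventually_elim (simp add: h_def mode_shift)
    have hball: "integrable (lebesgue_on (cball 0 ?R)) (h j)" for j
    proof (rule square_integrable_imp_integrable_ball)
      show "square_integrable (lebesgue_on (cball 0 ?R)) (h j)"
        using square_integrable_mult_bounded(1)[OF gball[of ?R j] measurable_restrict_space1[OF mode_measurable[of "- p"]], of 1]
        by (simp add: h_def[abs_def] mult.commute)
    qed
    have Uhball: "integrable (lebesgue_on (cball 0 ?R)) (\<lambda>z. U z * h j z)" for j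
    proof (rule U_bounded)
      fix C assume C: "\<And>z. cmod (U z) \<le> C"
      show ?thesis
      proof (rule Bochner_Integration.integrable_bound[OF Bochner_Integration.integrable_mult_right[OF integrable_norm[OF hball[of j]], of C]])
        show "(\<lambda>z. U z * h j z) \<in> borel_measurable (lebesgue_on (cball 0 ?R))"
          by (intro measurable_restrict_space1 borel_measurable_times U_measurable hm)
        show "AE z in lebesgue_on (cball 0 ?R). norm (U z * h j z) \<le> norm (C * norm (h j z))"
        proof (rule AE_I2)
          fix z
          have "norm (U z * h j z) \<le> C * norm (h j z)" unfolding norm_mult by (rule mult_right_mono[OF C]) simp
          then show "norm (U z * h j z) \<le> norm (C * norm (h j z))" by (simp add: abs_le_iff)
        qed
      qed
    qed
    have Uhm: "(\<lambda>z. U z * h j z) \<in> borel_measurable lebesgue" for j by (intro borel_measurable_times U_measurable hm)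
    have Uhper: "AE z in lebesgue. U (z + shift q) * h j (z + shift q) = U z * h j z" for j q
      using hper[of j q] by eventually_elim (simp add: U_periodic)
    have cs: "cmod z > ?R \<Longrightarrow> cutoff z = 0" "cmod z > ?R \<Longrightarrow> del cutoff z = 0" "cmod z > ?R \<Longrightarrow> delbar cutoff z = 0" for z
      using cutoff_bound del_cutoff_bound by simp_all
    note imc = integrable_mult_compact_support
    have ih: "integrable lebesgue (\<lambda>z. h j z * cutoff z)" "integrable lebesgue (\<lambda>z. h j z * del cutoff z)" "integrable lebesgue (\<lambda>z. h j z * delbar cutoff z)"
      for j by (rule imc[OF hball], rule cutoff_del, simp add: cs)+
    have iUh: "integrable lebesgue (\<lambda>z. (U z * h j z) * cutoff z)" for j
      by (rule imc[OF Uhball], rule cutoff_del, simp add: cs)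
    have m: "(\<integral>z. h j z * cutoff z \<partial>lebesgue) = (\<integral>z. h j z \<partial>?M)" "(\<integral>z. (U z * h j z) * cutoff z \<partial>lebesgue) = (\<integral>z. U z * h j z \<partial>?M)" for j
      by (rule integral_cutoff_eq_cell[OF hm ih(1) hper] integral_cutoff_eq_cell[OF Uhm iUh Uhper])+
    have d: "(\<integral>z. h j z * del cutoff z \<partial>lebesgue) = 0" "(\<integral>z. h j z * delbar cutoff z \<partial>lebesgue) = 0" for j
      by (rule integral_del_cutoff_eq_0[OF hm ih(2,3) hper])+
    have dphi: "del \<phi> z = wave ?P ?Q z * del cutoff z - pi * \<i> * (k $ 1 - \<i> * k $ 2 + cnj (freq p)) * (wave ?P ?Q z * cutoff z)"
      "delbar \<phi> z = wave ?P ?Q z * delbar cutoff z - pi * \<i> * (k $ 1 + \<i> * k $ 2 + freq p) * (wave ?P ?Q z * cutoff z)" for z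
      unfolding \<phi>_def[abs_def] del_wave_mult[OF cutoff_del(1)] PQ by (simp_all only: mult_minus_left mult_minus_right diff_conv_add_uminus add.commute)
    let ?a = "pi * \<i> * (k $ 1 - \<i> * k $ 2 + cnj (freq p))" and ?b = "pi * \<i> * (k $ 1 + \<i> * k $ 2 + freq p)"
    have r1: "- (f z $ 2) * del \<phi> z + U z * f z $ 1 * \<phi> z = - (h 2 z * del cutoff z) + ?a * (h 2 z * cutoff z) + (U z * h 1 z) * cutoff z" for z
      unfolding dphi wh[symmetric] \<phi>_def by (simp add: algebra_simps)
    have r2: "f z $ 1 * delbar \<phi> z + U z * f z $ 2 * \<phi> z = h 1 z * delbar cutoff z - ?b * (h 1 z * cutoff z) + (U z * h 2 z) * cutoff z" for z
      unfolding dphi wh[symmetric] \<phi>_def by (simp add: algebra_simps)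
    have e: "(E *s f z) $ j * \<phi> z = E * (h j z * cutoff z)" for z j
      unfolding wh[symmetric] \<phi>_def by simp
    have D: "(LINT z|lebesgue. - (f z $ 2) * del \<phi> z + U z * f z $ 1 * \<phi> z) = (LINT z|lebesgue. (E *s f z) $ 1 * \<phi> z)"
      "(LINT z|lebesgue. f z $ 1 * delbar \<phi> z + U z * f z $ 2 * \<phi> z) = (LINT z|lebesgue. (E *s f z) $ 2 * \<phi> z)"
      using dirac \<phi> unfolding dirac_eq_def by blast+
    have L1: "(LINT z|lebesgue. - (f z $ 2) * del \<phi> z + U z * f z $ 1 * \<phi> z) = ?a * (\<integral>z. h 2 z \<partial>?M) + (\<integral>z. U z * h 1 z \<partial>?M)"
      unfolding r1 using ih iUh by (simp add: d m)
    have L2: "(LINT z|lebesgue. f z $ 1 * delbar \<phi> z + U z * f z $ 2 * \<phi> z) = - ?b * (\<integral>z. h 1 z \<partial>?M) + (\<integral>z. U z * h 2 z \<partial>?M)"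
      unfolding r2 using ih iUh by (simp add: d m)
    have R12: "(LINT z|lebesgue. (E *s f z) $ j * \<phi> z) = E * (\<integral>z. h j z \<partial>?M)" for j
      unfolding e using m(1)[of j] by simp
    have cb: "v * cnj (basis p z) = v * mode (- p) z * (1 / sqrt area)" for v z by (simp add: basis_def cnj_mode)
    have cg: "fourier.coef (g j) p = (\<integral>z. h j z \<partial>?M) * (1 / sqrt area)" for j
      unfolding fourier.coef_def cb h_def[symmetric] by (rule integral_mult_left_zero)
    have cUg: "fourier.coef (\<lambda>z. U z * g j z) p = (\<integral>z. U z * h j z \<partial>?M) * (1 / sqrt area)" for j
    proof -
      have "U z * g j z * mode (- p) z = U z * h j z" for z by (simp add: h_def)
      then show ?thesis unfolding fourier.coef_def cb by (simp only: integral_mult_left_zero)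
    qed
    have Nx: "coord (blinfun_apply N x) p = fourier.coef (\<lambda>z. U z * g 1 z) p" "coord (blinfun_apply N y) p = fourier.coef (\<lambda>z. U z * g 2 z) p"
      using N gcell x y unfolding represents_U_def by metis+
    have "?a * (\<integral>z. h 2 z \<partial>?M) = E * (\<integral>z. h 1 z \<partial>?M) - (\<integral>z. U z * h 1 z \<partial>?M)"
      using D(1) unfolding L1 R12 by (simp add: algebra_simps)
    from arg_cong[OF this, of "\<lambda>v. v * (1 / sqrt area)"]
    have 1: "?a * coord y p = E * coord x p - coord (blinfun_apply N x) p"
      unfolding Nx x y cg cUg by (simp only: left_diff_distrib mult.assoc)
    have "?b * (\<integral>z. h 1 z \<partial>?M) = (\<integral>z. U z * h 2 z \<partial>?M) - E * (\<integral>z. h 2 z \<partial>?M)"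
      using D(2) unfolding L2 R12 by (simp add: algebra_simps)
    from arg_cong[OF this, of "\<lambda>v. v * (1 / sqrt area)"]
    have 2: "?b * coord x p = coord (blinfun_apply N y) p - E * coord y p"
      unfolding Nx x y cg cUg by (simp only: left_diff_distrib mult.assoc)
    show ?thesis using 1 2 by blast
  qed
  show ?thesis using nz eqs by blast
qed

end

text \<open>The dual basis is given by Cramer's rule; the determinant \<open>d\<close> is nonzero because the lattice has rank 2.\<close>

lemma lattice_frame_exists:
  assumes "plane_lattice \<Lambda>"
  obtains \<omega>1 \<omega>2 \<sigma> \<tau> where "lattice_frame \<omega>1 \<omega>2 \<sigma> \<tau>" "\<Lambda> = range (lattice_frame.shift \<omega>1 \<omega>2)"
proof -
  obtain \<omega>1 \<omega>2 where w: "\<omega>1 \<noteq> \<omega>2" "independent {\<omega>1, \<omega>2}" "\<Lambda> = {of_int m * \<omega>1 + of_int n * \<omega>2 |m n. True}"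
    using assms unfolding plane_lattice_def by blast
  define d where "d = Re \<omega>1 * Im \<omega>2 - Im \<omega>1 * Re \<omega>2"
  have d: "d \<noteq> 0"
  proof
    assume d0: "d = 0"
    have i: "\<omega>1 \<notin> span {\<omega>2}" "\<omega>2 \<noteq> 0"
      using w(1,2) by (auto simp: real_vector.independent_insert)
    have n: "(Re \<omega>2)\<^sup>2 + (Im \<omega>2)\<^sup>2 \<noteq> 0" using i(2) by (simp add: complex_eq_iff sum_power2_eq_zero_iff)
    define c where "c = (Re \<omega>1 * Re \<omega>2 + Im \<omega>1 * Im \<omega>2) / ((Re \<omega>2)\<^sup>2 + (Im \<omega>2)\<^sup>2)"
    have e: "Re \<omega>1 * Im \<omega>2 = Im \<omega>1 * Re \<omega>2" using d0 by (simp add: d_def)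
    have "c * Re \<omega>2 = Re \<omega>1"
    proof -
      have "(Re \<omega>1 * Re \<omega>2 + Im \<omega>1 * Im \<omega>2) * Re \<omega>2 = Re \<omega>1 * (Re \<omega>2)\<^sup>2 + (Im \<omega>1 * Re \<omega>2) * Im \<omega>2"
        by (simp add: power2_eq_square algebra_simps)
      also have "\<dots> = Re \<omega>1 * ((Re \<omega>2)\<^sup>2 + (Im \<omega>2)\<^sup>2)" unfolding e[symmetric] by (simp add: power2_eq_square algebra_simps)
      finally show ?thesis using n by (simp add: c_def)
    qed
    moreover have "c * Im \<omega>2 = Im \<omega>1"
    proof -
      have "(Re \<omega>1 * Re \<omega>2 + Im \<omega>1 * Im \<omega>2) * Im \<omega>2 = (Re \<omega>1 * Im \<omega>2) * Re \<omega>2 + Im \<omega>1 * (Im \<omega>2)\<^sup>2"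
        by (simp add: power2_eq_square algebra_simps)
      also have "\<dots> = Im \<omega>1 * ((Re \<omega>2)\<^sup>2 + (Im \<omega>2)\<^sup>2)" unfolding e by (simp add: power2_eq_square algebra_simps)
      finally show ?thesis using n by (simp add: c_def)
    qed
    ultimately have "\<omega>1 = c *\<^sub>R \<omega>2" by (simp add: complex_eq_iff)
    then show False using i(1) by (simp add: real_vector.span_base real_vector.span_scale)
  qed
  define \<sigma> where "\<sigma> = Complex (Im \<omega>2 / d) (- Re \<omega>2 / d)"
  define \<tau> where "\<tau> = Complex (- Im \<omega>1 / d) (Re \<omega>1 / d)"
  have rs: "Re (cnj \<sigma> * z) = (Im \<omega>2 * Re z - Re \<omega>2 * Im z) / d" and rt: "Re (cnj \<tau> * z) = (Re \<omega>1 * Im z - Im \<omega>1 * Re z) / d" for z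
    by (simp_all add: \<sigma>_def \<tau>_def diff_divide_distrib)
  have fr: "lattice_frame \<omega>1 \<omega>2 \<sigma> \<tau>"
  proof
    show "Re (cnj \<sigma> * \<omega>1) = 1" "Re (cnj \<sigma> * \<omega>2) = 0" "Re (cnj \<tau> * \<omega>1) = 0" "Re (cnj \<tau> * \<omega>2) = 1"
      unfolding rs rt using d by (simp_all add: d_def mult.commute)
    fix z
    have 1: "(Im \<omega>2 * Re z - Re \<omega>2 * Im z) * Re \<omega>1 + (Re \<omega>1 * Im z - Im \<omega>1 * Re z) * Re \<omega>2 = Re z * d"
      and 2: "(Im \<omega>2 * Re z - Re \<omega>2 * Im z) * Im \<omega>1 + (Re \<omega>1 * Im z - Im \<omega>1 * Re z) * Im \<omega>2 = Im z * d"
      by (simp_all add: d_def algebra_simps)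
    show "z = of_real (Re (cnj \<sigma> * z)) * \<omega>1 + of_real (Re (cnj \<tau> * z)) * \<omega>2"
      unfolding rs rt using 1 2 d by (simp add: complex_eq_iff add_divide_distrib[symmetric])
  qed
  have "\<Lambda> = range (lattice_frame.shift \<omega>1 \<omega>2)"
    unfolding w(3) lattice_frame.shift_def[OF fr, abs_def] by (auto simp: image_iff; intro exI; rule refl)
  then show thesis using that fr by blast
qed

theorem theorem4:
  fixes \<Lambda> :: "complex set" and U :: "complex \<Rightarrow> complex"
  assumes "plane_lattice \<Lambda>"
    and "continuous_on UNIV U"
    and "\<And>\<gamma> z. \<gamma> \<in> \<Lambda> \<Longrightarrow> U (z + \<gamma>) = U z"
  shows "\<exists>Q :: (complex ^ 3) set.
           analytic_set Q \<and> analytic_codim Q > 0 \<and>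
           (\<forall>(k :: complex ^ 2) E.
              (\<exists>f. floquet_function \<Lambda> U k E f) \<longleftrightarrow> vector [k $ 1, k $ 2, E] \<in> Q) \<and>
           analytic_set (Q \<inter> {w. w $ 3 = 0}) \<and>
           analytic_dim (Q \<inter> {w. w $ 3 = 0}) = 1"
proof -
  obtain \<omega>1 \<omega>2 \<sigma> \<tau> where fr: "lattice_frame \<omega>1 \<omega>2 \<sigma> \<tau>" and \<Lambda>: "\<Lambda> = range (lattice_frame.shift \<omega>1 \<omega>2)"
    by (rule lattice_frame_exists[OF assms(1)])
  interpret lattice_frame \<omega>1 \<omega>2 \<sigma> \<tau> by (rule fr)
  interpret dirac_frame \<omega>1 \<omega>2 \<sigma> \<tau> U
  proof
    show "U (z + shift p) = U z" for p z using assms(3)[of "shift p" z] \<Lambda> by simp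
  qed (rule assms(2))
  obtain C where C: "\<And>z. cmod (U z) \<le> C" by (rule U_bounded) (rule that; assumption)
  obtain N where N: "complex_linear_op N" "represents_U N"
    by (rule fourier.multiplication_operator[OF measurable_on_cell[OF U_measurable] C])
       (auto simp: represents_U_def intro: that)
  let ?Q = "dirac_spectrum N freq"
  have \<delta>: "1 / (cmod \<omega>1 + cmod \<omega>2) > 0" "1 / (4 * cmod \<omega>1) > 0"
    using omega_nonzero by (simp_all add: add_pos_pos)
  note an = dirac_spectrum_analytic[OF N(1) finite_freq_le freq_0 \<delta>(1) freq_gap \<delta>(2) half_integer_gap]
  have "(\<exists>f. floquet_function \<Lambda> U k E f) \<longleftrightarrow> vector [k $ 1, k $ 2, E] \<in> ?Q" for k :: "complex ^ 2" and E
  proof -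
    have Q: "vector [k $ 1, k $ 2, E] \<in> ?Q \<longleftrightarrow> (\<exists>x y. (x \<noteq> 0 \<or> y \<noteq> 0) \<and>
      (\<forall>p. pi * \<i> * (k $ 1 + \<i> * k $ 2 + freq p) * coord x p = coord (blinfun_apply N y) p - E * coord y p) \<and>
      (\<forall>p. pi * \<i> * (k $ 1 - \<i> * k $ 2 + cnj (freq p)) * coord y p = E * coord x p - coord (blinfun_apply N x) p))"
      by (simp add: dirac_spectrum_def)
    show ?thesis
    proof
      assume "\<exists>f. floquet_function \<Lambda> U k E f"
      then obtain f where "floquet_function (range shift) U k E f" unfolding \<Lambda> by (rule exE)
      from mode_equations_if_floquet[OF N(2) this] show "vector [k $ 1, k $ 2, E] \<in> ?Q" unfolding Q .
    next
      assume "vector [k $ 1, k $ 2, E] \<in> ?Q"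
      then obtain x y where xy: "x \<noteq> 0 \<or> y \<noteq> 0"
        "\<forall>p. pi * \<i> * (k $ 1 + \<i> * k $ 2 + freq p) * coord x p = coord (blinfun_apply N y) p - E * coord y p"
        "\<forall>p. pi * \<i> * (k $ 1 - \<i> * k $ 2 + cnj (freq p)) * coord y p = E * coord x p - coord (blinfun_apply N x) p"
        unfolding Q by (elim exE conjE) (rule that)
      show "\<exists>f. floquet_function \<Lambda> U k E f"
        unfolding \<Lambda> by (rule floquet_if_mode_equations[OF N(2) xy(1) xy(2)[rule_format] xy(3)[rule_format]])
    qed
  qed
  then show ?thesis by (intro exI[of _ ?Q] conjI allI an)
qed

end
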